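(* Let $\Omega=\omega_1\times\omega_2$ where $\omega_1$ and $\omega_2$ are two bounded open sets of $\mathbb{R}^q$ and $\mathbb{R}^{N-q}$ respectively, with $N>q\geq 1$. Suppose that $f\in L^2(\Omega)$ and that $A$ and $\beta$ satisfy the ellipticity, boundedness, monotonicity and growth assumptions, together with $\partial_{x_i}a_{ij},\partial_{x_j}a_{ij}\in L^\infty(\Omega)$ for $i=1,\dots,q$, $j=q+1,\dots,N$. Let $(V_n)$ be a sequence of finite dimensional subspaces of $H_0^1(\Omega)$ which approximates it, i.e. $\inf_{v\in V_n}\|w-v\|_{H_0^1(\Omega)}\to 0$ as $n\to\infty$ for every $w\in H_0^1(\Omega)$. For $\epsilon\in(0,1]$ and $n\in\mathbb{N}$ let $u_{\epsilon,n}\in V_n$ be the unique solution of $$\int_\Omega\beta(u_{\epsilon,n})\varphi\,dx+\int_\Omega A_\epsilon\nabla u_{\epsilon,n}\cdot\nabla\varphi\,dx=\int_\Omega f\varphi\,dx\quad\forall\varphi\in V_n.$$ Then $$\lim_{\epsilon}\big(\lim_n u_{\epsilon,n}\big)=\lim_n\big(\lim_{\epsilon}u_{\epsilon,n}\big)=u\quad\text{in } H_0^1(\Omega;\omega_2),$$ where $u$ is the unique solution in $H_0^1(\Omega;\omega_2)$ of the limit problem.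
   Context: Notation: $x=(X_1,X_2)\in\mathbb{R}^q\times\mathbb{R}^{N-q}$, $\nabla=(\nabla_{X_1},\nabla_{X_2})$. $A=(a_{ij}):\Omega\to\mathcal{M}_N(\mathbb{R})$ satisfies: there is $\lambda>0$ with $A\xi\cdot\xi\geq\lambda|\xi|^2$ for a.e. $x$ and all $\xi\in\mathbb{R}^N$, and $a_{ij}\in L^\infty(\Omega)$. $A$ is split into blocks $A_{11}$ ($q\times q$), $A_{12}$, $A_{21}$, $A_{22}$ ($(N-q)\times(N-q)$), and for $\epsilon\in(0,1]$, $A_\epsilon=\begin{pmatrix}\epsilon^2A_{11}&\epsilon A_{12}\\ \epsilon A_{21}&A_{22}\end{pmatrix}$. $\beta:\mathbb{R}\to\mathbb{R}$ is continuous, nondecreasing, $\beta(0)=0$, and $|\beta(s)|\leq M(1+|s|)$ for some $M\geq0$. $H_0^1(\Omega;\omega_2)=\{v\in L^2(\Omega):\nabla_{X_2}v\in L^2(\Omega)^{N-q},\ v(X_1,\cdot)\in H_0^1(\omega_2)\text{ for a.e. }X_1\in\omega_1\}$, normed by $\|\nabla_{X_2}\cdot\|_{L^2(\Omega)^{N-q}}$. The limit problem: $u\in H_0^1(\Omega;\omega_2)$ such that for a.e. $X_1\in\omega_1$, $\int_{\omega_2}\beta(u)(X_1,\cdot)\psi\,dX_2+\int_{\omega_2}A_{22}(X_1,\cdot)\nabla_{X_2}u(X_1,\cdot)\cdot\nabla_{X_2}\psi\,dX_2=\int_{\omega_2}f(X_1,\cdot)\psi\,dX_2$ for all $\psi\in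 H_0^1(\omega_2)$. *)

theory Defs
  imports "HOL-Analysis.Analysis"
begin

fun Ck :: "nat \<Rightarrow> ('x::euclidean_space \<Rightarrow> real) \<Rightarrow> bool" where
  "Ck 0 f = continuous_on UNIV f"
| "Ck (Suc k) f = ((\<forall>x. f differentiable (at x)) \<and>
        (\<forall>e\<in>Basis. Ck k (\<lambda>x. frechet_derivative f (at x) e)))"

definition smooth :: "('x::euclidean_space \<Rightarrow> real) \<Rightarrow> bool" where
  "smooth f \<longleftrightarrow> (\<forall>k. Ck k f)"

definition test_fun :: "'x::euclidean_space set \<Rightarrow> ('x \<Rightarrow> real) \<Rightarrow> bool" where
  "test_fun \<Omega> \<phi> \<longleftrightarrow> smooth \<phi> \<and> compact (closure {x. \<phi> x \<noteq> 0})
      \<and> closure {x. \<phi> x \<noteq> 0} \<subseteq> \<Omega>"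

definition grad :: "('x::euclidean_space \<Rightarrow> real) \<Rightarrow> 'x \<Rightarrow> 'x" where
  "grad \<phi> x = (\<Sum>e\<in>Basis. frechet_derivative \<phi> (at x) e *\<^sub>R e)"

definition L2 :: "'x::euclidean_space set \<Rightarrow> ('x \<Rightarrow> 'v::euclidean_space) \<Rightarrow> bool" where
  "L2 \<Omega> u \<longleftrightarrow> set_borel_measurable lebesgue \<Omega> u
      \<and> set_integrable lebesgue \<Omega> (\<lambda>x. (norm (u x))\<^sup>2)"

definition Linf :: "'x::euclidean_space set \<Rightarrow> ('x \<Rightarrow> real) \<Rightarrow> bool" where
  "Linf \<Omega> u \<longleftrightarrow> set_borel_measurable lebesgue \<Omega> u
      \<and> (\<exists>M. AE x in lebesgue. x \<in> \<Omega> \<longrightarrow> \<bar>u x\<bar> \<le> M)"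

definition L1loc :: "'x::euclidean_space set \<Rightarrow> ('x \<Rightarrow> real) \<Rightarrow> bool" where
  "L1loc \<Omega> u \<longleftrightarrow> (\<forall>K. compact K \<and> K \<subseteq> \<Omega> \<longrightarrow> set_integrable lebesgue K u)"

definition weak_pderiv :: "'x::euclidean_space set \<Rightarrow> ('x \<Rightarrow> real) \<Rightarrow> 'x \<Rightarrow> ('x \<Rightarrow> real) \<Rightarrow> bool" where
  "weak_pderiv \<Omega> u e g \<longleftrightarrow> L1loc \<Omega> u \<and> L1loc \<Omega> g \<and>
     (\<forall>\<phi>. test_fun \<Omega> \<phi> \<longrightarrow>
        (LINT x:\<Omega>|lebesgue. u x * frechet_derivative \<phi> (at x) e)
          = - (LINT x:\<Omega>|lebesgue. g x * \<phi> x))"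

definition weak_grad :: "'x::euclidean_space set \<Rightarrow> ('x \<Rightarrow> real) \<Rightarrow> ('x \<Rightarrow> 'x) \<Rightarrow> bool" where
  "weak_grad \<Omega> u G \<longleftrightarrow> (\<forall>e\<in>Basis. weak_pderiv \<Omega> u e (\<lambda>x. G x \<bullet> e))"

definition H01 :: "'x::euclidean_space set \<Rightarrow> ('x \<Rightarrow> real) set" where
  "H01 \<Omega> = {u. \<exists>G \<phi>s. L2 \<Omega> u \<and> L2 \<Omega> G \<and> weak_grad \<Omega> u G \<and>
      (\<forall>k. test_fun \<Omega> (\<phi>s k)) \<and>
      (\<lambda>k. (LINT x:\<Omega>|lebesgue. (\<phi>s k x - u x)\<^sup>2)
          + (LINT x:\<Omega>|lebesgue. (norm (grad (\<phi>s k) x - G x))\<^sup>2)) \<longlonglongrightarrow> 0}"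

definition weak_grad2 :: "('a::euclidean_space \<times> 'b::euclidean_space) set
     \<Rightarrow> ('a \<times> 'b \<Rightarrow> real) \<Rightarrow> ('a \<times> 'b \<Rightarrow> 'b) \<Rightarrow> bool" where
  "weak_grad2 \<Omega> u G \<longleftrightarrow> (\<forall>e\<in>Basis. weak_pderiv \<Omega> u (0, e) (\<lambda>x. G x \<bullet> e))"

definition H01_2 :: "'a::euclidean_space set \<Rightarrow> 'b::euclidean_space set \<Rightarrow> ('a \<times> 'b \<Rightarrow> real) set" where
  "H01_2 \<omega>1 \<omega>2 = {v. L2 (\<omega>1 \<times> \<omega>2) v \<and>
      (\<exists>G. weak_grad2 (\<omega>1 \<times> \<omega>2) v G \<and> L2 (\<omega>1 \<times> \<omega>2) G) \<and>
      (AE X1 in lebesgue. X1 \<in> \<omega>1 \<longrightarrow> (\<lambda>X2. v (X1, X2)) \<in> H01 \<omega>2)}"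

text \<open>Convergence w k --> v along filter F in the norm of H_0^1(Omega; omega2),
  i.e. the L^2 norm of the X2-gradient.\<close>
definition conv_H01_2 :: "'a::euclidean_space set \<Rightarrow> 'b::euclidean_space set
     \<Rightarrow> ('c \<Rightarrow> ('a \<times> 'b \<Rightarrow> real)) \<Rightarrow> 'c filter \<Rightarrow> ('a \<times> 'b \<Rightarrow> real) \<Rightarrow> bool" where
  "conv_H01_2 \<omega>1 \<omega>2 w F v \<longleftrightarrow> (\<exists>Gw Gv.
      (\<forall>\<^sub>F k in F. weak_grad2 (\<omega>1 \<times> \<omega>2) (w k) (Gw k)) \<and> weak_grad2 (\<omega>1 \<times> \<omega>2) v Gv \<and>
      ((\<lambda>k. LINT x:(\<omega>1 \<times> \<omega>2)|lebesgue. (norm (Gw k x - Gv x))\<^sup>2) \<longlongrightarrow> 0) F)"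

definition fspan :: "('x \<Rightarrow> real) set \<Rightarrow> ('x \<Rightarrow> real) set" where
  "fspan B = {(\<lambda>x. \<Sum>b\<in>B. c b * b x) | c. True}"

definition fin_dim_subspace :: "('x \<Rightarrow> real) set \<Rightarrow> bool" where
  "fin_dim_subspace V \<longleftrightarrow> (\<exists>B. finite B \<and> V = fspan B)"

definition A11 :: "('x \<Rightarrow> 'a::real_vector \<times> 'b::real_vector \<Rightarrow> 'a \<times> 'b) \<Rightarrow> 'x \<Rightarrow> 'a \<Rightarrow> 'a" where
  "A11 A x \<xi>1 = fst (A x (\<xi>1, 0))"
definition A12 :: "('x \<Rightarrow> 'a::real_vector \<times> 'b::real_vector \<Rightarrow> 'a \<times> 'b) \<Rightarrow> 'x \<Rightarrow> 'b \<Rightarrow> 'a" where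
  "A12 A x \<xi>2 = fst (A x (0, \<xi>2))"
definition A21 :: "('x \<Rightarrow> 'a::real_vector \<times> 'b::real_vector \<Rightarrow> 'a \<times> 'b) \<Rightarrow> 'x \<Rightarrow> 'a \<Rightarrow> 'b" where
  "A21 A x \<xi>1 = snd (A x (\<xi>1, 0))"
definition A22 :: "('x \<Rightarrow> 'a::real_vector \<times> 'b::real_vector \<Rightarrow> 'a \<times> 'b) \<Rightarrow> 'x \<Rightarrow> 'b \<Rightarrow> 'b" where
  "A22 A x \<xi>2 = snd (A x (0, \<xi>2))"

definition Aeps :: "real \<Rightarrow> ('x \<Rightarrow> 'a::real_vector \<times> 'b::real_vector \<Rightarrow> 'a \<times> 'b) \<Rightarrow> 'x \<Rightarrow> 'a \<times> 'b \<Rightarrow> 'a \<times> 'b" where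
  "Aeps \<epsilon> A x \<xi> = (\<epsilon>\<^sup>2 *\<^sub>R A11 A x (fst \<xi>) + \<epsilon> *\<^sub>R A12 A x (snd \<xi>),
                     \<epsilon> *\<^sub>R A21 A x (fst \<xi>) + A22 A x (snd \<xi>))"

definition coef :: "('x \<Rightarrow> 'v::real_inner \<Rightarrow> 'v) \<Rightarrow> 'v \<Rightarrow> 'v \<Rightarrow> 'x \<Rightarrow> real" where
  "coef A i j x = A x j \<bullet> i"

end

theory Submission
  imports Defs
begin

text \<open>
  A function \<open>u\<close> is represented by its jet \<open>w = (u, \<nabla>u)\<close> in \<open>L\<^sup>2\<close>, and the problem by the monotone operator
  \<open>S \<epsilon> w = (\<beta>(u) - f, A\<^sub>\<epsilon> \<nabla>u)\<close>, which is coercive in \<open>\<nabla>\<^sub>2u\<close> uniformly in \<open>\<epsilon>\<close>.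

  For fixed \<open>\<epsilon>\<close> the Galerkin solutions converge strongly by Minty's argument. For fixed \<open>n\<close>, all seminorms on
  \<open>V\<^sub>n\<close> are bounded by \<open>\<parallel>\<nabla>\<^sub>2 \<cdot>\<parallel>\<close>, so replacing \<open>A\<^sub>\<epsilon>\<close> by \<open>A\<^sub>0\<close> is an \<open>O(\<epsilon>)\<close> perturbation. The limit
  solution \<open>u\<close> satisfies the equation with \<open>A\<^sub>0\<close> integrated over \<open>\<Omega>\<close>; comparing it with an (approximate) solution
  and a test function \<open>v\<close> close to \<open>u\<close> in \<open>H\<^sub>0\<^sup>1(\<Omega>;\<omega>\<^sub>2)\<close> gives both outer limits, where the mixed term
  \<open>\<epsilon> A\<^sub>1\<^sub>2 \<nabla>\<^sub>2v \<cdot> \<nabla>\<^sub>1w\<close> is integrated by parts to remove the uncontrolled derivative \<open>\<nabla>\<^sub>1w\<close>.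
\<close>

subsection \<open>Square-integrable functions\<close>

text \<open>The energy bounds only the dilated gradient, that is \<open>\<epsilon>\<close> times its
  X1-part together with its X2-part, uniformly in \<open>\<epsilon>\<close>. The reason is the
  factorisation \<open>A\<^sub>\<epsilon> = D A D\<close> with D = diag(\<open>\<epsilon>\<close>,
  1), the map called \<open>dil\<close>. The limit u is only known to have an X2-gradient, so it
  cannot be inserted as a test function into the \<open>\<epsilon>\<close>-problem; a smooth v has
  to stand in for it, which is why the density theorem is needed. The norm comparison on
  \<open>V\<^sub>n\<close> has a constant depending on n, so the convergence in
  \<open>\<epsilon>\<close> is not shown to be uniform in n and the limits cannot simply be
  exchanged. Both outer limits instead come from \<open>key_convergence\<close>, which asks only
  that a jet z nearly solve the equation when tested with z - v, with a tolerance independent of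
  \<open>\<epsilon>\<close> and n. It is applied to exact solutions for small positive
  \<open>\<epsilon>\<close>, and at \<open>\<epsilon>\<close> = 0 to Galerkin solutions whose own
  parameter is chosen after n.\<close>

definition sq_integrable :: "'x measure \<Rightarrow> ('x \<Rightarrow> 'v::euclidean_space) \<Rightarrow> bool" where
  "sq_integrable M f \<longleftrightarrow> f \<in> borel_measurable M \<and> integrable M (\<lambda>x. (norm (f x))\<^sup>2)"

definition l2inner :: "'x measure \<Rightarrow> ('x \<Rightarrow> 'v::euclidean_space) \<Rightarrow> ('x \<Rightarrow> 'v) \<Rightarrow> real" where
  "l2inner M f g = (\<integral>x. f x \<bullet> g x \<partial>M)"

text \<open>Functions are not identified modulo null sets, so this is a seminorm and limits are
  determined only almost everywhere. That is why gradients appear later as witnesses and are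
  compared through \<open>AE\<close> statements.\<close>

definition l2norm :: "'x measure \<Rightarrow> ('x \<Rightarrow> 'v::euclidean_space) \<Rightarrow> real" where
  "l2norm M f = sqrt (\<integral>x. (norm (f x))\<^sup>2 \<partial>M)"

lemma sq_integrable_measurable[measurable_dest]: "sq_integrable M f \<Longrightarrow> f \<in> borel_measurable M"
  by (simp add: sq_integrable_def)

lemma sq_integrable_integrable: "sq_integrable M f \<Longrightarrow> integrable M (\<lambda>x. (norm (f x))\<^sup>2)"
  by (simp add: sq_integrable_def)

lemma norm_add_sq_le: "(norm (x + y))\<^sup>2 \<le> 2 * (norm x)\<^sup>2 + 2 * (norm (y::'v::real_normed_vector))\<^sup>2"
proof -
  have "(norm (x + y))\<^sup>2 \<le> (norm x + norm y)\<^sup>2"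
    by (intro power_mono norm_triangle_ineq) auto
  also have "\<dots> \<le> 2 * (norm x)\<^sup>2 + 2 * (norm y)\<^sup>2"
    using sum_squares_bound[of "norm x" "norm y"] by (simp add: power2_sum)
  finally show ?thesis .
qed

lemma sq_integrable_bound:
  assumes g: "sq_integrable M g" and f: "f \<in> borel_measurable M"
    and le: "AE x in M. norm (f x) \<le> C * norm (g x)"
  shows "sq_integrable M f"
  unfolding sq_integrable_def
proof (intro conjI f)
  have [measurable]: "f \<in> borel_measurable M" "g \<in> borel_measurable M" using f g by (auto simp: sq_integrable_def)
  show "integrable M (\<lambda>x. (norm (f x))\<^sup>2)"
  proof (rule Bochner_Integration.integrable_bound)
    show "integrable M (\<lambda>x. C\<^sup>2 * (norm (g x))\<^sup>2)" using g by (simp add: sq_integrable_def)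
    show "AE x in M. norm ((norm (f x))\<^sup>2) \<le> norm (C\<^sup>2 * (norm (g x))\<^sup>2)"
      using le by eventually_elim (simp add: power_mult_distrib[symmetric] power_mono)
  qed simp
qed

lemma sq_integrable_add:
  assumes f: "sq_integrable M f" and g: "sq_integrable M g"
  shows "sq_integrable M (\<lambda>x. f x + g x)"
  unfolding sq_integrable_def
proof
  have [measurable]: "f \<in> borel_measurable M" "g \<in> borel_measurable M" using f g by (auto simp: sq_integrable_def)
  show "(\<lambda>x. f x + g x) \<in> borel_measurable M" by simp
  show "integrable M (\<lambda>x. (norm (f x + g x))\<^sup>2)"
  proof (rule Bochner_Integration.integrable_bound)
    show "integrable M (\<lambda>x. 2 * (norm (f x))\<^sup>2 + 2 * (norm (g x))\<^sup>2)"
      using f g by (simp add: sq_integrable_def)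
  qed (auto simp: norm_add_sq_le)
qed

lemma sq_integrable_scaleR: "sq_integrable M f \<Longrightarrow> sq_integrable M (\<lambda>x. c *\<^sub>R f x)"
  unfolding sq_integrable_def by (auto simp: power_mult_distrib)

lemma sq_integrable_minus: "sq_integrable M f \<Longrightarrow> sq_integrable M (\<lambda>x. - f x)"
  using sq_integrable_scaleR[of M f "-1"] by simp

lemma sq_integrable_diff: "sq_integrable M f \<Longrightarrow> sq_integrable M g \<Longrightarrow> sq_integrable M (\<lambda>x. f x - g x)"
  using sq_integrable_add[of M f "\<lambda>x. - g x"] sq_integrable_minus[of M g] by simp

lemma sq_integrable_zero: "sq_integrable M (\<lambda>x. 0)"
  by (simp add: sq_integrable_def)

lemma sq_integrable_const: "finite_measure M \<Longrightarrow> sq_integrable M (\<lambda>x. c)"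
  by (simp add: sq_integrable_def finite_measure.integrable_const)

lemma sq_integrable_sum: "(\<And>i. i \<in> I \<Longrightarrow> sq_integrable M (f i)) \<Longrightarrow> sq_integrable M (\<lambda>x. \<Sum>i\<in>I. f i x)"
  by (induction I rule: infinite_finite_induct) (auto intro: sq_integrable_zero sq_integrable_add)

lemma sq_integrable_bounded_linear:
  assumes "bounded_linear P" "sq_integrable M f"
  shows "sq_integrable M (\<lambda>x. P (f x))"
proof -
  obtain K where K: "\<And>x. norm (P x) \<le> norm x * K" using bounded_linear.bounded[OF assms(1)] by blast
  have "(\<lambda>x. P (f x)) \<in> borel_measurable M"
    using borel_measurable_continuous_onI[OF linear_continuous_on[OF assms(1)]]
      sq_integrable_measurable[OF assms(2)] measurable_compose by blast
  then show ?thesis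
    by (intro sq_integrable_bound[OF assms(2), where C=K]) (auto simp: K mult.commute[of K])
qed

lemmas sq_integrable_fst = sq_integrable_bounded_linear[OF bounded_linear_fst]
lemmas sq_integrable_snd = sq_integrable_bounded_linear[OF bounded_linear_snd]

lemma sq_integrable_Pair:
  fixes f :: "'x \<Rightarrow> 'v::euclidean_space" and g :: "'x \<Rightarrow> 'w::euclidean_space"
  assumes "sq_integrable M f" "sq_integrable M g"
  shows "sq_integrable M (\<lambda>x. (f x, g x))"
proof -
  have 1: "bounded_linear (\<lambda>v::'v. (v, 0::'w))" "bounded_linear (\<lambda>w::'w. (0::'v, w))"
    by (auto intro!: bounded_linear_Pair bounded_linear_ident bounded_linear_zero)
  show ?thesis
    using sq_integrable_add[OF sq_integrable_bounded_linear[OF 1(1) assms(1)] sq_integrable_bounded_linear[OF 1(2) assms(2)]]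
    by simp
qed

lemma sq_integrable_inner:
  assumes f: "sq_integrable M f" and g: "sq_integrable M g"
  shows "integrable M (\<lambda>x. f x \<bullet> g x)"
proof (rule Bochner_Integration.integrable_bound)
  show "integrable M (\<lambda>x. (norm (f x))\<^sup>2 + (norm (g x))\<^sup>2)"
    using f g by (simp add: sq_integrable_def)
  show "(\<lambda>x. f x \<bullet> g x) \<in> borel_measurable M"
    using f g by (auto simp: sq_integrable_def)
  show "AE x in M. norm (f x \<bullet> g x) \<le> norm ((norm (f x))\<^sup>2 + (norm (g x))\<^sup>2)"
  proof (rule AE_I2)
    fix x
    have "\<bar>f x \<bullet> g x\<bar> \<le> norm (f x) * norm (g x)" by (rule Cauchy_Schwarz_ineq2)
    also have "\<dots> \<le> 2 * norm (f x) * norm (g x)" by simp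
    also have "\<dots> \<le> (norm (f x))\<^sup>2 + (norm (g x))\<^sup>2" by (rule sum_squares_bound)
    finally show "norm (f x \<bullet> g x) \<le> norm ((norm (f x))\<^sup>2 + (norm (g x))\<^sup>2)" by simp
  qed
qed

lemma sq_integrable_mult:
  fixes f g :: "'x \<Rightarrow> real"
  shows "sq_integrable M f \<Longrightarrow> sq_integrable M g \<Longrightarrow> integrable M (\<lambda>x. f x * g x)"
  using sq_integrable_inner[of M f g] by simp

lemma l2norm_nonneg[simp]: "0 \<le> l2norm M f"
  by (simp add: l2norm_def)

lemma l2norm_sq: "(l2norm M f)\<^sup>2 = (\<integral>x. (norm (f x))\<^sup>2 \<partial>M)"
  by (simp add: l2norm_def)

lemma l2inner_self: "l2inner M f f = (l2norm M f)\<^sup>2"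
  by (simp add: l2inner_def l2norm_sq power2_norm_eq_inner)

lemma l2inner_commute: "l2inner M f g = l2inner M g f"
  by (simp add: l2inner_def inner_commute)

lemma l2inner_add_left:
  "sq_integrable M f \<Longrightarrow> sq_integrable M g \<Longrightarrow> sq_integrable M h \<Longrightarrow>
    l2inner M (\<lambda>x. f x + g x) h = l2inner M f h + l2inner M g h"
  by (simp add: l2inner_def inner_add_left sq_integrable_inner)

lemma l2inner_add_right:
  "sq_integrable M f \<Longrightarrow> sq_integrable M g \<Longrightarrow> sq_integrable M h \<Longrightarrow>
    l2inner M h (\<lambda>x. f x + g x) = l2inner M h f + l2inner M h g"
  by (simp add: l2inner_def inner_add_right sq_integrable_inner)

lemma l2inner_diff_left:
  "sq_integrable M f \<Longrightarrow> sq_integrable M g \<Longrightarrow> sq_integrable M h \<Longrightarrow>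
    l2inner M (\<lambda>x. f x - g x) h = l2inner M f h - l2inner M g h"
  by (simp add: l2inner_def inner_diff_left sq_integrable_inner)

lemma l2inner_diff_right:
  "sq_integrable M f \<Longrightarrow> sq_integrable M g \<Longrightarrow> sq_integrable M h \<Longrightarrow>
    l2inner M h (\<lambda>x. f x - g x) = l2inner M h f - l2inner M h g"
  by (simp add: l2inner_def inner_diff_right sq_integrable_inner)

lemma l2inner_scaleR_left: "l2inner M (\<lambda>x. c *\<^sub>R f x) g = c * l2inner M f g"
  by (simp add: l2inner_def)

lemma l2inner_scaleR_right: "l2inner M f (\<lambda>x. c *\<^sub>R g x) = c * l2inner M f g"
  by (simp add: l2inner_def)

lemma l2inner_minus_right: "l2inner M f (\<lambda>x. - g x) = - l2inner M f g"
  by (simp add: l2inner_def)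

lemma l2norm_scaleR: "l2norm M (\<lambda>x. c *\<^sub>R f x) = \<bar>c\<bar> * l2norm M f"
  by (simp add: l2norm_def power_mult_distrib real_sqrt_mult)

lemma l2norm_minus: "l2norm M (\<lambda>x. - f x) = l2norm M f"
  by (simp add: l2norm_def)

lemma l2norm_commute: "l2norm M (\<lambda>x. f x - g x) = l2norm M (\<lambda>x. g x - f x)"
  by (simp add: l2norm_def norm_minus_commute)

lemma l2norm_add_sq:
  assumes "sq_integrable M f" "sq_integrable M g"
  shows "(l2norm M (\<lambda>x. f x + g x))\<^sup>2 = (l2norm M f)\<^sup>2 + 2 * l2inner M f g + (l2norm M g)\<^sup>2"
proof -
  have s: "sq_integrable M (\<lambda>x. f x + g x)" using assms by (rule sq_integrable_add)
  show ?thesis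
    unfolding l2inner_self[symmetric]
    using assms s by (simp add: l2inner_add_left l2inner_add_right l2inner_commute[of M g f])
qed

lemma l2norm_diff_sq:
  assumes "sq_integrable M f" "sq_integrable M g"
  shows "(l2norm M (\<lambda>x. f x - g x))\<^sup>2 = (l2norm M f)\<^sup>2 - 2 * l2inner M f g + (l2norm M g)\<^sup>2"
  using l2norm_add_sq[OF assms(1) sq_integrable_minus[OF assms(2)]]
  by (simp add: l2inner_minus_right l2norm_minus)

lemma l2_Cauchy_Schwarz:
  assumes f: "sq_integrable M f" and g: "sq_integrable M g"
  shows "\<bar>l2inner M f g\<bar> \<le> l2norm M f * l2norm M g"
proof -
  let ?a = "(l2norm M f)\<^sup>2" and ?b = "l2inner M f g" and ?c = "(l2norm M g)\<^sup>2"
  have q: "0 \<le> ?a - 2 * t * ?b + t\<^sup>2 * ?c" for t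
  proof -
    have "0 \<le> (l2norm M (\<lambda>x. f x - t *\<^sub>R g x))\<^sup>2" by simp
    also have "\<dots> = ?a - 2 * (t * ?b) + (\<bar>t\<bar> * l2norm M g)\<^sup>2"
      by (simp only: l2norm_diff_sq[OF f sq_integrable_scaleR[OF g]] l2inner_scaleR_right l2norm_scaleR)
    also have "\<dots> = ?a - 2 * t * ?b + t\<^sup>2 * ?c" by (simp add: power_mult_distrib)
    finally show ?thesis .
  qed
  have "?b\<^sup>2 \<le> ?a * ?c"
  proof (cases "?c = 0")
    case True
    have "?b = 0"
    proof (rule ccontr)
      assume "?b \<noteq> 0"
      \<comment> \<open>With \<open>?c = 0\<close> the quadratic is affine in t; this t gives it the
        value -1.\<close>
      then show False using q[of "(?a + 1) / (2 * ?b)"] True by (simp add: field_simps)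
    qed
    then show ?thesis by simp
  next
    case False
    then have "0 < ?c" by (simp add: less_le)
    have "0 \<le> ?a - 2 * (?b / ?c) * ?b + (?b / ?c)\<^sup>2 * ?c" by (rule q)
    also have "\<dots> = ?a - ?b\<^sup>2 / ?c" using \<open>0 < ?c\<close> by (simp add: field_simps power2_eq_square)
    finally show ?thesis using \<open>0 < ?c\<close> by (simp add: field_simps)
  qed
  then have "sqrt (?b\<^sup>2) \<le> sqrt (?a * ?c)" by (rule real_sqrt_le_mono)
  then show ?thesis by (simp add: real_sqrt_mult)
qed

lemma l2norm_triangle:
  assumes f: "sq_integrable M f" and g: "sq_integrable M g"
  shows "l2norm M (\<lambda>x. f x + g x) \<le> l2norm M f + l2norm M g"
proof (rule power2_le_imp_le)
  show "(l2norm M (\<lambda>x. f x + g x))\<^sup>2 \<le> (l2norm M f + l2norm M g)\<^sup>2"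
    using l2_Cauchy_Schwarz[OF f g] by (simp add: l2norm_add_sq[OF f g] power2_sum)
qed simp

lemma l2norm_triangle_diff:
  assumes f: "sq_integrable M f" and g: "sq_integrable M g"
  shows "l2norm M (\<lambda>x. f x - g x) \<le> l2norm M f + l2norm M g"
  using l2norm_triangle[OF f sq_integrable_minus[OF g]] by (simp add: l2norm_minus)

lemma l2norm_triangle3:
  assumes f: "sq_integrable M f" and g: "sq_integrable M g" and h: "sq_integrable M h"
  shows "l2norm M (\<lambda>x. f x - h x) \<le> l2norm M (\<lambda>x. f x - g x) + l2norm M (\<lambda>x. g x - h x)"
  using l2norm_triangle[OF sq_integrable_diff[OF f g] sq_integrable_diff[OF g h]] by simp

lemma l2norm_mono:
  assumes g: "sq_integrable M g" and f: "f \<in> borel_measurable M"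
    and le: "AE x in M. norm (f x) \<le> C * norm (g x)" and C: "0 \<le> C"
  shows "l2norm M f \<le> C * l2norm M g"
proof (rule power2_le_imp_le)
  have "(l2norm M f)\<^sup>2 \<le> (\<integral>x. C\<^sup>2 * (norm (g x))\<^sup>2 \<partial>M)"
    unfolding l2norm_sq
  proof (rule integral_mono_AE)
    show "integrable M (\<lambda>x. (norm (f x))\<^sup>2)"
      using sq_integrable_bound[OF g f le] by (simp add: sq_integrable_def)
    show "integrable M (\<lambda>x. C\<^sup>2 * (norm (g x))\<^sup>2)" using g by (simp add: sq_integrable_def)
    show "AE x in M. (norm (f x))\<^sup>2 \<le> C\<^sup>2 * (norm (g x))\<^sup>2"
      using le by eventually_elim (simp add: power_mult_distrib[symmetric] power_mono)
  qed
  also have "\<dots> = (C * l2norm M g)\<^sup>2" by (simp add: l2norm_sq power_mult_distrib)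
  finally show "(l2norm M f)\<^sup>2 \<le> (C * l2norm M g)\<^sup>2" .
qed (simp add: C)

lemma l2norm_fst_le:
  "sq_integrable M w \<Longrightarrow> l2norm M (\<lambda>x. fst (w x)) \<le> l2norm M w"
  using l2norm_mono[of M w "\<lambda>x. fst (w x)" 1, OF _ sq_integrable_measurable[OF sq_integrable_fst]]
  using norm_fst_le[of "fst (w x)" "snd (w x)" for x] by simp

lemma l2norm_snd_le:
  "sq_integrable M w \<Longrightarrow> l2norm M (\<lambda>x. snd (w x)) \<le> l2norm M w"
  using l2norm_mono[of M w "\<lambda>x. snd (w x)" 1, OF _ sq_integrable_measurable[OF sq_integrable_snd]]
  using norm_snd_le[of "snd (w x)" "fst (w x)" for x] by simp

lemma l2norm_Pair_sq:
  assumes w: "sq_integrable M w"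
  shows "(l2norm M w)\<^sup>2 = (l2norm M (\<lambda>x. fst (w x)))\<^sup>2 + (l2norm M (\<lambda>x. snd (w x)))\<^sup>2"
proof -
  have "(norm (w x))\<^sup>2 = (norm (fst (w x)))\<^sup>2 + (norm (snd (w x)))\<^sup>2" for x
    by (cases "w x") (simp add: norm_Pair)
  then show ?thesis
    using sq_integrable_fst[OF w] sq_integrable_snd[OF w] by (simp add: l2norm_sq sq_integrable_def)
qed

lemma l2norm_Pair_le:
  assumes w: "sq_integrable M w"
  shows "l2norm M w \<le> l2norm M (\<lambda>x. fst (w x)) + l2norm M (\<lambda>x. snd (w x))"
  by (rule power2_le_imp_le) (simp_all add: l2norm_Pair_sq[OF w] power2_sum)

lemma l2norm_eq_0_iff:
  assumes "sq_integrable M f"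
  shows "l2norm M f = 0 \<longleftrightarrow> (AE x in M. f x = 0)"
  using integral_nonneg_eq_0_iff_AE[OF sq_integrable_integrable[OF assms]] by (simp add: l2norm_def)

lemma l2norm_cong_AE:
  assumes "f \<in> borel_measurable M" "g \<in> borel_measurable M" "AE x in M. f x = g x"
  shows "l2norm M f = l2norm M g"
  unfolding l2norm_def using assms by (intro arg_cong[where f=sqrt] integral_cong_AE) auto

lemma l2inner_tendsto_left:
  assumes F: "\<And>k. sq_integrable M (F k)" and f: "sq_integrable M f" and g: "sq_integrable M g"
    and lim: "((\<lambda>k. l2norm M (\<lambda>x. F k x - f x)) \<longlongrightarrow> 0) A"
  shows "((\<lambda>k. l2inner M (F k) g) \<longlongrightarrow> l2inner M f g) A"
proof (rule LIM_zero_cancel, rule tendsto_rabs_zero_cancel, rule tendsto_sandwich[OF _ _ tendsto_const])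
  show "\<forall>\<^sub>F k in A. \<bar>l2inner M (F k) g - l2inner M f g\<bar> \<le> l2norm M (\<lambda>x. F k x - f x) * l2norm M g"
    using l2_Cauchy_Schwarz[OF sq_integrable_diff[OF F f] g]
    by (simp add: l2inner_diff_left[OF F f g])
  show "((\<lambda>k. l2norm M (\<lambda>x. F k x - f x) * l2norm M g) \<longlongrightarrow> 0) A"
    using tendsto_mult_right[OF lim, of "l2norm M g"] by simp
qed auto

lemma l2inner_tendsto_right:
  assumes F: "\<And>k. sq_integrable M (F k)" and f: "sq_integrable M f" and g: "sq_integrable M g"
    and lim: "((\<lambda>k. l2norm M (\<lambda>x. F k x - f x)) \<longlongrightarrow> 0) A"
  shows "((\<lambda>k. l2inner M g (F k)) \<longlongrightarrow> l2inner M g f) A"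
  using l2inner_tendsto_left[OF F f g lim] by (simp add: l2inner_commute)

lemma l2norm_tendsto:
  assumes F: "\<And>k. sq_integrable M (F k)" and f: "sq_integrable M f"
    and lim: "((\<lambda>k. l2norm M (\<lambda>x. F k x - f x)) \<longlongrightarrow> 0) A"
  shows "((\<lambda>k. l2norm M (F k)) \<longlongrightarrow> l2norm M f) A"
proof (rule LIM_zero_cancel, rule tendsto_rabs_zero_cancel, rule tendsto_sandwich[OF _ _ tendsto_const lim])
  have "l2norm M (F k) \<le> l2norm M f + l2norm M (\<lambda>x. F k x - f x)" for k
    using l2norm_triangle[OF f sq_integrable_diff[OF F[of k] f]] by simp
  moreover have "l2norm M f \<le> l2norm M (F k) + l2norm M (\<lambda>x. F k x - f x)" for k
    using l2norm_triangle_diff[OF F[of k] sq_integrable_diff[OF F[of k] f]] by simp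
  ultimately show "\<forall>\<^sub>F k in A. \<bar>l2norm M (F k) - l2norm M f\<bar> \<le> l2norm M (\<lambda>x. F k x - f x)"
    by (intro always_eventually allI abs_leI) (simp_all add: algebra_simps)
qed auto

section \<open>Completeness of L2, and a replacement for weak compactness\<close>

definition l2_Cauchy :: "'x measure \<Rightarrow> (nat \<Rightarrow> 'x \<Rightarrow> 'v::euclidean_space) \<Rightarrow> bool" where
  "l2_Cauchy M F \<longleftrightarrow> (\<forall>e>0. \<exists>N. \<forall>m\<ge>N. \<forall>n\<ge>N. l2norm M (\<lambda>x. F m x - F n x) < e)"

text \<open>Riesz-Fischer: a subsequence with geometrically small increments converges almost
  everywhere, and Fatou's lemma turns the Cauchy property into norm convergence of the whole
  sequence to that pointwise limit.\<close>

theorem l2_complete: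
  fixes F :: "nat \<Rightarrow> 'x \<Rightarrow> 'v::euclidean_space"
  assumes F: "\<And>k. sq_integrable M (F k)" and C: "l2_Cauchy M F"
  obtains f where "sq_integrable M f" "(\<lambda>k. l2norm M (\<lambda>x. F k x - f x)) \<longlonglongrightarrow> 0"
proof -
  have [measurable]: "F k \<in> borel_measurable M" for k using F by (rule sq_integrable_measurable)
  have sqd: "sq_integrable M (\<lambda>x. F m x - F n x)" for m n by (intro sq_integrable_diff F)
  have "\<exists>N. \<forall>m\<ge>N. \<forall>n\<ge>N. l2norm M (\<lambda>x. F m x - F n x) < (1/2)^k" for k
    using C unfolding l2_Cauchy_def by simp
  then obtain N0 where N0: "\<And>k m n. m \<ge> N0 k \<Longrightarrow> n \<ge> N0 k \<Longrightarrow> l2norm M (\<lambda>x. F m x - F n x) < (1/2)^k"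
    by metis
  \<comment> \<open>The sum dominates every \<open>N0 i\<close> with i up to k, so all later indices
    respect all earlier thresholds; the summand k makes r tend to infinity.\<close>
  define r where "r k = k + (\<Sum>i\<le>k. N0 i)" for k
  have r_ge: "r j \<ge> N0 k" if "j \<ge> k" for j k
    using member_le_sum[of k "{..j}" N0] that by (auto simp: r_def)
  have r_id: "r k \<ge> k" for k by (simp add: r_def)
  \<comment> \<open>The squared increments have integral at most \<open>(1/4)^k\<close>, so the
    weight \<open>2^k\<close> still leaves a summable series of integrals. In return, a finite sum
    at x forces the increments at x to decay like \<open>(sqrt (1/2))^k\<close>.\<close>
  define H where "H k x = 2^k * (norm (F (r (Suc k)) x - F (r k) x))\<^sup>2" for k x
  have Hint: "integrable M (H k)" for k
    unfolding H_def using sqd by (simp add: sq_integrable_def)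
  have Hm[measurable]: "H k \<in> borel_measurable M" for k unfolding H_def by simp
  have Hle: "(\<integral>x. H k x \<partial>M) \<le> (1/2)^k" for k
  proof -
    have "(\<integral>x. H k x \<partial>M) = 2^k * (l2norm M (\<lambda>x. F (r (Suc k)) x - F (r k) x))\<^sup>2"
      by (simp add: H_def l2norm_sq)
    also have "\<dots> \<le> 2^k * ((1/2)^k)\<^sup>2"
      using N0[OF r_ge r_ge, of k "Suc k" k] by (intro mult_left_mono power_mono) auto
    also have "\<dots> = (1/2)^k" by (simp add: power2_eq_square power_mult_distrib[symmetric])
    finally show ?thesis .
  qed
  have "(\<integral>\<^sup>+x. (\<Sum>k. ennreal (H k x)) \<partial>M) = (\<Sum>k. \<integral>\<^sup>+x. ennreal (H k x) \<partial>M)"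
    by (rule nn_integral_suminf) simp
  also have "\<dots> = (\<Sum>k. ennreal (\<integral>x. H k x \<partial>M))"
    by (intro suminf_cong nn_integral_eq_integral Hint) (simp add: H_def)
  also have "\<dots> \<le> (\<Sum>k. ennreal ((1/2)^k))"
    by (intro suminf_le) (auto intro: ennreal_leI Hle)
  also have "\<dots> < \<infinity>"
    by (subst suminf_ennreal2) (auto intro: summable_geometric)
  finally have fin: "(\<integral>\<^sup>+x. (\<Sum>k. ennreal (H k x)) \<partial>M) \<noteq> \<infinity>" by simp
  have "AE x in M. (\<Sum>k. ennreal (H k x)) \<noteq> \<infinity>"
    by (rule nn_integral_PInf_AE[OF _ fin]) simp
  then have conv: "AE x in M. convergent (\<lambda>k. F (r k) x)"
  proof eventually_elim
    case (elim x)
    have sm: "summable (\<lambda>k. H k x)"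
      using elim by (intro summable_suminf_not_top) (auto simp: H_def)
    then have "(\<lambda>k. H k x) \<longlonglongrightarrow> 0" by (rule summable_LIMSEQ_zero)
    then have "Bseq (\<lambda>k. H k x)" by (rule convergent_imp_Bseq[OF convergentI])
    then obtain K where K: "K > 0" "\<And>k. norm (H k x) \<le> K" by (auto elim!: BseqE)
    have "norm (F (r (Suc k)) x - F (r k) x) \<le> sqrt K * (sqrt (1/2))^k" for k
    proof -
      have "2^k * (norm (F (r (Suc k)) x - F (r k) x))\<^sup>2 \<le> K" using K(2)[of k] by (simp add: H_def)
      then have "(norm (F (r (Suc k)) x - F (r k) x))\<^sup>2 \<le> K * (1/2)^k" by (simp add: field_simps)
      then have "sqrt ((norm (F (r (Suc k)) x - F (r k) x))\<^sup>2) \<le> sqrt (K * (1/2)^k)" by (rule real_sqrt_le_mono)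
      then show ?thesis by (simp add: real_sqrt_mult real_sqrt_power)
    qed
    moreover have "summable (\<lambda>k. sqrt K * (sqrt (1/2))^k)"
      by (intro summable_mult summable_geometric) (simp add: real_sqrt_divide)
    ultimately have "summable (\<lambda>k. F (r (Suc k)) x - F (r k) x)"
      by (rule summable_comparison_test'[where N=0, rotated])
    then have "convergent (\<lambda>n. \<Sum>k<n. F (r (Suc k)) x - F (r k) x)" by (simp add: summable_iff_convergent)
    then have "convergent (\<lambda>n. F (r n) x - F (r 0) x)"
      using sum_lessThan_telescope[of "\<lambda>k. F (r k) x"] by simp
    then have "convergent (\<lambda>n. (F (r n) x - F (r 0) x) + F (r 0) x)" by (intro convergent_add convergent_const)
    then show ?case by simp
  qed
  define f where "f x = lim (\<lambda>k. F (r k) x)" for x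
  have fm[measurable]: "f \<in> borel_measurable M" unfolding f_def by (rule borel_measurable_lim_metric) simp
  have flim: "AE x in M. (\<lambda>k. F (r k) x) \<longlonglongrightarrow> f x"
    using conv by eventually_elim (simp add: f_def convergent_LIMSEQ_iff)
  \<comment> \<open>Fatou along the almost everywhere convergent subsequence. Integrability is
    concluded together with the bound, so that square integrability of f can be read off from a
    single difference.\<close>
  have key: "integrable M (\<lambda>x. (norm (F n x - f x))\<^sup>2) \<and> (l2norm M (\<lambda>x. F n x - f x))\<^sup>2 \<le> e\<^sup>2"
    if e: "e > 0" and N: "\<And>m. m \<ge> N \<Longrightarrow> l2norm M (\<lambda>x. F n x - F m x) < e" for n e N
  proof -
    have "(\<integral>\<^sup>+x. ennreal ((norm (F n x - f x))\<^sup>2) \<partial>M) \<le> (\<integral>\<^sup>+x. liminf (\<lambda>k. ennreal ((norm (F n x - F (r k) x))\<^sup>2)) \<partial>M)"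
    proof (rule nn_integral_mono_AE)
      show "AE x in M. ennreal ((norm (F n x - f x))\<^sup>2) \<le> liminf (\<lambda>k. ennreal ((norm (F n x - F (r k) x))\<^sup>2))"
        using flim
      proof eventually_elim
        case (elim x)
        have "(\<lambda>k. ennreal ((norm (F n x - F (r k) x))\<^sup>2)) \<longlonglongrightarrow> ennreal ((norm (F n x - f x))\<^sup>2)"
          by (intro tendsto_intros elim)
        then show ?case using lim_imp_Liminf[OF sequentially_bot, of "\<lambda>k. ennreal ((norm (F n x - F (r k) x))\<^sup>2)"] by (metis order_refl)
      qed
    qed
    also have "\<dots> \<le> liminf (\<lambda>k. \<integral>\<^sup>+x. ennreal ((norm (F n x - F (r k) x))\<^sup>2) \<partial>M)"
      by (rule nn_integral_liminf) simp
    also have "\<dots> \<le> ennreal (e\<^sup>2)"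
    proof -
      have "(\<integral>\<^sup>+x. ennreal ((norm (F n x - F (r k) x))\<^sup>2) \<partial>M) \<le> ennreal (e\<^sup>2)" if "k \<ge> N" for k
      proof -
        have "(\<integral>\<^sup>+x. ennreal ((norm (F n x - F (r k) x))\<^sup>2) \<partial>M) = ennreal ((l2norm M (\<lambda>x. F n x - F (r k) x))\<^sup>2)"
          unfolding l2norm_sq by (intro nn_integral_eq_integral sq_integrable_integrable sqd) simp
        also have "\<dots> \<le> ennreal (e\<^sup>2)"
          using N[of "r k"] r_id[of k] that by (intro ennreal_leI power_mono) auto
        finally show ?thesis .
      qed
      then have "\<forall>\<^sub>F k in sequentially. (\<integral>\<^sup>+x. ennreal ((norm (F n x - F (r k) x))\<^sup>2) \<partial>M) \<le> ennreal (e\<^sup>2)"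
        using eventually_sequentially by blast
      then have "limsup (\<lambda>k. \<integral>\<^sup>+x. ennreal ((norm (F n x - F (r k) x))\<^sup>2) \<partial>M) \<le> ennreal (e\<^sup>2)"
        by (rule Limsup_bounded)
      moreover have "liminf (\<lambda>k. \<integral>\<^sup>+x. ennreal ((norm (F n x - F (r k) x))\<^sup>2) \<partial>M) \<le> limsup (\<lambda>k. \<integral>\<^sup>+x. ennreal ((norm (F n x - F (r k) x))\<^sup>2) \<partial>M)"
        by (rule Liminf_le_Limsup) simp
      ultimately show ?thesis by order
    qed
    finally have le: "(\<integral>\<^sup>+x. ennreal ((norm (F n x - f x))\<^sup>2) \<partial>M) \<le> ennreal (e\<^sup>2)" .
    have i: "integrable M (\<lambda>x. (norm (F n x - f x))\<^sup>2)"
      using le by (intro integrableI_bounded) (auto simp: less_top[symmetric] top_unique)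
    have "ennreal (\<integral>x. (norm (F n x - f x))\<^sup>2 \<partial>M) \<le> ennreal (e\<^sup>2)"
      using le by (subst nn_integral_eq_integral[OF i, symmetric]) auto
    then show ?thesis using i by (simp add: l2norm_sq)
  qed
  have sqf: "sq_integrable M f"
  proof -
    have "sq_integrable M (\<lambda>x. F (N0 0) x - f x)"
      using key[of 1 "N0 0" "N0 0"] N0[of 0 "N0 0"] by (auto simp: sq_integrable_def)
    from sq_integrable_diff[OF F[of "N0 0"] this] show ?thesis by simp
  qed
  have "(\<lambda>k. l2norm M (\<lambda>x. F k x - f x)) \<longlonglongrightarrow> 0"
  proof (rule LIMSEQ_I)
    fix e :: real assume e: "0 < e"
    then obtain N where N: "\<forall>m\<ge>N. \<forall>n\<ge>N. l2norm M (\<lambda>x. F m x - F n x) < e/2"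
      using C unfolding l2_Cauchy_def by (meson half_gt_zero)
    have "l2norm M (\<lambda>x. F n x - f x) \<le> e/2" if "n \<ge> N" for n
    proof (rule power2_le_imp_le)
      show "(l2norm M (\<lambda>x. F n x - f x))\<^sup>2 \<le> (e/2)\<^sup>2"
        using key[of "e/2" N n] N that e by auto
    qed (use e in simp)
    then show "\<exists>no. \<forall>n\<ge>no. norm (l2norm M (\<lambda>x. F n x - f x) - 0) < e"
      using e by (intro exI[of _ N]) (auto intro: le_less_trans[where y="e/2"])
  qed
  then show ?thesis using that sqf by blast
qed

lemma l2_Cauchy_if_bound:
  assumes "\<And>m n. n \<le> m \<Longrightarrow> (l2norm M (\<lambda>x. F m x - F n x))\<^sup>2 \<le> b n" and b: "b \<longlonglongrightarrow> 0"
  shows "l2_Cauchy M F"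
  unfolding l2_Cauchy_def
proof (intro allI impI)
  fix e :: real assume e: "0 < e"
  then have "\<forall>\<^sub>F n in sequentially. b n < e\<^sup>2" using b by (intro order_tendstoD) auto
  then obtain N where N: "\<And>n. n \<ge> N \<Longrightarrow> b n < e\<^sup>2" unfolding eventually_sequentially by blast
  have *: "l2norm M (\<lambda>x. F m x - F n x) < e" if "n \<ge> N" "n \<le> m" for m n
    using assms(1)[OF that(2)] N[OF that(1)] e by (intro power2_less_imp_less[of _ e]) auto
  show "\<exists>N. \<forall>m\<ge>N. \<forall>n\<ge>N. l2norm M (\<lambda>x. F m x - F n x) < e"
    by (metis * l2norm_commute nle_le)
qed

text \<open>A substitute for weak compactness: near-minimisers of the norm in a decreasing sequence of
  midpoint-convex sets form a Cauchy sequence, by the parallelogram law.\<close>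
lemma near_minimisers_Cauchy:
  fixes K :: "nat \<Rightarrow> ('x \<Rightarrow> 'v::euclidean_space) set"
  assumes sq: "\<And>n z. z \<in> K n \<Longrightarrow> sq_integrable M z"
    and dec: "\<And>m n. n \<le> m \<Longrightarrow> K m \<subseteq> K n"
    and mid: "\<And>n y z. y \<in> K n \<Longrightarrow> z \<in> K n \<Longrightarrow> (\<lambda>x. (1/2) *\<^sub>R (y x + z x)) \<in> K n"
    and bd: "\<And>n. \<exists>z\<in>K n. l2norm M z \<le> R"
  obtains z d where "\<And>n. z n \<in> K n" "l2_Cauchy M z"
    "\<And>n y. y \<in> K n \<Longrightarrow> d n \<le> (l2norm M y)\<^sup>2" "\<And>n. (l2norm M (z n))\<^sup>2 \<le> d n + inverse (Suc n)"
proof -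
  define d where "d n = Inf ((\<lambda>z. (l2norm M z)\<^sup>2) ` K n)" for n
  have bdd: "bdd_below ((\<lambda>z. (l2norm M z)\<^sup>2) ` K n)" for n by (rule bdd_belowI2[of _ 0]) simp
  have d_le: "d n \<le> (l2norm M y)\<^sup>2" if "y \<in> K n" for n y
    unfolding d_def using that by (intro cInf_lower bdd) auto
  have ne: "K n \<noteq> {}" for n using bd[of n] by auto
  have "\<exists>z\<in>K n. (l2norm M z)\<^sup>2 < d n + inverse (Suc n)" for n
    using cInf_lessD[of "(\<lambda>z. (l2norm M z)\<^sup>2) ` K n" "d n + inverse (Suc n)"] ne[of n] by (auto simp: d_def)
  then obtain z where z: "\<And>n. z n \<in> K n" "\<And>n. (l2norm M (z n))\<^sup>2 < d n + inverse (Suc n)" by metis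
  have inc: "d n \<le> d m" if "n \<le> m" for m n
    unfolding d_def by (intro cInf_superset_mono image_mono dec that bdd) (use ne in auto)
  have dR: "d n \<le> R\<^sup>2" for n
  proof -
    obtain y where y: "y \<in> K n" "l2norm M y \<le> R" using bd by blast
    have "d n \<le> (l2norm M y)\<^sup>2" by (rule d_le[OF y(1)])
    also have "\<dots> \<le> R\<^sup>2" using y(2) by (intro power_mono) auto
    finally show ?thesis .
  qed
  define D where "D = (SUP n. d n)"
  have bddD: "bdd_above (range d)" using dR by (intro bdd_aboveI2)
  have dD: "d n \<le> D" for n unfolding D_def by (intro cSUP_upper bddD) simp
  have dlim: "d \<longlonglongrightarrow> D"
    unfolding D_def by (intro LIMSEQ_incseq_SUP bddD) (simp add: inc monoI)
  have "l2_Cauchy M z"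
  \<comment> \<open>Parallelogram law: the midpoint of \<open>z m\<close> and \<open>z n\<close>
    lies in \<open>K n\<close>, so the sum has squared norm at least \<open>4 * d n\<close>. The
    increasing numbers \<open>d n\<close> have the finite limit D, and each squared norm exceeds its
    infimum by at most the inverse of the index, which yields this null sequence.\<close>
  proof (rule l2_Cauchy_if_bound[where b="\<lambda>n. 2 * (D - d n) + 4 * inverse (Suc n)"])
    fix m n :: nat assume nm: "n \<le> m"
    have zm: "z m \<in> K n" using z(1)[of m] dec[OF nm] by auto
    note s = sq[OF z(1)[of m]] sq[OF z(1)[of n]]
    have "4 * d n \<le> 4 * (l2norm M (\<lambda>x. (1/2) *\<^sub>R (z m x + z n x)))\<^sup>2"
      using d_le[OF mid[OF zm z(1)[of n]]] by simp
    also have "\<dots> = (l2norm M (\<lambda>x. z m x + z n x))\<^sup>2"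
      unfolding l2norm_scaleR by (simp add: power2_eq_square)
    finally have "(l2norm M (\<lambda>x. z m x - z n x))\<^sup>2 \<le> 2 * (l2norm M (z m))\<^sup>2 + 2 * (l2norm M (z n))\<^sup>2 - 4 * d n"
      unfolding l2norm_add_sq[OF s] l2norm_diff_sq[OF s] by simp
    also have "\<dots> \<le> 2 * (d m + inverse (Suc m)) + 2 * (d n + inverse (Suc n)) - 4 * d n"
      using z(2)[of m] z(2)[of n] by simp
    also have "\<dots> \<le> 2 * (D - d n) + 4 * inverse (Suc n)"
    proof -
      have "inverse (real (Suc m)) \<le> inverse (real (Suc n))" using nm by (intro le_imp_inverse_le) auto
      then show ?thesis using dD[of m] by argo
    qed
    finally show "(l2norm M (\<lambda>x. z m x - z n x))\<^sup>2 \<le> 2 * (D - d n) + 4 * inverse (Suc n)" .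
  next
    have "(\<lambda>n. 2 * (D - d n) + 4 * inverse (real (Suc n))) \<longlonglongrightarrow> 2 * (D - D) + 4 * 0"
      by (intro tendsto_intros dlim LIMSEQ_inverse_real_of_nat)
    then show "(\<lambda>n. 2 * (D - d n) + 4 * inverse (real (Suc n))) \<longlonglongrightarrow> 0" by simp
  qed
  then show ?thesis using that[of z d] z d_le by (meson less_imp_le)
qed

subsection \<open>Smooth functions and test functions\<close>

lemma smooth_iff:
  "smooth f \<longleftrightarrow> (\<forall>x. f differentiable (at x)) \<and> (\<forall>e\<in>Basis. smooth (\<lambda>x. frechet_derivative f (at x) e))"
proof
  assume "smooth f"
  then have "Ck (Suc k) f" for k unfolding smooth_def by blast
  then show "(\<forall>x. f differentiable (at x)) \<and> (\<forall>e\<in>Basis. smooth (\<lambda>x. frechet_derivative f (at x) e))"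
    by (simp add: smooth_def)
next
  assume *: "(\<forall>x. f differentiable (at x)) \<and> (\<forall>e\<in>Basis. smooth (\<lambda>x. frechet_derivative f (at x) e))"
  have "Ck k f" for k
  proof (cases k)
    case 0
    have "continuous_on UNIV f"
      using * by (auto simp: continuous_on_eq_continuous_at intro: differentiable_imp_continuous_within)
    then show ?thesis using 0 by simp
  next
    case (Suc j)
    then show ?thesis using * by (simp add: smooth_def)
  qed
  then show "smooth f" by (simp add: smooth_def)
qed

text \<open>Smoothness is the largest property that implies differentiability and is inherited by
  partial derivatives. A class of functions given by a formula and stable under differentiation
  therefore consists of smooth functions; this avoids an induction over k for each formula.\<close>

lemma smooth_coinduct:
  assumes "P f"
    and step: "\<And>f. P f \<Longrightarrow> (\<forall>x. f differentiable (at x)) \<and> (\<forall>e\<in>Basis. P (\<lambda>x. frechet_derivative f (at x) e))"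
  shows "smooth f"
proof -
  have "P f \<Longrightarrow> Ck k f" for k f
  proof (induction k arbitrary: f)
    case 0
    then show ?case using step[OF 0]
      by (auto simp: continuous_on_eq_continuous_at intro: differentiable_imp_continuous_within)
  next
    case (Suc k)
    then show ?case using step[OF Suc.prems] by auto
  qed
  then show ?thesis using assms(1) by (simp add: smooth_def)
qed

lemma smooth_differentiable: "smooth f \<Longrightarrow> f differentiable (at x)"
  using smooth_iff by blast

lemma smooth_partial: "smooth f \<Longrightarrow> e \<in> Basis \<Longrightarrow> smooth (\<lambda>x. frechet_derivative f (at x) e)"
  using smooth_iff by blast

lemma smooth_has_derivative: "smooth f \<Longrightarrow> (f has_derivative frechet_derivative f (at x)) (at x)"
  using smooth_differentiable frechet_derivative_works by blast

lemma smooth_continuous: "smooth f \<Longrightarrow> continuous_on UNIV f"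
  unfolding smooth_def using Ck.simps(1) by blast

lemma Ck_add: "Ck k f \<Longrightarrow> Ck k g \<Longrightarrow> Ck k (\<lambda>x. f x + g x)"
proof (induction k arbitrary: f g)
  case 0
  then show ?case by (auto intro: continuous_on_add)
next
  case (Suc k)
  then have d: "f differentiable at x" "g differentiable at x" for x by auto
  have "frechet_derivative (\<lambda>x. f x + g x) (at x) = (\<lambda>h. frechet_derivative f (at x) h + frechet_derivative g (at x) h)" for x
    using d by (intro frechet_derivative_at[symmetric] has_derivative_add) (auto simp: frechet_derivative_works[symmetric])
  then show ?case using Suc d by simp
qed

lemma smooth_add: "smooth f \<Longrightarrow> smooth g \<Longrightarrow> smooth (\<lambda>x. f x + g x)"
  by (simp add: smooth_def Ck_add)

lemma frechet_derivative_mult_real: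
  fixes f g :: "'x::euclidean_space \<Rightarrow> real"
  assumes "f differentiable at x" "g differentiable at x"
  shows "frechet_derivative (\<lambda>x. f x * g x) (at x) e
    = f x * frechet_derivative g (at x) e + frechet_derivative f (at x) e * g x"
proof -
  have "((\<lambda>x. f x * g x) has_derivative (\<lambda>h. f x * frechet_derivative g (at x) h + frechet_derivative f (at x) h * g x)) (at x)"
    using assms by (intro has_derivative_mult) (auto simp: frechet_derivative_works[symmetric])
  from frechet_derivative_at[OF this, symmetric] show ?thesis by simp
qed

lemma smooth_mult:
  assumes "smooth f" "smooth g"
  shows "smooth (\<lambda>x. f x * g x)"
proof -
  \<comment> \<open>The induction carries smoothness of both factors rather than
    \<open>Ck k\<close>: the product rule leaves one factor undifferentiated, and
    \<open>Ck (Suc k)\<close> does not contain \<open>Ck k\<close> by definition.\<close>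
  have "smooth f \<Longrightarrow> smooth g \<Longrightarrow> Ck k (\<lambda>x. f x * g x)" for k f and g :: "'a \<Rightarrow> real"
  proof (induction k arbitrary: f g)
    case 0
    then show ?case by (auto intro: continuous_on_mult smooth_continuous)
  next
    case (Suc k)
    show ?case
      using Suc by (auto simp: frechet_derivative_mult_real smooth_differentiable smooth_partial
          intro!: Ck_add derivative_intros)
  qed
  then show ?thesis using assms by (simp add: smooth_def)
qed

lemma smooth_const: "smooth (\<lambda>x. c)"
proof (rule smooth_coinduct[where P="\<lambda>f. \<exists>c. f = (\<lambda>x. c)"])
  fix f :: "'a \<Rightarrow> real" assume "\<exists>c. f = (\<lambda>x. c)"
  then show "(\<forall>x. f differentiable at x) \<and> (\<forall>e\<in>Basis. \<exists>c. (\<lambda>x. frechet_derivative f (at x) e) = (\<lambda>x. c))"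
    by (auto simp: frechet_derivative_const)
qed auto

lemma frechet_derivative_inner: "frechet_derivative (\<lambda>x. x \<bullet> a) (at x) = (\<lambda>h. h \<bullet> a)"
  by (intro frechet_derivative_at[symmetric] derivative_eq_intros) auto

lemma smooth_inner: "smooth (\<lambda>x. x \<bullet> a)"
  by (subst smooth_iff) (auto simp: frechet_derivative_inner smooth_const intro!: derivative_intros)

lemma smooth_prod: "(\<And>i. i \<in> I \<Longrightarrow> smooth (f i)) \<Longrightarrow> smooth (\<lambda>x. \<Prod>i\<in>I. f i x)"
  by (induction I rule: infinite_finite_induct) (auto intro: smooth_const smooth_mult)

lemma smooth_compose_affine:
  fixes g :: "real \<Rightarrow> real" and a :: "'x::euclidean_space"
  assumes "smooth g"
  shows "smooth (\<lambda>x. g (x \<bullet> a + d))"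
\<comment> \<open>The factor c absorbs the constant \<open>e \<bullet> a\<close> that the chain rule
  produces, so the class is closed under partial derivatives.\<close>
proof (rule smooth_coinduct[where P="\<lambda>f. \<exists>g c. smooth g \<and> f = (\<lambda>x. c * g (x \<bullet> a + d))"])
  show "\<exists>g' c. smooth g' \<and> (\<lambda>x. g (x \<bullet> a + d)) = (\<lambda>x. c * g' (x \<bullet> a + d))"
    using assms by (intro exI[of _ g] exI[of _ 1]) simp
  fix f :: "'x \<Rightarrow> real" assume "\<exists>g c. smooth g \<and> f = (\<lambda>x. c * g (x \<bullet> a + d))"
  then obtain g c where g: "smooth g" and f: "f = (\<lambda>x. c * g (x \<bullet> a + d))" by blast
  have D: "(f has_derivative (\<lambda>h. c * frechet_derivative g (at (x \<bullet> a + d)) (h \<bullet> a))) (at x)" for x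
  proof -
    have "((\<lambda>x. x \<bullet> a + d) has_derivative (\<lambda>h. h \<bullet> a)) (at x)" by (auto intro!: derivative_eq_intros)
    from has_derivative_compose[OF this smooth_has_derivative[OF g]]
    show ?thesis unfolding f by (rule has_derivative_mult_right)
  qed
  have lin: "frechet_derivative g (at y) r = r * frechet_derivative g (at y) 1" for y r
    using linear_frechet_derivative[OF smooth_differentiable[OF g], of y] linear_scale[of _ r 1]
    by (metis mult.right_neutral real_scaleR_def)
  have "frechet_derivative f (at x) e = c * (e \<bullet> a) * frechet_derivative g (at (x \<bullet> a + d)) 1" for x e
    unfolding frechet_derivative_at[OF D, symmetric] by (subst lin) simp
  moreover have "smooth (\<lambda>y. frechet_derivative g (at y) 1)" by (rule smooth_partial[OF g]) simp
  ultimately show "(\<forall>x. f differentiable at x) \<and> (\<forall>e\<in>Basis. \<exists>g c. smooth g \<and> (\<lambda>x. frechet_derivative f (at x) e) = (\<lambda>x. c * g (x \<bullet> a + d)))"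
    using D by (auto simp: differentiable_def)
qed

text \<open>The classical flat function exp(-1/t), multiplied by polynomials in 1/t so that the
  family is closed under differentiation.\<close>

definition exp_flat :: "real poly \<Rightarrow> real \<Rightarrow> real" where
  "exp_flat p t = (if t > 0 then poly p (1/t) * exp (- (1/t)) else 0)"

lemma poly_exp_tendsto_0: "((\<lambda>s. poly p s * exp (- s)) \<longlongrightarrow> (0::real)) at_top"
proof -
  have "((\<lambda>s. \<Sum>i\<le>degree p. coeff p i * (s ^ i / exp s)) \<longlongrightarrow> (\<Sum>i\<le>degree p. coeff p i * 0)) at_top"
    by (intro tendsto_sum tendsto_mult tendsto_const tendsto_power_div_exp_0)
  then show ?thesis by (simp add: poly_altdef exp_minus sum_distrib_right divide_inverse mult.assoc)
qed

lemma exp_flat_tendsto_0: "(exp_flat p \<longlongrightarrow> 0) (at 0)"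
proof (rule filterlim_split_at_real)
  show "(exp_flat p \<longlongrightarrow> 0) (at_left 0)"
    by (rule tendsto_eventually) (auto simp: exp_flat_def eventually_at_filter)
  have "((\<lambda>t. poly p (inverse t) * exp (- inverse t)) \<longlongrightarrow> 0) (at_right (0::real))"
    using poly_exp_tendsto_0 filterlim_inverse_at_top_right by (rule filterlim_compose)
  then show "(exp_flat p \<longlongrightarrow> 0) (at_right 0)"
    by (rule Lim_transform_eventually) (auto simp: exp_flat_def eventually_at_filter inverse_eq_divide)
qed

text \<open>With s = 1/t one has d/dt = -s^2 d/ds, so p(s) exp(-s) has derivative s^2 (p(s) - p'(s))
  exp(-s). The only delicate point is t = 0.\<close>

lemma exp_flat_DERIV:
  "(exp_flat p has_real_derivative exp_flat ([:0,0,1:] * (p - pderiv p)) t) (at t)"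
proof -
  consider "t > 0" | "t < 0" | "t = 0" by linarith
  then show ?thesis
  proof cases
    case 1
    have "((\<lambda>t. poly p (1/t) * exp (- (1/t))) has_real_derivative exp_flat ([:0,0,1:] * (p - pderiv p)) t) (at t)"
      using 1 by (auto intro!: derivative_eq_intros poly_DERIV[THEN DERIV_chain2]
          simp: exp_flat_def field_simps power2_eq_square)
    then show ?thesis
      by (rule DERIV_cong_ev[THEN iffD1, OF refl _ refl, rotated])
        (use 1 in \<open>auto simp: exp_flat_def intro!: eventually_mono[OF eventually_nhds_in_open[of "{0<..}" t]]\<close>)
  next
    case 2
    have "((\<lambda>t. 0) has_real_derivative 0) (at t)" by simp
    then have "(exp_flat p has_real_derivative 0) (at t)"
      by (rule DERIV_cong_ev[THEN iffD1, OF refl _ refl, rotated])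
        (use 2 in \<open>auto simp: exp_flat_def intro!: eventually_mono[OF eventually_nhds_in_open[of "{..<0}" t]]\<close>)
    then show ?thesis using 2 by (simp add: exp_flat_def)
  next
    case 3
    \<comment> \<open>At 0 the difference quotient is again a member of the family, with the
      polynomial s p(s), and therefore tends to 0.\<close>
    have "((\<lambda>h. (exp_flat p (0 + h) - exp_flat p 0) / h) \<longlongrightarrow> 0) (at 0)"
      using exp_flat_tendsto_0[of "[:0,1:] * p"]
      by (rule Lim_transform_eventually) (auto simp: exp_flat_def eventually_at_filter)
    then show ?thesis using 3 by (simp add: DERIV_def exp_flat_def)
  qed
qed

lemma smooth_exp_flat: "smooth (exp_flat p)"
proof (rule smooth_coinduct[where P="\<lambda>f. \<exists>p. f = exp_flat p"])
  fix f assume "\<exists>p. f = exp_flat p"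
  then obtain p where f: "f = exp_flat p" by blast
  have "frechet_derivative f (at x) = (\<lambda>h. exp_flat ([:0,0,1:] * (p - pderiv p)) x * h)" for x
    using exp_flat_DERIV[of p x] unfolding f has_field_derivative_def by (rule frechet_derivative_at[symmetric])
  moreover have "f differentiable at x" for x
    using exp_flat_DERIV[of p x] unfolding f by (auto simp: real_differentiable_def)
  ultimately show "(\<forall>x. f differentiable at x) \<and> (\<forall>e\<in>Basis. \<exists>p. (\<lambda>x. frechet_derivative f (at x) e) = exp_flat p)"
    by auto
qed auto

text \<open>One flat factor for each face of the box. The dilation by k makes every factor tend to 1
  where its argument is positive, so the bumps are test functions with values in [0, 1] that
  converge pointwise to the indicator of the open box.\<close>

definition box_bump :: "'x::euclidean_space \<Rightarrow> 'x \<Rightarrow> real \<Rightarrow> 'x \<Rightarrow> real" where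
  "box_bump a b k x = (\<Prod>e\<in>Basis. exp_flat 1 (k * (x \<bullet> e - a \<bullet> e)) * exp_flat 1 (k * (b \<bullet> e - x \<bullet> e)))"

lemma exp_flat_1_bounds: "0 \<le> exp_flat 1 t" "exp_flat 1 t \<le> 1"
  by (auto simp: exp_flat_def)

lemma box_bump_bounds: "0 \<le> box_bump a b k x" "box_bump a b k x \<le> 1"
  unfolding box_bump_def
  by (rule prod_nonneg, simp add: exp_flat_1_bounds)
    (rule prod_le_1, simp add: exp_flat_1_bounds mult_le_one)

lemma box_bump_eq_0: "k > 0 \<Longrightarrow> x \<notin> box a b \<Longrightarrow> box_bump a b k x = 0"
proof -
  assume k: "k > 0" and "x \<notin> box a b"
  then obtain e where e: "e \<in> Basis" "\<not> (a \<bullet> e < x \<bullet> e \<and> x \<bullet> e < b \<bullet> e)" by (auto simp: mem_box)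
  have "exp_flat 1 (k * t) = 0" if "t \<le> 0" for t
    using that k by (simp add: exp_flat_def not_less mult_nonneg_nonpos)
  then have "exp_flat 1 (k * (x \<bullet> e - a \<bullet> e)) * exp_flat 1 (k * (b \<bullet> e - x \<bullet> e)) = 0"
    using e(2) by (cases "a \<bullet> e < x \<bullet> e") auto
  then show "box_bump a b k x = 0"
    unfolding box_bump_def using e(1) by (intro prod_zero) auto
qed

lemma smooth_box_bump: "smooth (box_bump a b k)"
proof -
  have "smooth (\<lambda>x. exp_flat 1 (x \<bullet> (k *\<^sub>R e) + (- k * (a \<bullet> e))) * exp_flat 1 (x \<bullet> ((- k) *\<^sub>R e) + k * (b \<bullet> e)))" for e
    by (intro smooth_mult smooth_compose_affine smooth_exp_flat)
  then have "smooth (\<lambda>x. exp_flat 1 (k * (x \<bullet> e - a \<bullet> e)) * exp_flat 1 (k * (b \<bullet> e - x \<bullet> e)))" for e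
    by (simp add: algebra_simps)
  then have "smooth (\<lambda>x. \<Prod>e\<in>Basis. exp_flat 1 (k * (x \<bullet> e - a \<bullet> e)) * exp_flat 1 (k * (b \<bullet> e - x \<bullet> e)))"
    by (rule smooth_prod)
  then show ?thesis by (simp add: box_bump_def[abs_def])
qed

lemma box_bump_tendsto:
  "(\<lambda>n. box_bump a b (real (Suc n)) x) \<longlonglongrightarrow> indicator (box a b) x"
proof (cases "x \<in> box a b")
  case True
  have "(\<lambda>n. exp_flat 1 (real (Suc n) * t)) \<longlonglongrightarrow> 1" if "t > 0" for t
  proof -
    have "(\<lambda>n. exp (- (inverse (real (Suc n)) * inverse t))) \<longlonglongrightarrow> exp (- (0 * inverse t))"
      by (intro tendsto_intros LIMSEQ_inverse_real_of_nat)
    then show ?thesis using that by (simp add: exp_flat_def divide_inverse)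
  qed
  then have "(\<lambda>n. box_bump a b (real (Suc n)) x) \<longlonglongrightarrow> (\<Prod>e\<in>(Basis::'a set). 1 * 1)"
    unfolding box_bump_def using True by (intro tendsto_prod tendsto_mult) (auto simp: mem_box)
  then show ?thesis using True by simp
next
  case False
  then show ?thesis by (simp add: box_bump_eq_0)
qed

section \<open>Test functions, gradients and jets\<close>

lemma test_fun_smooth: "test_fun \<Omega> \<phi> \<Longrightarrow> smooth \<phi>"
  by (simp add: test_fun_def)

lemma test_funI:
  assumes "smooth \<phi>" "compact K" "K \<subseteq> \<Omega>" "\<And>x. x \<notin> K \<Longrightarrow> \<phi> x = 0"
  shows "test_fun \<Omega> \<phi>"
proof -
  have "closure {x. \<phi> x \<noteq> 0} \<subseteq> K"
    using assms(2,4) by (intro closure_minimal) (auto simp: compact_imp_closed)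
  moreover from this have "compact (closure {x. \<phi> x \<noteq> 0})"
    using bounded_subset[OF compact_imp_bounded[OF assms(2)], of "closure {x. \<phi> x \<noteq> 0}"] by (simp add: compact_eq_bounded_closed)
  ultimately show ?thesis using assms(1,3) by (auto simp: test_fun_def)
qed

lemma test_fun_box_bump:
  assumes "cbox a b \<subseteq> \<Omega>" "k > 0"
  shows "test_fun \<Omega> (box_bump a b k)"
proof (rule test_funI[OF smooth_box_bump compact_cbox assms(1)])
  fix x assume "x \<notin> cbox a b"
  then have "x \<notin> box a b" using box_subset_cbox by blast
  then show "box_bump a b k x = 0" by (rule box_bump_eq_0[OF assms(2)])
qed

lemma test_fun_supp:
  assumes "test_fun \<Omega> \<phi>"
  obtains K where "compact K" "K \<subseteq> \<Omega>" "\<And>x. x \<notin> K \<Longrightarrow> \<phi> x = 0"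
    "\<And>x e. x \<notin> K \<Longrightarrow> frechet_derivative \<phi> (at x) e = 0"
proof -
  define K where "K = closure {x. \<phi> x \<noteq> 0}"
  have K: "compact K" "K \<subseteq> \<Omega>" using assms by (auto simp: test_fun_def K_def)
  have *: "\<phi> x = 0" if "x \<notin> K" for x
    using that closure_subset[of "{x. \<phi> x \<noteq> 0}"] unfolding K_def by blast
  have "frechet_derivative \<phi> (at x) e = 0" if "x \<notin> K" for x e
  proof -
    have "((\<lambda>x. 0::real) has_derivative (\<lambda>h. 0)) (at x)" by simp
    then have "(\<phi> has_derivative (\<lambda>h. 0)) (at x)"
      by (rule has_derivative_transform_within_open[where s="- K"]) (use that * K(1) in \<open>auto intro: compact_imp_closed\<close>)
    from frechet_derivative_at[OF this, symmetric] show ?thesis by simp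
  qed
  with K * show thesis by (rule that)
qed

lemma test_fun_outside:
  assumes "test_fun \<Omega> \<phi>" "x \<notin> \<Omega>" shows "\<phi> x = 0"
  by (rule test_fun_supp[OF assms(1)]) (use assms(2) in auto)

lemma test_fun_partial:
  assumes "test_fun \<Omega> \<phi>" "e \<in> Basis"
  shows "test_fun \<Omega> (\<lambda>x. frechet_derivative \<phi> (at x) e)"
proof -
  obtain K where "compact K" "K \<subseteq> \<Omega>" "\<And>x. x \<notin> K \<Longrightarrow> \<phi> x = 0" "\<And>x e. x \<notin> K \<Longrightarrow> frechet_derivative \<phi> (at x) e = 0"
    by (rule test_fun_supp[OF assms(1)]) (rule that)
  then show ?thesis
    using smooth_partial[OF test_fun_smooth[OF assms(1)] assms(2)] by (intro test_funI) auto
qed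

lemma test_fun_mult:
  assumes "test_fun \<Omega> \<phi>" "smooth g"
  shows "test_fun \<Omega> (\<lambda>x. \<phi> x * g x)"
proof -
  obtain K where "compact K" "K \<subseteq> \<Omega>" "\<And>x. x \<notin> K \<Longrightarrow> \<phi> x = 0"
    by (rule test_fun_supp[OF assms(1)]) (rule that)
  then show ?thesis
    using smooth_mult[OF test_fun_smooth[OF assms(1)] assms(2)] by (intro test_funI) auto
qed

lemma test_fun_scaleR: "test_fun \<Omega> \<phi> \<Longrightarrow> test_fun \<Omega> (\<lambda>x. c * \<phi> x)"
  using test_fun_mult[OF _ smooth_const[of c]] by (simp add: mult.commute)

lemma test_fun_add:
  assumes "test_fun \<Omega> \<phi>" "test_fun \<Omega> \<psi>"
  shows "test_fun \<Omega> (\<lambda>x. \<phi> x + \<psi> x)"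
proof -
  obtain K where "compact K" "K \<subseteq> \<Omega>" "\<And>x. x \<notin> K \<Longrightarrow> \<phi> x = 0"
    by (rule test_fun_supp[OF assms(1)]) (rule that)
  moreover obtain L where "compact L" "L \<subseteq> \<Omega>" "\<And>x. x \<notin> L \<Longrightarrow> \<psi> x = 0"
    by (rule test_fun_supp[OF assms(2)]) (rule that)
  ultimately show ?thesis
    using smooth_add[OF assms[THEN test_fun_smooth]] by (intro test_funI[of _ "K \<union> L"]) auto
qed

lemma test_fun_zero: "test_fun \<Omega> (\<lambda>x. 0)"
  by (rule test_funI[of _ "{}"]) (auto intro: smooth_const)

lemma frechet_derivative_grad:
  assumes "smooth \<phi>"
  shows "frechet_derivative \<phi> (at x) h = grad \<phi> x \<bullet> h"
proof -
  have "linear (frechet_derivative \<phi> (at x))"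
    by (rule linear_frechet_derivative[OF smooth_differentiable[OF assms]])
  then have "frechet_derivative \<phi> (at x) h = (\<Sum>e\<in>Basis. (h \<bullet> e) * frechet_derivative \<phi> (at x) e)"
    by (subst euclidean_representation[of h, symmetric]) (simp add: linear_sum linear_cmul)
  then show ?thesis by (simp add: grad_def inner_sum_left inner_sum_right inner_commute mult.commute)
qed

lemma grad_eqI:
  assumes "(\<phi> has_derivative (\<lambda>h. g \<bullet> h)) (at x)"
  shows "grad \<phi> x = g"
  unfolding grad_def frechet_derivative_at[OF assms, symmetric] by (simp add: euclidean_representation)

lemma smooth_has_derivative_grad:
  assumes "smooth \<phi>" shows "(\<phi> has_derivative (\<lambda>h. grad \<phi> x \<bullet> h)) (at x)"
proof -
  have "frechet_derivative \<phi> (at x) = (\<lambda>h. grad \<phi> x \<bullet> h)"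
    by (rule ext) (rule frechet_derivative_grad[OF assms])
  then show ?thesis using smooth_has_derivative[OF assms, of x] by simp
qed

lemma grad_add:
  assumes "smooth \<phi>" "smooth \<psi>" shows "grad (\<lambda>x. \<phi> x + \<psi> x) x = grad \<phi> x + grad \<psi> x"
  by (rule grad_eqI) (auto intro!: derivative_eq_intros smooth_has_derivative_grad[OF assms(1)]
      smooth_has_derivative_grad[OF assms(2)] simp: inner_add_left)

lemma grad_scaleR:
  assumes "smooth \<phi>" shows "grad (\<lambda>x. c * \<phi> x) x = c *\<^sub>R grad \<phi> x"
  by (rule grad_eqI) (auto intro!: derivative_eq_intros smooth_has_derivative_grad[OF assms(1)])

lemma continuous_on_grad: "smooth \<phi> \<Longrightarrow> continuous_on UNIV (grad \<phi>)"
  unfolding grad_def[abs_def]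
  by (intro continuous_on_sum continuous_on_scaleR smooth_continuous smooth_partial continuous_on_const) auto

definition jet :: "('x::euclidean_space \<Rightarrow> real) \<Rightarrow> 'x \<Rightarrow> real \<times> 'x" where
  "jet \<phi> x = (\<phi> x, grad \<phi> x)"

lemma continuous_on_jet: "smooth \<phi> \<Longrightarrow> continuous_on UNIV (jet \<phi>)"
  unfolding jet_def[abs_def] by (intro continuous_on_Pair smooth_continuous continuous_on_grad)

lemma jet_supp:
  assumes "test_fun \<Omega> \<phi>"
  obtains K where "compact K" "K \<subseteq> \<Omega>" "\<And>x. x \<notin> K \<Longrightarrow> jet \<phi> x = 0"
proof -
  obtain K where "compact K" "K \<subseteq> \<Omega>" "\<And>x. x \<notin> K \<Longrightarrow> \<phi> x = 0"
    "\<And>x e. x \<notin> K \<Longrightarrow> frechet_derivative \<phi> (at x) e = 0"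
    by (rule test_fun_supp[OF assms]) (rule that)
  then show ?thesis by (intro that[of K]) (auto simp: jet_def grad_def zero_prod_def)
qed

lemma jet_add: "smooth \<phi> \<Longrightarrow> smooth \<psi> \<Longrightarrow> jet (\<lambda>x. \<phi> x + \<psi> x) x = jet \<phi> x + jet \<psi> x"
  by (simp add: jet_def grad_add)

lemma jet_scaleR: "smooth \<phi> \<Longrightarrow> jet (\<lambda>x. c * \<phi> x) x = c *\<^sub>R jet \<phi> x"
  by (simp add: jet_def grad_scaleR)

section \<open>Integrals of compactly supported functions, integration by parts and Poincare's
  inequality\<close>

lemma compact_supp_integrable:
  fixes f :: "'x::euclidean_space \<Rightarrow> 'v::euclidean_space"
  assumes f: "continuous_on UNIV f" and K: "compact K" "\<And>x. x \<notin> K \<Longrightarrow> f x = 0"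
  shows "integrable lborel f" "integrable lebesgue f" "bounded (range f)"
proof -
  have "integrable lborel (\<lambda>x. indicator K x *\<^sub>R f x)"
    by (rule borel_integrable_compact[OF K(1) continuous_on_subset[OF f]]) simp
  moreover have "(\<lambda>x. indicator K x *\<^sub>R f x) = f" using K(2) by (auto simp: indicator_def)
  ultimately show i: "integrable lborel f" by simp
  then show "integrable lebesgue f"
    by (subst integrable_completion) (auto intro: borel_measurable_continuous_onI f)
  have "bounded (f ` K)" using K(1) f by (meson compact_continuous_image compact_imp_bounded continuous_on_subset subset_UNIV)
  moreover have "range f \<subseteq> insert 0 (f ` K)" using K(2) by blast
  ultimately show "bounded (range f)" by (meson bounded_insert bounded_subset)
qed

lemma borel_measurable_lebesgue_on_continuous:
  fixes f :: "'x::euclidean_space \<Rightarrow> 'v::euclidean_space"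
  shows "continuous_on UNIV f \<Longrightarrow> f \<in> borel_measurable (lebesgue_on \<Omega>)"
  by (intro measurable_restrict_space1 measurable_completion) (simp add: borel_measurable_continuous_onI)

lemma compact_supp_sq_integrable:
  fixes f :: "'x::euclidean_space \<Rightarrow> 'v::euclidean_space"
  assumes f: "continuous_on UNIV f" and K: "compact K" "\<And>x. x \<notin> K \<Longrightarrow> f x = 0"
    and \<Omega>: "\<Omega> \<in> sets lebesgue"
  shows "sq_integrable (lebesgue_on \<Omega>) f"
  unfolding sq_integrable_def
proof
  show "f \<in> borel_measurable (lebesgue_on \<Omega>)"
    by (rule borel_measurable_lebesgue_on_continuous[OF f])
  have "integrable lebesgue (\<lambda>x. (norm (f x))\<^sup>2)"
    by (rule compact_supp_integrable[OF _ K(1)]) (auto intro!: continuous_intros f simp: K(2))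
  from integrable_mult_indicator[OF \<Omega> this]
  show "integrable (lebesgue_on \<Omega>) (\<lambda>x. (norm (f x))\<^sup>2)"
    using \<Omega> by (simp add: integrable_restrict_space)
qed

lemma sq_integrable_jet:
  assumes "test_fun \<Omega>' \<phi>" "\<Omega> \<in> sets lebesgue"
  shows "sq_integrable (lebesgue_on \<Omega>) (jet \<phi>)"
proof -
  obtain K where K: "compact K" "K \<subseteq> \<Omega>'" "\<And>x. x \<notin> K \<Longrightarrow> jet \<phi> x = 0" by (rule jet_supp[OF assms(1)]) (rule that)
  show ?thesis
    by (rule compact_supp_sq_integrable[OF continuous_on_jet[OF test_fun_smooth[OF assms(1)]] K(1,3) assms(2)])
qed

lemma integral_lebesgue_on_supp:
  fixes f :: "'x::euclidean_space \<Rightarrow> 'v::euclidean_space"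
  assumes "\<Omega> \<in> sets lebesgue" "\<And>x. x \<notin> \<Omega> \<Longrightarrow> f x = 0"
  shows "integral\<^sup>L (lebesgue_on \<Omega>) f = integral\<^sup>L lebesgue f"
proof -
  have "(\<lambda>x. indicator \<Omega> x *\<^sub>R f x) = f" using assms(2) by (auto simp: indicator_def)
  then show ?thesis using assms(1) by (simp add: integral_restrict_space)
qed

lemma lborel_integral_translation:
  fixes f :: "'x::euclidean_space \<Rightarrow> real"
  assumes "f \<in> borel_measurable borel"
  shows "(\<integral>x. f (x + v) \<partial>lborel) = (\<integral>x. f x \<partial>lborel)"
proof -
  have "(\<integral>x. f x \<partial>lborel) = (\<integral>x. f x \<partial>distr lborel borel ((+) v))" by (simp add: lborel_distr_plus)
  also have "\<dots> = (\<integral>x. f (v + x) \<partial>lborel)" using assms by (intro integral_distr) auto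
  finally show ?thesis by (simp add: add.commute)
qed

text \<open>By translation invariance the difference quotients have integral zero.\<close>
lemma integral_frechet_derivative_eq_0:
  assumes \<phi>: "test_fun \<Omega> \<phi>"
  shows "(\<integral>x. frechet_derivative \<phi> (at x) e \<partial>lebesgue) = 0"
proof -
  note sm = test_fun_smooth[OF \<phi>]
  obtain K where K': "compact K" "K \<subseteq> \<Omega>" "\<And>x. x \<notin> K \<Longrightarrow> jet \<phi> x = 0" by (rule jet_supp[OF \<phi>]) (rule that)
  then have K: "compact K" "\<And>x. x \<notin> K \<Longrightarrow> \<phi> x = 0" "\<And>x. x \<notin> K \<Longrightarrow> grad \<phi> x = 0"
    by (simp_all add: jet_def zero_prod_def)
  have meas[measurable]: "\<phi> \<in> borel_measurable borel" "grad \<phi> \<in> borel_measurable borel"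
    using smooth_continuous[OF sm] continuous_on_grad[OF sm] by (auto intro: borel_measurable_continuous_onI)
  have fd: "frechet_derivative \<phi> (at x) e = grad \<phi> x \<bullet> e" for x by (rule frechet_derivative_grad[OF sm])
  obtain B where B: "\<And>x. norm (grad \<phi> x) \<le> B"
    using compact_supp_integrable(3)[OF continuous_on_grad[OF sm] K(1,3)] by (auto simp: bounded_iff)
  obtain R where R: "\<And>x. x \<in> K \<Longrightarrow> norm x \<le> R" using compact_imp_bounded[OF K(1)] by (auto simp: bounded_iff)
  define t where "t n = inverse (real (Suc n))" for n
  have t: "t n > 0" "t n \<le> 1" for n by (auto simp: t_def inverse_le_1_iff)
  have t0: "t \<longlonglongrightarrow> 0" unfolding t_def by (rule LIMSEQ_inverse_real_of_nat)
  define q where "q n x = (\<phi> (x + t n *\<^sub>R e) - \<phi> x) / t n" for n x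
  have int\<phi>: "integrable lborel \<phi>" by (rule compact_supp_integrable[OF smooth_continuous[OF sm] K(1,2)])
  have i2: "integrable lborel (\<lambda>x. \<phi> (x + v))" for v
  proof -
    have "integrable (distr lborel borel ((+) v)) \<phi>" using int\<phi> by (simp add: lborel_distr_plus)
    then show ?thesis by (subst (asm) integrable_distr_eq) (auto simp: add.commute)
  qed
  have q0: "(\<integral>x. q n x \<partial>lborel) = 0" for n
    unfolding q_def using int\<phi> i2[of "t n *\<^sub>R e"] by (simp add: lborel_integral_translation)
  have bound: "\<bar>\<phi> (x + t n *\<^sub>R e) - \<phi> x\<bar> \<le> B * (t n * norm e)" for x n
  proof -
    have "norm (\<phi> (x + t n *\<^sub>R e) - \<phi> x) \<le> B * norm ((x + t n *\<^sub>R e) - x)"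
    proof (rule differentiable_bound[OF convex_UNIV])
      fix y
      show "(\<phi> has_derivative (\<lambda>h. grad \<phi> y \<bullet> h)) (at y within UNIV)"
        using smooth_has_derivative_grad[OF sm] by simp
      show "onorm (\<lambda>h. grad \<phi> y \<bullet> h) \<le> B"
        using B[of y] by (intro onorm_bound) (auto intro!: order_trans[OF Cauchy_Schwarz_ineq2] mult_right_mono order_trans[OF norm_ge_zero B])
    qed auto
    then show ?thesis using t[of n] by simp
  qed
  have "(\<lambda>n. \<integral>x. q n x \<partial>lborel) \<longlonglongrightarrow> (\<integral>x. grad \<phi> x \<bullet> e \<partial>lborel)"
  \<comment> \<open>The step \<open>t n\<close> is at most 1, so x or its translate can meet the
    support only inside the ball of radius \<open>R + norm e\<close>; there the mean value theorem
    bounds the quotient by \<open>B * norm e\<close>.\<close>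
  proof (rule integral_dominated_convergence[where w="\<lambda>x. indicator (cball 0 (R + norm e)) x *\<^sub>R (B * norm e)"])
    show "integrable lborel (\<lambda>x. indicator (cball 0 (R + norm e)) x *\<^sub>R (B * norm e))"
      by (rule borel_integrable_compact) auto
    show "AE x in lborel. norm (q n x) \<le> indicator (cball 0 (R + norm e)) x *\<^sub>R (B * norm e)" for n
    proof (rule AE_I2)
      fix x
      show "norm (q n x) \<le> indicator (cball 0 (R + norm e)) x *\<^sub>R (B * norm e)"
      proof (cases "x \<in> cball 0 (R + norm e)")
        case True
        have "norm (q n x) \<le> B * norm e"
          using bound[of x n] t[of n] by (simp add: q_def field_simps)
        then show ?thesis using True by simp
      next
        case False
        then have "x \<notin> K" using R[of x] norm_ge_zero[of e] by (auto simp del: norm_ge_zero)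
        moreover have "x + t n *\<^sub>R e \<notin> K"
        proof
          assume "x + t n *\<^sub>R e \<in> K"
          then have "norm x \<le> R + norm (t n *\<^sub>R e)" using R norm_triangle_ineq4[of "x + t n *\<^sub>R e" "t n *\<^sub>R e"] by fastforce
          also have "norm (t n *\<^sub>R e) \<le> norm e" using t[of n] by (simp add: mult_left_le_one_le)
          finally show False using False by simp
        qed
        ultimately show ?thesis using K(2) False by (simp add: q_def)
      qed
    qed
    show "AE x in lborel. (\<lambda>n. q n x) \<longlonglongrightarrow> grad \<phi> x \<bullet> e"
    proof (rule AE_I2)
      fix x
      have "((\<lambda>s. x + s *\<^sub>R e) has_derivative (\<lambda>s. s *\<^sub>R e)) (at 0)" by (auto intro!: derivative_eq_intros)
      from has_derivative_compose[OF this, of \<phi> "\<lambda>h. grad \<phi> x \<bullet> h"]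
      have "((\<lambda>s. \<phi> (x + s *\<^sub>R e)) has_derivative (\<lambda>s. grad \<phi> x \<bullet> (s *\<^sub>R e))) (at 0)"
        using smooth_has_derivative_grad[OF sm, of x] by simp
      then have "((\<lambda>s. \<phi> (x + s *\<^sub>R e)) has_real_derivative (grad \<phi> x \<bullet> e)) (at 0)"
        by (simp add: has_field_derivative_def mult.commute[of "grad \<phi> x \<bullet> e"] mult_commute_abs)
      then have "((\<lambda>h. (\<phi> (x + (0 + h) *\<^sub>R e) - \<phi> (x + 0 *\<^sub>R e)) / h) \<longlongrightarrow> grad \<phi> x \<bullet> e) (at 0)"
        unfolding DERIV_def .
      moreover have "filterlim t (at 0) sequentially"
        using t0 t(1) by (auto simp: filterlim_at intro!: always_eventually) (metis less_irrefl)
      ultimately show "(\<lambda>n. q n x) \<longlonglongrightarrow> grad \<phi> x \<bullet> e"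
        unfolding q_def by (rule filterlim_compose[THEN filterlim_cong[THEN iffD1, OF refl refl, rotated]]) auto
    qed
  qed (simp_all add: q_def)
  then have "(\<integral>x. grad \<phi> x \<bullet> e \<partial>lborel) = 0" using q0 by (simp add: LIMSEQ_const_iff)
  then show ?thesis by (simp add: fd integral_completion)
qed

text \<open>Only one factor needs compact support: the product is then a test function and its
  derivative integrates to zero. This allows g to be a coordinate function in Poincare's
  inequality.\<close>

lemma test_integration_by_parts:
  assumes \<phi>: "test_fun \<Omega> \<phi>" and g: "smooth g" and \<Omega>: "\<Omega> \<in> sets lebesgue"
  shows "(\<integral>x. g x * frechet_derivative \<phi> (at x) e \<partial>lebesgue_on \<Omega>)
    = - (\<integral>x. frechet_derivative g (at x) e * \<phi> x \<partial>lebesgue_on \<Omega>)"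
proof -
  obtain K where K: "compact K" "K \<subseteq> \<Omega>" "\<And>x. x \<notin> K \<Longrightarrow> \<phi> x = 0"
    "\<And>x e. x \<notin> K \<Longrightarrow> frechet_derivative \<phi> (at x) e = 0"
    by (rule test_fun_supp[OF \<phi>]) (rule that)
  have cont: "continuous_on UNIV (\<lambda>x. frechet_derivative h (at x) e)" if "smooth h" for h :: "'a \<Rightarrow> real"
    using continuous_on_grad[OF that] by (simp add: frechet_derivative_grad[OF that] continuous_on_inner)
  note sm = test_fun_smooth[OF \<phi>]
  have i: "integrable lebesgue (\<lambda>x. g x * frechet_derivative \<phi> (at x) e)"
     "integrable lebesgue (\<lambda>x. frechet_derivative g (at x) e * \<phi> x)"
    using K compact_supp_integrable(2)[OF continuous_on_mult[OF smooth_continuous[OF g] cont[OF sm]] K(1)]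
      compact_supp_integrable(2)[OF continuous_on_mult[OF cont[OF g] smooth_continuous[OF sm]] K(1)] by auto
  have "0 = (\<integral>x. frechet_derivative (\<lambda>x. \<phi> x * g x) (at x) e \<partial>lebesgue)"
    by (rule integral_frechet_derivative_eq_0[OF test_fun_mult[OF \<phi> g], symmetric])
  also have "\<dots> = (\<integral>x. g x * frechet_derivative \<phi> (at x) e + frechet_derivative g (at x) e * \<phi> x \<partial>lebesgue)"
    by (simp add: frechet_derivative_mult_real smooth_differentiable g sm algebra_simps)
  also have "\<dots> = (\<integral>x. g x * frechet_derivative \<phi> (at x) e \<partial>lebesgue) + (\<integral>x. frechet_derivative g (at x) e * \<phi> x \<partial>lebesgue)"
    using i by simp
  finally show ?thesis
    using K by (subst (1 2) integral_lebesgue_on_supp[OF \<Omega>]) auto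
qed

text \<open>Poincare's inequality, by integrating the derivative of \<open>\<phi>\<^sup>2 x\<^sub>e\<close>.\<close>
lemma test_Poincare:
  fixes \<phi> :: "'x::euclidean_space \<Rightarrow> real"
  assumes \<phi>: "test_fun \<Omega> \<phi>" and \<Omega>: "\<Omega> \<in> sets lebesgue" "\<And>x. x \<in> \<Omega> \<Longrightarrow> norm x \<le> R" and R: "R \<ge> 0"
    and e: "e \<in> Basis"
  shows "l2norm (lebesgue_on \<Omega>) \<phi> \<le> 2 * R * l2norm (lebesgue_on \<Omega>) (\<lambda>x. grad \<phi> x \<bullet> e)"
proof -
  let ?M = "lebesgue_on \<Omega>"
  note sm = test_fun_smooth[OF \<phi>]
  have sj: "sq_integrable ?M (jet \<phi>)" by (rule sq_integrable_jet[OF \<phi> \<Omega>(1)])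
  have s1: "sq_integrable ?M \<phi>" using sq_integrable_fst[OF sj] by (simp add: jet_def)
  have "sq_integrable ?M (grad \<phi>)" using sq_integrable_snd[OF sj] by (simp add: jet_def)
  from sq_integrable_bounded_linear[OF bounded_linear_inner_left this]
  have s2: "sq_integrable ?M (\<lambda>x. grad \<phi> x \<bullet> e)" .
  have m: "(\<lambda>x. x \<bullet> e) \<in> borel_measurable ?M" by (intro borel_measurable_lebesgue_on_continuous continuous_intros)
  have [measurable]: "\<phi> \<in> borel_measurable ?M" "(\<lambda>x. grad \<phi> x \<bullet> e) \<in> borel_measurable ?M"
    using s1 s2 by (auto simp: sq_integrable_def)
  have s3: "sq_integrable ?M (\<lambda>x. (x \<bullet> e) * \<phi> x)"
  proof (rule sq_integrable_bound[OF s1, where C=R])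
    show "(\<lambda>x. x \<bullet> e * \<phi> x) \<in> borel_measurable ?M" using m by simp
    show "AE x in ?M. norm (x \<bullet> e * \<phi> x) \<le> R * norm (\<phi> x)"
      using \<Omega>(2) e by (intro AE_I2) (auto simp: abs_mult intro!: mult_right_mono order_trans[OF Basis_le_norm])
  qed
  have le3: "l2norm ?M (\<lambda>x. (x \<bullet> e) * \<phi> x) \<le> R * l2norm ?M \<phi>"
    using \<Omega>(2) e R m by (intro l2norm_mono s1) (auto simp: abs_mult intro!: AE_I2 mult_right_mono order_trans[OF Basis_le_norm])
  have "(l2norm ?M \<phi>)\<^sup>2 = (\<integral>x. frechet_derivative (\<lambda>x. (x \<bullet> e)) (at x) e * (\<phi> x * \<phi> x) \<partial>?M)"
    using e unfolding l2norm_sq by (simp add: frechet_derivative_inner inner_same_Basis power2_eq_square)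
  also have "\<dots> = - (\<integral>x. (x \<bullet> e) * frechet_derivative (\<lambda>x. \<phi> x * \<phi> x) (at x) e \<partial>?M)"
    using test_integration_by_parts[OF test_fun_mult[OF \<phi> sm] smooth_inner[of e] \<Omega>(1), of e] by linarith
  also have "\<dots> = - (\<integral>x. 2 * (((x \<bullet> e) * \<phi> x) * (grad \<phi> x \<bullet> e)) \<partial>?M)"
    by (simp add: frechet_derivative_mult_real smooth_differentiable sm frechet_derivative_grad algebra_simps)
  also have "\<dots> = -2 * l2inner ?M (\<lambda>x. (x \<bullet> e) * \<phi> x) (\<lambda>x. grad \<phi> x \<bullet> e)"
    by (simp add: l2inner_def)
  also have "\<dots> \<le> 2 * (l2norm ?M (\<lambda>x. (x \<bullet> e) * \<phi> x) * l2norm ?M (\<lambda>x. grad \<phi> x \<bullet> e))"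
    using l2_Cauchy_Schwarz[OF s3 s2] by linarith
  also have "\<dots> \<le> 2 * ((R * l2norm ?M \<phi>) * l2norm ?M (\<lambda>x. grad \<phi> x \<bullet> e))"
    by (intro mult_left_mono mult_right_mono le3) auto
  finally have *: "l2norm ?M \<phi> * l2norm ?M \<phi> \<le> l2norm ?M \<phi> * (2 * R * l2norm ?M (\<lambda>x. grad \<phi> x \<bullet> e))"
    by (simp add: power2_eq_square mult_ac)
  show ?thesis
  proof (cases "l2norm ?M \<phi> = 0")
    case True then show ?thesis using R by simp
  next
    case False
    then have "l2norm ?M \<phi> > 0" using l2norm_nonneg[of ?M \<phi>] by linarith
    then show ?thesis using * by (simp only: mult_le_cancel_left_pos)
  qed
qed

subsection \<open>Jets and weak gradients\<close>

text \<open>Boxes generate the Borel sets and are stable under intersection, so the vanishing of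
  integrals extends from boxes to all Borel sets by the pi-lambda theorem. The assumption
  \<open>all\<close> provides the integral over the whole space, from which complements are
  obtained.\<close>

lemma set_integral_boxes_eq_0:
  fixes f :: "'x::euclidean_space \<Rightarrow> real"
  assumes f: "integrable lborel f" and box: "\<And>c d. (\<integral>x. indicator (box c d) x * f x \<partial>lborel) = 0"
    and all: "(\<integral>x. f x \<partial>lborel) = 0"
  shows "AE x in lborel. f x = 0"
proof (rule density_unique_real)
  show "integrable lborel f" "integrable lborel (\<lambda>x. 0::real)" using f by auto
  have sets_eq: "sets lborel = sigma_sets UNIV (range (\<lambda>(a, b). box a (b::'x)))"
    by (simp add: borel_eq_box)
  fix A :: "'x set" assume "A \<in> sets lborel"
  then have A: "A \<in> sigma_sets UNIV (range (\<lambda>(a, b). box a b))"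
    unfolding sets_eq .
  have int: "set_integrable lborel A f" if "A \<in> sigma_sets UNIV (range (\<lambda>(a, b). box a b))" for A :: "'x set"
    using integrable_mult_indicator[OF _ f, of A] that unfolding set_integrable_def sets_eq by blast
  have Is: "Int_stable (range (\<lambda>(a, b). box a (b::'x)))" by (auto simp: Int_stable_def box_Int_box)
  have "(LINT x:A|lborel. f x) = 0"
    using Is subset_Pow_Union[of "range (\<lambda>(a, b). box a (b::'x))", THEN subset_trans, OF Pow_mono[OF subset_UNIV]] A
  proof (induction rule: sigma_sets_induct_disjoint)
    case (basic A)
    then show ?case using box by (auto simp: set_lebesgue_integral_def)
  next
    case (compl A)
    have "indicator (UNIV - A) x *\<^sub>R f x = f x - indicator A x *\<^sub>R f x" for x
      by (auto simp: indicator_def)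
    then have "(LINT x:(UNIV - A)|lborel. f x) = (\<integral>x. f x \<partial>lborel) - (LINT x:A|lborel. f x)"
      using f int[OF compl(1)] by (simp add: set_lebesgue_integral_def set_integrable_def)
    then show ?case using all compl(2) by simp
  next
    case (union A)
    have "(LINT x:(\<Union>i. A i)|lborel. f x) = (\<Sum>i. (LINT x:(A i)|lborel. f x))"
    proof (rule lebesgue_integral_countable_add)
      show "A i \<in> sets lborel" for i using union(2) unfolding sets_eq by auto
      show "A i \<inter> A j = {}" if "i \<noteq> j" for i j using union(1) that by (auto simp: disjoint_family_on_def)
      show "set_integrable lborel (\<Union>i. A i) f" using union(2) by (intro int sigma_sets.Union) auto
    qed
    then show ?case using union(3) by simp
  qed (auto simp: set_lebesgue_integral_def)
  then show "(LINT x:A|lborel. f x) = (LINT x:A|lborel. 0)" by simp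
qed

text \<open>Smooth bumps recover integrals over boxes.\<close>
theorem test_fun_integral_eq_0:
  fixes h :: "'x::euclidean_space \<Rightarrow> real"
  assumes \<Omega>: "open \<Omega>" and h: "L1loc \<Omega> h"
    and zero: "\<And>\<phi>. test_fun \<Omega> \<phi> \<Longrightarrow> (\<integral>x. h x * \<phi> x \<partial>lebesgue_on \<Omega>) = 0"
  shows "AE x in lebesgue. x \<in> \<Omega> \<longrightarrow> h x = 0"
proof -
  have \<Omega>s: "\<Omega> \<in> sets lebesgue" using \<Omega> by auto
  have hint: "integrable lebesgue (\<lambda>x. indicator (cbox a b) x * h x)" if "cbox a b \<subseteq> \<Omega>" for a b
    using h that unfolding L1loc_def set_integrable_def by (force simp: compact_cbox)
  have box0: "(\<integral>x. indicator (box a b) x * h x \<partial>lebesgue) = 0" if ab: "cbox a b \<subseteq> \<Omega>" for a b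
  proof -
    \<comment> \<open>The bump vanishes off the open box, so the cutoff does not change the product.
      It is carried along because h is integrable only locally, whereas the cut-off h can serve as
      the dominating function.\<close>
    have supp: "indicator (cbox a b) x * h x * box_bump a b (real (Suc n)) x = h x * box_bump a b (real (Suc n)) x" for x n
      using box_bump_eq_0[of "real (Suc n)" x a b] box_subset_cbox[of a b] by (cases "x \<in> box a b") auto
    have "(\<lambda>n. \<integral>x. indicator (cbox a b) x * h x * box_bump a b (real (Suc n)) x \<partial>lebesgue)
        \<longlonglongrightarrow> (\<integral>x. indicator (cbox a b) x * h x * indicator (box a b) x \<partial>lebesgue)"
    proof (rule integral_dominated_convergence[where w="\<lambda>x. \<bar>indicator (cbox a b) x * h x\<bar>"])
      show "integrable lebesgue (\<lambda>x. \<bar>indicator (cbox a b) x * h x\<bar>)" using hint[OF ab] by simp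
      have hm: "(\<lambda>x. indicator (cbox a b) x * h x) \<in> borel_measurable lebesgue" using hint[OF ab] by auto
      have bm: "box_bump a b k \<in> borel_measurable lebesgue" for k
        by (intro measurable_completion) (simp add: borel_measurable_continuous_onI smooth_continuous smooth_box_bump)
      show "(\<lambda>x. indicator (cbox a b) x * h x * box_bump a b (real (Suc n)) x) \<in> borel_measurable lebesgue" for n
        by (intro borel_measurable_times hm bm)
      show "(\<lambda>x. indicator (cbox a b) x * h x * indicator (box a b) x) \<in> borel_measurable lebesgue"
        by (intro borel_measurable_times hm borel_measurable_indicator) auto
      show "AE x in lebesgue. (\<lambda>n. indicator (cbox a b) x * h x * box_bump a b (real (Suc n)) x)
          \<longlonglongrightarrow> indicator (cbox a b) x * h x * indicator (box a b) x"
        by (intro AE_I2 tendsto_mult tendsto_const box_bump_tendsto)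
      show "AE x in lebesgue. norm (indicator (cbox a b) x * h x * box_bump a b (real (Suc n)) x) \<le> \<bar>indicator (cbox a b) x * h x\<bar>" for n
      proof (rule AE_I2)
        fix x
        have "\<bar>box_bump a b (real (Suc n)) x\<bar> \<le> 1" using box_bump_bounds[of a b "real (Suc n)" x] by simp
        then show "norm (indicator (cbox a b) x * h x * box_bump a b (real (Suc n)) x) \<le> \<bar>indicator (cbox a b) x * h x\<bar>"
          unfolding real_norm_def abs_mult by (intro mult_left_le) auto
      qed
    qed
    moreover have "(\<integral>x. indicator (cbox a b) x * h x * box_bump a b (real (Suc n)) x \<partial>lebesgue) = 0" for n
    proof -
      have t: "test_fun \<Omega> (box_bump a b (real (Suc n)))" by (rule test_fun_box_bump[OF ab]) simp
      show ?thesis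
        unfolding supp
        using zero[OF t] integral_lebesgue_on_supp[OF \<Omega>s, of "\<lambda>x. h x * box_bump a b (real (Suc n)) x"] test_fun_outside[OF t]
        by simp
    qed
    ultimately have "(\<integral>x. indicator (cbox a b) x * h x * indicator (box a b) x \<partial>lebesgue) = 0"
      by (simp add: LIMSEQ_const_iff)
    moreover have "indicator (cbox a b) x * h x * indicator (box a b) x = indicator (box a b) x * h x" for x
      using box_subset_cbox[of a b] by (auto simp: indicator_def)
    ultimately show ?thesis by simp
  qed
  have AEbox: "AE x in lebesgue. x \<in> box a b \<longrightarrow> h x = 0" if ab: "cbox a b \<subseteq> \<Omega>" for a b
  proof -
    define f where "f x = indicator (box a b) x * h x" for x
    have f_eq: "f x = indicator (box a b) x *\<^sub>R (indicator (cbox a b) x * h x)" for x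
      using box_subset_cbox[of a b] by (auto simp: f_def indicator_def)
    have f_int: "integrable lebesgue f"
      unfolding f_eq[abs_def] by (rule integrable_mult_indicator[OF _ hint[OF ab]]) simp
    \<comment> \<open>h is merely Lebesgue measurable, while the pi-lambda argument runs over Borel
      sets; a Borel representative bridges the two.\<close>
    then obtain g where g: "g \<in> borel_measurable lborel" and fg: "AE x in lborel. f x = g x"
      using completion_ex_borel_measurable_real[of f lborel] by auto
    have fg': "AE x in lebesgue. f x = g x" using fg by (rule AE_completion)
    have gm: "g \<in> borel_measurable lebesgue" using g by (rule measurable_completion)
    have "integrable lebesgue g"
      using integrable_cong_AE[OF _ gm fg'] f_int by auto
    then have g_int: "integrable lborel g" using integrable_completion[OF g] by simp
    have eq: "(\<integral>x. indicator S x * g x \<partial>lborel) = (\<integral>x. indicator S x * f x \<partial>lebesgue)" if "S \<in> sets borel" for S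
    proof -
      have "(\<integral>x. indicator S x * f x \<partial>lebesgue) = (\<integral>x. indicator S x * g x \<partial>lebesgue)"
        using fg' that f_int gm by (intro integral_cong_AE) (auto intro!: borel_measurable_times borel_measurable_indicator)
      also have "\<dots> = (\<integral>x. indicator S x * g x \<partial>lborel)"
        using g that by (intro integral_completion) auto
      finally show ?thesis by simp
    qed
    have "AE x in lborel. g x = 0"
    proof (rule set_integral_boxes_eq_0[OF g_int])
      show "(\<integral>x. indicator (box c d) x * g x \<partial>lborel) = 0" for c d
      proof -
        obtain p q where pq: "box c d \<inter> box a b = box p q" using box_Int_box by blast
        have "indicator (box c d) x * f x = indicator (box p q) x * h x" for x
          by (auto simp: f_def indicator_def pq[symmetric])
        \<comment> \<open>If \<open>box p q\<close> is empty, the closed box may still be a nonempty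
          degenerate one lying outside the domain; in that case the integral over the open box is
          trivially zero.\<close>
        moreover have "cbox p q \<subseteq> \<Omega> \<or> box p q = {}"
        proof (cases "box p q = {}")
          case False
          then have "cbox p q = closure (box p q)" by (simp add: closure_box)
          also have "\<dots> \<subseteq> cbox a b"
            using pq box_subset_cbox[of a b] by (intro closure_minimal) auto
          finally show ?thesis using ab by auto
        qed simp
        ultimately show ?thesis using box0[of p q] by (auto simp: eq)
      qed
      show "(\<integral>x. g x \<partial>lborel) = 0" using eq[of UNIV] box0[OF ab] by (simp add: f_def)
    qed
    then have "AE x in lebesgue. g x = 0" by (rule AE_completion)
    with fg' show ?thesis by eventually_elim (auto simp: f_def indicator_def)
  qed
  obtain \<D> where D: "countable \<D>" "\<D> \<subseteq> Pow \<Omega>" "\<And>X. X \<in> \<D> \<Longrightarrow> \<exists>a b. X = cbox a b" "\<Union>\<D> = \<Omega>"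
    using open_countable_Union_open_cbox[OF \<Omega>] by metis
  have "AE x in lebesgue. x \<in> X \<longrightarrow> h x = 0" if "X \<in> \<D>" for X
  proof -
    obtain a b where X: "X = cbox a b" using D(3) \<open>X \<in> \<D>\<close> by blast
    have ab: "cbox a b \<subseteq> \<Omega>" using D(2) that X by auto
    \<comment> \<open>The countable cover consists of closed boxes, whereas vanishing was obtained
      on open ones; the faces form a null set.\<close>
    have "cbox a b - box a b \<in> null_sets lebesgue"
      using negligible_frontier_interval by (simp add: negligible_iff_null_sets)
    then have "AE x in lebesgue. x \<notin> cbox a b - box a b" by (rule AE_not_in)
    with AEbox[OF ab] show ?thesis by eventually_elim (auto simp: X)
  qed
  then have "AE x in lebesgue. \<forall>X\<in>\<D>. x \<in> X \<longrightarrow> h x = 0" by (subst AE_ball_countable[OF D(1)]) blast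
  then show ?thesis by eventually_elim (use D(4) in auto)
qed

section \<open>The spaces of the statement in terms of \<open>lebesgue_on\<close>, and uniqueness of
  weak derivatives\<close>

lemma L2_iff: "\<Omega> \<in> sets lebesgue \<Longrightarrow> L2 \<Omega> u \<longleftrightarrow> sq_integrable (lebesgue_on \<Omega>) u"
  unfolding L2_def sq_integrable_def set_borel_measurable_def set_integrable_def
  by (subst borel_measurable_restrict_space_iff, simp, subst integrable_restrict_space) auto

lemma set_integral_lebesgue_on:
  fixes f :: "'x::euclidean_space \<Rightarrow> real"
  shows "\<Omega> \<in> sets lebesgue \<Longrightarrow> (LINT x:\<Omega>|lebesgue. f x) = (\<integral>x. f x \<partial>lebesgue_on \<Omega>)"
  unfolding set_lebesgue_integral_def by (subst integral_restrict_space) auto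

lemma AE_lebesgue_on_iff:
  "\<Omega> \<in> sets lebesgue \<Longrightarrow> (AE x in lebesgue_on \<Omega>. P x) \<longleftrightarrow> (AE x in lebesgue. x \<in> \<Omega> \<longrightarrow> P x)"
  by (subst AE_restrict_space_iff) auto

text \<open>Compact sets have finite measure, and |u| is at most 1 + u^2.\<close>

lemma L1loc_if_sq_integrable:
  fixes u :: "'x::euclidean_space \<Rightarrow> real"
  assumes \<Omega>: "\<Omega> \<in> sets lebesgue" and u: "sq_integrable (lebesgue_on \<Omega>) u"
  shows "L1loc \<Omega> u"
  unfolding L1loc_def
proof (intro allI impI)
  fix K :: "'x set" assume "compact K \<and> K \<subseteq> \<Omega>"
  then have K: "compact K" "K \<subseteq> \<Omega>" by auto
  have um: "(\<lambda>x. indicator \<Omega> x * u x) \<in> borel_measurable lebesgue"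
    and ui: "integrable lebesgue (\<lambda>x. indicator \<Omega> x * (u x)\<^sup>2)"
    using u \<Omega> L2_iff[OF \<Omega>, of u] by (auto simp: L2_def set_borel_measurable_def set_integrable_def)
  have Ks: "K \<in> sets lebesgue" using K(1) by (simp add: compact_imp_closed lebesgue_closedin)
  have eq: "indicator K x *\<^sub>R u x = indicator K x * (indicator \<Omega> x * u x)" for x
    using K(2) by (auto simp: indicator_def)
  have iK: "integrable lebesgue (indicator K :: 'x \<Rightarrow> real)"
    using Ks emeasure_bounded_finite[OF compact_imp_bounded[OF K(1)]] by (intro integrable_real_indicator) (auto simp: emeasure_completion K(1) compact_imp_closed)
  show "set_integrable lebesgue K u"
    unfolding set_integrable_def eq
  proof (rule Bochner_Integration.integrable_bound)
    show "integrable lebesgue (\<lambda>x. indicator K x + indicator \<Omega> x * (u x)\<^sup>2)"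
      using iK ui by simp
    show "(\<lambda>x. indicator K x * (indicator \<Omega> x * u x)) \<in> borel_measurable lebesgue"
      using Ks um by simp
    have "\<bar>u x\<bar> \<le> 1 + (u x)\<^sup>2" for x
      using sum_squares_bound[of 1 "\<bar>u x\<bar>"] by simp
    then show "AE x in lebesgue. norm (indicator K x * (indicator \<Omega> x * u x)) \<le> norm (indicator K x + indicator \<Omega> x * (u x)\<^sup>2)"
      using K(2) by (auto simp: indicator_def)
  qed
qed

lemma weak_pderiv_iff:
  assumes "\<Omega> \<in> sets lebesgue"
  shows "weak_pderiv \<Omega> u e g \<longleftrightarrow> L1loc \<Omega> u \<and> L1loc \<Omega> g \<and>
     (\<forall>\<phi>. test_fun \<Omega> \<phi> \<longrightarrow>
        (\<integral>x. u x * frechet_derivative \<phi> (at x) e \<partial>lebesgue_on \<Omega>) = - (\<integral>x. g x * \<phi> x \<partial>lebesgue_on \<Omega>))"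
  unfolding weak_pderiv_def set_integral_lebesgue_on[OF assms] by simp

lemma L1loc_diff: "L1loc \<Omega> u \<Longrightarrow> L1loc \<Omega> v \<Longrightarrow> L1loc \<Omega> (\<lambda>x. u x - v x)"
  unfolding L1loc_def by (auto intro: set_integral_diff)

lemma L1loc_mult_test_integrable:
  fixes u :: "'x::euclidean_space \<Rightarrow> real"
  assumes u: "L1loc \<Omega> u" and \<phi>: "test_fun \<Omega> \<phi>" and \<Omega>: "\<Omega> \<in> sets lebesgue"
  shows "integrable (lebesgue_on \<Omega>) (\<lambda>x. u x * \<phi> x)"
proof -
  obtain K where K: "compact K" "K \<subseteq> \<Omega>" "\<And>x. x \<notin> K \<Longrightarrow> \<phi> x = 0"
    "\<And>x e. x \<notin> K \<Longrightarrow> frechet_derivative \<phi> (at x) e = 0"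
    by (rule test_fun_supp[OF \<phi>]) (rule that)
  have cont: "continuous_on UNIV \<phi>" by (rule smooth_continuous[OF test_fun_smooth[OF \<phi>]])
  obtain B where B: "\<And>x. \<bar>\<phi> x\<bar> \<le> B"
    using compact_supp_integrable(3)[OF cont K(1,3)] by (auto simp: bounded_iff)
  have ui: "integrable lebesgue (\<lambda>x. indicator K x * u x)"
    using u K(1,2) by (auto simp: L1loc_def set_integrable_def)
  have "integrable lebesgue (\<lambda>x. (indicator K x * u x) * \<phi> x)"
  proof (rule Bochner_Integration.integrable_bound)
    show "integrable lebesgue (\<lambda>x. B * (indicator K x * u x))" using ui by simp
    have "\<phi> \<in> borel_measurable lebesgue"
      by (intro measurable_completion) (simp add: borel_measurable_continuous_onI cont)
    then show "(\<lambda>x. (indicator K x * u x) * \<phi> x) \<in> borel_measurable lebesgue"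
      using borel_measurable_integrable[OF ui] by (rule borel_measurable_times[rotated])
    show "AE x in lebesgue. norm ((indicator K x * u x) * \<phi> x) \<le> norm (B * (indicator K x * u x))"
    proof (rule AE_I2)
      fix x
      have "\<bar>\<phi> x\<bar> \<le> \<bar>B\<bar>" using B[of x] by linarith
      then show "norm ((indicator K x * u x) * \<phi> x) \<le> norm (B * (indicator K x * u x))"
        unfolding real_norm_def abs_mult[of B] by (subst mult.commute, subst abs_mult) (intro mult_right_mono, auto)
    qed
  qed
  moreover have "(\<lambda>x. (indicator K x * u x) * \<phi> x) = (\<lambda>x. indicator \<Omega> x *\<^sub>R (u x * \<phi> x))"
    using K(2,3) by (force simp: indicator_def)
  ultimately show ?thesis using \<Omega> by (simp add: integrable_restrict_space)
qed

lemma weak_pderiv_unique: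
  assumes \<Omega>: "open \<Omega>" and "weak_pderiv \<Omega> u e g" "weak_pderiv \<Omega> u e h"
  shows "AE x in lebesgue. x \<in> \<Omega> \<longrightarrow> g x = h x"
proof -
  have \<Omega>s: "\<Omega> \<in> sets lebesgue" using \<Omega> by auto
  have l: "L1loc \<Omega> g" "L1loc \<Omega> h" using assms by (auto simp: weak_pderiv_def)
  have "AE x in lebesgue. x \<in> \<Omega> \<longrightarrow> g x - h x = 0"
  proof (rule test_fun_integral_eq_0[OF \<Omega> L1loc_diff[OF l]])
    fix \<phi> assume \<phi>: "test_fun \<Omega> \<phi>"
    have "(\<integral>x. (g x - h x) * \<phi> x \<partial>lebesgue_on \<Omega>) = (\<integral>x. g x * \<phi> x \<partial>lebesgue_on \<Omega>) - (\<integral>x. h x * \<phi> x \<partial>lebesgue_on \<Omega>)"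
      using L1loc_mult_test_integrable[OF l(1) \<phi> \<Omega>s] L1loc_mult_test_integrable[OF l(2) \<phi> \<Omega>s]
      by (simp add: left_diff_distrib)
    also have "\<dots> = 0" using assms(2,3) \<phi> unfolding weak_pderiv_iff[OF \<Omega>s] by auto
    finally show "(\<integral>x. (g x - h x) * \<phi> x \<partial>lebesgue_on \<Omega>) = 0" .
  qed
  then show ?thesis by eventually_elim auto
qed

text \<open>Uniqueness lets a gradient supplied by a hypothesis be identified with the one carried
  by a jet.\<close>

lemma weak_grad_unique:
  assumes \<Omega>: "open \<Omega>" and "weak_grad \<Omega> u G" "weak_grad \<Omega> u H"
  shows "AE x in lebesgue. x \<in> \<Omega> \<longrightarrow> G x = H x"
proof -
  have "AE x in lebesgue. x \<in> \<Omega> \<longrightarrow> G x \<bullet> e = H x \<bullet> e" if "e \<in> Basis" for e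
    using assms that by (intro weak_pderiv_unique[OF \<Omega>]) (auto simp: weak_grad_def)
  then have "AE x in lebesgue. \<forall>e\<in>Basis. x \<in> \<Omega> \<longrightarrow> G x \<bullet> e = H x \<bullet> e"
    by (intro AE_finite_allI) auto
  then show ?thesis by eventually_elim (auto intro: euclidean_eqI)
qed

text \<open>The \<open>L\<^sup>2\<close>-closure of the image under \<open>T\<close> of the 1-jets of test functions: with \<open>T = id\<close> these are the
  pairs \<open>(u, \<nabla>u)\<close> with \<open>u\<close> in \<open>H\<^sub>0\<^sup>1(\<Omega>)\<close>; other \<open>T\<close> select part of the derivatives.\<close>
definition jet_closure :: "(real \<times> 'x \<Rightarrow> 'v) \<Rightarrow> 'x::euclidean_space set \<Rightarrow> ('x \<Rightarrow> 'v::euclidean_space) set" where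
  "jet_closure T \<Omega> = {w. sq_integrable (lebesgue_on \<Omega>) w \<and>
     (\<forall>e>0. \<exists>\<phi>. test_fun \<Omega> \<phi> \<and> l2norm (lebesgue_on \<Omega>) (\<lambda>x. T (jet \<phi> x) - w x) < e)}"

lemma jet_closure_sq: "w \<in> jet_closure T \<Omega> \<Longrightarrow> sq_integrable (lebesgue_on \<Omega>) w"
  by (simp add: jet_closure_def)

lemma jet_closure_seq:
  assumes "w \<in> jet_closure T \<Omega>"
  obtains \<phi> where "\<And>k. test_fun \<Omega> (\<phi> k)" "(\<lambda>k. l2norm (lebesgue_on \<Omega>) (\<lambda>x. T (jet (\<phi> k) x) - w x)) \<longlonglongrightarrow> 0"
proof -
  have "\<exists>\<phi>. test_fun \<Omega> \<phi> \<and> l2norm (lebesgue_on \<Omega>) (\<lambda>x. T (jet \<phi> x) - w x) < inverse (real (Suc k))" for k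
    using assms unfolding jet_closure_def by auto
  then obtain \<phi> where \<phi>: "\<And>k. test_fun \<Omega> (\<phi> k)"
      "\<And>k. l2norm (lebesgue_on \<Omega>) (\<lambda>x. T (jet (\<phi> k) x) - w x) < inverse (real (Suc k))" by metis
  have "(\<lambda>k. l2norm (lebesgue_on \<Omega>) (\<lambda>x. T (jet (\<phi> k) x) - w x)) \<longlonglongrightarrow> 0"
    by (rule tendsto_sandwich[OF _ _ tendsto_const LIMSEQ_inverse_real_of_nat])
      (auto intro!: always_eventually less_imp_le \<phi>(2)[simplified])
  then show ?thesis using that \<phi>(1) by blast
qed

lemma jet_closureI_seq:
  assumes "sq_integrable (lebesgue_on \<Omega>) w" "\<And>k. test_fun \<Omega> (\<phi> k)"
    "(\<lambda>k. l2norm (lebesgue_on \<Omega>) (\<lambda>x. T (jet (\<phi> k) x) - w x)) \<longlonglongrightarrow> 0"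
  shows "w \<in> jet_closure T \<Omega>"
  unfolding jet_closure_def
proof (intro CollectI conjI assms allI impI)
  fix e :: real assume "e > 0"
  then have "\<forall>\<^sub>F k in sequentially. l2norm (lebesgue_on \<Omega>) (\<lambda>x. T (jet (\<phi> k) x) - w x) < e"
    using assms(3) by (rule order_tendstoD(2)[rotated])
  then obtain k where "l2norm (lebesgue_on \<Omega>) (\<lambda>x. T (jet (\<phi> k) x) - w x) < e"
    using eventually_happens'[OF sequentially_bot] by blast
  then show "\<exists>\<phi>. test_fun \<Omega> \<phi> \<and> l2norm (lebesgue_on \<Omega>) (\<lambda>x. T (jet \<phi> x) - w x) < e" using assms(2) by blast
qed

context
  fixes T :: "real \<times> 'x::euclidean_space \<Rightarrow> 'v::euclidean_space" and \<Omega> :: "'x set"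
  assumes T: "bounded_linear T" and \<Omega>s: "\<Omega> \<in> sets lebesgue"
begin

lemma sq_integrable_T_jet: "test_fun \<Omega> \<phi> \<Longrightarrow> sq_integrable (lebesgue_on \<Omega>) (\<lambda>x. T (jet \<phi> x))"
  by (intro sq_integrable_bounded_linear[OF T] sq_integrable_jet \<Omega>s)

lemma jet_in_jet_closure: "test_fun \<Omega> \<phi> \<Longrightarrow> (\<lambda>x. T (jet \<phi> x)) \<in> jet_closure T \<Omega>"
  unfolding jet_closure_def by (auto intro!: sq_integrable_T_jet exI[of _ \<phi>] simp: l2norm_def)

lemma jet_closure_add:
  assumes "v \<in> jet_closure T \<Omega>" "w \<in> jet_closure T \<Omega>"
  shows "(\<lambda>x. v x + w x) \<in> jet_closure T \<Omega>"
  unfolding jet_closure_def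
proof (intro CollectI conjI allI impI)
  let ?M = "lebesgue_on \<Omega>"
  have s: "sq_integrable ?M v" "sq_integrable ?M w" using assms by (auto simp: jet_closure_sq)
  then show "sq_integrable ?M (\<lambda>x. v x + w x)" by (rule sq_integrable_add)
  fix e :: real assume e: "e > 0"
  obtain \<phi> where \<phi>: "test_fun \<Omega> \<phi>" "l2norm ?M (\<lambda>x. T (jet \<phi> x) - v x) < e / 2"
    using assms(1) e unfolding jet_closure_def by (auto dest!: spec[of _ "e / 2"])
  obtain \<psi> where \<psi>: "test_fun \<Omega> \<psi>" "l2norm ?M (\<lambda>x. T (jet \<psi> x) - w x) < e / 2"
    using assms(2) e unfolding jet_closure_def by (auto dest!: spec[of _ "e / 2"])
  have "l2norm ?M (\<lambda>x. T (jet (\<lambda>x. \<phi> x + \<psi> x) x) - (v x + w x))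
      = l2norm ?M (\<lambda>x. (T (jet \<phi> x) - v x) + (T (jet \<psi> x) - w x))"
    using \<phi>(1) \<psi>(1) by (simp add: jet_add test_fun_smooth linear_add[OF bounded_linear.linear[OF T]] algebra_simps)
  also have "\<dots> \<le> l2norm ?M (\<lambda>x. T (jet \<phi> x) - v x) + l2norm ?M (\<lambda>x. T (jet \<psi> x) - w x)"
    by (intro l2norm_triangle sq_integrable_diff sq_integrable_T_jet \<phi> \<psi> s)
  also have "\<dots> < e" using \<phi>(2) \<psi>(2) by simp
  finally show "\<exists>\<phi>. test_fun \<Omega> \<phi> \<and> l2norm ?M (\<lambda>x. T (jet \<phi> x) - (v x + w x)) < e"
    using test_fun_add[OF \<phi>(1) \<psi>(1)] by blast
qed

lemma jet_closure_scaleR: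
  assumes "w \<in> jet_closure T \<Omega>"
  shows "(\<lambda>x. c *\<^sub>R w x) \<in> jet_closure T \<Omega>"
proof -
  let ?M = "lebesgue_on \<Omega>"
  obtain \<phi> where \<phi>: "\<And>k. test_fun \<Omega> (\<phi> k)" "(\<lambda>k. l2norm ?M (\<lambda>x. T (jet (\<phi> k) x) - w x)) \<longlonglongrightarrow> 0"
    by (rule jet_closure_seq[OF assms]) (rule that)
  show ?thesis
  proof (rule jet_closureI_seq[where \<phi>="\<lambda>k x. c * \<phi> k x"])
    show "sq_integrable ?M (\<lambda>x. c *\<^sub>R w x)" by (rule sq_integrable_scaleR[OF jet_closure_sq[OF assms]])
    show "test_fun \<Omega> (\<lambda>x. c * \<phi> k x)" for k by (rule test_fun_scaleR[OF \<phi>(1)])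
    have "T (jet (\<lambda>x. c * \<phi> k x) x) - c *\<^sub>R w x = c *\<^sub>R (T (jet (\<phi> k) x) - w x)" for k x
      by (simp add: jet_scaleR[OF test_fun_smooth[OF \<phi>(1)]] linear_scale[OF bounded_linear.linear[OF T]] scaleR_diff_right)
    then show "(\<lambda>k. l2norm ?M (\<lambda>x. T (jet (\<lambda>x. c * \<phi> k x) x) - c *\<^sub>R w x)) \<longlonglongrightarrow> 0"
      using tendsto_mult_right_zero[OF \<phi>(2)] by (simp add: l2norm_scaleR)
  qed
qed

lemma jet_closure_diff:
  assumes "v \<in> jet_closure T \<Omega>" "w \<in> jet_closure T \<Omega>"
  shows "(\<lambda>x. v x - w x) \<in> jet_closure T \<Omega>"
  using jet_closure_add[OF assms(1) jet_closure_scaleR[OF assms(2), of "-1"]] by simp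

lemma jet_closure_zero: "(\<lambda>x. 0) \<in> jet_closure T \<Omega>"
  using jet_closure_scaleR[OF jet_in_jet_closure[OF test_fun_zero], of 0] by simp

lemma jet_closure_sum:
  "(\<And>i. i \<in> I \<Longrightarrow> f i \<in> jet_closure T \<Omega>) \<Longrightarrow> (\<lambda>x. \<Sum>i\<in>I. f i x) \<in> jet_closure T \<Omega>"
  by (induction I rule: infinite_finite_induct) (auto intro: jet_closure_zero jet_closure_add)

lemma jet_closure_closed:
  assumes "\<And>k. F k \<in> jet_closure T \<Omega>" "sq_integrable (lebesgue_on \<Omega>) w"
    "(\<lambda>k. l2norm (lebesgue_on \<Omega>) (\<lambda>x. F k x - w x)) \<longlonglongrightarrow> 0"
  shows "w \<in> jet_closure T \<Omega>"
  unfolding jet_closure_def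
proof (intro CollectI conjI allI impI assms)
  let ?M = "lebesgue_on \<Omega>"
  fix e :: real assume e: "e > 0"
  then have "\<forall>\<^sub>F k in sequentially. l2norm ?M (\<lambda>x. F k x - w x) < e / 2"
    using assms(3) by (intro order_tendstoD(2)) auto
  then obtain k where k: "l2norm ?M (\<lambda>x. F k x - w x) < e / 2"
    using eventually_happens'[OF sequentially_bot] by blast
  obtain \<phi> where \<phi>: "test_fun \<Omega> \<phi>" "l2norm ?M (\<lambda>x. T (jet \<phi> x) - F k x) < e / 2"
    using assms(1)[of k] e unfolding jet_closure_def by (auto dest!: spec[of _ "e / 2"])
  have "l2norm ?M (\<lambda>x. T (jet \<phi> x) - w x) \<le> l2norm ?M (\<lambda>x. T (jet \<phi> x) - F k x) + l2norm ?M (\<lambda>x. F k x - w x)"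
    by (intro l2norm_triangle3 sq_integrable_T_jet \<phi> jet_closure_sq[OF assms(1)] assms(2))
  then show "\<exists>\<phi>. test_fun \<Omega> \<phi> \<and> l2norm ?M (\<lambda>x. T (jet \<phi> x) - w x) < e"
    using k \<phi> by (intro exI[of _ \<phi>]) auto
qed

lemma jet_closure_complete:
  assumes F: "\<And>k. F k \<in> jet_closure T \<Omega>" and C: "l2_Cauchy (lebesgue_on \<Omega>) F"
  obtains w where "w \<in> jet_closure T \<Omega>" "(\<lambda>k. l2norm (lebesgue_on \<Omega>) (\<lambda>x. F k x - w x)) \<longlonglongrightarrow> 0"
proof -
  obtain w where w: "sq_integrable (lebesgue_on \<Omega>) w" "(\<lambda>k. l2norm (lebesgue_on \<Omega>) (\<lambda>x. F k x - w x)) \<longlonglongrightarrow> 0"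
    by (rule l2_complete[OF jet_closure_sq[OF F] C]) (rule that)
  then show ?thesis using jet_closure_closed[OF F w] that by blast
qed

text \<open>S is Lipschitz, so it maps approximating jets to approximating jets. This is how full
  jets are reduced to their X2-part or to a single directional derivative.\<close>

lemma jet_closure_bounded_linear:
  assumes S: "bounded_linear S" and w: "w \<in> jet_closure T \<Omega>"
  shows "(\<lambda>x. S (w x)) \<in> jet_closure (\<lambda>p. S (T p)) \<Omega>"
proof -
  let ?M = "lebesgue_on \<Omega>"
  obtain \<phi> where \<phi>: "\<And>k. test_fun \<Omega> (\<phi> k)" "(\<lambda>k. l2norm ?M (\<lambda>x. T (jet (\<phi> k) x) - w x)) \<longlonglongrightarrow> 0"
    by (rule jet_closure_seq[OF w]) (rule that)
  obtain K where K: "K > 0" "\<And>x. norm (S x) \<le> norm x * K" using bounded_linear.pos_bounded[OF S] by blast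
  show ?thesis
  proof (rule jet_closureI_seq[OF _ \<phi>(1)])
    show "sq_integrable ?M (\<lambda>x. S (w x))" by (intro sq_integrable_bounded_linear[OF S] jet_closure_sq[OF w])
    have sd: "sq_integrable ?M (\<lambda>x. T (jet (\<phi> k) x) - w x)" for k
      by (intro sq_integrable_diff sq_integrable_T_jet \<phi> jet_closure_sq[OF w])
    have "l2norm ?M (\<lambda>x. S (T (jet (\<phi> k) x)) - S (w x)) \<le> K * l2norm ?M (\<lambda>x. T (jet (\<phi> k) x) - w x)" for k
      using sq_integrable_measurable[OF sq_integrable_bounded_linear[OF S sd]] K(1)
      by (intro l2norm_mono sd AE_I2) (auto simp: K(2) mult.commute[of K] linear_diff[OF bounded_linear.linear[OF S], symmetric])
    then show "(\<lambda>k. l2norm ?M (\<lambda>x. S (T (jet (\<phi> k) x)) - S (w x))) \<longlonglongrightarrow> 0"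
      by (intro tendsto_sandwich[OF _ _ tendsto_const tendsto_mult_right_zero[OF \<phi>(2), of K]] always_eventually allI) auto
  qed
qed

end

text \<open>The value together with one directional derivative: exactly the data that enter
  integration by parts and Poincare's inequality in the direction e.\<close>

definition pjet :: "'x::euclidean_space \<Rightarrow> real \<times> 'x \<Rightarrow> real \<times> real" where
  "pjet e p = (fst p, snd p \<bullet> e)"

lemma bounded_linear_pjet: "bounded_linear (pjet e)"
  unfolding pjet_def[abs_def]
  by (intro bounded_linear_Pair bounded_linear_fst bounded_linear_inner_left_comp bounded_linear_snd)

text \<open>For test functions the identity is integration by parts. Written as vanishing of the
  pairing of the jet with P, the pair of derivative and value of \<open>\<psi>\<close>, it is a
  continuous linear condition and survives L2 limits.\<close>

lemma pjet_closure_weak_pderiv: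
  assumes \<Omega>s: "\<Omega> \<in> sets lebesgue" and e: "e \<in> Basis" and w: "w \<in> jet_closure (pjet e) \<Omega>"
  shows "weak_pderiv \<Omega> (\<lambda>x. fst (w x)) e (\<lambda>x. snd (w x))"
  unfolding weak_pderiv_iff[OF \<Omega>s]
proof (intro conjI allI impI)
  let ?M = "lebesgue_on \<Omega>"
  have sw: "sq_integrable ?M w" using w by (rule jet_closure_sq)
  note s = sq_integrable_fst[OF sw] sq_integrable_snd[OF sw]
  show "L1loc \<Omega> (\<lambda>x. fst (w x))" "L1loc \<Omega> (\<lambda>x. snd (w x))" by (intro L1loc_if_sq_integrable \<Omega>s s)+
  fix \<psi> assume \<psi>: "test_fun \<Omega> \<psi>"
  note sm\<psi> = test_fun_smooth[OF \<psi>]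
  define P where "P x = (frechet_derivative \<psi> (at x) e, \<psi> x)" for x
  have fd: "frechet_derivative \<psi> (at x) e = grad \<psi> x \<bullet> e" for x by (rule frechet_derivative_grad[OF sm\<psi>])
  have sP: "sq_integrable ?M P"
  proof -
    have "bounded_linear (\<lambda>p. (snd p \<bullet> e, fst p) :: real \<times> real)"
      by (intro bounded_linear_Pair bounded_linear_fst bounded_linear_inner_left_comp bounded_linear_snd)
    from sq_integrable_bounded_linear[OF this sq_integrable_jet[OF \<psi> \<Omega>s]]
    show ?thesis by (simp add: P_def[abs_def] jet_def fd)
  qed
  obtain \<phi> where \<phi>: "\<And>k. test_fun \<Omega> (\<phi> k)" "(\<lambda>k. l2norm ?M (\<lambda>x. pjet e (jet (\<phi> k) x) - w x)) \<longlonglongrightarrow> 0"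
    by (rule jet_closure_seq[OF w]) (rule that)
  have sj: "sq_integrable ?M (\<lambda>x. pjet e (jet (\<phi> k) x))" for k
    by (rule sq_integrable_T_jet[OF bounded_linear_pjet \<Omega>s \<phi>(1)])
  have "l2inner ?M (\<lambda>x. pjet e (jet (\<phi> k) x)) P = 0" for k
  proof -
    note sm = test_fun_smooth[OF \<phi>(1)[of k]]
    note s1 = sq_integrable_fst[OF sj[of k]] sq_integrable_snd[OF sj[of k]]
    note s2 = sq_integrable_fst[OF sP] sq_integrable_snd[OF sP]
    have i: "integrable ?M (\<lambda>x. \<phi> k x * frechet_derivative \<psi> (at x) e)"
       "integrable ?M (\<lambda>x. (grad (\<phi> k) x \<bullet> e) * \<psi> x)"
      using sq_integrable_mult[OF s1(1) s2(1)] sq_integrable_mult[OF s1(2) s2(2)]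
      by (simp_all add: pjet_def jet_def P_def)
    have "l2inner ?M (\<lambda>x. pjet e (jet (\<phi> k) x)) P
        = (\<integral>x. \<phi> k x * frechet_derivative \<psi> (at x) e + (grad (\<phi> k) x \<bullet> e) * \<psi> x \<partial>?M)"
      by (simp add: l2inner_def pjet_def jet_def P_def)
    also have "\<dots> = (\<integral>x. \<phi> k x * frechet_derivative \<psi> (at x) e \<partial>?M) + (\<integral>x. (grad (\<phi> k) x \<bullet> e) * \<psi> x \<partial>?M)"
      using i by simp
    also have "\<dots> = 0"
      using test_integration_by_parts[OF \<psi> sm \<Omega>s, of e] by (simp add: frechet_derivative_grad[OF sm])
    finally show ?thesis .
  qed
  then have "l2inner ?M w P = 0"
    using l2inner_tendsto_left[OF sj sw sP \<phi>(2)] by (simp add: LIMSEQ_const_iff)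
  moreover have "l2inner ?M w P = (\<integral>x. fst (w x) * frechet_derivative \<psi> (at x) e \<partial>?M) + (\<integral>x. snd (w x) * \<psi> x \<partial>?M)"
    using sq_integrable_mult[OF s(1) sq_integrable_fst[OF sP]] sq_integrable_mult[OF s(2) sq_integrable_snd[OF sP]]
    by (simp add: l2inner_def P_def inner_prod_def)
  ultimately show "(\<integral>x. fst (w x) * frechet_derivative \<psi> (at x) e \<partial>?M) = - (\<integral>x. snd (w x) * \<psi> x \<partial>?M)" by simp
qed

lemma pjet_closure_Poincare:
  assumes \<Omega>s: "\<Omega> \<in> sets lebesgue" and R: "\<And>x. x \<in> \<Omega> \<Longrightarrow> norm x \<le> R" "R \<ge> 0"
    and e: "e \<in> Basis" and w: "w \<in> jet_closure (pjet e) \<Omega>"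
  shows "l2norm (lebesgue_on \<Omega>) (\<lambda>x. fst (w x)) \<le> 2 * R * l2norm (lebesgue_on \<Omega>) (\<lambda>x. snd (w x))"
proof -
  let ?M = "lebesgue_on \<Omega>"
  have sw: "sq_integrable ?M w" using w by (rule jet_closure_sq)
  obtain \<phi> where \<phi>: "\<And>k. test_fun \<Omega> (\<phi> k)" "(\<lambda>k. l2norm ?M (\<lambda>x. pjet e (jet (\<phi> k) x) - w x)) \<longlonglongrightarrow> 0"
    by (rule jet_closure_seq[OF w]) (rule that)
  have sj: "sq_integrable ?M (\<lambda>x. pjet e (jet (\<phi> k) x))" for k
    by (rule sq_integrable_T_jet[OF bounded_linear_pjet \<Omega>s \<phi>(1)])
  have sd: "sq_integrable ?M (\<lambda>x. pjet e (jet (\<phi> k) x) - w x)" for k by (intro sq_integrable_diff sj sw)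
  have f: "(\<lambda>k. l2norm ?M (\<lambda>x. fst (pjet e (jet (\<phi> k) x)) - fst (w x))) \<longlonglongrightarrow> 0"
    using l2norm_fst_le[OF sd] by (intro tendsto_sandwich[OF _ _ tendsto_const \<phi>(2)]) (auto intro!: always_eventually)
  have s: "(\<lambda>k. l2norm ?M (\<lambda>x. snd (pjet e (jet (\<phi> k) x)) - snd (w x))) \<longlonglongrightarrow> 0"
    using l2norm_snd_le[OF sd] by (intro tendsto_sandwich[OF _ _ tendsto_const \<phi>(2)]) (auto intro!: always_eventually)
  show ?thesis
  proof (rule tendsto_le[OF sequentially_bot])
    show "(\<lambda>k. l2norm ?M (\<lambda>x. fst (pjet e (jet (\<phi> k) x)))) \<longlonglongrightarrow> l2norm ?M (\<lambda>x. fst (w x))"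
      by (intro l2norm_tendsto sq_integrable_fst sj sw f)
    show "(\<lambda>k. 2 * R * l2norm ?M (\<lambda>x. snd (pjet e (jet (\<phi> k) x)))) \<longlonglongrightarrow> 2 * R * l2norm ?M (\<lambda>x. snd (w x))"
      by (intro tendsto_mult tendsto_const l2norm_tendsto sq_integrable_snd sj sw s)
    show "\<forall>\<^sub>F k in sequentially. l2norm ?M (\<lambda>x. fst (pjet e (jet (\<phi> k) x))) \<le> 2 * R * l2norm ?M (\<lambda>x. snd (pjet e (jet (\<phi> k) x)))"
      using test_Poincare[OF \<phi>(1) \<Omega>s R e] by (intro always_eventually allI) (simp add: pjet_def jet_def)
  qed
qed

lemma jet_closure_weak_grad:
  assumes \<Omega>s: "\<Omega> \<in> sets lebesgue" and w: "w \<in> jet_closure (\<lambda>p. p) \<Omega>"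
  shows "weak_grad \<Omega> (\<lambda>x. fst (w x)) (\<lambda>x. snd (w x))"
  unfolding weak_grad_def
proof
  fix e :: 'a assume e: "e \<in> Basis"
  have "(\<lambda>x. pjet e (w x)) \<in> jet_closure (\<lambda>p. pjet e p) \<Omega>"
    by (rule jet_closure_bounded_linear[OF bounded_linear_ident \<Omega>s bounded_linear_pjet w])
  from pjet_closure_weak_pderiv[OF \<Omega>s e this]
  show "weak_pderiv \<Omega> (\<lambda>x. fst (w x)) e (\<lambda>x. snd (w x) \<bullet> e)" by (simp add: pjet_def)
qed

text \<open>The two integrals in the definition add up to the squared seminorm of a difference of
  jets. The gradient stays existentially quantified since it is determined only up to null
  sets.\<close>

lemma H01_iff:
  assumes \<Omega>s: "\<Omega> \<in> sets lebesgue"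
  shows "u \<in> H01 \<Omega> \<longleftrightarrow> (\<exists>G. (\<lambda>x. (u x, G x)) \<in> jet_closure (\<lambda>p. p) \<Omega>)"
proof -
  let ?M = "lebesgue_on \<Omega>"
  have eq: "(LINT x:\<Omega>|lebesgue. (\<phi> x - u x)\<^sup>2) + (LINT x:\<Omega>|lebesgue. (norm (grad \<phi> x - G x))\<^sup>2)
      = (l2norm ?M (\<lambda>x. jet \<phi> x - (u x, G x)))\<^sup>2"
    if "test_fun \<Omega> \<phi>" "sq_integrable ?M u" "sq_integrable ?M G" for \<phi> G
  proof -
    have "sq_integrable ?M (\<lambda>x. jet \<phi> x - (u x, G x))"
      by (intro sq_integrable_diff sq_integrable_jet[OF that(1) \<Omega>s] sq_integrable_Pair that)
    from l2norm_Pair_sq[OF this] show ?thesis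
      by (simp add: set_integral_lebesgue_on[OF \<Omega>s] jet_def l2norm_sq)
  qed
  show ?thesis
  proof
    assume "u \<in> H01 \<Omega>"
    then obtain G \<phi> where u: "sq_integrable ?M u" "sq_integrable ?M G" and \<phi>: "\<And>k. test_fun \<Omega> (\<phi> k)"
      and lim: "(\<lambda>k. (LINT x:\<Omega>|lebesgue. (\<phi> k x - u x)\<^sup>2)
          + (LINT x:\<Omega>|lebesgue. (norm (grad (\<phi> k) x - G x))\<^sup>2)) \<longlonglongrightarrow> 0"
      unfolding H01_def by (auto simp: L2_iff[OF \<Omega>s])
    have "(\<lambda>k. sqrt ((l2norm ?M (\<lambda>x. jet (\<phi> k) x - (u x, G x)))\<^sup>2)) \<longlonglongrightarrow> sqrt 0"
      using lim unfolding eq[OF \<phi> u] by (rule tendsto_real_sqrt)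
    then have "(\<lambda>x. (u x, G x)) \<in> jet_closure (\<lambda>p. p) \<Omega>"
      by (intro jet_closureI_seq[OF _ \<phi>] sq_integrable_Pair u) simp
    then show "\<exists>G. (\<lambda>x. (u x, G x)) \<in> jet_closure (\<lambda>p. p) \<Omega>" by blast
  next
    assume "\<exists>G. (\<lambda>x. (u x, G x)) \<in> jet_closure (\<lambda>p. p) \<Omega>"
    then obtain G where G: "(\<lambda>x. (u x, G x)) \<in> jet_closure (\<lambda>p. p) \<Omega>" by blast
    have u: "sq_integrable ?M u" "sq_integrable ?M G"
      using sq_integrable_fst[OF jet_closure_sq[OF G]] sq_integrable_snd[OF jet_closure_sq[OF G]] by simp_all
    obtain \<phi> where \<phi>: "\<And>k. test_fun \<Omega> (\<phi> k)" "(\<lambda>k. l2norm ?M (\<lambda>x. jet (\<phi> k) x - (u x, G x))) \<longlonglongrightarrow> 0"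
      by (rule jet_closure_seq[OF G]) (rule that)
    have "(\<lambda>k. (l2norm ?M (\<lambda>x. jet (\<phi> k) x - (u x, G x)))\<^sup>2) \<longlonglongrightarrow> 0\<^sup>2"
      using \<phi>(2) by (rule tendsto_power)
    then show "u \<in> H01 \<Omega>"
      unfolding H01_def using jet_closure_weak_grad[OF \<Omega>s G] \<phi>(1) u
      by (intro CollectI exI[of _ G] exI[of _ \<phi>]) (simp add: L2_iff[OF \<Omega>s] eq[OF \<phi>(1) u])
  qed
qed

subsection \<open>Slices of product domains\<close>

text \<open>The completed measure on the product is not the product of the completed measures, so
  one descends to \<open>lborel\<close>, where the product structure is available, and completes
  again.\<close>

lemma AE_lebesgue_Pair:
  fixes P :: "'a::euclidean_space \<times> 'b::euclidean_space \<Rightarrow> bool"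
  assumes "AE z in lebesgue. P z"
  shows "AE x in lebesgue. AE y in lebesgue. P (x, y)"
proof -
  have "AE z in lborel. P z" using assms by (simp add: AE_completion_iff)
  then have "AE z in lborel \<Otimes>\<^sub>M lborel. P z" by (subst lborel_prod)
  then have "AE x in lborel. AE y in lborel. P (x, y)" by (rule lborel_pair.AE_pair)
  then show ?thesis by (simp add: AE_completion_iff)
qed

lemma borel_measurable_lebesgue_cong_AE:
  fixes f g :: "'x::euclidean_space \<Rightarrow> 'v::euclidean_space"
  assumes g: "g \<in> borel_measurable lebesgue" and ae: "AE x in lebesgue. f x = g x"
  shows "f \<in> borel_measurable lebesgue"
proof (rule measurableI)
  fix A :: "'v set" assume A: "A \<in> sets borel"
  have "g -` A \<inter> space lebesgue \<in> sets lebesgue" using g A by (rule measurable_sets)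
  moreover have "AE x in lebesgue. x \<in> g -` A \<inter> space lebesgue \<longleftrightarrow> x \<in> f -` A \<inter> space lebesgue"
    using ae by eventually_elim auto
  ultimately show "f -` A \<inter> space lebesgue \<in> sets lebesgue"
    using completion.in_sets_AE[where M=lborel] by blast
qed auto

lemma lebesgue_borel_representative:
  fixes F :: "'x::euclidean_space \<Rightarrow> 'v::euclidean_space"
  assumes "F \<in> borel_measurable lebesgue"
  obtains g where "g \<in> borel_measurable lborel" "AE x in lebesgue. F x = g x"
proof -
  have "\<exists>g\<in>borel_measurable lborel. AE x in lborel. F x \<bullet> e = g x" for e
    using assms by (intro completion_ex_borel_measurable_real) auto
  then obtain g where g: "\<And>e. g e \<in> borel_measurable lborel" "\<And>e. AE x in lborel. F x \<bullet> e = g e x" by metis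
  have "AE x in lebesgue. F x = (\<Sum>e\<in>Basis. g e x *\<^sub>R e)"
  proof -
    have "AE x in lebesgue. \<forall>e\<in>Basis. F x \<bullet> e = g e x"
      using g(2) by (intro AE_finite_allI AE_completion) auto
    then show ?thesis
    proof eventually_elim
      case (elim x)
      have "F x = (\<Sum>e\<in>Basis. (F x \<bullet> e) *\<^sub>R e)" by (simp add: euclidean_representation)
      also have "\<dots> = (\<Sum>e\<in>Basis. g e x *\<^sub>R e)" using elim by (intro sum.cong) auto
      finally show ?case .
    qed
  qed
  then show ?thesis using g(1) by (intro that[of "\<lambda>x. \<Sum>e\<in>Basis. g e x *\<^sub>R e"]) auto
qed

lemma lebesgue_slice_measurable:
  fixes F :: "'a::euclidean_space \<times> 'b::euclidean_space \<Rightarrow> 'v::euclidean_space"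
  assumes "F \<in> borel_measurable lebesgue"
  shows "AE x in lebesgue. (\<lambda>y. F (x, y)) \<in> borel_measurable lebesgue"
proof -
  obtain g where g: "g \<in> borel_measurable lborel" "AE z in lebesgue. F z = g z"
    by (rule lebesgue_borel_representative[OF assms]) (rule that)
  have g1: "(\<lambda>y. g (x, y)) \<in> borel_measurable lebesgue" for x
  proof (rule measurable_completion)
    have [measurable]: "g \<in> borel_measurable borel" using g(1) by simp
    show "(\<lambda>y. g (x, y)) \<in> borel_measurable lborel" by (simp add: borel_prod[symmetric])
  qed
  from AE_lebesgue_Pair[OF g(2)] show ?thesis
    by eventually_elim (rule borel_measurable_lebesgue_cong_AE[OF g1])
qed

text \<open>Fubini is applied to a Borel representative g. The null set where F and g differ has
  null slices for almost every x, so measurability, integrability and inner integrals of F transfer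
  from g for those x.\<close>

lemma lebesgue_Fubini:
  fixes F :: "'a::euclidean_space \<times> 'b::euclidean_space \<Rightarrow> real"
  assumes F: "integrable lebesgue F"
  shows "AE x in lebesgue. integrable lebesgue (\<lambda>y. F (x, y))"
    and "integrable lebesgue (\<lambda>x. \<integral>y. F (x, y) \<partial>lebesgue)"
    and "(\<integral>x. (\<integral>y. F (x, y) \<partial>lebesgue) \<partial>lebesgue) = (\<integral>z. F z \<partial>lebesgue)"
proof -
  obtain g where g: "g \<in> borel_measurable lborel" "AE z in lebesgue. F z = g z"
    by (rule lebesgue_borel_representative[OF borel_measurable_integrable[OF F]]) (rule that)
  have gm: "g \<in> borel_measurable lebesgue" using g(1) by (rule measurable_completion)
  have gi: "integrable lborel g"
    using integrable_cong_AE[OF borel_measurable_integrable[OF F] gm g(2)] F integrable_completion[OF g(1)] by simp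
  then have gi2: "integrable (lborel \<Otimes>\<^sub>M lborel) g" by (simp add: lborel_prod)
  have g1: "(\<lambda>y. g (x, y)) \<in> borel_measurable lborel" for x
  proof -
    have [measurable]: "g \<in> borel_measurable borel" using g(1) by simp
    show "(\<lambda>y. g (x, y)) \<in> borel_measurable lborel" by (simp add: borel_prod[symmetric])
  qed
  have g1': "(\<lambda>y. g (x, y)) \<in> borel_measurable lebesgue" for x by (rule measurable_completion[OF g1])
  have gI: "integrable lborel (\<lambda>x. \<integral>y. g (x, y) \<partial>lborel)" by (rule lborel_pair.integrable_fst'[OF gi2])
  have gI': "integrable lebesgue (\<lambda>x. \<integral>y. g (x, y) \<partial>lborel)"
    using gI integrable_completion[OF borel_measurable_integrable[OF gI]] by simp
  have ae: "AE x in lebesgue. AE y in lebesgue. F (x, y) = g (x, y)" by (rule AE_lebesgue_Pair[OF g(2)])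
  have iae: "AE x in lebesgue. integrable lborel (\<lambda>y. g (x, y))"
    by (intro AE_completion lborel_pair.AE_integrable_fst'[OF gi2])
  have Fm: "AE x in lebesgue. (\<lambda>y. F (x, y)) \<in> borel_measurable lebesgue"
    by (rule lebesgue_slice_measurable[OF borel_measurable_integrable[OF F]])
  show "AE x in lebesgue. integrable lebesgue (\<lambda>y. F (x, y))"
    using ae iae Fm
  proof eventually_elim
    case (elim x)
    have "integrable lebesgue (\<lambda>y. g (x, y))" using elim(2) integrable_completion[OF g1] by simp
    then show ?case using integrable_cong_AE[OF elim(3) g1' elim(1)] by simp
  qed
  have eq: "AE x in lebesgue. (\<integral>y. F (x, y) \<partial>lebesgue) = (\<integral>y. g (x, y) \<partial>lborel)"
    using ae Fm
  proof eventually_elim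
    case (elim x)
    have "(\<integral>y. F (x, y) \<partial>lebesgue) = (\<integral>y. g (x, y) \<partial>lebesgue)"
      by (rule integral_cong_AE[OF elim(2) g1' elim(1)])
    then show ?case by (simp add: integral_completion[OF g1])
  qed
  have m: "(\<lambda>x. \<integral>y. F (x, y) \<partial>lebesgue) \<in> borel_measurable lebesgue"
    by (rule borel_measurable_lebesgue_cong_AE[OF borel_measurable_integrable[OF gI'] eq])
  show "integrable lebesgue (\<lambda>x. \<integral>y. F (x, y) \<partial>lebesgue)"
    using integrable_cong_AE[OF m borel_measurable_integrable[OF gI'] eq] gI' by simp
  have "(\<integral>x. (\<integral>y. F (x, y) \<partial>lebesgue) \<partial>lebesgue) = (\<integral>x. (\<integral>y. g (x, y) \<partial>lborel) \<partial>lebesgue)"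
    by (rule integral_cong_AE[OF m borel_measurable_integrable[OF gI'] eq])
  also have "\<dots> = (\<integral>x. (\<integral>y. g (x, y) \<partial>lborel) \<partial>lborel)"
    by (rule integral_completion[OF borel_measurable_integrable[OF gI]])
  also have "\<dots> = (\<integral>z. g z \<partial>lborel)"
    using lborel_pair.integral_fst'[OF gi2] by (simp add: lborel_prod)
  also have "\<dots> = (\<integral>z. g z \<partial>lebesgue)" by (rule integral_completion[OF g(1), symmetric])
  also have "\<dots> = (\<integral>z. F z \<partial>lebesgue)"
    by (rule integral_cong_AE[OF borel_measurable_integrable[OF F] gm g(2), symmetric])
  finally show "(\<integral>x. (\<integral>y. F (x, y) \<partial>lebesgue) \<partial>lebesgue) = (\<integral>z. F z \<partial>lebesgue)" .
qed

text \<open>The jet without its X1-derivatives. \<open>jet_closure part2\<close> is the setting in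
  which \<open>H\<^sub>0\<^sup>1(\<Omega>;\<omega>\<^sub>2)\<close> is handled: u together with its
  X2-gradient will be shown to lie there.\<close>

definition part2 :: "real \<times> ('a \<times> 'b) \<Rightarrow> real \<times> 'b" where
  "part2 p = (fst p, snd (snd p))"

lemma bounded_linear_part2:
  "bounded_linear (part2 :: real \<times> ('a::euclidean_space \<times> 'b::euclidean_space) \<Rightarrow> real \<times> 'b)"
  unfolding part2_def[abs_def]
  by (intro bounded_linear_Pair bounded_linear_fst bounded_linear_compose[OF bounded_linear_snd bounded_linear_snd])

lemma slice_has_derivative:
  fixes \<phi> :: "'a::euclidean_space \<times> 'b::euclidean_space \<Rightarrow> real"
  assumes "smooth \<phi>"
  shows "((\<lambda>y. \<phi> (x, y)) has_derivative (\<lambda>h. frechet_derivative \<phi> (at (x, y)) (0, h))) (at y)"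
proof -
  have "((\<lambda>y. (x, y)) has_derivative (\<lambda>h. (0, h))) (at y)" by (auto intro!: derivative_eq_intros)
  from has_derivative_compose[OF this smooth_has_derivative[OF assms]] show ?thesis .
qed

lemma smooth_slice:
  fixes \<phi> :: "'a::euclidean_space \<times> 'b::euclidean_space \<Rightarrow> real"
  assumes "smooth \<phi>"
  shows "smooth (\<lambda>y. \<phi> (x, y))"
\<comment> \<open>Differentiating a slice along e is the same as slicing the derivative along (0,
  e), so the slices at a fixed x form a class stable under partial derivatives.\<close>
proof (rule smooth_coinduct[where P="\<lambda>f. \<exists>\<phi> :: 'a \<times> 'b \<Rightarrow> real. smooth \<phi> \<and> f = (\<lambda>y. \<phi> (x, y))"])
  show "\<exists>\<phi>' :: 'a \<times> 'b \<Rightarrow> real. smooth \<phi>' \<and> (\<lambda>y. \<phi> (x, y)) = (\<lambda>y. \<phi>' (x, y))" using assms by blast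
  fix f :: "'b \<Rightarrow> real" assume "\<exists>\<phi> :: 'a \<times> 'b \<Rightarrow> real. smooth \<phi> \<and> f = (\<lambda>y. \<phi> (x, y))"
  then obtain \<phi> :: "'a \<times> 'b \<Rightarrow> real" where \<phi>: "smooth \<phi>" and f: "f = (\<lambda>y. \<phi> (x, y))" by blast
  note d = slice_has_derivative[OF \<phi>, of x, folded f]
  have "frechet_derivative f (at y) e = frechet_derivative \<phi> (at (x, y)) (0, e)" for y e
    using frechet_derivative_at[OF d, symmetric] by simp
  moreover have "smooth (\<lambda>z. frechet_derivative \<phi> (at z) (0, e))" if "e \<in> Basis" for e
    using that by (intro smooth_partial[OF \<phi>]) (simp add: Basis_prod_def)
  moreover have "f differentiable at y" for y using d unfolding differentiable_def by blast
  ultimately show "(\<forall>y. f differentiable at y) \<and>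
      (\<forall>e\<in>Basis. \<exists>\<phi> :: 'a \<times> 'b \<Rightarrow> real. smooth \<phi> \<and> (\<lambda>y. frechet_derivative f (at y) e) = (\<lambda>y. \<phi> (x, y)))"
    by auto
qed

lemma jet_slice:
  fixes \<phi> :: "'a::euclidean_space \<times> 'b::euclidean_space \<Rightarrow> real"
  assumes "smooth \<phi>"
  shows "jet (\<lambda>y. \<phi> (x, y)) y = part2 (jet \<phi> (x, y))"
proof -
  have "grad (\<lambda>y. \<phi> (x, y)) y = snd (grad \<phi> (x, y))"
    using slice_has_derivative[OF assms, of x y]
    by (intro grad_eqI) (simp add: frechet_derivative_grad[OF assms] inner_prod_def)
  then show ?thesis by (simp add: jet_def part2_def)
qed

lemma test_fun_slice:
  fixes \<phi> :: "'a::euclidean_space \<times> 'b::euclidean_space \<Rightarrow> real"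
  assumes "test_fun (\<omega>1 \<times> \<omega>2) \<phi>"
  shows "test_fun \<omega>2 (\<lambda>y. \<phi> (x, y))"
proof -
  obtain K where K: "compact K" "K \<subseteq> \<omega>1 \<times> \<omega>2" "\<And>z. z \<notin> K \<Longrightarrow> \<phi> z = 0"
    "\<And>z e. z \<notin> K \<Longrightarrow> frechet_derivative \<phi> (at z) e = 0"
    by (rule test_fun_supp[OF assms]) (rule that)
  show ?thesis
  proof (rule test_funI[where K="snd ` (K \<inter> ({x} \<times> UNIV))"])
    show "smooth (\<lambda>y. \<phi> (x, y))" by (rule smooth_slice[OF test_fun_smooth[OF assms]])
    have "compact (K \<inter> ({x} \<times> UNIV))" by (intro compact_Int_closed K(1) closed_Times) auto
    then show "compact (snd ` (K \<inter> ({x} \<times> UNIV)))"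
      by (intro compact_continuous_image continuous_on_snd continuous_on_id)
    show "snd ` (K \<inter> ({x} \<times> UNIV)) \<subseteq> \<omega>2" using K(2) by auto
    fix y assume "y \<notin> snd ` (K \<inter> ({x} \<times> UNIV))"
    then have "(x, y) \<notin> K" by force
    then show "\<phi> (x, y) = 0" by (rule K(3))
  qed
qed

lemma smooth_fst:
  fixes \<eta> :: "'a::euclidean_space \<Rightarrow> real"
  assumes "smooth \<eta>" shows "smooth (\<lambda>z :: 'a \<times> 'b::euclidean_space. \<eta> (fst z))"
proof (rule smooth_coinduct[where P="\<lambda>f. \<exists>\<eta>. smooth \<eta> \<and> f = (\<lambda>z :: 'a \<times> 'b. \<eta> (fst z))"])
  show "\<exists>\<eta>'. smooth \<eta>' \<and> (\<lambda>z :: 'a \<times> 'b. \<eta> (fst z)) = (\<lambda>z. \<eta>' (fst z))" using assms by blast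
  fix f :: "'a \<times> 'b \<Rightarrow> real" assume "\<exists>\<eta>. smooth \<eta> \<and> f = (\<lambda>z :: 'a \<times> 'b. \<eta> (fst z))"
  then obtain \<eta> where \<eta>: "smooth \<eta>" and f: "f = (\<lambda>z. \<eta> (fst z))" by blast
  have d: "(f has_derivative (\<lambda>h. frechet_derivative \<eta> (at (fst z)) (fst h))) (at z)" for z
    unfolding f by (rule has_derivative_compose[OF _ smooth_has_derivative[OF \<eta>]]) (auto intro!: derivative_eq_intros)
  have fd: "frechet_derivative f (at z) e = frechet_derivative \<eta> (at (fst z)) (fst e)" for z e
    using frechet_derivative_at[OF d, symmetric] by simp
  have "\<exists>\<eta>'. smooth \<eta>' \<and> (\<lambda>z. frechet_derivative f (at z) e) = (\<lambda>z. \<eta>' (fst z))" if e: "e \<in> Basis" for e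
  \<comment> \<open>A basis vector of the product either has first component 0, and the derivative
    is then the zero function, or has a basis vector as first component.\<close>
  proof (cases "fst e = 0")
    case True
    have "frechet_derivative \<eta> (at (fst z)) 0 = 0" for z :: "'a \<times> 'b"
      by (rule linear_0[OF linear_frechet_derivative[OF smooth_differentiable[OF \<eta>]]])
    then show ?thesis using smooth_const[of 0] by (intro exI[of _ "\<lambda>x. 0"]) (simp add: fd True)
  next
    case False
    then have "fst e \<in> Basis" using e by (auto simp: Basis_prod_def)
    then show ?thesis using smooth_partial[OF \<eta>] by (intro exI[of _ "\<lambda>x. frechet_derivative \<eta> (at x) (fst e)"]) (simp add: fd)
  qed
  then show "(\<forall>z. f differentiable at z) \<and> (\<forall>e\<in>Basis. \<exists>\<eta>. smooth \<eta> \<and> (\<lambda>z. frechet_derivative f (at z) e) = (\<lambda>z. \<eta> (fst z)))"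
    using d unfolding differentiable_def by blast
qed

lemma smooth_snd:
  fixes \<eta> :: "'b::euclidean_space \<Rightarrow> real"
  assumes "smooth \<eta>" shows "smooth (\<lambda>z :: 'a::euclidean_space \<times> 'b. \<eta> (snd z))"
proof (rule smooth_coinduct[where P="\<lambda>f. \<exists>\<eta>. smooth \<eta> \<and> f = (\<lambda>z :: 'a \<times> 'b. \<eta> (snd z))"])
  show "\<exists>\<eta>'. smooth \<eta>' \<and> (\<lambda>z :: 'a \<times> 'b. \<eta> (snd z)) = (\<lambda>z. \<eta>' (snd z))" using assms by blast
  fix f :: "'a \<times> 'b \<Rightarrow> real" assume "\<exists>\<eta>. smooth \<eta> \<and> f = (\<lambda>z :: 'a \<times> 'b. \<eta> (snd z))"
  then obtain \<eta> where \<eta>: "smooth \<eta>" and f: "f = (\<lambda>z. \<eta> (snd z))" by blast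
  have d: "(f has_derivative (\<lambda>h. frechet_derivative \<eta> (at (snd z)) (snd h))) (at z)" for z
    unfolding f by (rule has_derivative_compose[OF _ smooth_has_derivative[OF \<eta>]]) (auto intro!: derivative_eq_intros)
  have fd: "frechet_derivative f (at z) e = frechet_derivative \<eta> (at (snd z)) (snd e)" for z e
    using frechet_derivative_at[OF d, symmetric] by simp
  have "\<exists>\<eta>'. smooth \<eta>' \<and> (\<lambda>z. frechet_derivative f (at z) e) = (\<lambda>z. \<eta>' (snd z))" if e: "e \<in> Basis" for e
  proof (cases "snd e = 0")
    case True
    have "frechet_derivative \<eta> (at (snd z)) 0 = 0" for z :: "'a \<times> 'b"
      by (rule linear_0[OF linear_frechet_derivative[OF smooth_differentiable[OF \<eta>]]])
    then show ?thesis using smooth_const[of 0] by (intro exI[of _ "\<lambda>x. 0"]) (simp add: fd True)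
  next
    case False
    then have "snd e \<in> Basis" using e by (auto simp: Basis_prod_def)
    then show ?thesis using smooth_partial[OF \<eta>] by (intro exI[of _ "\<lambda>x. frechet_derivative \<eta> (at x) (snd e)"]) (simp add: fd)
  qed
  then show "(\<forall>z. f differentiable at z) \<and> (\<forall>e\<in>Basis. \<exists>\<eta>. smooth \<eta> \<and> (\<lambda>z. frechet_derivative f (at z) e) = (\<lambda>z. \<eta> (snd z)))"
    using d unfolding differentiable_def by blast
qed

lemma test_fun_tensor:
  assumes \<eta>: "test_fun \<omega>1 \<eta>" and \<psi>: "test_fun \<omega>2 \<psi>"
  shows "test_fun (\<omega>1 \<times> \<omega>2) (\<lambda>z. \<eta> (fst z) * \<psi> (snd z))"
proof -
  obtain K where K: "compact K" "K \<subseteq> \<omega>1" "\<And>x. x \<notin> K \<Longrightarrow> \<eta> x = 0"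
    "\<And>x e. x \<notin> K \<Longrightarrow> frechet_derivative \<eta> (at x) e = 0"
    by (rule test_fun_supp[OF \<eta>]) (rule that)
  obtain L where L: "compact L" "L \<subseteq> \<omega>2" "\<And>x. x \<notin> L \<Longrightarrow> \<psi> x = 0"
    "\<And>x e. x \<notin> L \<Longrightarrow> frechet_derivative \<psi> (at x) e = 0"
    by (rule test_fun_supp[OF \<psi>]) (rule that)
  show ?thesis
  proof (rule test_funI[where K="K \<times> L"])
    show "smooth (\<lambda>z. \<eta> (fst z) * \<psi> (snd z))"
      by (intro smooth_mult smooth_fst smooth_snd test_fun_smooth[OF \<eta>] test_fun_smooth[OF \<psi>])
    show "compact (K \<times> L)" by (intro compact_Times K L)
    show "K \<times> L \<subseteq> \<omega>1 \<times> \<omega>2" using K L by auto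
    show "\<eta> (fst z) * \<psi> (snd z) = 0" if "z \<notin> K \<times> L" for z
      using that K(3)[of "fst z"] L(3)[of "snd z"] by (cases z) auto
  qed
qed

lemma part2_jet_tensor:
  fixes \<eta> :: "'a::euclidean_space \<Rightarrow> real" and \<psi> :: "'b::euclidean_space \<Rightarrow> real"
  assumes "smooth \<eta>" "smooth \<psi>"
  shows "part2 (jet (\<lambda>z. \<eta> (fst z) * \<psi> (snd z)) (x, y)) = \<eta> x *\<^sub>R jet \<psi> y"
proof -
  have sm: "smooth (\<lambda>z. \<eta> (fst z) * \<psi> (snd z))"
    by (intro smooth_mult smooth_fst smooth_snd assms)
  show ?thesis
    using jet_slice[OF sm, of x y] jet_scaleR[OF assms(2), of "\<eta> x" y] by simp
qed

locale bounded_product =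
  fixes \<omega>1 :: "'a::euclidean_space set" and \<omega>2 :: "'b::euclidean_space set"
  assumes dom: "bounded \<omega>1" "open \<omega>1" "bounded \<omega>2" "open \<omega>2"
begin

abbreviation "\<Omega> \<equiv> \<omega>1 \<times> \<omega>2"
abbreviation "M \<equiv> lebesgue_on (\<omega>1 \<times> \<omega>2)"

lemma open_\<Omega>: "open \<Omega>" using dom by (intro open_Times)

lemma sets_dom: "\<omega>1 \<in> sets lebesgue" "\<omega>2 \<in> sets lebesgue" "\<Omega> \<in> sets lebesgue"
  using dom open_\<Omega> by auto

lemma finite_measure_lebesgue_on_bounded:
  "bounded S \<Longrightarrow> S \<in> sets lebesgue \<Longrightarrow> finite_measure (lebesgue_on S)"
  using bounded_set_imp_lmeasurable finite_measure_lebesgue_on by blast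

lemma indicator_slice: "indicator \<Omega> (x, y) *\<^sub>R (f (x, y)) = indicator \<omega>1 x *\<^sub>R indicator \<omega>2 y *\<^sub>R f (x, y)"
  for f :: "_ \<Rightarrow> 'v::euclidean_space"
  by (auto simp: indicator_def)

lemma Fubini_on:
  fixes F :: "'a \<times> 'b \<Rightarrow> real"
  assumes F: "integrable M F"
  shows "AE x in lebesgue_on \<omega>1. integrable (lebesgue_on \<omega>2) (\<lambda>y. F (x, y))"
    and "integrable (lebesgue_on \<omega>1) (\<lambda>x. \<integral>y. F (x, y) \<partial>lebesgue_on \<omega>2)"
    and "(\<integral>x. (\<integral>y. F (x, y) \<partial>lebesgue_on \<omega>2) \<partial>lebesgue_on \<omega>1) = (\<integral>z. F z \<partial>M)"
proof -
  define F' where "F' z = indicator \<Omega> z *\<^sub>R F z" for z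
  have F': "integrable lebesgue F'"
    using F sets_dom by (simp add: integrable_restrict_space F'_def[abs_def])
  have F'_eq: "F' (x, y) = indicator \<omega>1 x *\<^sub>R indicator \<omega>2 y *\<^sub>R F (x, y)" for x y
    unfolding F'_def by (rule indicator_slice)
  have int_eq: "(\<integral>y. F' (x, y) \<partial>lebesgue) = indicator \<omega>1 x *\<^sub>R (\<integral>y. F (x, y) \<partial>lebesgue_on \<omega>2)" for x
    using sets_dom by (simp add: F'_eq integral_restrict_space)
  show "AE x in lebesgue_on \<omega>1. integrable (lebesgue_on \<omega>2) (\<lambda>y. F (x, y))"
    unfolding AE_lebesgue_on_iff[OF sets_dom(1)]
    using lebesgue_Fubini(1)[OF F']
    by eventually_elim (use sets_dom in \<open>auto simp: F'_eq integrable_restrict_space\<close>)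
  show "integrable (lebesgue_on \<omega>1) (\<lambda>x. \<integral>y. F (x, y) \<partial>lebesgue_on \<omega>2)"
    using lebesgue_Fubini(2)[OF F'] sets_dom(1) unfolding int_eq by (simp add: integrable_restrict_space)
  have "(\<integral>x. (\<integral>y. F (x, y) \<partial>lebesgue_on \<omega>2) \<partial>lebesgue_on \<omega>1) = (\<integral>x. (\<integral>y. F' (x, y) \<partial>lebesgue) \<partial>lebesgue)"
    unfolding int_eq using sets_dom(1) by (simp add: integral_restrict_space)
  also have "\<dots> = (\<integral>z. F z \<partial>M)"
    using lebesgue_Fubini(3)[OF F'] sets_dom(3) by (simp add: integral_restrict_space F'_def)
  finally show "(\<integral>x. (\<integral>y. F (x, y) \<partial>lebesgue_on \<omega>2) \<partial>lebesgue_on \<omega>1) = (\<integral>z. F z \<partial>M)" .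
qed

lemma sq_integrable_slice:
  fixes F :: "'a \<times> 'b \<Rightarrow> 'v::euclidean_space"
  assumes F: "sq_integrable M F"
  shows "AE x in lebesgue_on \<omega>1. sq_integrable (lebesgue_on \<omega>2) (\<lambda>y. F (x, y))"
proof -
  have m: "(\<lambda>z. indicator \<Omega> z *\<^sub>R F z) \<in> borel_measurable lebesgue"
    using sq_integrable_measurable[OF F] sets_dom(3) by (simp add: borel_measurable_restrict_space_iff)
  have "AE x in lebesgue_on \<omega>1. (\<lambda>y. F (x, y)) \<in> borel_measurable (lebesgue_on \<omega>2)"
    unfolding AE_lebesgue_on_iff[OF sets_dom(1)] using lebesgue_slice_measurable[OF m]
  proof eventually_elim
    case (elim x)
    show ?case
    proof
      assume "x \<in> \<omega>1"
      then have "(\<lambda>y. indicator \<omega>2 y *\<^sub>R F (x, y)) \<in> borel_measurable lebesgue"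
        using elim unfolding indicator_slice by simp
      then show "(\<lambda>y. F (x, y)) \<in> borel_measurable (lebesgue_on \<omega>2)"
        using sets_dom(2) by (simp add: borel_measurable_restrict_space_iff)
    qed
  qed
  moreover have "AE x in lebesgue_on \<omega>1. integrable (lebesgue_on \<omega>2) (\<lambda>y. (norm (F (x, y)))\<^sup>2)"
    by (rule Fubini_on(1)[OF sq_integrable_integrable[OF F]])
  ultimately show ?thesis by eventually_elim (simp add: sq_integrable_def)
qed

lemma l2norm_slice:
  fixes F :: "'a \<times> 'b \<Rightarrow> 'v::euclidean_space"
  assumes F: "sq_integrable M F"
  shows "(\<integral>x. (l2norm (lebesgue_on \<omega>2) (\<lambda>y. F (x, y)))\<^sup>2 \<partial>lebesgue_on \<omega>1) = (l2norm M F)\<^sup>2"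
    and "integrable (lebesgue_on \<omega>1) (\<lambda>x. (l2norm (lebesgue_on \<omega>2) (\<lambda>y. F (x, y)))\<^sup>2)"
  using Fubini_on(2,3)[OF sq_integrable_integrable[OF F]] by (simp_all add: l2norm_sq)

text \<open>\<open>L\<^sup>2(\<Omega>)\<close>-convergence of the jets implies convergence on almost every slice along a subsequence.\<close>
lemma jet_closure_slice:
  assumes w: "w \<in> jet_closure part2 \<Omega>"
  shows "AE x in lebesgue_on \<omega>1. (\<lambda>y. w (x, y)) \<in> jet_closure (\<lambda>p. p) \<omega>2"
proof -
  obtain \<phi> where \<phi>: "\<And>k. test_fun \<Omega> (\<phi> k)" "(\<lambda>k. l2norm M (\<lambda>z. part2 (jet (\<phi> k) z) - w z)) \<longlonglongrightarrow> 0"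
    by (rule jet_closure_seq[OF w]) (rule that)
  have sw: "sq_integrable M w" by (rule jet_closure_sq[OF w])
  have s: "sq_integrable M (\<lambda>z. part2 (jet (\<phi> k) z) - w z)" for k
    by (intro sq_integrable_diff sw sq_integrable_T_jet[OF bounded_linear_part2 sets_dom(3) \<phi>(1)])
  define D where "D k x = (l2norm (lebesgue_on \<omega>2) (\<lambda>y. part2 (jet (\<phi> k) (x, y)) - w (x, y)))\<^sup>2" for k x
  have "(\<lambda>k. (l2norm M (\<lambda>z. part2 (jet (\<phi> k) z) - w z))\<^sup>2) \<longlonglongrightarrow> 0\<^sup>2" by (rule tendsto_power[OF \<phi>(2)])
  then have "(\<lambda>k. \<integral>x. norm (D k x) \<partial>lebesgue_on \<omega>1) \<longlonglongrightarrow> 0"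
    using l2norm_slice(1)[OF s] by (simp add: D_def)
  moreover have "integrable (lebesgue_on \<omega>1) (D k)" for k
    using l2norm_slice(2)[OF s] by (simp add: D_def[abs_def])
  ultimately obtain r where r: "strict_mono r" "AE x in lebesgue_on \<omega>1. (\<lambda>k. D (r k) x) \<longlonglongrightarrow> 0"
    using tendsto_L1_AE_subseq[of "lebesgue_on \<omega>1" D] by blast
  from r(2) sq_integrable_slice[OF sw] show ?thesis
  proof eventually_elim
    case (elim x)
    have sm: "smooth (\<phi> k)" for k by (rule test_fun_smooth[OF \<phi>(1)])
    have "(\<lambda>k. sqrt (D (r k) x)) \<longlonglongrightarrow> sqrt 0" by (rule tendsto_real_sqrt[OF elim(1)])
    then have "(\<lambda>k. l2norm (lebesgue_on \<omega>2) (\<lambda>y. jet (\<lambda>y. \<phi> (r k) (x, y)) y - w (x, y))) \<longlonglongrightarrow> 0"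
      by (simp add: D_def jet_slice[OF sm])
    then show ?case by (intro jet_closureI_seq[OF elim(2) test_fun_slice[OF \<phi>(1)]])
  qed
qed

end

section \<open>A countable family of test functions that detects all others\<close>

lemma test_fun_lipschitz:
  assumes "test_fun \<Omega> \<phi>"
  obtains B where "B \<ge> 0" "\<And>x y. \<bar>\<phi> x - \<phi> y\<bar> \<le> B * dist x y"
proof -
  note sm = test_fun_smooth[OF assms]
  obtain K where K: "compact K" "K \<subseteq> \<Omega>" "\<And>x. x \<notin> K \<Longrightarrow> jet \<phi> x = 0"
    by (rule jet_supp[OF assms]) (rule that)
  then have K3: "\<And>x. x \<notin> K \<Longrightarrow> grad \<phi> x = 0" by (simp add: jet_def zero_prod_def)
  obtain B where B: "\<And>x. norm (grad \<phi> x) \<le> B"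
    using compact_supp_integrable(3)[OF continuous_on_grad[OF sm] K(1) K3] by (auto simp: bounded_iff)
  have B0: "B \<ge> 0" using order_trans[OF norm_ge_zero B] .
  have "norm (\<phi> x - \<phi> y) \<le> B * norm (x - y)" for x y
  proof (rule differentiable_bound[OF convex_UNIV])
    fix z
    show "(\<phi> has_derivative (\<lambda>h. grad \<phi> z \<bullet> h)) (at z within UNIV)"
      using smooth_has_derivative_grad[OF sm] by simp
    show "onorm (\<lambda>h. grad \<phi> z \<bullet> h) \<le> B"
      by (intro onorm_bound B0) (auto intro!: order_trans[OF Cauchy_Schwarz_ineq2] mult_right_mono B)
  qed auto
  then show ?thesis using B0 that by (auto simp: dist_norm)
qed

text \<open>The constant is a natural number so that the test functions fall into countably many
  classes with a common Lipschitz constant.\<close>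

lemma jet_lipschitz:
  fixes \<phi> :: "'x::euclidean_space \<Rightarrow> real"
  assumes "test_fun \<Omega> \<phi>"
  shows "\<exists>L::nat. \<forall>x y. dist (jet \<phi> x) (jet \<phi> y) \<le> L * dist x y"
proof -
  obtain B where B: "B \<ge> 0" "\<And>x y. \<bar>\<phi> x - \<phi> y\<bar> \<le> B * dist x y" by (rule test_fun_lipschitz[OF assms]) (rule that)
  have "\<exists>C. \<forall>x y. \<bar>frechet_derivative \<phi> (at x) e - frechet_derivative \<phi> (at y) e\<bar> \<le> C * dist x y" if "e \<in> Basis" for e
  proof -
    show ?thesis
      by (rule test_fun_lipschitz[OF test_fun_partial[OF assms that]]) blast
  qed
  then obtain C where C: "\<And>e x y. e \<in> Basis \<Longrightarrow> \<bar>frechet_derivative \<phi> (at x) e - frechet_derivative \<phi> (at y) e\<bar> \<le> C e * dist x y"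
    by metis
  define S where "S = B + (\<Sum>e\<in>Basis. C e)"
  have le: "dist (jet \<phi> x) (jet \<phi> y) \<le> S * dist x y" for x y
  proof -
    have "norm (grad \<phi> x - grad \<phi> y) = norm (\<Sum>e\<in>Basis. (frechet_derivative \<phi> (at x) e - frechet_derivative \<phi> (at y) e) *\<^sub>R e)"
      by (simp add: grad_def sum_subtractf scaleR_diff_left)
    also have "\<dots> \<le> (\<Sum>e\<in>Basis. C e * dist x y)"
      by (rule sum_norm_le) (simp add: C)
    finally have "norm (grad \<phi> x - grad \<phi> y) \<le> (\<Sum>e\<in>Basis. C e) * dist x y" by (simp add: sum_distrib_right)
    moreover have "dist (jet \<phi> x) (jet \<phi> y) \<le> \<bar>\<phi> x - \<phi> y\<bar> + norm (grad \<phi> x - grad \<phi> y)"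
      using norm_Pair_le[of "\<phi> x - \<phi> y" "grad \<phi> x - grad \<phi> y"] by (simp add: dist_norm jet_def)
    ultimately show ?thesis using B(2)[of x y] by (simp add: S_def algebra_simps)
  qed
  obtain L :: nat where L: "S \<le> real L" using real_arch_simple by blast
  have "dist (jet \<phi> x) (jet \<phi> y) \<le> real L * dist x y" for x y
    using le[of x y] mult_right_mono[OF L zero_le_dist[of x y]] by linarith
  then show ?thesis by blast
qed

text \<open>Countably many test functions suffice: those with \<open>L\<close>-Lipschitz jets embed into the separable space of
  sequences by evaluating the jet on a countable dense set, and pointwise convergence there
  propagates to all points.\<close>
lemma countable_test_functions:
  fixes \<omega> :: "'x::euclidean_space set"
  assumes \<omega>: "bounded \<omega>" "open \<omega>"
  obtains C where "countable C" "\<And>\<psi>. \<psi> \<in> C \<Longrightarrow> test_fun \<omega> \<psi>"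
    "\<And>P. sq_integrable (lebesgue_on \<omega>) P \<Longrightarrow> \<forall>\<psi>\<in>C. l2inner (lebesgue_on \<omega>) P (jet \<psi>) = 0 \<Longrightarrow>
      \<forall>\<psi>. test_fun \<omega> \<psi> \<longrightarrow> l2inner (lebesgue_on \<omega>) P (jet \<psi>) = 0"
proof -
  let ?M = "lebesgue_on \<omega>"
  have \<omega>s: "\<omega> \<in> sets lebesgue" using \<omega>(2) by auto
  obtain Q :: "'x set" where Q: "countable Q" "UNIV \<subseteq> closure Q" using separable[of "UNIV :: 'x set"] by metis
  then have "Q \<noteq> {}" by auto
  define q where "q = from_nat_into Q"
  have q: "range q = Q" unfolding q_def by (rule range_from_nat_into[OF \<open>Q \<noteq> {}\<close> Q(1)])
  define D where "D L = {\<psi>. test_fun \<omega> \<psi> \<and> (\<forall>x y. dist (jet \<psi> x) (jet \<psi> y) \<le> real L * dist x y)}" for L :: nat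
  define J :: "('x \<Rightarrow> real) \<Rightarrow> nat \<Rightarrow> real \<times> 'x" where "J \<psi> n = jet \<psi> (q n)" for \<psi> n
  have "\<exists>S. countable S \<and> S \<subseteq> D L \<and> J ` D L \<subseteq> closure (J ` S)" for L
  proof -
    \<comment> \<open>The dense set is taken inside the image of \<open>D L\<close> itself, so that
      its points can be lifted back to test functions with the same Lipschitz bound.\<close>
    obtain T where T: "countable T" "T \<subseteq> J ` D L" "J ` D L \<subseteq> closure T" by (rule separable[of "J ` D L"])
    then obtain S where "S \<subseteq> D L" "countable S" "J ` S = T"
      using countable_subset_image[of T J "D L"] by metis
    then show ?thesis using T by blast
  qed
  then obtain S where S: "\<And>L. countable (S L)" "\<And>L. S L \<subseteq> D L" "\<And>L. J ` D L \<subseteq> closure (J ` S L)" by metis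
  show ?thesis
  proof (rule that[of "\<Union>L. S L"])
    show "countable (\<Union>L. S L)" using S(1) by auto
    show "test_fun \<omega> \<psi>" if "\<psi> \<in> (\<Union>L. S L)" for \<psi> using that S(2) by (auto simp: D_def)
    fix P assume P: "sq_integrable ?M P" and zero: "\<forall>\<psi>\<in>(\<Union>L. S L). l2inner ?M P (jet \<psi>) = 0"
    show "\<forall>\<psi>. test_fun \<omega> \<psi> \<longrightarrow> l2inner ?M P (jet \<psi>) = 0"
    proof (intro allI impI)
    fix \<psi> assume \<psi>: "test_fun \<omega> \<psi>"
    obtain L :: nat where L: "\<forall>x y. dist (jet \<psi> x) (jet \<psi> y) \<le> L * dist x y" using jet_lipschitz[OF \<psi>] by blast
    then have "\<psi> \<in> D L" using \<psi> by (simp add: D_def)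
    then have "J \<psi> \<in> closure (J ` S L)" using S(3) by blast
    then obtain t where t: "\<And>k. t k \<in> J ` S L" "t \<longlonglongrightarrow> J \<psi>" unfolding closure_sequential by blast
    then obtain s where s: "\<And>k. s k \<in> S L" "\<And>k. t k = J (s k)" unfolding image_iff by metis
    have sD: "s k \<in> D L" for k using s(1) S(2) by blast
    have ts: "test_fun \<omega> (s k)" for k using sD[of k] by (simp add: D_def)
    have Ls: "dist (jet (s k) x) (jet (s k) y) \<le> L * dist x y" for k x y using sD[of k] by (simp add: D_def)
    have cv: "(\<lambda>k. jet (s k) (q n)) \<longlonglongrightarrow> jet \<psi> (q n)" for n
    proof -
      have "continuous_on UNIV (\<lambda>f :: nat \<Rightarrow> real \<times> 'x. f n)" by (rule continuous_on_product_coordinates)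
      from continuous_on_tendsto_compose[OF this t(2)] show ?thesis by (simp add: s(2) J_def)
    qed
    have cv_all: "(\<lambda>k. jet (s k) x) \<longlonglongrightarrow> jet \<psi> x" for x
    proof (rule metric_LIMSEQ_I)
      fix r :: real assume r: "0 < r"
      \<comment> \<open>The two Lipschitz errors together cost \<open>2 * L * d\<close>, which is
        less than r/2; the summand 1 also covers L = 0.\<close>
      define d where "d = r / (2 * (2 * real L + 1))"
      have d: "d > 0" using r by (simp add: d_def)
      have "x \<in> closure Q" using Q(2) by auto
      then obtain y where "y \<in> Q" "dist y x < d" using d by (auto simp: closure_approachable)
      then obtain n where n: "dist (q n) x < d" using q by (metis imageE)
      obtain N where N: "\<And>k. k \<ge> N \<Longrightarrow> dist (jet (s k) (q n)) (jet \<psi> (q n)) < r / 2"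
        using metric_LIMSEQ_D[OF cv, of "r / 2" n] r by auto
      have "dist (jet (s k) x) (jet \<psi> x) < r" if "k \<ge> N" for k
      proof -
        have "dist (jet (s k) x) (jet \<psi> x) \<le> dist (jet (s k) x) (jet (s k) (q n))
            + dist (jet (s k) (q n)) (jet \<psi> (q n)) + dist (jet \<psi> (q n)) (jet \<psi> x)"
          using dist_triangle[of "jet (s k) x" "jet \<psi> x" "jet (s k) (q n)"]
            dist_triangle[of "jet (s k) (q n)" "jet \<psi> x" "jet \<psi> (q n)"] by linarith
        also have "\<dots> \<le> L * dist (q n) x + r / 2 + L * dist (q n) x"
          using Ls[of k x "q n"] L N[OF that] by (intro add_mono) (auto simp: dist_commute)
        also have "\<dots> \<le> L * d + r / 2 + L * d" using n by (intro add_mono mult_left_mono) auto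
        also have "\<dots> < (2 * real L + 1) * d + r / 2" using d by (simp add: algebra_simps)
        also have "(2 * real L + 1) * d = r / 2" by (simp add: d_def field_simps)
        also have "r / 2 + r / 2 = r" by simp
        finally show ?thesis .
      qed
      then show "\<exists>N. \<forall>k\<ge>N. dist (jet (s k) x) (jet \<psi> x) < r" by blast
    qed
    \<comment> \<open>At a point outside the bounded set \<open>\<omega>\<close> all these jets
      vanish. Together with the common Lipschitz constant this bounds them uniformly on
      \<open>\<omega>\<close>, which is the domination needed to pass to the limit in the pairing
      with P.\<close>
    have "\<omega> \<noteq> UNIV" using \<omega>(1) not_bounded_UNIV by auto
    then obtain x0 where x0: "x0 \<notin> \<omega>" by blast
    obtain R where R: "\<And>x. x \<in> \<omega> \<Longrightarrow> dist x0 x \<le> R" using bounded_any_center[of \<omega> x0] \<omega>(1) by blast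
    have bound: "norm (jet (s k) x) \<le> L * R" if "x \<in> \<omega>" for k x
    proof -
      obtain K where K: "compact K" "K \<subseteq> \<omega>" "\<And>x. x \<notin> K \<Longrightarrow> jet (s k) x = 0" by (rule jet_supp[OF ts]) (rule that)
      then have "jet (s k) x0 = 0" using x0 by blast
      then have "norm (jet (s k) x) \<le> L * dist x0 x" using Ls[of k x0 x] by (simp add: dist_commute)
      also have "\<dots> \<le> L * R" using R[OF that] by (intro mult_left_mono) auto
      finally show ?thesis .
    qed
    have fin: "finite_measure ?M"
      using bounded_set_imp_lmeasurable[OF \<omega>(1) \<omega>s] by (rule finite_measure_lebesgue_on)
    have Pi: "integrable ?M (\<lambda>x. norm (P x))"
    proof -
      have "sq_integrable ?M (\<lambda>x. norm (P x))"
        using P by (auto simp: sq_integrable_def)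
      from sq_integrable_mult[OF this sq_integrable_const[OF fin, of "1::real"]] show ?thesis by simp
    qed
    have "(\<lambda>k. l2inner ?M P (jet (s k))) \<longlonglongrightarrow> l2inner ?M P (jet \<psi>)"
      unfolding l2inner_def
    proof (rule integral_dominated_convergence[where w="\<lambda>x. norm (P x) * (L * R)"])
      show "integrable ?M (\<lambda>x. norm (P x) * (L * R))" using Pi by simp
      show "(\<lambda>x. P x \<bullet> jet \<psi> x) \<in> borel_measurable ?M" "(\<lambda>x. P x \<bullet> jet (s k) x) \<in> borel_measurable ?M" for k
        by (intro borel_measurable_integrable sq_integrable_inner P sq_integrable_jet[OF \<psi> \<omega>s] sq_integrable_jet[OF ts \<omega>s])+
      show "AE x in ?M. (\<lambda>k. P x \<bullet> jet (s k) x) \<longlonglongrightarrow> P x \<bullet> jet \<psi> x"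
        by (intro AE_I2 tendsto_inner tendsto_const cv_all)
      show "AE x in ?M. norm (P x \<bullet> jet (s k) x) \<le> norm (P x) * (L * R)" for k
      proof (rule AE_I2)
        fix x assume "x \<in> space ?M"
        then have "x \<in> \<omega>" by simp
        have "norm (P x \<bullet> jet (s k) x) \<le> norm (P x) * norm (jet (s k) x)" by (simp add: Cauchy_Schwarz_ineq2)
        also have "\<dots> \<le> norm (P x) * (L * R)" by (intro mult_left_mono bound \<open>x \<in> \<omega>\<close>) simp
        finally show "norm (P x \<bullet> jet (s k) x) \<le> norm (P x) * (L * R)" .
      qed
    qed
    moreover have "l2inner ?M P (jet (s k)) = 0" for k using s(1) zero by auto
    ultimately show "l2inner ?M P (jet \<psi>) = 0" by (simp add: LIMSEQ_const_iff)
    qed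
  qed
qed

context bounded_product
begin

text \<open>Testing with products \<open>\<eta>(x) \<psi>(y)\<close> separates the variables: for
  fixed \<open>\<psi>\<close> the pairing on the slice is a function of x orthogonal to all
  \<open>\<eta>\<close>, hence zero almost everywhere. The exceptional set depends on
  \<open>\<psi>\<close>, and the countable family makes it common to all
  \<open>\<psi>\<close>.\<close>

lemma annihilator_slice:
  assumes P: "sq_integrable M P"
    and zero: "\<And>\<phi>. test_fun \<Omega> \<phi> \<Longrightarrow> l2inner M P (\<lambda>z. part2 (jet \<phi> z)) = 0"
  shows "AE x in lebesgue_on \<omega>1. \<forall>\<psi>. test_fun \<omega>2 \<psi> \<longrightarrow> l2inner (lebesgue_on \<omega>2) (\<lambda>y. P (x, y)) (jet \<psi>) = 0"
proof -
  obtain C where C: "countable C" "\<And>\<psi>. \<psi> \<in> C \<Longrightarrow> test_fun \<omega>2 \<psi>"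
    "\<And>P. sq_integrable (lebesgue_on \<omega>2) P \<Longrightarrow> \<forall>\<psi>\<in>C. l2inner (lebesgue_on \<omega>2) P (jet \<psi>) = 0 \<Longrightarrow>
      \<forall>\<psi>. test_fun \<omega>2 \<psi> \<longrightarrow> l2inner (lebesgue_on \<omega>2) P (jet \<psi>) = 0"
    by (rule countable_test_functions[OF dom(3,4)]) (rule that)
  have "AE x in lebesgue_on \<omega>1. l2inner (lebesgue_on \<omega>2) (\<lambda>y. P (x, y)) (jet \<psi>) = 0" if \<psi>: "test_fun \<omega>2 \<psi>" for \<psi>
  proof -
    define h where "h x = l2inner (lebesgue_on \<omega>2) (\<lambda>y. P (x, y)) (jet \<psi>)" for x
    have "sq_integrable M (\<lambda>z. jet \<psi> (snd z))"
    proof -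
      have c: "continuous_on UNIV (\<lambda>z :: 'a \<times> 'b. jet \<psi> (snd z))"
        using continuous_on_compose2[OF continuous_on_jet[OF test_fun_smooth[OF \<psi>]] continuous_on_snd[OF continuous_on_id]] by simp
      obtain K where K: "compact K" "K \<subseteq> \<omega>2" "\<And>x. x \<notin> K \<Longrightarrow> jet \<psi> x = 0" by (rule jet_supp[OF \<psi>]) (rule that)
      obtain B where B: "\<And>y. norm (jet \<psi> y) \<le> B"
        using compact_supp_integrable(3)[OF continuous_on_jet[OF test_fun_smooth[OF \<psi>]] K(1,3)] by (auto simp: bounded_iff)
      have "finite_measure M"
        using bounded_Times[OF dom(1,3)] sets_dom(3) by (rule finite_measure_lebesgue_on_bounded)
      from sq_integrable_const[OF this, of "1::real"] show ?thesis
        by (rule sq_integrable_bound[where C=B]) (auto simp: B intro!: borel_measurable_lebesgue_on_continuous c)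
    qed
    note i = sq_integrable_inner[OF P this]
    have hi: "integrable (lebesgue_on \<omega>1) h"
      using Fubini_on(2)[OF i] by (simp add: h_def[abs_def] l2inner_def)
    have "AE x in lebesgue. x \<in> \<omega>1 \<longrightarrow> h x = 0"
    proof (rule test_fun_integral_eq_0[OF dom(2)])
      show "L1loc \<omega>1 h"
        unfolding L1loc_def set_integrable_def
      proof (intro allI impI)
        fix K :: "'a set" assume K: "compact K \<and> K \<subseteq> \<omega>1"
        have "integrable lebesgue (\<lambda>x. indicator \<omega>1 x *\<^sub>R h x)" using hi sets_dom(1) by (simp add: integrable_restrict_space)
        from integrable_mult_indicator[OF _ this, of K]
        have "integrable lebesgue (\<lambda>x. indicator K x *\<^sub>R (indicator \<omega>1 x *\<^sub>R h x))"
          using K by (simp add: compact_imp_closed)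
        moreover have "(\<lambda>x. indicator K x *\<^sub>R (indicator \<omega>1 x *\<^sub>R h x)) = (\<lambda>x. indicator K x *\<^sub>R h x)"
          using K by (intro ext) (auto simp: indicator_def)
        ultimately show "integrable lebesgue (\<lambda>x. indicator K x *\<^sub>R h x)" by (simp only:)
      qed
      fix \<eta> assume \<eta>: "test_fun \<omega>1 \<eta>"
      have j: "part2 (jet (\<lambda>z. \<eta> (fst z) * \<psi> (snd z)) (x, y)) = \<eta> x *\<^sub>R jet \<psi> y" for x y
        by (rule part2_jet_tensor[OF test_fun_smooth[OF \<eta>] test_fun_smooth[OF \<psi>]])
      have t: "test_fun \<Omega> (\<lambda>z. \<eta> (fst z) * \<psi> (snd z))" by (rule test_fun_tensor[OF \<eta> \<psi>])
      have "integrable M (\<lambda>z. P z \<bullet> part2 (jet (\<lambda>z. \<eta> (fst z) * \<psi> (snd z)) z))"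
        by (intro sq_integrable_inner P sq_integrable_T_jet[OF bounded_linear_part2 sets_dom(3) t])
      from Fubini_on(3)[OF this]
      have "(\<integral>x. \<eta> x * h x \<partial>lebesgue_on \<omega>1) = l2inner M P (\<lambda>z. part2 (jet (\<lambda>z. \<eta> (fst z) * \<psi> (snd z)) z))"
        by (simp add: l2inner_def j h_def)
      then show "(\<integral>x. h x * \<eta> x \<partial>lebesgue_on \<omega>1) = 0" using zero[OF t] by (simp add: mult.commute)
    qed
    then show ?thesis by (simp add: AE_lebesgue_on_iff[OF sets_dom(1)] h_def)
  qed
  then have "AE x in lebesgue_on \<omega>1. \<forall>\<psi>\<in>C. l2inner (lebesgue_on \<omega>2) (\<lambda>y. P (x, y)) (jet \<psi>) = 0"
    using C(2) by (subst AE_ball_countable[OF C(1)]) blast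
  with sq_integrable_slice[OF P] show ?thesis
    by eventually_elim (use C(3) in blast)
qed

text \<open>The defining identity of a weak derivative along (0, e) says that
  \<open>(G \<bullet> e, u e)\<close> annihilates the X2-jets of test functions; annihilation
  descends to almost every slice, where it reads as the identity on
  \<open>\<omega>2\<close>.\<close>

lemma weak_grad2_slice:
  assumes u: "sq_integrable M u" and G: "sq_integrable M G" and wg: "weak_grad2 \<Omega> u G"
  shows "AE x in lebesgue_on \<omega>1. weak_grad \<omega>2 (\<lambda>y. u (x, y)) (\<lambda>y. G (x, y))"
proof -
  have "AE x in lebesgue_on \<omega>1. weak_pderiv \<omega>2 (\<lambda>y. u (x, y)) e (\<lambda>y. G (x, y) \<bullet> e)" if e: "e \<in> Basis" for e
  proof -
    have sGe: "sq_integrable M (\<lambda>z. G z \<bullet> e)" by (rule sq_integrable_bounded_linear[OF bounded_linear_inner_left G])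
    have sue: "sq_integrable M (\<lambda>z. u z *\<^sub>R e)" by (rule sq_integrable_bounded_linear[OF bounded_linear_scaleR_left u])
    have P: "sq_integrable M (\<lambda>z. (G z \<bullet> e, u z *\<^sub>R e))" by (rule sq_integrable_Pair[OF sGe sue])
    have wp: "weak_pderiv \<Omega> u (0, e) (\<lambda>z. G z \<bullet> e)" using wg e by (simp add: weak_grad2_def)
    have "AE x in lebesgue_on \<omega>1. \<forall>\<psi>. test_fun \<omega>2 \<psi> \<longrightarrow>
        l2inner (lebesgue_on \<omega>2) (\<lambda>y. (G (x, y) \<bullet> e, u (x, y) *\<^sub>R e)) (jet \<psi>) = 0"
    proof (rule annihilator_slice[OF P])
      fix \<phi> assume \<phi>: "test_fun \<Omega> \<phi>"
      have fd: "frechet_derivative \<phi> (at z) (0, e) = e \<bullet> snd (grad \<phi> z)" for z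
        by (simp add: frechet_derivative_grad[OF test_fun_smooth[OF \<phi>]] inner_prod_def inner_commute)
      have sj: "sq_integrable M (\<lambda>z. part2 (jet \<phi> z))" by (rule sq_integrable_T_jet[OF bounded_linear_part2 sets_dom(3) \<phi>])
      have i1: "integrable M (\<lambda>z. (G z \<bullet> e) * \<phi> z)"
        using sq_integrable_mult[OF sGe sq_integrable_fst[OF sj]] by (simp add: part2_def jet_def)
      have i2: "integrable M (\<lambda>z. u z * (e \<bullet> snd (grad \<phi> z)))"
        using sq_integrable_inner[OF sue sq_integrable_snd[OF sj]] by (simp add: part2_def jet_def)
      have "l2inner M (\<lambda>z. (G z \<bullet> e, u z *\<^sub>R e)) (\<lambda>z. part2 (jet \<phi> z))
          = (\<integral>z. (G z \<bullet> e) * \<phi> z \<partial>M) + (\<integral>z. u z * (e \<bullet> snd (grad \<phi> z)) \<partial>M)"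
        using i1 i2 by (simp add: l2inner_def part2_def jet_def)
      also have "\<dots> = 0"
      proof -
        have "(\<integral>z. u z * frechet_derivative \<phi> (at z) (0, e) \<partial>M) = - (\<integral>z. (G z \<bullet> e) * \<phi> z \<partial>M)"
          using wp \<phi> unfolding weak_pderiv_iff[OF sets_dom(3)] by blast
        then show ?thesis unfolding fd by simp
      qed
      finally show "l2inner M (\<lambda>z. (G z \<bullet> e, u z *\<^sub>R e)) (\<lambda>z. part2 (jet \<phi> z)) = 0" .
    qed
    with sq_integrable_slice[OF P] sq_integrable_slice[OF u] show ?thesis
    proof eventually_elim
      case (elim x)
      have s1: "sq_integrable (lebesgue_on \<omega>2) (\<lambda>y. G (x, y) \<bullet> e)" using sq_integrable_fst[OF elim(1)] by simp
      have s2: "sq_integrable (lebesgue_on \<omega>2) (\<lambda>y. u (x, y) *\<^sub>R e)" using sq_integrable_snd[OF elim(1)] by simp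
      show ?case
        unfolding weak_pderiv_iff[OF sets_dom(2)]
      proof (intro conjI allI impI)
        show "L1loc \<omega>2 (\<lambda>y. u (x, y))" "L1loc \<omega>2 (\<lambda>y. G (x, y) \<bullet> e)"
          by (intro L1loc_if_sq_integrable sets_dom(2) elim(2) s1)+
        fix \<psi> assume \<psi>: "test_fun \<omega>2 \<psi>"
        have sj: "sq_integrable (lebesgue_on \<omega>2) (jet \<psi>)" by (rule sq_integrable_jet[OF \<psi> sets_dom(2)])
        have i1: "integrable (lebesgue_on \<omega>2) (\<lambda>y. (G (x, y) \<bullet> e) * \<psi> y)"
          using sq_integrable_mult[OF s1 sq_integrable_fst[OF sj]] by (simp add: jet_def)
        have i2: "integrable (lebesgue_on \<omega>2) (\<lambda>y. u (x, y) * (e \<bullet> grad \<psi> y))"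
          using sq_integrable_inner[OF s2 sq_integrable_snd[OF sj]] by (simp add: jet_def)
        have "0 = l2inner (lebesgue_on \<omega>2) (\<lambda>y. (G (x, y) \<bullet> e, u (x, y) *\<^sub>R e)) (jet \<psi>)"
          using elim(3) \<psi> by simp
        also have "\<dots> = (\<integral>y. (G (x, y) \<bullet> e) * \<psi> y \<partial>lebesgue_on \<omega>2) + (\<integral>y. u (x, y) * (e \<bullet> grad \<psi> y) \<partial>lebesgue_on \<omega>2)"
          using i1 i2 by (simp add: l2inner_def jet_def)
        finally show "(\<integral>y. u (x, y) * frechet_derivative \<psi> (at y) e \<partial>lebesgue_on \<omega>2)
            = - (\<integral>y. (G (x, y) \<bullet> e) * \<psi> y \<partial>lebesgue_on \<omega>2)"
          by (simp add: frechet_derivative_grad[OF test_fun_smooth[OF \<psi>]] inner_commute)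
      qed
    qed
  qed
  then have "AE x in lebesgue_on \<omega>1. \<forall>e\<in>Basis. weak_pderiv \<omega>2 (\<lambda>y. u (x, y)) e (\<lambda>y. G (x, y) \<bullet> e)"
    by (intro AE_finite_allI) auto
  then show ?thesis by (simp add: weak_grad_def)
qed

end

subsection \<open>Density of test functions in \<open>H\<^sub>0\<^sup>1(\<Omega>;\<omega>\<^sub>2)\<close>\<close>

lemma quadratic_nonneg_imp_0:
  fixes b c :: real
  assumes "\<And>t. 0 \<le> t\<^sup>2 * c - 2 * t * b"
  shows "b = 0"
proof (rule ccontr)
  assume b: "b \<noteq> 0"
  \<comment> \<open>At t = b/k the expression is \<open>(b / k)\<^sup>2 * (c - 2 * k)\<close>, and k
    is positive and exceeds c.\<close>
  define k where "k = \<bar>c\<bar> + 1"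
  have k: "k > 0" "c < k" by (auto simp: k_def)
  have "0 \<le> (b / k)\<^sup>2 * c - 2 * (b / k) * b" by (rule assms)
  also have "\<dots> = (b / k)\<^sup>2 * c - 2 * ((b / k)\<^sup>2 * k)" using k by (simp add: power2_eq_square)
  also have "\<dots> = (b / k)\<^sup>2 * (c - 2 * k)" by (simp add: algebra_simps)
  also have "\<dots> < 0" using b k by (intro mult_pos_neg) auto
  finally show False by simp
qed

context bounded_product
begin

text \<open>Poincare's inequality in one fixed direction e of the second factor, used as (0, e) on
  the product, so that only the X2-gradient appears on the right. A common constant serves the
  product and the slices.\<close>

lemma Poincare_const:
  obtains R where "R > 0"
    "\<And>w. w \<in> jet_closure part2 \<Omega> \<Longrightarrow> l2norm M (\<lambda>z. fst (w z)) \<le> R * l2norm M (\<lambda>z. snd (w z))"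
    "\<And>w. w \<in> jet_closure (\<lambda>p. p) \<omega>2 \<Longrightarrow>
      l2norm (lebesgue_on \<omega>2) (\<lambda>y. fst (w y)) \<le> R * l2norm (lebesgue_on \<omega>2) (\<lambda>y. snd (w y))"
proof -
  obtain e :: 'b where e: "e \<in> Basis" using nonempty_Basis by blast
  have bd: "bounded \<Omega>" by (rule bounded_Times[OF dom(1,3)])
  obtain R1 where R1: "R1 > 0" "\<And>z. z \<in> \<Omega> \<Longrightarrow> norm z \<le> R1" using bd by (auto simp: bounded_pos)
  obtain R2 where R2: "R2 > 0" "\<And>z. z \<in> \<omega>2 \<Longrightarrow> norm z \<le> R2" using dom(3) by (auto simp: bounded_pos)
  define R where "R = 2 * max R1 R2"
  have le: "2 * R1 * t \<le> R * t" "2 * R2 * t \<le> R * t" if "t \<ge> 0" for t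
    using that by (auto simp: R_def intro!: mult_right_mono)
  show ?thesis
  proof (rule that[of R])
    show "R > 0" using R1(1) by (simp add: R_def)
    fix w :: "'a \<times> 'b \<Rightarrow> real \<times> 'b" assume w: "w \<in> jet_closure part2 \<Omega>"
    note sw = jet_closure_sq[OF w]
    have "(\<lambda>z. pjet e (w z)) \<in> jet_closure (\<lambda>p. pjet e (part2 p)) \<Omega>"
      by (rule jet_closure_bounded_linear[OF bounded_linear_part2 sets_dom(3) bounded_linear_pjet w])
    moreover have "(\<lambda>p. pjet e (part2 p)) = pjet ((0, e) :: 'a \<times> 'b)"
      by (auto simp: pjet_def part2_def inner_prod_def)
    ultimately have "(\<lambda>z. pjet e (w z)) \<in> jet_closure (pjet ((0, e) :: 'a \<times> 'b)) \<Omega>" by simp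
    from pjet_closure_Poincare[OF sets_dom(3) R1(2) less_imp_le[OF R1(1)] _ this]
    have "l2norm M (\<lambda>z. fst (w z)) \<le> 2 * R1 * l2norm M (\<lambda>z. snd (w z) \<bullet> e)"
      using e by (simp add: pjet_def Basis_prod_def)
    also have "\<dots> \<le> R * l2norm M (\<lambda>z. snd (w z) \<bullet> e)" by (rule le) simp
    also have "\<dots> \<le> R * l2norm M (\<lambda>z. snd (w z))"
    proof (rule mult_left_mono)
      show "l2norm M (\<lambda>z. snd (w z) \<bullet> e) \<le> l2norm M (\<lambda>z. snd (w z))"
        using l2norm_mono[OF sq_integrable_snd[OF sw] sq_integrable_measurable[OF sq_integrable_bounded_linear[OF bounded_linear_inner_left sq_integrable_snd[OF sw]]], of e 1]
          Basis_le_norm[OF e] by simp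
    qed (use R1 in \<open>simp add: R_def\<close>)
    finally show "l2norm M (\<lambda>z. fst (w z)) \<le> R * l2norm M (\<lambda>z. snd (w z))" .
  next
    fix w :: "'b \<Rightarrow> real \<times> 'b" assume w: "w \<in> jet_closure (\<lambda>p. p) \<omega>2"
    note sw = jet_closure_sq[OF w]
    have "(\<lambda>z. pjet e (w z)) \<in> jet_closure (\<lambda>p. pjet e p) \<omega>2"
      by (rule jet_closure_bounded_linear[OF bounded_linear_ident sets_dom(2) bounded_linear_pjet w])
    from pjet_closure_Poincare[OF sets_dom(2) R2(2) less_imp_le[OF R2(1)] e this]
    have "l2norm (lebesgue_on \<omega>2) (\<lambda>z. fst (w z)) \<le> 2 * R2 * l2norm (lebesgue_on \<omega>2) (\<lambda>z. snd (w z) \<bullet> e)"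
      by (simp add: pjet_def)
    also have "\<dots> \<le> R * l2norm (lebesgue_on \<omega>2) (\<lambda>z. snd (w z) \<bullet> e)" by (rule le) simp
    also have "\<dots> \<le> R * l2norm (lebesgue_on \<omega>2) (\<lambda>z. snd (w z))"
    proof (rule mult_left_mono)
      show "l2norm (lebesgue_on \<omega>2) (\<lambda>z. snd (w z) \<bullet> e) \<le> l2norm (lebesgue_on \<omega>2) (\<lambda>z. snd (w z))"
        using l2norm_mono[OF sq_integrable_snd[OF sw] sq_integrable_measurable[OF sq_integrable_bounded_linear[OF bounded_linear_inner_left sq_integrable_snd[OF sw]]], of e 1]
          Basis_le_norm[OF e] by simp
    qed (use R1 in \<open>simp add: R_def\<close>)
    finally show "l2norm (lebesgue_on \<omega>2) (\<lambda>y. fst (w y)) \<le> R * l2norm (lebesgue_on \<omega>2) (\<lambda>y. snd (w y))" .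
  qed
qed

text \<open>Density of test functions: project \<open>\<nabla>\<^sub>2u\<close> onto the closure of the \<open>\<nabla>\<^sub>2\<phi>\<close>; the remainder is
  orthogonal to all \<open>\<nabla>\<^sub>2\<phi>\<close>, hence slicewise orthogonal to \<open>H\<^sub>0\<^sup>1(\<omega>\<^sub>2)\<close>, where it belongs.\<close>
theorem H01_2_dense:
  assumes u: "u \<in> H01_2 \<omega>1 \<omega>2" and G: "weak_grad2 \<Omega> u G" "sq_integrable M G"
  shows "(\<lambda>z. (u z, G z)) \<in> jet_closure part2 \<Omega>"
proof -
  have su: "sq_integrable M u" using u by (simp add: H01_2_def L2_iff[OF sets_dom(3)])
  obtain R where R: "R > 0"
    "\<And>w. w \<in> jet_closure part2 \<Omega> \<Longrightarrow> l2norm M (\<lambda>z. fst (w z)) \<le> R * l2norm M (\<lambda>z. snd (w z))"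
    "\<And>w. w \<in> jet_closure (\<lambda>p. p) \<omega>2 \<Longrightarrow>
      l2norm (lebesgue_on \<omega>2) (\<lambda>y. fst (w y)) \<le> R * l2norm (lebesgue_on \<omega>2) (\<lambda>y. snd (w y))"
    by (rule Poincare_const) (rule that)
  define d2 where "d2 \<phi> z = snd (grad \<phi> z)" for \<phi> :: "'a \<times> 'b \<Rightarrow> real" and z
  have sj: "sq_integrable M (\<lambda>z. part2 (jet \<phi> z))" if "test_fun \<Omega> \<phi>" for \<phi>
    by (rule sq_integrable_T_jet[OF bounded_linear_part2 sets_dom(3) that])
  have snd_j: "snd (part2 (jet \<phi> z)) = d2 \<phi> z" for \<phi> z by (simp add: part2_def jet_def d2_def)
  have sd: "sq_integrable M (d2 \<phi>)" if "test_fun \<Omega> \<phi>" for \<phi>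
    using sq_integrable_snd[OF sj[OF that]] by (simp add: snd_j)
  have d2_add: "d2 (\<lambda>z. \<phi> z + \<psi> z) z = d2 \<phi> z + d2 \<psi> z" if "test_fun \<Omega> \<phi>" "test_fun \<Omega> \<psi>" for \<phi> \<psi> z
    by (simp add: d2_def grad_add[OF that[THEN test_fun_smooth]])
  have d2_scale: "d2 (\<lambda>z. c * \<phi> z) z = c *\<^sub>R d2 \<phi> z" if "test_fun \<Omega> \<phi>" for \<phi> c z
    by (simp add: d2_def grad_scaleR[OF that[THEN test_fun_smooth]])
  \<comment> \<open>The remainders of G after subtracting X2-gradients of test functions.
    Near-minimisers of the norm in this affine set converge to the component of G orthogonal to all
    such gradients.\<close>
  define K where "K = {(\<lambda>z. G z - d2 \<phi> z) |\<phi>. test_fun \<Omega> \<phi>}"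
  have KI: "(\<lambda>z. G z - d2 \<phi> z) \<in> K" if "test_fun \<Omega> \<phi>" for \<phi> using that by (auto simp: K_def)
  obtain z d where z: "\<And>n. z n \<in> K" "l2_Cauchy M z" "\<And>(n::nat) y. y \<in> K \<Longrightarrow> d n \<le> (l2norm M y)\<^sup>2"
    "\<And>n. (l2norm M (z n))\<^sup>2 \<le> d n + inverse (real (Suc n))"
  proof (rule near_minimisers_Cauchy[of "\<lambda>n. K" M "l2norm M (\<lambda>z. G z - d2 (\<lambda>z. 0) z)"])
    show "sq_integrable M y" if "y \<in> K" for y
      using that by (auto simp: K_def intro!: sq_integrable_diff G(2) sd)
    show "(\<lambda>z. (1/2) *\<^sub>R (y1 z + y2 z)) \<in> K" if y: "y1 \<in> K" "y2 \<in> K" for y1 y2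
    proof -
      obtain \<phi> \<psi> where t: "test_fun \<Omega> \<phi>" "test_fun \<Omega> \<psi>" and y: "y1 = (\<lambda>z. G z - d2 \<phi> z)" "y2 = (\<lambda>z. G z - d2 \<psi> z)"
        using y by (auto simp: K_def)
      have t2: "test_fun \<Omega> (\<lambda>z. \<phi> z + \<psi> z)" by (rule test_fun_add[OF t])
      have "(1/2) *\<^sub>R (y1 z + y2 z) = G z - d2 (\<lambda>z. (1/2) * (\<phi> z + \<psi> z)) z" for z
      proof -
        have "G z = (1/2) *\<^sub>R (G z + G z)" by (simp add: scaleR_2[symmetric])
        then show ?thesis unfolding d2_scale[OF t2] d2_add[OF t] y by (simp add: algebra_simps)
      qed
      then have "(\<lambda>z. (1/2) *\<^sub>R (y1 z + y2 z)) = (\<lambda>z. G z - d2 (\<lambda>z. (1/2) * (\<phi> z + \<psi> z)) z)" by (rule ext)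
      then show ?thesis using KI[OF test_fun_scaleR[OF t2, of "1/2"]] by (simp only:)
    qed
    show "\<exists>z\<in>K. l2norm M z \<le> l2norm M (\<lambda>z. G z - d2 (\<lambda>z. 0) z)" for n :: nat
      using KI[OF test_fun_zero] by blast
  qed (auto intro: that)
  obtain \<phi> where \<phi>: "\<And>n. test_fun \<Omega> (\<phi> n)" "\<And>n. z n = (\<lambda>x. G x - d2 (\<phi> n) x)"
    using z(1) unfolding K_def mem_Collect_eq by metis
  have diff_cl: "(\<lambda>x. part2 (jet (\<phi> m) x) - part2 (jet (\<phi> n) x)) \<in> jet_closure part2 \<Omega>" for m n
    by (intro jet_closure_diff[OF bounded_linear_part2 sets_dom(3)] jet_in_jet_closure[OF bounded_linear_part2 sets_dom(3)] \<phi>)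
  \<comment> \<open>Poincare upgrades the Cauchy property from X2-gradients to X2-jets, so the limit
    is the gradient part of an element w of the closure, with a value attached to it.\<close>
  have le: "l2norm M (\<lambda>x. part2 (jet (\<phi> m) x) - part2 (jet (\<phi> n) x)) \<le> (R + 1) * l2norm M (\<lambda>x. z m x - z n x)" for m n
  proof -
    have "l2norm M (\<lambda>x. snd (part2 (jet (\<phi> m) x) - part2 (jet (\<phi> n) x))) = l2norm M (\<lambda>x. z n x - z m x)"
      by (simp add: snd_j \<phi>(2))
    also have "\<dots> = l2norm M (\<lambda>x. z m x - z n x)" by (rule l2norm_commute)
    finally show ?thesis
      using l2norm_Pair_le[OF jet_closure_sq[OF diff_cl[of m n]]] R(2)[OF diff_cl[of m n]]
      by (simp add: distrib_right)
  qed
  have "l2_Cauchy M (\<lambda>n x. part2 (jet (\<phi> n) x))"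
    unfolding l2_Cauchy_def
  proof (intro allI impI)
    fix e :: real assume "e > 0"
    then have "e / (R + 1) > 0" using R(1) by simp
    then obtain N where N: "\<And>m n. m \<ge> N \<Longrightarrow> n \<ge> N \<Longrightarrow> l2norm M (\<lambda>x. z m x - z n x) < e / (R + 1)"
      using z(2) unfolding l2_Cauchy_def by blast
    have "l2norm M (\<lambda>x. part2 (jet (\<phi> m) x) - part2 (jet (\<phi> n) x)) < e" if "m \<ge> N" "n \<ge> N" for m n
    proof -
      have "(R + 1) * l2norm M (\<lambda>x. z m x - z n x) < (R + 1) * (e / (R + 1))"
        using N[OF that] R(1) by (intro mult_strict_left_mono) auto
      then show ?thesis using le[of m n] R(1) by simp
    qed
    then show "\<exists>N. \<forall>m\<ge>N. \<forall>n\<ge>N. l2norm M (\<lambda>x. part2 (jet (\<phi> m) x) - part2 (jet (\<phi> n) x)) < e" by blast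
  qed
  then obtain w where w: "w \<in> jet_closure part2 \<Omega>" "(\<lambda>n. l2norm M (\<lambda>x. part2 (jet (\<phi> n) x) - w x)) \<longlonglongrightarrow> 0"
    by (rule jet_closure_complete[OF bounded_linear_part2 sets_dom(3) jet_in_jet_closure[OF bounded_linear_part2 sets_dom(3) \<phi>(1)]]) (rule that)
  have sw: "sq_integrable M w" by (rule jet_closure_sq[OF w(1)])
  define D where "D x = G x - snd (w x)" for x
  have sD: "sq_integrable M D" unfolding D_def[abs_def] by (intro sq_integrable_diff G(2) sq_integrable_snd sw)
  have sz: "sq_integrable M (z n)" for n unfolding \<phi>(2) by (intro sq_integrable_diff G(2) sd \<phi>)
  have zD: "(\<lambda>n. l2norm M (\<lambda>x. z n x - D x)) \<longlonglongrightarrow> 0"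
  proof (rule tendsto_sandwich[OF _ _ tendsto_const w(2)])
    have "l2norm M (\<lambda>x. z n x - D x) \<le> l2norm M (\<lambda>x. part2 (jet (\<phi> n) x) - w x)" for n
    proof -
      have "l2norm M (\<lambda>x. z n x - D x) = l2norm M (\<lambda>x. snd (w x) - d2 (\<phi> n) x)"
        by (simp add: \<phi>(2) D_def)
      also have "\<dots> = l2norm M (\<lambda>x. snd (part2 (jet (\<phi> n) x) - w x))"
        unfolding snd_diff snd_j by (rule l2norm_commute)
      also have "\<dots> \<le> l2norm M (\<lambda>x. part2 (jet (\<phi> n) x) - w x)"
        by (intro l2norm_snd_le sq_integrable_diff sj \<phi> sw)
      finally show ?thesis .
    qed
    then show "\<forall>\<^sub>F n in sequentially. l2norm M (\<lambda>x. z n x - D x) \<le> l2norm M (\<lambda>x. part2 (jet (\<phi> n) x) - w x)"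
      by (intro always_eventually allI)
  qed simp
  \<comment> \<open>First variation of the minimum. It is carried out for \<open>z n\<close>, which
    minimises up to a slack tending to 0, and then passed to the limit D.\<close>
  have orth: "l2inner M D (d2 \<psi>) = 0" if \<psi>: "test_fun \<Omega> \<psi>" for \<psi>
  proof (rule quadratic_nonneg_imp_0)
    fix t :: real
    have ge: "(l2norm M (z n))\<^sup>2 - inverse (real (Suc n)) \<le> (l2norm M (z n))\<^sup>2 - 2 * t * l2inner M (z n) (d2 \<psi>) + t\<^sup>2 * (l2norm M (d2 \<psi>))\<^sup>2" for n
    proof -
      have "(\<lambda>x. z n x - t *\<^sub>R d2 \<psi> x) = (\<lambda>x. G x - d2 (\<lambda>x. \<phi> n x + t * \<psi> x) x)"
        using d2_add[OF \<phi>(1)[of n] test_fun_scaleR[OF \<psi>, of t]] by (simp add: d2_scale[OF \<psi>] \<phi>(2) diff_diff_eq)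
      then have "(\<lambda>x. z n x - t *\<^sub>R d2 \<psi> x) \<in> K"
        using KI[OF test_fun_add[OF \<phi>(1)[of n] test_fun_scaleR[OF \<psi>, of t]]] by simp
      from z(3)[OF this, of n] z(4)[of n]
      have "(l2norm M (z n))\<^sup>2 - inverse (real (Suc n)) \<le> (l2norm M (\<lambda>x. z n x - t *\<^sub>R d2 \<psi> x))\<^sup>2" by linarith
      then show ?thesis
        unfolding l2norm_diff_sq[OF sz sq_integrable_scaleR[OF sd[OF \<psi>]]] l2inner_scaleR_right l2norm_scaleR
        by (simp add: power_mult_distrib)
    qed
    have "(\<lambda>n. l2inner M (z n) (d2 \<psi>)) \<longlonglongrightarrow> l2inner M D (d2 \<psi>)"
      by (intro l2inner_tendsto_left sz sD sd[OF \<psi>] zD)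
    then have lim: "(\<lambda>n. t\<^sup>2 * (l2norm M (d2 \<psi>))\<^sup>2 - 2 * t * l2inner M (z n) (d2 \<psi>) + inverse (real (Suc n)))
        \<longlonglongrightarrow> t\<^sup>2 * (l2norm M (d2 \<psi>))\<^sup>2 - 2 * t * l2inner M D (d2 \<psi>) + 0"
      by (intro tendsto_add tendsto_diff tendsto_mult tendsto_const LIMSEQ_inverse_real_of_nat)
    show "0 \<le> t\<^sup>2 * (l2norm M (d2 \<psi>))\<^sup>2 - 2 * t * l2inner M D (d2 \<psi>)"
    proof -
      have "0 \<le> t\<^sup>2 * (l2norm M (d2 \<psi>))\<^sup>2 - 2 * t * l2inner M (z n) (d2 \<psi>) + inverse (real (Suc n))" for n
        using ge[of n] by linarith
      then show ?thesis using LIMSEQ_le_const[OF lim, of 0] by simp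
    qed
  qed
  have P: "sq_integrable M (\<lambda>x. (0::real, D x))" by (rule sq_integrable_Pair[OF sq_integrable_zero sD])
  have an: "AE x in lebesgue_on \<omega>1. \<forall>\<psi>. test_fun \<omega>2 \<psi> \<longrightarrow>
      l2inner (lebesgue_on \<omega>2) (\<lambda>y. (0::real, D (x, y))) (jet \<psi>) = 0"
    by (rule annihilator_slice[OF P]) (use orth in \<open>simp add: l2inner_def part2_def jet_def d2_def\<close>)
  have u_sl: "AE x in lebesgue_on \<omega>1. (\<lambda>y. u (x, y)) \<in> H01 \<omega>2"
    using u by (simp add: H01_2_def AE_lebesgue_on_iff[OF sets_dom(1)])
  have sq: "sq_integrable M (\<lambda>x. (u x, G x) - w x)" by (intro sq_integrable_diff sq_integrable_Pair su G(2) sw)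
  have "AE x in lebesgue_on \<omega>1. l2norm (lebesgue_on \<omega>2) (\<lambda>y. (u (x, y), G (x, y)) - w (x, y)) = 0"
    using an u_sl jet_closure_slice[OF w(1)] weak_grad2_slice[OF su G(2,1)] sq_integrable_slice[OF sq]
      sq_integrable_slice[OF sD] sq_integrable_slice[OF G(2)]
  proof eventually_elim
    case (elim x)
    let ?N = "lebesgue_on \<omega>2"
    obtain H where H: "(\<lambda>y. (u (x, y), H y)) \<in> jet_closure (\<lambda>p. p) \<omega>2"
      using elim(2) unfolding H01_iff[OF sets_dom(2)] by blast
    have "weak_grad \<omega>2 (\<lambda>y. u (x, y)) H" using jet_closure_weak_grad[OF sets_dom(2) H] by simp
    from weak_grad_unique[OF dom(4) this elim(4)]
    have HG: "AE y in ?N. H y = G (x, y)" by (simp add: AE_lebesgue_on_iff[OF sets_dom(2)])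
    \<comment> \<open>Membership of the slice of u in \<open>H01 \<omega>2\<close> places v in the
      closure of jets on \<open>\<omega>2\<close>. By uniqueness of weak gradients its gradient is
      the slice of D, which is orthogonal to all gradients of test functions and so, by closure, to
      itself. Hence the gradient of v vanishes, and Poincare on \<open>\<omega>2\<close> removes its
      value.\<close>
    define v where "v y = (u (x, y), H y) - w (x, y)" for y
    have v: "v \<in> jet_closure (\<lambda>p. p) \<omega>2"
      unfolding v_def[abs_def] by (rule jet_closure_diff[OF bounded_linear_ident sets_dom(2) H elim(3)])
    have sv: "sq_integrable ?N v" by (rule jet_closure_sq[OF v])
    have vD: "AE y in ?N. snd (v y) = D (x, y)" using HG by eventually_elim (simp add: v_def D_def)
    obtain \<psi> where \<psi>: "\<And>k. test_fun \<omega>2 (\<psi> k)" "(\<lambda>k. l2norm ?N (\<lambda>y. jet (\<psi> k) y - v y)) \<longlonglongrightarrow> 0"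
      by (rule jet_closure_seq[OF v]) (rule that)
    have sP: "sq_integrable ?N (\<lambda>y. (0::real, D (x, y)))" by (rule sq_integrable_Pair[OF sq_integrable_zero elim(6)])
    have "(\<lambda>k. l2inner ?N (\<lambda>y. (0::real, D (x, y))) (jet (\<psi> k))) \<longlonglongrightarrow> l2inner ?N (\<lambda>y. (0::real, D (x, y))) v"
      by (rule l2inner_tendsto_right[OF sq_integrable_jet[OF \<psi>(1) sets_dom(2)] sv sP \<psi>(2)])
    then have "l2inner ?N (\<lambda>y. (0::real, D (x, y))) v = 0" using elim(1) \<psi>(1) by (simp add: LIMSEQ_const_iff)
    moreover have "l2inner ?N (\<lambda>y. (0::real, D (x, y))) v = (l2norm ?N (\<lambda>y. snd (v y)))\<^sup>2"
      unfolding l2inner_def l2norm_sq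
      using vD sq_integrable_inner[OF sP sv] sq_integrable_integrable[OF sq_integrable_snd[OF sv]]
      by (intro integral_cong_AE borel_measurable_integrable) (auto simp: inner_prod_def power2_norm_eq_inner)
    ultimately have "l2norm ?N (\<lambda>y. snd (v y)) = 0" by simp
    moreover from this have "l2norm ?N (\<lambda>y. fst (v y)) \<le> 0" using R(3)[OF v] by simp
    ultimately have "l2norm ?N v = 0" using l2norm_Pair_le[OF sv] l2norm_nonneg[of ?N v] by linarith
    moreover have "l2norm ?N (\<lambda>y. (u (x, y), G (x, y)) - w (x, y)) = l2norm ?N v"
      using HG sv elim(5) by (intro l2norm_cong_AE sq_integrable_measurable) (auto simp: v_def)
    ultimately show ?case by simp
  qed
  then have "(\<integral>x. (l2norm (lebesgue_on \<omega>2) (\<lambda>y. (u (x, y), G (x, y)) - w (x, y)))\<^sup>2 \<partial>lebesgue_on \<omega>1) = 0"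
    by (rule integral_eq_zero_AE[OF eventually_mono]) simp
  then have "l2norm M (\<lambda>x. (u x, G x) - w x) = 0" using l2norm_slice(1)[OF sq] by simp
  then have "l2norm M (\<lambda>x. w x - (u x, G x)) = 0" by (subst l2norm_commute)
  then show ?thesis
    by (intro jet_closure_closed[OF bounded_linear_part2 sets_dom(3) w(1)] sq_integrable_Pair su G(2)) simp
qed

end

subsection \<open>The elliptic problem\<close>

text \<open>The matrix diag(\<open>\<epsilon>\<close>, 1). It is symmetric, a contraction for
  \<open>\<epsilon>\<close> in [0, 1], and never shrinks the X2-component. Applying it on both sides
  of A produces exactly the powers of \<open>\<epsilon>\<close> in the blocks of
  \<open>Aeps\<close>, so ellipticity of A bounds the dilated gradient.\<close>

definition dil :: "real \<Rightarrow> 'a \<times> 'b \<Rightarrow> 'a::real_vector \<times> 'b" where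
  "dil \<epsilon> \<xi> = (\<epsilon> *\<^sub>R fst \<xi>, snd \<xi>)"

lemma bounded_linear_dil: "bounded_linear (dil \<epsilon> :: 'a::euclidean_space \<times> 'b::euclidean_space \<Rightarrow> _)"
  unfolding dil_def[abs_def]
  by (intro bounded_linear_Pair bounded_linear_scaleR_right[THEN bounded_linear_compose] bounded_linear_fst bounded_linear_snd)

lemmas linear_dil = bounded_linear.linear[OF bounded_linear_dil]

lemma dil_inner: "dil \<epsilon> \<xi> \<bullet> \<eta> = \<xi> \<bullet> dil \<epsilon> (\<eta> :: 'a::euclidean_space \<times> 'b::euclidean_space)"
  by (simp add: dil_def inner_prod_def)

lemma norm_dil_le:
  assumes "0 \<le> \<epsilon>" "\<epsilon> \<le> 1"
  shows "norm (dil \<epsilon> (\<xi> :: 'a::euclidean_space \<times> 'b::euclidean_space)) \<le> norm \<xi>"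
proof -
  have "norm (\<epsilon> *\<^sub>R fst \<xi>) \<le> norm (fst \<xi>)" using assms by (simp add: mult_left_le_one_le)
  then have "(norm (\<epsilon> *\<^sub>R fst \<xi>))\<^sup>2 \<le> (norm (fst \<xi>))\<^sup>2" by (intro power_mono) auto
  then show ?thesis by (simp add: dil_def norm_prod_def)
qed

lemma norm_dil_ge:
  assumes "0 \<le> \<epsilon>" "\<epsilon> \<le> 1"
  shows "\<epsilon> * norm (\<xi> :: 'a::euclidean_space \<times> 'b::euclidean_space) \<le> norm (dil \<epsilon> \<xi>)"
proof -
  have "(\<epsilon> * norm (snd \<xi>))\<^sup>2 \<le> (norm (snd \<xi>))\<^sup>2"
    using assms by (intro power_mono) (auto simp: mult_left_le_one_le)
  then have "(\<epsilon> * norm \<xi>)\<^sup>2 \<le> (norm (dil \<epsilon> \<xi>))\<^sup>2"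
    by (simp add: dil_def norm_prod_def power_mult_distrib distrib_left)
  then show ?thesis by (rule power2_le_imp_le) simp
qed

lemma norm_snd_le_dil: "norm (snd \<xi>) \<le> norm (dil \<epsilon> (\<xi> :: 'a::euclidean_space \<times> 'b::euclidean_space))"
  using norm_snd_le[of "snd \<xi>" "\<epsilon> *\<^sub>R fst \<xi>"] by (simp add: dil_def)

lemma norm_dil_diff_0: "0 \<le> \<epsilon> \<Longrightarrow> norm (dil \<epsilon> \<xi> - dil 0 (\<xi> :: 'a::euclidean_space \<times> 'b::euclidean_space)) \<le> \<epsilon> * norm \<xi>"
  using norm_fst_le[of "fst \<xi>" "snd \<xi>"] by (simp add: dil_def norm_Pair mult_left_mono)

lemma Aeps_dil:
  fixes A :: "'x \<Rightarrow> 'a::euclidean_space \<times> 'b::euclidean_space \<Rightarrow> 'a \<times> 'b"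
  assumes "linear (A x)"
  shows "Aeps \<epsilon> A x \<xi> = dil \<epsilon> (A x (dil \<epsilon> \<xi>))"
proof -
  have "dil \<epsilon> \<xi> = \<epsilon> *\<^sub>R (fst \<xi>, 0) + (0, snd \<xi>)" by (simp add: dil_def)
  then have "A x (dil \<epsilon> \<xi>) = \<epsilon> *\<^sub>R A x (fst \<xi>, 0) + A x (0, snd \<xi>)"
    using assms by (simp only: linear_add linear_scale)
  then show ?thesis
    by (simp add: Aeps_def A11_def A12_def A21_def A22_def dil_def scaleR_add_right power2_eq_square)
qed

locale elliptic = bounded_product \<omega>1 \<omega>2
  for \<omega>1 :: "'a::euclidean_space set" and \<omega>2 :: "'b::euclidean_space set" +
  fixes A :: "'a \<times> 'b \<Rightarrow> 'a \<times> 'b \<Rightarrow> 'a \<times> 'b" and \<beta> :: "real \<Rightarrow> real" and f :: "'a \<times> 'b \<Rightarrow> real"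
    and lam m :: real
  assumes f_L2: "L2 \<Omega> f"
    and A_lin: "\<And>x. linear (A x)"
    and lam: "lam > 0"
    and A_ell: "AE x in lebesgue. x \<in> \<Omega> \<longrightarrow> (\<forall>\<xi>. A x \<xi> \<bullet> \<xi> \<ge> lam * (norm \<xi>)\<^sup>2)"
    and A_Linf: "\<And>i j. i \<in> Basis \<Longrightarrow> j \<in> Basis \<Longrightarrow> Linf \<Omega> (coef A i j)"
    and \<beta>_cont: "continuous_on UNIV \<beta>" and \<beta>_mono: "mono \<beta>" and \<beta>0: "\<beta> 0 = 0"
    and \<beta>_growth: "m \<ge> 0" "\<And>s. \<bar>\<beta> s\<bar> \<le> m * (1 + \<bar>s\<bar>)"
begin

lemma sq_f: "sq_integrable M f"
  using f_L2 by (simp add: L2_iff[OF sets_dom(3)])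

lemma finite_M: "finite_measure M"
  using bounded_Times[OF dom(1,3)] sets_dom(3) by (rule finite_measure_lebesgue_on_bounded)

lemma Linf_measurable: "Linf \<Omega> a \<Longrightarrow> a \<in> borel_measurable M"
  using sets_dom(3) by (simp add: Linf_def set_borel_measurable_def borel_measurable_restrict_space_iff)

lemma Linf_AE: "Linf \<Omega> a \<Longrightarrow> \<exists>K\<ge>0. AE x in M. \<bar>a x\<bar> \<le> K"
proof -
  assume "Linf \<Omega> a"
  then obtain K where K: "AE x in M. \<bar>a x\<bar> \<le> K"
    unfolding Linf_def AE_lebesgue_on_iff[OF sets_dom(3)] by blast
  then have "AE x in M. \<bar>a x\<bar> \<le> max K 0" by eventually_elim auto
  then show ?thesis by (intro exI[of _ "max K 0"]) auto
qed

lemma A_expand: "A x \<xi> = (\<Sum>i\<in>Basis. (\<Sum>j\<in>Basis. (\<xi> \<bullet> j) * coef A i j x) *\<^sub>R i)"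
proof -
  have "A x \<xi> = A x (\<Sum>j\<in>Basis. (\<xi> \<bullet> j) *\<^sub>R j)" by (simp add: euclidean_representation)
  also have "\<dots> = (\<Sum>j\<in>Basis. (\<xi> \<bullet> j) *\<^sub>R A x j)" by (simp add: linear_sum[OF A_lin] linear_scale[OF A_lin])
  finally have "A x \<xi> \<bullet> i = (\<Sum>j\<in>Basis. (\<xi> \<bullet> j) * coef A i j x)" for i
    by (simp add: inner_sum_left coef_def)
  then show ?thesis by (subst euclidean_representation[of "A x \<xi>", symmetric]) simp
qed

lemma A_measurable:
  assumes "G \<in> borel_measurable M"
  shows "(\<lambda>x. A x (G x)) \<in> borel_measurable M"
proof -
  have "(\<lambda>x. \<Sum>i\<in>Basis. (\<Sum>j\<in>Basis. (G x \<bullet> j) * coef A i j x) *\<^sub>R i) \<in> borel_measurable M"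
    by (intro borel_measurable_sum borel_measurable_scaleR borel_measurable_const borel_measurable_times
      borel_measurable_inner assms Linf_measurable A_Linf)
  then show ?thesis by (simp only: A_expand[symmetric])
qed

lemma A_bound: "\<exists>K>0. AE x in M. \<forall>\<xi>. norm (A x \<xi>) \<le> K * norm \<xi>"
proof -
  have "\<exists>K. \<forall>i\<in>Basis. \<forall>j\<in>Basis. K i j \<ge> 0 \<and> (AE x in M. \<bar>coef A i j x\<bar> \<le> K i j)"
    using Linf_AE[OF A_Linf] by metis
  then obtain K where K: "\<And>i j. i \<in> Basis \<Longrightarrow> j \<in> Basis \<Longrightarrow> K i j \<ge> 0"
    "\<And>i j. i \<in> Basis \<Longrightarrow> j \<in> Basis \<Longrightarrow> AE x in M. \<bar>coef A i j x\<bar> \<le> K i j" by blast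
  \<comment> \<open>The sum of all entry bounds; adding 1 makes the constant strictly positive, so
    that it may be divided by.\<close>
  define K' where "K' = (\<Sum>i\<in>Basis. \<Sum>j\<in>Basis. K i j) + 1"
  have "AE x in M. \<forall>i\<in>Basis. \<forall>j\<in>Basis. \<bar>coef A i j x\<bar> \<le> K i j"
    using K(2) by (intro AE_finite_allI) auto
  then have "AE x in M. \<forall>\<xi>. norm (A x \<xi>) \<le> K' * norm \<xi>"
  proof eventually_elim
    case (elim x)
    show ?case
    proof
      fix \<xi> :: "'a \<times> 'b"
      have "norm (A x \<xi>) \<le> (\<Sum>i\<in>Basis. \<Sum>j\<in>Basis. norm \<xi> * K i j)"
      proof (subst A_expand, rule sum_norm_le)
        fix i :: "'a \<times> 'b" assume i: "i \<in> Basis"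
        have "norm ((\<Sum>j\<in>Basis. (\<xi> \<bullet> j) * coef A i j x) *\<^sub>R i) = \<bar>\<Sum>j\<in>Basis. (\<xi> \<bullet> j) * coef A i j x\<bar>"
          by (simp only: norm_scaleR norm_Basis[OF i] mult_1_right)
        also have "\<dots> \<le> (\<Sum>j\<in>Basis. \<bar>(\<xi> \<bullet> j) * coef A i j x\<bar>)" by (rule sum_abs)
        also have "\<dots> \<le> (\<Sum>j\<in>Basis. norm \<xi> * K i j)"
          using elim i by (intro sum_mono) (auto simp: abs_mult intro!: mult_mono Basis_le_norm)
        finally show "norm ((\<Sum>j\<in>Basis. (\<xi> \<bullet> j) * coef A i j x) *\<^sub>R i) \<le> (\<Sum>j\<in>Basis. norm \<xi> * K i j)" .
      qed
      also have "\<dots> = (\<Sum>i\<in>Basis. \<Sum>j\<in>Basis. K i j) * norm \<xi>"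
        by (simp add: sum_distrib_left sum_distrib_right mult.commute)
      also have "\<dots> \<le> K' * norm \<xi>" by (intro mult_right_mono) (auto simp: K'_def)
      finally show "norm (A x \<xi>) \<le> K' * norm \<xi>" .
    qed
  qed
  moreover have "0 \<le> (\<Sum>i\<in>Basis. \<Sum>j\<in>Basis. K i j)" by (intro sum_nonneg K(1))
  then have "K' > 0" by (simp add: K'_def)
  ultimately show ?thesis by blast
qed

definition K where "K = (SOME K. K > 0 \<and> (AE x in M. \<forall>\<xi>. norm (A x \<xi>) \<le> K * norm \<xi>))"

lemma K: "K > 0" "AE x in M. \<forall>\<xi>. norm (A x \<xi>) \<le> K * norm \<xi>"
  using someI_ex[OF A_bound, folded K_def] by blast+

lemma sq_A:
  assumes "sq_integrable M G" shows "sq_integrable M (\<lambda>x. A x (G x))"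
proof (rule sq_integrable_bound[OF assms A_measurable[OF sq_integrable_measurable[OF assms]]])
  show "AE x in M. norm (A x (G x)) \<le> K * norm (G x)" using K(2) by eventually_elim blast
qed

lemma l2norm_A:
  assumes "sq_integrable M G" shows "l2norm M (\<lambda>x. A x (G x)) \<le> K * l2norm M G"
proof (rule l2norm_mono[OF assms A_measurable[OF sq_integrable_measurable[OF assms]]])
  show "AE x in M. norm (A x (G x)) \<le> K * norm (G x)" using K(2) by eventually_elim blast
qed (use K(1) in simp)

lemma sq_\<beta>:
  assumes "sq_integrable M u" shows "sq_integrable M (\<lambda>x. \<beta> (u x))"
proof (rule sq_integrable_bound[where g="\<lambda>x. 1 + \<bar>u x\<bar>" and C=m])
  have "sq_integrable M (\<lambda>x. \<bar>u x\<bar>)" using assms by (auto simp: sq_integrable_def)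
  then show "sq_integrable M (\<lambda>x. 1 + \<bar>u x\<bar>)" by (intro sq_integrable_add sq_integrable_const finite_M)
  have "\<beta> \<in> borel_measurable borel" by (rule borel_measurable_continuous_onI[OF \<beta>_cont])
  then show "(\<lambda>x. \<beta> (u x)) \<in> borel_measurable M"
    using measurable_compose[OF sq_integrable_measurable[OF assms]] by blast
  show "AE x in M. norm (\<beta> (u x)) \<le> m * norm (1 + \<bar>u x\<bar>)" using \<beta>_growth(2) by auto
qed

lemma l2norm_\<beta>:
  assumes "sq_integrable M u" shows "l2norm M (\<lambda>x. \<beta> (u x)) \<le> m * (l2norm M (\<lambda>x. 1::real) + l2norm M u)"
proof -
  have s: "sq_integrable M (\<lambda>x. \<bar>u x\<bar>)" using assms by (auto simp: sq_integrable_def)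
  note c = sq_integrable_const[OF finite_M, of "1::real"]
  have "l2norm M (\<lambda>x. \<beta> (u x)) \<le> m * l2norm M (\<lambda>x. 1 + \<bar>u x\<bar>)"
    using \<beta>_growth by (intro l2norm_mono sq_integrable_add c s sq_integrable_measurable[OF sq_\<beta>[OF assms]]) auto
  also have "\<dots> \<le> m * (l2norm M (\<lambda>x. 1::real) + l2norm M (\<lambda>x. \<bar>u x\<bar>))"
    using \<beta>_growth(1) by (intro mult_left_mono l2norm_triangle c s)
  also have "l2norm M (\<lambda>x. \<bar>u x\<bar>) = l2norm M u" by (simp add: l2norm_def)
  finally show ?thesis .
qed

text \<open>The integrand of the problem, acting on jets: \<open>S \<epsilon> w\<close> pairs with a test jet \<open>(\<phi>, \<nabla>\<phi>)\<close>.\<close>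
definition S :: "real \<Rightarrow> ('a \<times> 'b \<Rightarrow> real \<times> 'a \<times> 'b) \<Rightarrow> 'a \<times> 'b \<Rightarrow> real \<times> 'a \<times> 'b" where
  "S \<epsilon> w x = (\<beta> (fst (w x)) - f x, Aeps \<epsilon> A x (snd (w x)))"

lemma S_eq: "S \<epsilon> w x = (\<beta> (fst (w x)) - f x, dil \<epsilon> (A x (dil \<epsilon> (snd (w x)))))"
  by (simp add: S_def Aeps_dil[OF A_lin])

lemma sq_dil: "sq_integrable M G \<Longrightarrow> sq_integrable M (\<lambda>x. dil \<epsilon> (G x))"
  by (rule sq_integrable_bounded_linear[OF bounded_linear_dil])

lemma sq_S:
  assumes "sq_integrable M w" shows "sq_integrable M (S \<epsilon> w)"
  unfolding S_eq[abs_def]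
  by (intro sq_integrable_Pair sq_integrable_diff sq_\<beta> sq_dil sq_A sq_integrable_fst sq_integrable_snd assms sq_f)

lemma l2norm_dil_le:
  "0 \<le> \<epsilon> \<Longrightarrow> \<epsilon> \<le> 1 \<Longrightarrow> sq_integrable M G \<Longrightarrow> l2norm M (\<lambda>x. dil \<epsilon> (G x)) \<le> l2norm M G"
  using l2norm_mono[of M G "\<lambda>x. dil \<epsilon> (G x)" 1, OF _ sq_integrable_measurable[OF sq_dil]] by (simp add: norm_dil_le)

lemma l2norm_dil_ge:
  assumes "0 < \<epsilon>" "\<epsilon> \<le> 1" "sq_integrable M G" shows "l2norm M G \<le> (1 / \<epsilon>) * l2norm M (\<lambda>x. dil \<epsilon> (G x))"
proof (rule l2norm_mono[OF sq_dil[OF assms(3)] sq_integrable_measurable[OF assms(3)]])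
  show "AE x in M. norm (G x) \<le> 1 / \<epsilon> * norm (dil \<epsilon> (G x))"
    using norm_dil_ge[of \<epsilon> "G x" for x] assms by (intro AE_I2) (simp add: field_simps)
qed (use assms in simp)

lemma l2norm_snd_le_dil:
  "sq_integrable M G \<Longrightarrow> l2norm M (\<lambda>x. snd (G x)) \<le> l2norm M (\<lambda>x. dil \<epsilon> (G x))"
  using l2norm_mono[OF sq_dil sq_integrable_measurable[OF sq_integrable_snd], of G G 1 \<epsilon>] by (simp add: norm_snd_le_dil)

lemma l2norm_S:
  assumes e: "0 \<le> \<epsilon>" "\<epsilon> \<le> 1" and w: "sq_integrable M w"
  shows "l2norm M (S \<epsilon> w) \<le> m * (l2norm M (\<lambda>x. 1::real) + l2norm M (\<lambda>x. fst (w x))) + l2norm M f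
      + K * l2norm M (\<lambda>x. dil \<epsilon> (snd (w x)))"
proof -
  note s1 = sq_integrable_fst[OF w] and s2 = sq_integrable_snd[OF w]
  have "l2norm M (S \<epsilon> w) \<le> l2norm M (\<lambda>x. \<beta> (fst (w x)) - f x) + l2norm M (\<lambda>x. dil \<epsilon> (A x (dil \<epsilon> (snd (w x)))))"
    using l2norm_Pair_le[OF sq_S[OF w, of \<epsilon>]] by (simp add: S_eq)
  also have "l2norm M (\<lambda>x. \<beta> (fst (w x)) - f x) \<le> l2norm M (\<lambda>x. \<beta> (fst (w x))) + l2norm M f"
    by (intro l2norm_triangle_diff sq_\<beta> s1 sq_f)
  also have "l2norm M (\<lambda>x. \<beta> (fst (w x))) \<le> m * (l2norm M (\<lambda>x. 1::real) + l2norm M (\<lambda>x. fst (w x)))"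
    by (rule l2norm_\<beta>[OF s1])
  also have "l2norm M (\<lambda>x. dil \<epsilon> (A x (dil \<epsilon> (snd (w x))))) \<le> l2norm M (\<lambda>x. A x (dil \<epsilon> (snd (w x))))"
    by (intro l2norm_dil_le e sq_A sq_dil s2)
  also have "\<dots> \<le> K * l2norm M (\<lambda>x. dil \<epsilon> (snd (w x)))" by (intro l2norm_A sq_dil s2)
  finally show ?thesis by simp
qed

lemma \<beta>_monotone: "0 \<le> (\<beta> s - \<beta> t) * (s - t)"
  using \<beta>_mono by (cases s t rule: linorder_cases) (auto simp: mono_def intro: mult_nonpos_nonpos mult_nonneg_nonneg)

lemma A_elliptic: "AE x in M. \<forall>\<xi>. lam * (norm \<xi>)\<^sup>2 \<le> A x \<xi> \<bullet> \<xi>"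
  using A_ell by (simp add: AE_lebesgue_on_iff[OF sets_dom(3)])

lemma coercive:
  assumes G: "sq_integrable M G"
  shows "lam * (l2norm M (\<lambda>x. dil \<epsilon> (G x)))\<^sup>2 \<le> l2inner M (\<lambda>x. A x (dil \<epsilon> (G x))) (\<lambda>x. dil \<epsilon> (G x))"
proof -
  have "lam * (l2norm M (\<lambda>x. dil \<epsilon> (G x)))\<^sup>2 = (\<integral>x. lam * (norm (dil \<epsilon> (G x)))\<^sup>2 \<partial>M)" by (simp add: l2norm_sq)
  also have "\<dots> \<le> l2inner M (\<lambda>x. A x (dil \<epsilon> (G x))) (\<lambda>x. dil \<epsilon> (G x))"
    unfolding l2inner_def
  proof (rule integral_mono_AE)
    show "integrable M (\<lambda>x. lam * (norm (dil \<epsilon> (G x)))\<^sup>2)"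
      using sq_integrable_integrable[OF sq_dil[OF G, of \<epsilon>]] by simp
    show "integrable M (\<lambda>x. A x (dil \<epsilon> (G x)) \<bullet> dil \<epsilon> (G x))"
      by (intro sq_integrable_inner sq_A sq_dil G)
    show "AE x in M. lam * (norm (dil \<epsilon> (G x)))\<^sup>2 \<le> A x (dil \<epsilon> (G x)) \<bullet> dil \<epsilon> (G x)"
      using A_elliptic by eventually_elim blast
  qed
  finally show ?thesis .
qed

lemma S_inner:
  assumes w: "sq_integrable M w" and v: "sq_integrable M v"
  shows "l2inner M (S \<epsilon> w) v = l2inner M (\<lambda>x. \<beta> (fst (w x)) - f x) (\<lambda>x. fst (v x))
    + l2inner M (\<lambda>x. A x (dil \<epsilon> (snd (w x)))) (\<lambda>x. dil \<epsilon> (snd (v x)))"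
proof -
  have "S \<epsilon> w x \<bullet> v x = (\<beta> (fst (w x)) - f x) \<bullet> fst (v x) + A x (dil \<epsilon> (snd (w x))) \<bullet> dil \<epsilon> (snd (v x))" for x
    by (cases "v x") (simp add: S_eq dil_inner)
  then show ?thesis
    unfolding l2inner_def
    by (simp del: inner_real_def add: sq_integrable_inner sq_integrable_diff sq_\<beta> sq_f sq_A sq_dil sq_integrable_fst[OF w]
        sq_integrable_fst[OF v] sq_integrable_snd[OF w] sq_integrable_snd[OF v])
qed

text \<open>In the difference f cancels and the contribution of \<open>\<beta>\<close> is
  nonnegative by monotonicity, so ellipticity of the linear part survives as a lower bound.\<close>

lemma S_monotone:
  assumes w: "sq_integrable M w" and v: "sq_integrable M v"
  shows "lam * (l2norm M (\<lambda>x. dil \<epsilon> (snd (w x) - snd (v x))))\<^sup>2 \<le> l2inner M (\<lambda>x. S \<epsilon> w x - S \<epsilon> v x) (\<lambda>x. w x - v x)"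
proof -
  let ?G = "\<lambda>x. snd (w x) - snd (v x)"
  have G: "sq_integrable M ?G" by (intro sq_integrable_diff sq_integrable_snd w v)
  have "lam * (l2norm M (\<lambda>x. dil \<epsilon> (?G x)))\<^sup>2 \<le> l2inner M (\<lambda>x. A x (dil \<epsilon> (?G x))) (\<lambda>x. dil \<epsilon> (?G x))"
    by (rule coercive[OF G])
  also have "\<dots> \<le> l2inner M (\<lambda>x. S \<epsilon> w x - S \<epsilon> v x) (\<lambda>x. w x - v x)"
    unfolding l2inner_def
  proof (rule integral_mono)
    show "integrable M (\<lambda>x. A x (dil \<epsilon> (?G x)) \<bullet> dil \<epsilon> (?G x))"
      by (intro sq_integrable_inner sq_A sq_dil G)
    show "integrable M (\<lambda>x. (S \<epsilon> w x - S \<epsilon> v x) \<bullet> (w x - v x))"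
      by (intro sq_integrable_inner sq_integrable_diff sq_S w v)
    fix x
    have "(S \<epsilon> w x - S \<epsilon> v x) \<bullet> (w x - v x)
        = (\<beta> (fst (w x)) - \<beta> (fst (v x))) * (fst (w x) - fst (v x)) + A x (dil \<epsilon> (?G x)) \<bullet> dil \<epsilon> (?G x)"
    proof -
      have "dil \<epsilon> (A x (dil \<epsilon> (snd (w x)))) - dil \<epsilon> (A x (dil \<epsilon> (snd (v x)))) = dil \<epsilon> (A x (dil \<epsilon> (?G x)))"
        by (simp add: linear_diff[OF linear_dil] linear_diff[OF A_lin])
      then have 1: "S \<epsilon> w x - S \<epsilon> v x = (\<beta> (fst (w x)) - \<beta> (fst (v x)), dil \<epsilon> (A x (dil \<epsilon> (?G x))))"
        by (simp add: S_eq)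
      have 2: "w x - v x = (fst (w x) - fst (v x), ?G x)" by (simp add: prod_eq_iff)
      show ?thesis unfolding 1 2 inner_Pair dil_inner by simp
    qed
    then show "A x (dil \<epsilon> (?G x)) \<bullet> dil \<epsilon> (?G x) \<le> (S \<epsilon> w x - S \<epsilon> v x) \<bullet> (w x - v x)"
      using \<beta>_monotone[of "fst (w x)" "fst (v x)"] by simp
  qed
  finally show ?thesis .
qed

section \<open>The jet space of the problem: Poincare inequalities, energy bound, uniqueness of the
  gradient\<close>

abbreviation "H \<equiv> jet_closure (\<lambda>p :: real \<times> 'a \<times> 'b. p) \<Omega>"

lemmas H_sq = jet_closure_sq[of _ "\<lambda>p. p" \<Omega>]
lemmas H_add = jet_closure_add[OF bounded_linear_ident sets_dom(3)]
lemmas H_diff = jet_closure_diff[OF bounded_linear_ident sets_dom(3)]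
lemmas H_scaleR = jet_closure_scaleR[OF bounded_linear_ident sets_dom(3)]
lemmas H_jet = jet_in_jet_closure[OF bounded_linear_ident sets_dom(3)]

lemma H_part2: "w \<in> H \<Longrightarrow> (\<lambda>x. part2 (w x)) \<in> jet_closure part2 \<Omega>"
  using jet_closure_bounded_linear[OF bounded_linear_ident sets_dom(3) bounded_linear_part2] .

definition R where "R = (SOME R. R > 0 \<and> (\<forall>w\<in>jet_closure part2 \<Omega>. l2norm M (\<lambda>z. fst (w z)) \<le> R * l2norm M (\<lambda>z. snd (w z))))"

lemma R: "R > 0" "w \<in> jet_closure part2 \<Omega> \<Longrightarrow> l2norm M (\<lambda>z. fst (w z)) \<le> R * l2norm M (\<lambda>z. snd (w z))"
proof -
  have "\<exists>R>0. \<forall>w\<in>jet_closure part2 \<Omega>. l2norm M (\<lambda>z. fst (w z)) \<le> R * l2norm M (\<lambda>z. snd (w z))"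
    by (rule Poincare_const) blast
  from someI_ex[OF this] show "R > 0" "w \<in> jet_closure part2 \<Omega> \<Longrightarrow> l2norm M (\<lambda>z. fst (w z)) \<le> R * l2norm M (\<lambda>z. snd (w z))"
    unfolding R_def by auto
qed

lemma H_Poincare: "w \<in> H \<Longrightarrow> l2norm M (\<lambda>x. fst (w x)) \<le> R * l2norm M (\<lambda>x. snd (snd (w x)))"
  using R(2)[OF H_part2] by (simp add: part2_def)

lemma H_Poincare_dil: "w \<in> H \<Longrightarrow> l2norm M (\<lambda>x. fst (w x)) \<le> R * l2norm M (\<lambda>x. dil \<epsilon> (snd (w x)))"
  using H_Poincare[of w] mult_left_mono[OF l2norm_snd_le_dil[OF sq_integrable_snd[OF H_sq]] less_imp_le[OF R(1)], of w \<epsilon>]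
  by linarith

lemma H_Poincare_snd: "w \<in> H \<Longrightarrow> l2norm M w \<le> (R + 1) * l2norm M (\<lambda>x. snd (w x))"
proof -
  assume w: "w \<in> H"
  \<comment> \<open>At \<open>\<epsilon>\<close> = 1 the dilation is the identity, so
    \<open>H_Poincare_dil\<close> specialises to the full gradient.\<close>
  have d: "dil 1 \<xi> = \<xi>" for \<xi> :: "'a \<times> 'b" by (simp add: dil_def)
  show ?thesis
    using l2norm_Pair_le[OF H_sq[OF w]] H_Poincare_dil[OF w, of 1] by (simp add: d distrib_right)
qed

text \<open>Test with z itself: \<open>\<beta>(z) z\<close> is nonnegative because
  \<open>\<beta>\<close> is monotone with \<open>\<beta> 0 = 0\<close>, and Poincare absorbs the
  value of z into the dilated gradient. The bound does not depend on
  \<open>\<epsilon>\<close>.\<close>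

lemma energy_bound:
  assumes z: "z \<in> H" and eq: "l2inner M (S \<epsilon> z) z = 0"
  shows "l2norm M (\<lambda>x. dil \<epsilon> (snd (z x))) \<le> R * l2norm M f / lam"
proof -
  let ?X = "l2norm M (\<lambda>x. dil \<epsilon> (snd (z x)))"
  note s = H_sq[OF z] and s1 = sq_integrable_fst[OF H_sq[OF z]] and s2 = sq_integrable_snd[OF H_sq[OF z]]
  have b: "0 \<le> l2inner M (\<lambda>x. \<beta> (fst (z x))) (\<lambda>x. fst (z x))"
  proof -
    have "0 \<le> \<beta> s * s" for s using \<beta>_monotone[of s 0] \<beta>0 by simp
    then show ?thesis unfolding l2inner_def inner_real_def by (rule Bochner_Integration.integral_nonneg)
  qed
  have "lam * ?X\<^sup>2 \<le> l2inner M (\<lambda>x. A x (dil \<epsilon> (snd (z x)))) (\<lambda>x. dil \<epsilon> (snd (z x)))"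
    by (rule coercive[OF s2])
  also have "\<dots> = - l2inner M (\<lambda>x. \<beta> (fst (z x)) - f x) (\<lambda>x. fst (z x))" using S_inner[OF s s, of \<epsilon>] eq by simp
  also have "\<dots> = l2inner M f (\<lambda>x. fst (z x)) - l2inner M (\<lambda>x. \<beta> (fst (z x))) (\<lambda>x. fst (z x))"
    by (simp add: l2inner_diff_left[OF sq_\<beta>[OF s1] sq_f s1])
  also have "\<dots> \<le> l2norm M f * l2norm M (\<lambda>x. fst (z x))"
    using b l2_Cauchy_Schwarz[OF sq_f s1] by linarith
  also have "\<dots> \<le> l2norm M f * (R * ?X)" by (intro mult_left_mono H_Poincare_dil z) simp
  finally have *: "?X * (lam * ?X) \<le> ?X * (R * l2norm M f)" by (simp add: power2_eq_square mult_ac)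
  show ?thesis
  proof (cases "?X = 0")
    case True then show ?thesis using R(1) lam by simp
  next
    case False
    then have "?X > 0" using l2norm_nonneg[of M "\<lambda>x. dil \<epsilon> (snd (z x))"] by linarith
    then show ?thesis using * lam by (simp add: field_simps)
  qed
qed

lemma H_weak_grad: "w \<in> H \<Longrightarrow> weak_grad \<Omega> (\<lambda>x. fst (w x)) (\<lambda>x. snd (w x))"
  by (rule jet_closure_weak_grad[OF sets_dom(3)])

lemma H_weak_grad2: "w \<in> H \<Longrightarrow> weak_grad2 \<Omega> (\<lambda>x. fst (w x)) (\<lambda>x. snd (snd (w x)))"
proof -
  assume w: "w \<in> H"
  show ?thesis
    unfolding weak_grad2_def
  proof
    fix e :: 'b assume "e \<in> Basis"
    then have "(0, e) \<in> (Basis :: ('a \<times> 'b) set)" by (simp add: Basis_prod_def)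
    then have "weak_pderiv \<Omega> (\<lambda>x. fst (w x)) (0, e) (\<lambda>x. snd (w x) \<bullet> (0, e))"
      using H_weak_grad[OF w] by (simp add: weak_grad_def)
    then show "weak_pderiv \<Omega> (\<lambda>x. fst (w x)) (0, e) (\<lambda>x. snd (snd (w x)) \<bullet> e)" by (simp add: inner_prod_def)
  qed
qed

lemma H_fst_H01_2: "w \<in> H \<Longrightarrow> (\<lambda>x. fst (w x)) \<in> H01_2 \<omega>1 \<omega>2"
proof -
  assume w: "w \<in> H"
  note s = H_sq[OF w]
  have "AE x in lebesgue_on \<omega>1. (\<lambda>y. fst (w (x, y))) \<in> H01 \<omega>2"
    using jet_closure_slice[OF H_part2[OF w]]
  proof eventually_elim
    case (elim x)
    then show ?case unfolding H01_iff[OF sets_dom(2)]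
      by (intro exI[of _ "\<lambda>y. snd (snd (w (x, y)))"]) (simp add: part2_def)
  qed
  then show ?thesis
    unfolding H01_2_def using H_weak_grad2[OF w] sq_integrable_fst[OF s] sq_integrable_snd[OF sq_integrable_snd[OF s]]
    by (auto simp: L2_iff[OF sets_dom(3)] AE_lebesgue_on_iff[OF sets_dom(1)])
qed

lemma H01_jet: "u \<in> H01 \<Omega> \<Longrightarrow> \<exists>w\<in>H. (\<lambda>x. fst (w x)) = u"
  unfolding H01_iff[OF sets_dom(3)] by (elim exE, rule bexI) auto

text \<open>A vanishing X2-gradient forces the value to vanish by Poincare, and then the whole weak
  gradient is zero by uniqueness. This is the null-space condition under which
  \<open>finite_span_seminorm_bound\<close> compares the full gradient with the X2-gradient.\<close>

lemma H_null:
  assumes w: "w \<in> H" and "l2norm M (\<lambda>x. snd (snd (w x))) = 0"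
  shows "l2norm M (\<lambda>x. snd (w x)) = 0"
proof -
  note s = H_sq[OF w]
  have "l2norm M (\<lambda>x. fst (w x)) = 0"
    using H_Poincare[OF w] assms(2) l2norm_nonneg[of M "\<lambda>x. fst (w x)"] by simp
  then have f0: "AE x in M. fst (w x) = 0" using l2norm_eq_0_iff[OF sq_integrable_fst[OF s]] by simp
  have "weak_grad \<Omega> (\<lambda>x. fst (w x)) (\<lambda>x. 0)"
    unfolding weak_grad_def
  proof
    fix e :: "'a \<times> 'b" assume "e \<in> Basis"
    show "weak_pderiv \<Omega> (\<lambda>x. fst (w x)) e (\<lambda>x. 0 \<bullet> e)"
      unfolding weak_pderiv_iff[OF sets_dom(3)]
    proof (intro conjI allI impI)
      show "L1loc \<Omega> (\<lambda>x. fst (w x))" by (rule L1loc_if_sq_integrable[OF sets_dom(3) sq_integrable_fst[OF s]])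
      show "L1loc \<Omega> (\<lambda>x. 0 \<bullet> e)" by (simp add: L1loc_def set_integrable_def)
      fix \<phi> :: "'a \<times> 'b \<Rightarrow> real"
      have "(\<integral>x. fst (w x) * frechet_derivative \<phi> (at x) e \<partial>M) = 0"
        using f0 by (rule integral_eq_zero_AE[OF eventually_mono]) simp
      then show "(\<integral>x. fst (w x) * frechet_derivative \<phi> (at x) e \<partial>M) = - (\<integral>x. (0 \<bullet> e) * \<phi> x \<partial>M)" by simp
    qed
  qed
  from weak_grad_unique[OF open_\<Omega> H_weak_grad[OF w] this]
  have "AE x in M. snd (w x) = 0" by (simp add: AE_lebesgue_on_iff[OF sets_dom(3)])
  then show ?thesis using l2norm_eq_0_iff[OF sq_integrable_snd[OF s]] by simp
qed

text \<open>Existence for the full problem and strong convergence of asymptotically exact approximations.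
  The limit is a limit of near-minimisers, in place of a weak limit, and solves the equation
  by Minty's argument.\<close>
theorem approximate_solutions_converge:
  assumes e: "0 < \<epsilon>" "\<epsilon> \<le> 1"
    and W: "\<And>n. W n \<in> H" "\<And>n::nat. l2inner M (S \<epsilon> (W n)) (W n) = 0"
    and res: "\<And>w. w \<in> H \<Longrightarrow> (\<lambda>n. l2inner M (S \<epsilon> (W n)) w) \<longlonglongrightarrow> 0"
  obtains z where "z \<in> H" "\<And>\<phi>. \<phi> \<in> H \<Longrightarrow> l2inner M (S \<epsilon> z) \<phi> = 0"
    "(\<lambda>n. l2norm M (\<lambda>x. snd (W n x) - snd (z x))) \<longlonglongrightarrow> 0"
proof -
  have mono: "0 \<le> l2inner M (\<lambda>x. S \<epsilon> w x - S \<epsilon> v x) (\<lambda>x. w x - v x)" if "w \<in> H" "v \<in> H" for w v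
  proof -
    have "0 \<le> lam * (l2norm M (\<lambda>x. dil \<epsilon> (snd (w x) - snd (v x))))\<^sup>2" using lam by simp
    also have "\<dots> \<le> l2inner M (\<lambda>x. S \<epsilon> w x - S \<epsilon> v x) (\<lambda>x. w x - v x)"
      by (intro S_monotone H_sq that)
    finally show ?thesis .
  qed
  \<comment> \<open>Monotonicity and the energy identity for \<open>W n\<close> give that the
    pairing of \<open>S \<epsilon> w\<close> with \<open>w - W n\<close> is at least the residual of
    \<open>W n\<close> at w. These residuals only tend to zero, so the sets record every lower bound
    c valid along the tail. The condition is affine in z, so \<open>C n\<close> is convex, and its
    members play the part of candidates for the weak limit.\<close>
  define C where "C n = {z \<in> H. \<forall>w\<in>H. \<forall>c. (\<forall>j\<ge>n. c \<le> l2inner M (S \<epsilon> (W j)) w) \<longrightarrow> c \<le> l2inner M (S \<epsilon> w) (\<lambda>x. w x - z x)}" for n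
  have WC: "W n \<in> C n" for n
    unfolding C_def
  proof (intro CollectI conjI ballI allI impI W)
    fix w c assume w: "w \<in> H" and c: "\<forall>j\<ge>n. c \<le> l2inner M (S \<epsilon> (W j)) w"
    note s = H_sq[OF w] H_sq[OF W(1)[of n]]
    have "l2inner M (\<lambda>x. S \<epsilon> w x - S \<epsilon> (W n) x) (\<lambda>x. w x - W n x)
        = l2inner M (S \<epsilon> w) (\<lambda>x. w x - W n x) - l2inner M (S \<epsilon> (W n)) w + l2inner M (S \<epsilon> (W n)) (W n)"
      using s by (simp add: l2inner_diff_left l2inner_diff_right sq_S sq_integrable_diff)
    then show "c \<le> l2inner M (S \<epsilon> w) (\<lambda>x. w x - W n x)"
      using mono[OF w W(1)[of n]] W(2)[of n] c by fastforce
  qed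
  \<comment> \<open>The energy bound, divided by \<open>\<epsilon>\<close> to recover the full
    gradient, and then Poincare for the value.\<close>
  define B where "B = (R + 1) * ((1 / \<epsilon>) * (R * l2norm M f / lam))"
  have WB: "l2norm M (W n) \<le> B" for n
  proof -
    have "l2norm M (\<lambda>x. snd (W n x)) \<le> (1 / \<epsilon>) * l2norm M (\<lambda>x. dil \<epsilon> (snd (W n x)))"
      by (intro l2norm_dil_ge e sq_integrable_snd H_sq W)
    also have "\<dots> \<le> (1 / \<epsilon>) * (R * l2norm M f / lam)" using e by (intro mult_left_mono energy_bound W) auto
    finally have "(R + 1) * l2norm M (\<lambda>x. snd (W n x)) \<le> B" unfolding B_def using R(1) by (intro mult_left_mono) auto
    then show ?thesis using H_Poincare_snd[OF W(1)[of n]] by linarith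
  qed
  obtain y d where y: "\<And>n. y n \<in> C n" "l2_Cauchy M y"
    "\<And>(n::nat) v. v \<in> C n \<Longrightarrow> d n \<le> (l2norm M v)\<^sup>2" "\<And>n. (l2norm M (y n))\<^sup>2 \<le> d n + inverse (real (Suc n))"
  proof (rule near_minimisers_Cauchy[of C M B])
    show "sq_integrable M z" if "z \<in> C n" for n z using that H_sq by (auto simp: C_def)
    show "C k \<subseteq> C n" if "n \<le> k" for k n using that unfolding C_def by (auto dest: order_trans)
    show "\<exists>z\<in>C n. l2norm M z \<le> B" for n using WC WB by blast
    show "(\<lambda>x. (1/2) *\<^sub>R (p x + q x)) \<in> C n" if p: "p \<in> C n" and q: "q \<in> C n" for n p q
      unfolding C_def
    proof (intro CollectI conjI ballI allI impI)
      have pq: "p \<in> H" "q \<in> H" using p q by (auto simp: C_def)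
      then show "(\<lambda>x. (1/2) *\<^sub>R (p x + q x)) \<in> H" by (intro H_scaleR H_add)
      fix w c assume w: "w \<in> H" and c: "\<forall>j\<ge>n. c \<le> l2inner M (S \<epsilon> (W j)) w"
      have "c \<le> l2inner M (S \<epsilon> w) (\<lambda>x. w x - p x)" "c \<le> l2inner M (S \<epsilon> w) (\<lambda>x. w x - q x)"
        using p q w c by (auto simp: C_def)
      then have "c \<le> l2inner M (S \<epsilon> w) w - l2inner M (S \<epsilon> w) p" "c \<le> l2inner M (S \<epsilon> w) w - l2inner M (S \<epsilon> w) q"
        using H_sq[OF w] pq[THEN H_sq] by (simp_all add: l2inner_diff_right sq_S)
      moreover have "c \<le> r - (1/2) * (s + t)" if "c \<le> r - s" "c \<le> r - t" for r s t :: real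
        using that by argo
      ultimately have "c \<le> l2inner M (S \<epsilon> w) w - (1/2) * (l2inner M (S \<epsilon> w) p + l2inner M (S \<epsilon> w) q)"
        by blast
      also have "\<dots> = l2inner M (S \<epsilon> w) (\<lambda>x. w x - (1/2) *\<^sub>R (p x + q x))"
        using H_sq[OF w] pq[THEN H_sq]
        by (simp only: l2inner_diff_right l2inner_scaleR_right l2inner_add_right sq_S sq_integrable_add sq_integrable_scaleR)
      finally show "c \<le> l2inner M (S \<epsilon> w) (\<lambda>x. w x - (1/2) *\<^sub>R (p x + q x))" .
    qed
  qed (auto intro: that)
  have yH: "y n \<in> H" for n using y(1)[of n] by (simp add: C_def)
  obtain z where z: "z \<in> H" "(\<lambda>n. l2norm M (\<lambda>x. y n x - z x)) \<longlonglongrightarrow> 0"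
    by (rule jet_closure_complete[OF bounded_linear_ident sets_dom(3) yH y(2)]) (rule that)
  \<comment> \<open>By \<open>res\<close>, every negative number is eventually a lower bound for the
    residuals, so late \<open>y n\<close> satisfy the inequality with \<open>c = - \<delta>\<close>.
    For fixed w the right-hand side is affine and continuous in \<open>y n\<close>, so the limit z
    inherits it.\<close>
  have minty: "0 \<le> l2inner M (S \<epsilon> w) (\<lambda>x. w x - z x)" if w: "w \<in> H" for w
  proof (rule field_le_epsilon)
    fix \<delta> :: real assume "\<delta> > 0"
    then have "\<forall>\<^sub>F n in sequentially. - \<delta> < l2inner M (S \<epsilon> (W n)) w" by (intro order_tendstoD(1)[OF res[OF w]]) simp
    then obtain N where N: "\<And>n. n \<ge> N \<Longrightarrow> - \<delta> \<le> l2inner M (S \<epsilon> (W n)) w"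
      unfolding eventually_sequentially by (meson less_imp_le)
    have "- \<delta> \<le> l2inner M (S \<epsilon> w) (\<lambda>x. w x - y n x)" if n: "n \<ge> N" for n
    proof -
      have "\<forall>j\<ge>n. - \<delta> \<le> l2inner M (S \<epsilon> (W j)) w" using N n by (meson order_trans)
      then show ?thesis using y(1)[of n] w unfolding C_def by blast
    qed
    then have *: "- \<delta> \<le> l2inner M (S \<epsilon> w) w - l2inner M (S \<epsilon> w) (y n)" if "n \<ge> N" for n
      using that by (simp add: l2inner_diff_right sq_S H_sq[OF w] H_sq[OF yH])
    have "(\<lambda>n. l2inner M (S \<epsilon> w) w - l2inner M (S \<epsilon> w) (y n)) \<longlonglongrightarrow> l2inner M (S \<epsilon> w) w - l2inner M (S \<epsilon> w) z"
      by (intro tendsto_diff tendsto_const l2inner_tendsto_right H_sq[OF yH] H_sq[OF z(1)] sq_S H_sq[OF w] z(2))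
    then have "- \<delta> \<le> l2inner M (S \<epsilon> w) w - l2inner M (S \<epsilon> w) z"
      using * by (intro LIMSEQ_le_const) blast+
    then show "0 \<le> l2inner M (S \<epsilon> w) (\<lambda>x. w x - z x) + \<delta>"
      by (simp add: l2inner_diff_right sq_S H_sq[OF w] H_sq[OF z(1)])
  qed
  \<comment> \<open>Insert z + t \<open>\<phi>\<close> into the inequality, divide by t and let t
    tend to 0. The part with A is affine in t; the part with \<open>\<beta>\<close> converges by
    dominated convergence, the growth bound and t at most 1 providing the majorant.\<close>
  have ge: "0 \<le> l2inner M (S \<epsilon> z) \<phi>" if \<phi>: "\<phi> \<in> H" for \<phi>
  proof -
    define t where "t n = inverse (real (Suc n))" for n
    have t: "t n > 0" "t n \<le> 1" for n by (auto simp: t_def inverse_le_1_iff)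
    have t0: "t \<longlonglongrightarrow> 0" unfolding t_def by (rule LIMSEQ_inverse_real_of_nat)
    define w where "w n x = z x + t n *\<^sub>R \<phi> x" for n x
    have wH: "w n \<in> H" for n unfolding w_def[abs_def] by (intro H_add H_scaleR z \<phi>)
    note s\<phi> = H_sq[OF \<phi>] and sz = H_sq[OF z(1)]
    have pos: "0 \<le> l2inner M (S \<epsilon> (w n)) \<phi>" for n
    proof -
      have "0 \<le> l2inner M (S \<epsilon> (w n)) (\<lambda>x. t n *\<^sub>R \<phi> x)" using minty[OF wH[of n]] by (simp add: w_def)
      then show ?thesis using t(1)[of n] by (simp add: l2inner_scaleR_right zero_le_mult_iff)
    qed
    have sb: "sq_integrable M (\<lambda>x. 1 + \<bar>fst (z x)\<bar> + \<bar>fst (\<phi> x)\<bar>)"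
    proof -
      have "sq_integrable M (\<lambda>x. \<bar>fst (v x)\<bar>)" if "sq_integrable M v" for v :: "'a \<times> 'b \<Rightarrow> real \<times> 'a \<times> 'b"
        using sq_integrable_fst[OF that] by (auto simp: sq_integrable_def)
      from this[OF s\<phi>] this[OF sz] show ?thesis by (intro sq_integrable_add sq_integrable_const finite_M)
    qed
    have b: "(\<lambda>n. l2inner M (\<lambda>x. \<beta> (fst (w n x)) - f x) (\<lambda>x. fst (\<phi> x)))
        \<longlonglongrightarrow> l2inner M (\<lambda>x. \<beta> (fst (z x)) - f x) (\<lambda>x. fst (\<phi> x))"
      unfolding l2inner_def
    proof (rule integral_dominated_convergence[where w="\<lambda>x. m * ((1 + \<bar>fst (z x)\<bar> + \<bar>fst (\<phi> x)\<bar>) * \<bar>fst (\<phi> x)\<bar>) + \<bar>f x * fst (\<phi> x)\<bar>"])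
      have "sq_integrable M (\<lambda>x. \<bar>fst (\<phi> x)\<bar>)" using sq_integrable_fst[OF s\<phi>] by (auto simp: sq_integrable_def)
      then show "integrable M (\<lambda>x. m * ((1 + \<bar>fst (z x)\<bar> + \<bar>fst (\<phi> x)\<bar>) * \<bar>fst (\<phi> x)\<bar>) + \<bar>f x * fst (\<phi> x)\<bar>)"
        using sq_integrable_mult[OF sb] sq_integrable_mult[OF sq_f sq_integrable_fst[OF s\<phi>]]
        by (intro Bochner_Integration.integrable_add integrable_mult_right integrable_abs)
      show "(\<lambda>x. (\<beta> (fst (z x)) - f x) \<bullet> fst (\<phi> x)) \<in> borel_measurable M"
        "(\<lambda>x. (\<beta> (fst (w n x)) - f x) \<bullet> fst (\<phi> x)) \<in> borel_measurable M" for n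
        by (intro borel_measurable_integrable sq_integrable_inner sq_integrable_diff sq_\<beta> sq_f sq_integrable_fst s\<phi> sz H_sq[OF wH])+
      show "AE x in M. (\<lambda>n. (\<beta> (fst (w n x)) - f x) \<bullet> fst (\<phi> x)) \<longlonglongrightarrow> (\<beta> (fst (z x)) - f x) \<bullet> fst (\<phi> x)"
      proof (rule AE_I2)
        fix x
        have "(\<lambda>n. fst (z x) + t n * fst (\<phi> x)) \<longlonglongrightarrow> fst (z x) + 0 * fst (\<phi> x)"
          by (intro tendsto_add tendsto_const tendsto_mult t0)
        then have "(\<lambda>n. fst (w n x)) \<longlonglongrightarrow> fst (z x)" by (simp add: w_def)
        then have "(\<lambda>n. \<beta> (fst (w n x))) \<longlonglongrightarrow> \<beta> (fst (z x))"
          by (rule continuous_on_tendsto_compose[OF \<beta>_cont]) auto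
        then show "(\<lambda>n. (\<beta> (fst (w n x)) - f x) \<bullet> fst (\<phi> x)) \<longlonglongrightarrow> (\<beta> (fst (z x)) - f x) \<bullet> fst (\<phi> x)"
          by (intro tendsto_inner tendsto_diff tendsto_const)
      qed
      show "AE x in M. norm ((\<beta> (fst (w n x)) - f x) \<bullet> fst (\<phi> x))
          \<le> m * ((1 + \<bar>fst (z x)\<bar> + \<bar>fst (\<phi> x)\<bar>) * \<bar>fst (\<phi> x)\<bar>) + \<bar>f x * fst (\<phi> x)\<bar>" for n
      proof (rule AE_I2)
        fix x
        have "\<bar>t n * fst (\<phi> x)\<bar> \<le> \<bar>fst (\<phi> x)\<bar>" using t[of n] by (simp add: abs_mult mult_left_le_one_le)
        then have "1 + \<bar>fst (w n x)\<bar> \<le> 1 + \<bar>fst (z x)\<bar> + \<bar>fst (\<phi> x)\<bar>" by (simp add: w_def)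
        then have "m * (1 + \<bar>fst (w n x)\<bar>) \<le> m * (1 + \<bar>fst (z x)\<bar> + \<bar>fst (\<phi> x)\<bar>)"
          by (rule mult_left_mono[OF _ \<beta>_growth(1)])
        then have "\<bar>\<beta> (fst (w n x))\<bar> \<le> m * (1 + \<bar>fst (z x)\<bar> + \<bar>fst (\<phi> x)\<bar>)"
          using \<beta>_growth(2)[of "fst (w n x)"] by linarith
        then have "\<bar>\<beta> (fst (w n x))\<bar> * \<bar>fst (\<phi> x)\<bar> \<le> m * (1 + \<bar>fst (z x)\<bar> + \<bar>fst (\<phi> x)\<bar>) * \<bar>fst (\<phi> x)\<bar>"
          by (rule mult_right_mono) simp
        moreover have "\<bar>(\<beta> (fst (w n x)) - f x) * fst (\<phi> x)\<bar> \<le> \<bar>\<beta> (fst (w n x))\<bar> * \<bar>fst (\<phi> x)\<bar> + \<bar>f x * fst (\<phi> x)\<bar>"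
          unfolding left_diff_distrib abs_mult[symmetric] by (rule abs_triangle_ineq4)
        ultimately show "norm ((\<beta> (fst (w n x)) - f x) \<bullet> fst (\<phi> x))
          \<le> m * ((1 + \<bar>fst (z x)\<bar> + \<bar>fst (\<phi> x)\<bar>) * \<bar>fst (\<phi> x)\<bar>) + \<bar>f x * fst (\<phi> x)\<bar>" by (simp add: mult.assoc)
      qed
    qed
    have a: "l2inner M (\<lambda>x. A x (dil \<epsilon> (snd (w n x)))) (\<lambda>x. dil \<epsilon> (snd (\<phi> x)))
        = l2inner M (\<lambda>x. A x (dil \<epsilon> (snd (z x)))) (\<lambda>x. dil \<epsilon> (snd (\<phi> x)))
        + t n * l2inner M (\<lambda>x. A x (dil \<epsilon> (snd (\<phi> x)))) (\<lambda>x. dil \<epsilon> (snd (\<phi> x)))" for n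
    proof -
      have "A x (dil \<epsilon> (snd (w n x))) = A x (dil \<epsilon> (snd (z x))) + t n *\<^sub>R A x (dil \<epsilon> (snd (\<phi> x)))" for x
        by (simp add: w_def linear_add[OF linear_dil] linear_scale[OF linear_dil] linear_add[OF A_lin] linear_scale[OF A_lin])
      then show ?thesis
        by (simp only: l2inner_add_left l2inner_scaleR_left sq_A sq_dil sq_integrable_snd s\<phi> sz sq_integrable_scaleR)
    qed
    have "(\<lambda>n. l2inner M (S \<epsilon> (w n)) \<phi>) \<longlonglongrightarrow> l2inner M (\<lambda>x. \<beta> (fst (z x)) - f x) (\<lambda>x. fst (\<phi> x))
        + (l2inner M (\<lambda>x. A x (dil \<epsilon> (snd (z x)))) (\<lambda>x. dil \<epsilon> (snd (\<phi> x)))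
        + 0 * l2inner M (\<lambda>x. A x (dil \<epsilon> (snd (\<phi> x)))) (\<lambda>x. dil \<epsilon> (snd (\<phi> x))))"
      unfolding S_inner[OF H_sq[OF wH] s\<phi>] a by (intro tendsto_add b tendsto_const tendsto_mult t0)
    then have "(\<lambda>n. l2inner M (S \<epsilon> (w n)) \<phi>) \<longlonglongrightarrow> l2inner M (S \<epsilon> z) \<phi>" by (simp add: S_inner[OF sz s\<phi>])
    then show ?thesis by (rule LIMSEQ_le_const) (use pos in blast)
  qed
  have sol: "l2inner M (S \<epsilon> z) \<phi> = 0" if "\<phi> \<in> H" for \<phi>
    using ge[OF that] ge[OF H_scaleR[OF that, of "-1"]] by (simp add: l2inner_minus_right)
  \<comment> \<open>Since z is a solution and \<open>W n\<close> satisfies its energy identity, the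
    pairing in \<open>S_monotone\<close> collapses to minus the residual of \<open>W n\<close> at z.
    Monotonicity thus turns a vanishing residual into strong convergence.\<close>
  have le: "l2norm M (\<lambda>x. snd (W n x) - snd (z x)) \<le> (1 / \<epsilon>) * sqrt (- l2inner M (S \<epsilon> (W n)) z / lam)" for n
  proof -
    let ?X = "l2norm M (\<lambda>x. dil \<epsilon> (snd (W n x) - snd (z x)))"
    note s = H_sq[OF W(1)[of n]] H_sq[OF z(1)]
    have "lam * ?X\<^sup>2 \<le> l2inner M (\<lambda>x. S \<epsilon> (W n) x - S \<epsilon> z x) (\<lambda>x. W n x - z x)" by (intro S_monotone s)
    also have "\<dots> = - l2inner M (S \<epsilon> (W n)) z"
      using s sol[OF W(1)[of n]] sol[OF z(1)] W(2)[of n] by (simp add: l2inner_diff_left l2inner_diff_right sq_S sq_integrable_diff)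
    finally have "?X\<^sup>2 \<le> - l2inner M (S \<epsilon> (W n)) z / lam" using lam by (simp add: field_simps)
    then have "?X \<le> sqrt (- l2inner M (S \<epsilon> (W n)) z / lam)" by (rule real_le_rsqrt)
    then have "(1 / \<epsilon>) * ?X \<le> (1 / \<epsilon>) * sqrt (- l2inner M (S \<epsilon> (W n)) z / lam)" using e by (intro mult_left_mono) auto
    then show ?thesis
      using l2norm_dil_ge[OF e sq_integrable_diff[OF sq_integrable_snd[OF s(1)] sq_integrable_snd[OF s(2)]]] by linarith
  qed
  have "(\<lambda>n. (1 / \<epsilon>) * sqrt (- l2inner M (S \<epsilon> (W n)) z / lam)) \<longlonglongrightarrow> (1 / \<epsilon>) * sqrt (- 0 / lam)"
    by (intro tendsto_mult tendsto_const tendsto_real_sqrt tendsto_divide tendsto_minus res[OF z(1)]) (use lam in simp)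
  then have lim: "(\<lambda>n. (1 / \<epsilon>) * sqrt (- l2inner M (S \<epsilon> (W n)) z / lam)) \<longlonglongrightarrow> 0" by simp
  have "(\<lambda>n. l2norm M (\<lambda>x. snd (W n x) - snd (z x))) \<longlonglongrightarrow> 0"
  proof (rule tendsto_sandwich[OF _ _ tendsto_const lim])
    show "\<forall>\<^sub>F n in sequentially. l2norm M (\<lambda>x. snd (W n x) - snd (z x)) \<le> (1 / \<epsilon>) * sqrt (- l2inner M (S \<epsilon> (W n)) z / lam)"
      by (intro always_eventually allI le)
  qed simp
  then show ?thesis using that z(1) sol by blast
qed

end

subsection \<open>The limit problem\<close>

text \<open>Norm comparison on a finite-dimensional span, by a Gram-Schmidt induction: the second conclusion
  of the induction provides orthogonal projections with respect to the seminorm given by \<open>P\<close>.\<close>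
lemma finite_span_seminorm_bound:
  fixes J :: "'i \<Rightarrow> 'x \<Rightarrow> 'v::euclidean_space" and P :: "'v \<Rightarrow> 'w::euclidean_space" and Q :: "'v \<Rightarrow> 'u::euclidean_space"
  assumes P: "bounded_linear P" and Q: "bounded_linear Q" and fin: "finite B"
    and J: "\<And>b. b \<in> B \<Longrightarrow> sq_integrable N (J b)"
    and null: "\<And>c. l2norm N (\<lambda>x. P (\<Sum>b\<in>B. c b *\<^sub>R J b x)) = 0 \<Longrightarrow> l2norm N (\<lambda>x. Q (\<Sum>b\<in>B. c b *\<^sub>R J b x)) = 0"
  shows "\<exists>C\<ge>0. \<forall>c. l2norm N (\<lambda>x. Q (\<Sum>b\<in>B. c b *\<^sub>R J b x)) \<le> C * l2norm N (\<lambda>x. P (\<Sum>b\<in>B. c b *\<^sub>R J b x))"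
proof -
  have linP: "linear P" and linQ: "linear Q" using P Q bounded_linear.linear by auto
  have "(\<exists>C\<ge>0. \<forall>c. l2norm N (\<lambda>x. Q (\<Sum>b\<in>B. c b *\<^sub>R J b x)) \<le> C * l2norm N (\<lambda>x. P (\<Sum>b\<in>B. c b *\<^sub>R J b x)))
    \<and> (\<forall>y. sq_integrable N y \<longrightarrow> (\<exists>c. \<forall>d. l2inner N (\<lambda>x. P (y x - (\<Sum>b\<in>B. c b *\<^sub>R J b x))) (\<lambda>x. P (\<Sum>b\<in>B. d b *\<^sub>R J b x)) = 0))"
    using fin J null
  proof (induction B rule: finite_induct)
    case empty
    show ?case using linear_0[OF linP] linear_0[OF linQ] by (auto simp: l2norm_def l2inner_def)
  next
    case (insert b B)
    define cb where "cb c x = (\<Sum>i\<in>B. c i *\<^sub>R J i x)" for c x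
    define ci where "ci c x = (\<Sum>i\<in>insert b B. c i *\<^sub>R J i x)" for c x
    have ci_eq: "ci c x = c b *\<^sub>R J b x + cb c x" for c x
      unfolding ci_def cb_def using insert.hyps by simp
    have cb_cong: "cb c x = cb d x" if "\<And>i. i \<in> B \<Longrightarrow> c i = d i" for c d x
      unfolding cb_def using that by (intro sum.cong) auto
    have cb_lin: "cb (\<lambda>i. s * c i + t * d i) x = s *\<^sub>R cb c x + t *\<^sub>R cb d x" for s t c d x
      by (simp add: cb_def scaleR_add_left sum.distrib scaleR_sum_right)
    have sqJ: "sq_integrable N (J i)" if "i \<in> insert b B" for i by (rule insert.prems(1)[OF that])
    have sqb: "sq_integrable N (cb c)" for c
      unfolding cb_def[abs_def] by (intro sq_integrable_sum sq_integrable_scaleR sqJ) auto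
    have sqP: "sq_integrable N (\<lambda>x. P (g x))" if "sq_integrable N g" for g
      by (rule sq_integrable_bounded_linear[OF P that])
    have sqQ: "sq_integrable N (\<lambda>x. Q (g x))" if "sq_integrable N g" for g
      by (rule sq_integrable_bounded_linear[OF Q that])
    have nullB: "l2norm N (\<lambda>x. Q (\<Sum>i\<in>B. c i *\<^sub>R J i x)) = 0"
      if 0: "l2norm N (\<lambda>x. P (\<Sum>i\<in>B. c i *\<^sub>R J i x)) = 0" for c
    proof -
      have "ci (c(b := 0)) x = cb c x" for x
      proof -
        have "cb (c(b := 0)) x = cb c x" using insert.hyps by (intro cb_cong) auto
        then show ?thesis by (simp add: ci_eq)
      qed
      then have e: "ci (c(b := 0)) = cb c" by (rule ext)
      show ?thesis
        using insert.prems(2)[of "c(b := 0)", folded ci_def, unfolded e] 0 unfolding cb_def by blast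
    qed
    have IH: "(\<exists>C\<ge>0. \<forall>c. l2norm N (\<lambda>x. Q (cb c x)) \<le> C * l2norm N (\<lambda>x. P (cb c x)))"
      "\<And>y. sq_integrable N y \<Longrightarrow> \<exists>c. \<forall>d. l2inner N (\<lambda>x. P (y x - cb c x)) (\<lambda>x. P (cb d x)) = 0"
      using insert.IH[OF sqJ nullB] unfolding cb_def by blast+
    obtain C where C: "C \<ge> 0" "\<And>c. l2norm N (\<lambda>x. Q (cb c x)) \<le> C * l2norm N (\<lambda>x. P (cb c x))" using IH(1) by blast
    obtain c0 where c0: "\<And>d. l2inner N (\<lambda>x. P (J b x - cb c0 x)) (\<lambda>x. P (cb d x)) = 0" using IH(2)[OF sqJ[of b]] by auto
    define r where "r x = J b x - cb c0 x" for x
    have sqr: "sq_integrable N r" unfolding r_def[abs_def] by (intro sq_integrable_diff sqJ sqb) auto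
    have orth: "l2inner N (\<lambda>x. P (r x)) (\<lambda>x. P (cb d x)) = 0" for d using c0 by (simp add: r_def)
    \<comment> \<open>Change of basis: J b is replaced by its component r orthogonal to the old
      span. The factors \<open>1 *\<close> give the coefficients the exact shape of
      \<open>cb_lin\<close>.\<close>
    have ci_r: "ci c x = c b *\<^sub>R r x + cb (\<lambda>i. 1 * c i + c b * c0 i) x" for c x
      unfolding ci_eq r_def cb_lin by (simp add: scaleR_diff_right)
    have r_ci: "s *\<^sub>R r x + cb d x = ci (\<lambda>i. if i = b then s else 1 * d i + (- s) * c0 i) x" for s d x
    proof -
      have "cb (\<lambda>i. if i = b then s else 1 * d i + (- s) * c0 i) x = cb (\<lambda>i. 1 * d i + (- s) * c0 i) x"
        using insert.hyps by (intro cb_cong) auto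
      then show ?thesis unfolding ci_eq cb_lin r_def by (simp add: scaleR_diff_right)
    qed
    have P_ci: "P (ci c x) = c b *\<^sub>R P (r x) + P (cb (\<lambda>i. 1 * c i + c b * c0 i) x)" for c x
      unfolding ci_r by (simp add: linear_add[OF linP] linear_scale[OF linP])
    have pyth: "(l2norm N (\<lambda>x. P (ci c x)))\<^sup>2 = (\<bar>c b\<bar> * l2norm N (\<lambda>x. P (r x)))\<^sup>2
        + (l2norm N (\<lambda>x. P (cb (\<lambda>i. 1 * c i + c b * c0 i) x)))\<^sup>2" for c
      unfolding P_ci l2norm_add_sq[OF sq_integrable_scaleR[OF sqP[OF sqr]] sqP[OF sqb]] l2norm_scaleR
        l2inner_scaleR_left orth by simp
    have le1: "\<bar>c b\<bar> * l2norm N (\<lambda>x. P (r x)) \<le> l2norm N (\<lambda>x. P (ci c x))" for c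
      by (rule power2_le_imp_le) (simp_all add: pyth)
    have le2: "l2norm N (\<lambda>x. P (cb (\<lambda>i. 1 * c i + c b * c0 i) x)) \<le> l2norm N (\<lambda>x. P (ci c x))" for c
      by (rule power2_le_imp_le) (simp_all only: pyth l2norm_nonneg, simp)
    have Qle: "l2norm N (\<lambda>x. Q (ci c x)) \<le> \<bar>c b\<bar> * l2norm N (\<lambda>x. Q (r x)) + C * l2norm N (\<lambda>x. P (ci c x))" for c
    proof -
      have "l2norm N (\<lambda>x. Q (ci c x)) = l2norm N (\<lambda>x. c b *\<^sub>R Q (r x) + Q (cb (\<lambda>i. 1 * c i + c b * c0 i) x))"
        unfolding ci_r by (simp add: linear_add[OF linQ] linear_scale[OF linQ])
      also have "\<dots> \<le> l2norm N (\<lambda>x. c b *\<^sub>R Q (r x)) + l2norm N (\<lambda>x. Q (cb (\<lambda>i. 1 * c i + c b * c0 i) x))"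
        by (intro l2norm_triangle sq_integrable_scaleR sqQ sqr sqb)
      also have "l2norm N (\<lambda>x. Q (cb (\<lambda>i. 1 * c i + c b * c0 i) x)) \<le> C * l2norm N (\<lambda>x. P (ci c x))"
        using C(2)[of "\<lambda>i. 1 * c i + c b * c0 i"] mult_left_mono[OF le2[of c] C(1)] by linarith
      finally show ?thesis by (simp add: l2norm_scaleR)
    qed
    have "\<exists>C'\<ge>0. \<forall>c. l2norm N (\<lambda>x. Q (ci c x)) \<le> C' * l2norm N (\<lambda>x. P (ci c x))"
    \<comment> \<open>If r is null for P, then it is null for Q by assumption and the old constant
      suffices. Otherwise the coefficient of r is controlled by Pythagoras, at the price of adding
      the ratio k of the two seminorms of r.\<close>
    proof (cases "l2norm N (\<lambda>x. P (r x)) = 0")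
      case True
      have req: "r x = ci (\<lambda>i. if i = b then 1 else 1 * 0 + (- 1) * c0 i) x" for x
        using r_ci[of 1 x "\<lambda>i. 0"] by (simp add: cb_def)
      have "l2norm N (\<lambda>x. Q (r x)) = 0"
        using insert.prems(2)[of "\<lambda>i. if i = b then 1 else 1 * 0 + (- 1) * c0 i"] True unfolding ci_def[symmetric] req[symmetric] .
      then show ?thesis using Qle C(1) by (intro exI[of _ C]) simp
    next
      case False
      then have pos: "l2norm N (\<lambda>x. P (r x)) > 0" using l2norm_nonneg[of N "\<lambda>x. P (r x)"] by linarith
      define k where "k = l2norm N (\<lambda>x. Q (r x)) / l2norm N (\<lambda>x. P (r x))"
      have k: "k \<ge> 0" "l2norm N (\<lambda>x. Q (r x)) = k * l2norm N (\<lambda>x. P (r x))" using pos by (auto simp: k_def)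
      have "l2norm N (\<lambda>x. Q (ci c x)) \<le> (k + C) * l2norm N (\<lambda>x. P (ci c x))" for c
        using Qle[of c] mult_left_mono[OF le1[of c] k(1)] unfolding k(2) by (simp add: algebra_simps)
      then show ?thesis using k(1) C(1) by (intro exI[of _ "k + C"]) auto
    qed
    moreover have "\<exists>c. \<forall>d. l2inner N (\<lambda>x. P (y x - ci c x)) (\<lambda>x. P (ci d x)) = 0" if y: "sq_integrable N y" for y
    proof -
      obtain c1 where c1: "\<And>d. l2inner N (\<lambda>x. P (y x - cb c1 x)) (\<lambda>x. P (cb d x)) = 0" using IH(2)[OF y] by blast
      \<comment> \<open>The Fourier coefficient along r. If r is null for P, division by zero gives
        k = 0, which is the right value because the numerator then vanishes by
        Cauchy-Schwarz.\<close>
      define k where "k = l2inner N (\<lambda>x. P (y x - cb c1 x)) (\<lambda>x. P (r x)) / (l2norm N (\<lambda>x. P (r x)))\<^sup>2"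
      have sy: "sq_integrable N (\<lambda>x. P (y x - cb c1 x))" by (intro sqP sq_integrable_diff y sqb)
      have kr: "l2inner N (\<lambda>x. P (y x - cb c1 x)) (\<lambda>x. P (r x)) = k * (l2norm N (\<lambda>x. P (r x)))\<^sup>2"
      proof (cases "l2norm N (\<lambda>x. P (r x)) = 0")
        case True
        then show ?thesis using l2_Cauchy_Schwarz[OF sy sqP[OF sqr]] by simp
      qed (simp add: k_def)
      define c where "c = (\<lambda>i. if i = b then k else 1 * c1 i + (- k) * c0 i)"
      have Py: "P (y x - ci c x) = P (y x - cb c1 x) - k *\<^sub>R P (r x)" for x
      proof -
        have "y x - ci c x = (y x - cb c1 x) - k *\<^sub>R r x" unfolding c_def r_ci[symmetric] by simp
        then show ?thesis by (simp only: linear_diff[OF linP] linear_scale[OF linP])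
      qed
      have "l2inner N (\<lambda>x. P (y x - ci c x)) (\<lambda>x. P (ci d x)) = 0" for d
      proof -
        let ?e = "\<lambda>i. 1 * d i + d b * c0 i"
        have s: "sq_integrable N (\<lambda>x. P (r x))" "sq_integrable N (\<lambda>x. P (cb ?e x))" by (intro sqP sqr sqb)+
        have "l2inner N (\<lambda>x. P (y x - ci c x)) (\<lambda>x. P (ci d x))
            = d b * (l2inner N (\<lambda>x. P (y x - cb c1 x)) (\<lambda>x. P (r x)) - k * l2inner N (\<lambda>x. P (r x)) (\<lambda>x. P (r x)))
              + (l2inner N (\<lambda>x. P (y x - cb c1 x)) (\<lambda>x. P (cb ?e x)) - k * l2inner N (\<lambda>x. P (r x)) (\<lambda>x. P (cb ?e x)))"
          unfolding Py P_ci
          by (simp only: l2inner_add_right l2inner_diff_left l2inner_scaleR_left l2inner_scaleR_right s sy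
              sq_integrable_scaleR sq_integrable_diff)
        then show ?thesis unfolding kr l2inner_self orth c1 by simp
      qed
      then show ?thesis by blast
    qed
    ultimately show ?case unfolding ci_def by blast
  qed
  then show ?thesis by blast
qed

locale limit_problem = elliptic \<omega>1 \<omega>2 A \<beta> f lam m
  for \<omega>1 :: "'a::euclidean_space set" and \<omega>2 :: "'b::euclidean_space set" and A \<beta> f lam m +
  fixes u :: "'a \<times> 'b \<Rightarrow> real" and Gu :: "'a \<times> 'b \<Rightarrow> 'b"
  assumes A_deriv: "\<And>i j. i \<in> Basis \<Longrightarrow> j \<in> Basis \<Longrightarrow> \<exists>g. weak_pderiv \<Omega> (coef A (i, 0) (0, j)) (i, 0) g \<and> Linf \<Omega> g"
    and u: "u \<in> H01_2 \<omega>1 \<omega>2" and Gu: "weak_grad2 \<Omega> u Gu" "sq_integrable M Gu"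
    and u_sol: "AE X1 in lebesgue. X1 \<in> \<omega>1 \<longrightarrow>
         (\<forall>\<psi>\<in>H01 \<omega>2. \<forall>Gu G\<psi>. weak_grad \<omega>2 (\<lambda>X2. u (X1, X2)) Gu \<longrightarrow> weak_grad \<omega>2 \<psi> G\<psi> \<longrightarrow>
            (LINT X2:\<omega>2|lebesgue. \<beta> (u (X1, X2)) * \<psi> X2)
            + (LINT X2:\<omega>2|lebesgue. A22 A (X1, X2) (Gu X2) \<bullet> G\<psi> X2)
            = (LINT X2:\<omega>2|lebesgue. f (X1, X2) * \<psi> X2))"
begin

lemma sq_u: "sq_integrable M u"
  using u by (simp add: H01_2_def L2_iff[OF sets_dom(3)])

lemma sq_emb2: "sq_integrable M G \<Longrightarrow> sq_integrable M (\<lambda>x. (0::'a, G x :: 'b))"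
  by (rule sq_integrable_Pair[OF sq_integrable_zero])

lemma sq_emb1: "sq_integrable M G \<Longrightarrow> sq_integrable M (\<lambda>x. (G x :: 'a, 0::'b))"
  by (rule sq_integrable_Pair[OF _ sq_integrable_zero])

lemma sq_A22: "sq_integrable M G \<Longrightarrow> sq_integrable M (\<lambda>x. snd (A x (0, G x)))"
  by (intro sq_integrable_snd sq_A sq_emb2)

text \<open>Slices of a test function are admissible in the limit problem on almost every slice, and
  the slices of \<open>Gu\<close> are weak gradients of the slices of u. Integrating the slice
  equations over \<open>\<omega>1\<close> gives one equation on the product.\<close>

lemma limit_equation_test:
  assumes \<phi>: "test_fun \<Omega> \<phi>"
  shows "l2inner M (\<lambda>x. (\<beta> (u x) - f x, snd (A x (0, Gu x)))) (\<lambda>x. part2 (jet \<phi> x)) = 0"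
proof -
  let ?S = "\<lambda>x. (\<beta> (u x) - f x, snd (A x (0, Gu x)))"
  have sS: "sq_integrable M ?S" by (intro sq_integrable_Pair sq_integrable_diff sq_\<beta> sq_u sq_f sq_A22 Gu)
  have sj: "sq_integrable M (\<lambda>x. part2 (jet \<phi> x))" by (rule sq_integrable_T_jet[OF bounded_linear_part2 sets_dom(3) \<phi>])
  note sm = test_fun_smooth[OF \<phi>]
  have "AE x in lebesgue_on \<omega>1. (\<integral>y. ?S (x, y) \<bullet> part2 (jet \<phi> (x, y)) \<partial>lebesgue_on \<omega>2) = 0"
    using u_sol[folded AE_lebesgue_on_iff[OF sets_dom(1)]] weak_grad2_slice[OF sq_u Gu(2,1)]
      sq_integrable_slice[OF sq_\<beta>[OF sq_u]] sq_integrable_slice[OF sq_f] sq_integrable_slice[OF sq_A22[OF Gu(2)]]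
  proof eventually_elim
    case (elim x)
    let ?N = "lebesgue_on \<omega>2"
    define \<psi> where "\<psi> y = \<phi> (x, y)" for y
    have t: "test_fun \<omega>2 \<psi>" unfolding \<psi>_def[abs_def] by (rule test_fun_slice[OF \<phi>])
    have j: "part2 (jet \<phi> (x, y)) = (\<psi> y, grad \<psi> y)" for y
      using jet_slice[OF sm, of x y] by (simp add: jet_def[of "\<lambda>y. \<phi> (x, y)"] \<psi>_def[abs_def])
    have jH: "(\<lambda>y. (\<psi> y, grad \<psi> y)) \<in> jet_closure (\<lambda>p. p) \<omega>2"
      using jet_in_jet_closure[OF bounded_linear_ident sets_dom(2) t] by (simp add: jet_def[abs_def])
    have s\<psi>: "sq_integrable ?N \<psi>" "sq_integrable ?N (grad \<psi>)"
      using sq_integrable_fst[OF jet_closure_sq[OF jH]] sq_integrable_snd[OF jet_closure_sq[OF jH]] by simp_all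
    have "\<psi> \<in> H01 \<omega>2" using jH unfolding H01_iff[OF sets_dom(2)] by blast
    moreover have "weak_grad \<omega>2 \<psi> (grad \<psi>)" using jet_closure_weak_grad[OF sets_dom(2) jH] by simp
    ultimately have eq: "(\<integral>y. \<beta> (u (x, y)) * \<psi> y \<partial>?N) + (\<integral>y. A22 A (x, y) (Gu (x, y)) \<bullet> grad \<psi> y \<partial>?N) = (\<integral>y. f (x, y) * \<psi> y \<partial>?N)"
      using elim(1,2) unfolding set_integral_lebesgue_on[OF sets_dom(2)] by blast
    have "(\<integral>y. ?S (x, y) \<bullet> part2 (jet \<phi> (x, y)) \<partial>?N)
        = (\<integral>y. (\<beta> (u (x, y)) * \<psi> y - f (x, y) * \<psi> y) + A22 A (x, y) (Gu (x, y)) \<bullet> grad \<psi> y \<partial>?N)"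
      by (simp add: j A22_def left_diff_distrib)
    also have "\<dots> = (\<integral>y. \<beta> (u (x, y)) * \<psi> y \<partial>?N) - (\<integral>y. f (x, y) * \<psi> y \<partial>?N) + (\<integral>y. A22 A (x, y) (Gu (x, y)) \<bullet> grad \<psi> y \<partial>?N)"
      using sq_integrable_mult[OF elim(3) s\<psi>(1)] sq_integrable_mult[OF elim(4) s\<psi>(1)] sq_integrable_inner[OF elim(5) s\<psi>(2)]
      by (simp add: A22_def)
    finally show ?case using eq by simp
  qed
  then have "(\<integral>x. (\<integral>y. ?S (x, y) \<bullet> part2 (jet \<phi> (x, y)) \<partial>lebesgue_on \<omega>2) \<partial>lebesgue_on \<omega>1) = 0"
    by (rule integral_eq_zero_AE)
  then show ?thesis using Fubini_on(3)[OF sq_integrable_inner[OF sS sj]] by (simp only: l2inner_def)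
qed

text \<open>Extension by continuity from test functions to the closure. In particular the X2-part of
  any jet in H may be inserted, which is what the comparison with the
  \<open>\<epsilon>\<close>-problem requires.\<close>

lemma limit_equation:
  assumes w: "w \<in> jet_closure part2 \<Omega>"
  shows "l2inner M (\<lambda>x. \<beta> (u x) - f x) (\<lambda>x. fst (w x)) + l2inner M (\<lambda>x. snd (A x (0, Gu x))) (\<lambda>x. snd (w x)) = 0"
proof -
  let ?S = "\<lambda>x. (\<beta> (u x) - f x, snd (A x (0, Gu x)))"
  have s: "sq_integrable M (\<lambda>x. \<beta> (u x) - f x)" "sq_integrable M (\<lambda>x. snd (A x (0, Gu x)))"
    by (intro sq_integrable_diff sq_\<beta> sq_u sq_f sq_A22 Gu)+
  have sS: "sq_integrable M ?S" by (intro sq_integrable_Pair s)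
  note sw = jet_closure_sq[OF w]
  obtain \<phi> where \<phi>: "\<And>k. test_fun \<Omega> (\<phi> k)" "(\<lambda>k. l2norm M (\<lambda>x. part2 (jet (\<phi> k) x) - w x)) \<longlonglongrightarrow> 0"
    by (rule jet_closure_seq[OF w]) (rule that)
  have "(\<lambda>k. l2inner M ?S (\<lambda>x. part2 (jet (\<phi> k) x))) \<longlonglongrightarrow> l2inner M ?S w"
    by (rule l2inner_tendsto_right[OF sq_integrable_T_jet[OF bounded_linear_part2 sets_dom(3) \<phi>(1)] sw sS \<phi>(2)])
  then have "l2inner M ?S w = 0" by (simp add: limit_equation_test[OF \<phi>(1)] LIMSEQ_const_iff)
  moreover have "?S x \<bullet> w x = (\<beta> (u x) - f x) \<bullet> fst (w x) + snd (A x (0, Gu x)) \<bullet> snd (w x)" for x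
    by (simp add: inner_prod_def)
  ultimately show ?thesis
    unfolding l2inner_def using sq_integrable_inner[OF s(1) sq_integrable_fst[OF sw]] sq_integrable_inner[OF s(2) sq_integrable_snd[OF sw]]
    by (simp del: inner_real_def)
qed

text \<open>The only place where the differentiability of \<open>A\<^sub>1\<^sub>2\<close> enters: for smooth \<open>v\<close> the mixed term is
  controlled without the \<open>X\<^sub>1\<close>-gradient of \<open>w\<close>.\<close>
lemma mixed_term_coef:
  assumes v: "test_fun \<Omega> v" and i: "i \<in> Basis" and j: "j \<in> Basis"
  shows "\<exists>C\<ge>0. \<forall>w\<in>H. \<bar>\<integral>x. coef A (i, 0) (0, j) x * (snd (grad v x) \<bullet> j) * (fst (snd (w x)) \<bullet> i) \<partial>M\<bar> \<le> C * l2norm M (\<lambda>x. fst (w x))"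
proof -
  define a where "a = coef A (i, 0) (0, j)"
  obtain g where g: "weak_pderiv \<Omega> a (i, 0) g" "Linf \<Omega> g" using A_deriv[OF i j] unfolding a_def by blast
  have B: "(i, 0) \<in> (Basis :: ('a \<times> 'b) set)" "(0, j) \<in> (Basis :: ('a \<times> 'b) set)" using i j by (auto simp: Basis_prod_def)
  have aL: "Linf \<Omega> a" unfolding a_def by (rule A_Linf[OF B])
  define vj where "vj x = frechet_derivative v (at x) (0, j)" for x
  have tj: "test_fun \<Omega> vj" unfolding vj_def[abs_def] by (rule test_fun_partial[OF v B(2)])
  have vj_eq: "vj x = snd (grad v x) \<bullet> j" for x
    by (simp add: vj_def frechet_derivative_grad[OF test_fun_smooth[OF v]] inner_prod_def)
  define vij where "vij x = frechet_derivative vj (at x) (i, 0)" for x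
  have tij: "test_fun \<Omega> vij" unfolding vij_def[abs_def] by (rule test_fun_partial[OF tj B(1)])
  have st: "sq_integrable M \<phi>" if "test_fun \<Omega> \<phi>" for \<phi>
    using sq_integrable_fst[OF sq_integrable_jet[OF that sets_dom(3)]] by (simp add: jet_def)
  have mult: "sq_integrable M (\<lambda>x. b x * h x)" if b: "Linf \<Omega> b" and h: "sq_integrable M h" for b h
  proof -
    obtain k where k: "k \<ge> 0" "AE x in M. \<bar>b x\<bar> \<le> k" using Linf_AE[OF b] by blast
    show ?thesis
    proof (rule sq_integrable_bound[OF h])
      show "(\<lambda>x. b x * h x) \<in> borel_measurable M"
        by (rule borel_measurable_times[OF Linf_measurable[OF b] sq_integrable_measurable[OF h]])
      show "AE x in M. norm (b x * h x) \<le> k * norm (h x)"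
        using k(2) by eventually_elim (auto simp: abs_mult intro: mult_right_mono)
    qed
  qed
  \<comment> \<open>The derivative along (i, 0) of the product of a and vj, formed by the product
    rule from the weak derivative g of a.\<close>
  define q where "q x = g x * vj x + a x * vij x" for x
  have sq: "sq_integrable M q" unfolding q_def[abs_def] by (intro sq_integrable_add mult g aL st tj tij)
  have sav: "sq_integrable M (\<lambda>x. a x * vj x)" by (intro mult aL st tj)
  \<comment> \<open>Integration by parts is encoded as orthogonality to \<open>Pv\<close>. On jets
    of test functions it follows by testing the weak derivative of a with vj \<open>\<phi>\<close>;
    being a continuous condition, it extends to all of H, and there expresses the mixed integral as
    minus the pairing of q with the value.\<close>
  define Pv where "Pv x = (q x, (a x * vj x) *\<^sub>R ((i, 0) :: 'a \<times> 'b))" for x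
  have "sq_integrable M (\<lambda>x. (a x * vj x) *\<^sub>R ((i, 0) :: 'a \<times> 'b))"
    by (rule sq_integrable_bounded_linear[OF bounded_linear_scaleR_left sav])
  from sq_integrable_Pair[OF sq this] have sP: "sq_integrable M Pv" by (simp only: Pv_def[abs_def])
  have P_eq: "l2inner M Pv w
      = l2inner M q (\<lambda>x. fst (w x)) + (\<integral>x. a x * vj x * (fst (snd (w x)) \<bullet> i) \<partial>M)" if w: "sq_integrable M w" for w
  proof -
    have "sq_integrable M (\<lambda>x. fst (snd (w x)) \<bullet> i)"
      by (rule sq_integrable_bounded_linear[OF bounded_linear_inner_left sq_integrable_fst[OF sq_integrable_snd[OF w]]])
    note i2 = sq_integrable_mult[OF sav this]
    note i1 = sq_integrable_mult[OF sq sq_integrable_fst[OF w]]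
    have "Pv x \<bullet> w x = q x * fst (w x) + a x * vj x * (fst (snd (w x)) \<bullet> i)" for x
      by (cases "w x") (simp add: Pv_def inner_commute)
    then show ?thesis unfolding l2inner_def using i1 i2 by simp
  qed
  have zero_test: "l2inner M Pv (jet \<phi>) = 0" if \<phi>: "test_fun \<Omega> \<phi>" for \<phi>
  proof -
    have s\<phi>: "sq_integrable M \<phi>" by (rule st[OF \<phi>])
    define \<phi>i where "\<phi>i x = frechet_derivative \<phi> (at x) (i, 0)" for x
    have \<phi>i_eq: "\<phi>i x = fst (grad \<phi> x) \<bullet> i" for x
      by (simp add: \<phi>i_def frechet_derivative_grad[OF test_fun_smooth[OF \<phi>]] inner_prod_def)
    have s\<phi>i: "sq_integrable M \<phi>i" using st[OF test_fun_partial[OF \<phi> B(1)]] by (simp add: \<phi>i_def[abs_def])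
    have fd: "frechet_derivative (\<lambda>x. vj x * \<phi> x) (at x) (i, 0) = vj x * \<phi>i x + vij x * \<phi> x" for x
      by (simp add: frechet_derivative_mult_real smooth_differentiable test_fun_smooth[OF tj] test_fun_smooth[OF \<phi>] \<phi>i_def vij_def)
    have "(\<integral>x. a x * (vj x * \<phi>i x + vij x * \<phi> x) \<partial>M) = - (\<integral>x. g x * (vj x * \<phi> x) \<partial>M)"
      using g(1) test_fun_mult[OF tj test_fun_smooth[OF \<phi>]] unfolding weak_pderiv_iff[OF sets_dom(3)] fd[symmetric] by blast
    moreover have "(\<integral>x. a x * (vj x * \<phi>i x + vij x * \<phi> x) \<partial>M) = (\<integral>x. (a x * vj x) * \<phi>i x \<partial>M) + (\<integral>x. (a x * vij x) * \<phi> x \<partial>M)"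
      using sq_integrable_mult[OF sav s\<phi>i] sq_integrable_mult[OF mult[OF aL st[OF tij]] s\<phi>]
      by (subst Bochner_Integration.integral_add[symmetric]) (auto simp: algebra_simps)
    moreover have "l2inner M q \<phi> = (\<integral>x. g x * (vj x * \<phi> x) \<partial>M) + (\<integral>x. (a x * vij x) * \<phi> x \<partial>M)"
      unfolding l2inner_def q_def
      using sq_integrable_mult[OF mult[OF g(2) st[OF tj]] s\<phi>] sq_integrable_mult[OF mult[OF aL st[OF tij]] s\<phi>]
      by (subst Bochner_Integration.integral_add[symmetric]) (auto simp: algebra_simps)
    ultimately show ?thesis
      unfolding P_eq[OF sq_integrable_jet[OF \<phi> sets_dom(3)]] by (simp add: jet_def \<phi>i_eq[symmetric])
  qed
  have "\<bar>\<integral>x. a x * vj x * (fst (snd (w x)) \<bullet> i) \<partial>M\<bar> \<le> l2norm M q * l2norm M (\<lambda>x. fst (w x))" if w: "w \<in> H" for w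
  proof -
    obtain \<phi> where \<phi>: "\<And>k. test_fun \<Omega> (\<phi> k)" "(\<lambda>k. l2norm M (\<lambda>x. jet (\<phi> k) x - w x)) \<longlonglongrightarrow> 0"
      by (rule jet_closure_seq[OF w]) (rule that)
    have "(\<lambda>k. l2inner M Pv (jet (\<phi> k)))
        \<longlonglongrightarrow> l2inner M Pv w"
      by (rule l2inner_tendsto_right[OF sq_integrable_jet[OF \<phi>(1) sets_dom(3)] H_sq[OF w] sP \<phi>(2)])
    then have "l2inner M Pv w = 0"
      by (simp add: zero_test[OF \<phi>(1)] LIMSEQ_const_iff)
    then show ?thesis
      using l2_Cauchy_Schwarz[OF sq sq_integrable_fst[OF H_sq[OF w]]] unfolding P_eq[OF H_sq[OF w]] by linarith
  qed
  then show ?thesis unfolding a_def vj_eq using l2norm_nonneg[of M q] by blast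
qed

lemma mixed_term:
  assumes v: "test_fun \<Omega> v"
  shows "\<exists>C\<ge>0. \<forall>w\<in>H. \<bar>l2inner M (\<lambda>x. A x (0, snd (grad v x))) (\<lambda>x. (fst (snd (w x)), 0))\<bar> \<le> C * l2norm M (\<lambda>x. fst (w x))"
proof -
  define Pr where "Pr i j c \<longleftrightarrow> c \<ge> 0 \<and> (\<forall>w\<in>H. \<bar>\<integral>x. coef A (i, 0) (0, j) x * (snd (grad v x) \<bullet> j) * (fst (snd (w x)) \<bullet> i) \<partial>M\<bar>
      \<le> c * l2norm M (\<lambda>x. fst (w x)))" for i j c
  define C where "C i j = (SOME c. Pr i j c)" for i j
  have Pr: "Pr i j (C i j)" if "i \<in> Basis" "j \<in> Basis" for i j
    unfolding C_def using mixed_term_coef[OF v that] by (intro someI_ex[of "Pr i j"]) (auto simp: Pr_def)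
  have C: "\<And>i j. i \<in> Basis \<Longrightarrow> j \<in> Basis \<Longrightarrow> C i j \<ge> 0"
    "\<And>i j w. i \<in> Basis \<Longrightarrow> j \<in> Basis \<Longrightarrow> w \<in> H \<Longrightarrow>
      \<bar>\<integral>x. coef A (i, 0) (0, j) x * (snd (grad v x) \<bullet> j) * (fst (snd (w x)) \<bullet> i) \<partial>M\<bar> \<le> C i j * l2norm M (\<lambda>x. fst (w x))"
    using Pr unfolding Pr_def by blast+
  have sv: "sq_integrable M (\<lambda>x. snd (grad v x))"
    using sq_integrable_snd[OF sq_integrable_snd[OF sq_integrable_jet[OF v sets_dom(3)]]] by (simp add: jet_def)
  have "\<bar>l2inner M (\<lambda>x. A x (0, snd (grad v x))) (\<lambda>x. (fst (snd (w x)), 0))\<bar> \<le> (\<Sum>i\<in>Basis. \<Sum>j\<in>Basis. C i j) * l2norm M (\<lambda>x. fst (w x))"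
    if w: "w \<in> H" for w
  proof -
    let ?t = "\<lambda>i j x. coef A (i, 0) (0, j) x * (snd (grad v x) \<bullet> j) * (fst (snd (w x)) \<bullet> i)"
    have eq: "A x (0, \<eta>) \<bullet> (\<xi>, 0) = (\<Sum>i\<in>Basis. \<Sum>j\<in>Basis. coef A (i, 0) (0, j) x * (\<eta> \<bullet> j) * (\<xi> \<bullet> i))" for x \<eta> \<xi>
    proof -
      have 1: "((0::'a), \<eta>) = (\<Sum>j\<in>Basis. (\<eta> \<bullet> j) *\<^sub>R (0, j))"
        by (rule prod_eqI) (simp_all add: fst_sum snd_sum euclidean_representation)
      have 2: "(\<xi>, (0::'b)) = (\<Sum>i\<in>Basis. (\<xi> \<bullet> i) *\<^sub>R (i, 0))"
        by (rule prod_eqI) (simp_all add: fst_sum snd_sum euclidean_representation)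
      have "A x (0, \<eta>) = (\<Sum>j\<in>Basis. (\<eta> \<bullet> j) *\<^sub>R A x (0, j))"
        unfolding 1 by (simp only: linear_sum[OF A_lin] linear_scale[OF A_lin])
      then have "A x (0, \<eta>) \<bullet> (\<xi>, 0) = (\<Sum>i\<in>Basis. (\<xi> \<bullet> i) * (\<Sum>j\<in>Basis. (\<eta> \<bullet> j) * (A x (0, j) \<bullet> (i, 0))))"
        unfolding 2 by (simp only: inner_sum_right inner_scaleR_right inner_sum_left inner_scaleR_left)
      then show ?thesis by (simp add: coef_def sum_distrib_left mult_ac)
    qed
    have int: "integrable M (?t i j)" if ij: "i \<in> Basis" "j \<in> Basis" for i j
    proof -
      have s1: "sq_integrable M (\<lambda>x. A x (0, (snd (grad v x) \<bullet> j) *\<^sub>R j))"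
        by (intro sq_A sq_emb2 sq_integrable_bounded_linear[OF _ sv] bounded_linear_compose[OF bounded_linear_scaleR_left bounded_linear_inner_left])
      have s2: "sq_integrable M (\<lambda>x. ((fst (snd (w x)) \<bullet> i) *\<^sub>R i, 0::'b))"
        by (intro sq_emb1 sq_integrable_bounded_linear[OF _ sq_integrable_fst[OF sq_integrable_snd[OF H_sq[OF w]]]]
            bounded_linear_compose[OF bounded_linear_scaleR_left bounded_linear_inner_left])
      have "A x (0, s *\<^sub>R j) \<bullet> (t *\<^sub>R i, 0) = coef A (i, 0) (0, j) x * s * t" for x s t
      proof -
        have "A x (0, s *\<^sub>R j) = s *\<^sub>R A x (0, j)" using linear_scale[OF A_lin, of x s "(0, j)"] by simp
        moreover have "(t *\<^sub>R i, 0::'b) = t *\<^sub>R (i, 0)" by simp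
        ultimately show ?thesis by (simp only: inner_scaleR_left inner_scaleR_right coef_def mult_ac)
      qed
      then show ?thesis using sq_integrable_inner[OF s1 s2] by simp
    qed
    have "l2inner M (\<lambda>x. A x (0, snd (grad v x))) (\<lambda>x. (fst (snd (w x)), 0)) = (\<Sum>i\<in>Basis. \<Sum>j\<in>Basis. \<integral>x. ?t i j x \<partial>M)"
      unfolding l2inner_def eq using int by (simp add: Bochner_Integration.integral_sum)
    also have "\<bar>\<dots>\<bar> \<le> (\<Sum>i\<in>Basis. \<Sum>j\<in>Basis. C i j * l2norm M (\<lambda>x. fst (w x)))"
      by (rule order_trans[OF sum_abs], rule sum_mono, rule order_trans[OF sum_abs], rule sum_mono) (rule C(2)[OF _ _ w])
    finally show ?thesis by (simp add: sum_distrib_right)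
  qed
  moreover have "0 \<le> (\<Sum>i\<in>Basis. \<Sum>j\<in>Basis. C i j)" by (intro sum_nonneg C(1))
  ultimately show ?thesis by blast
qed

end

text \<open>If X were larger than 2s, then s^2 would be below X^2/4 and sX below X^2/2, so the
  right-hand side would be smaller than lam X^2.\<close>

lemma quadratic_bound:
  fixes X :: real
  assumes "lam > 0" "lam * X\<^sup>2 \<le> a + b * X" "a \<le> lam * s\<^sup>2" "b \<le> lam * s" "s > 0"
  shows "X \<le> 2 * s"
proof (rule ccontr)
  assume "\<not> X \<le> 2 * s"
  then have X: "2 * s < X" by simp
  have "lam * X\<^sup>2 \<le> lam * s\<^sup>2 + lam * s * X"
    using assms(2,3) mult_right_mono[OF assms(4), of X] X assms(5) by linarith
  then have "lam * X\<^sup>2 \<le> lam * (s\<^sup>2 + s * X)" by (simp add: algebra_simps)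
  then have "X\<^sup>2 \<le> s\<^sup>2 + s * X" using assms(1) by simp
  moreover have "s * X < X / 2 * X" using X assms(5) by (intro mult_strict_right_mono) auto
  moreover have "s\<^sup>2 < (X / 2)\<^sup>2" using X assms(5) by (intro power_strict_mono) auto
  moreover have "X / 2 * X = X\<^sup>2 / 2" "(X / 2)\<^sup>2 = X\<^sup>2 / 4" by (simp_all add: power2_eq_square)
  ultimately show False using zero_le_power2[of X] by linarith
qed

lemma mult_divide_cancel:
  fixes p c :: real
  assumes "p > 0"
  shows "p * (c / (2 * p)) = c / 2" "c / (2 * p) * p = c / 2" "p * (c / (4 * p)) = c / 4"
  using assms by simp_all

section \<open>Comparison of approximate solutions with the limit solution\<close>

context limit_problem
begin

lemma key_estimate:
  assumes e: "0 \<le> \<epsilon>" "\<epsilon> \<le> 1" and z: "z \<in> H" and v: "test_fun \<Omega> v"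
    and C: "\<And>w. w \<in> H \<Longrightarrow> \<bar>l2inner M (\<lambda>x. A x (0, snd (grad v x))) (\<lambda>x. (fst (snd (w x)), 0))\<bar> \<le> C * l2norm M (\<lambda>x. fst (w x))"
      "C \<ge> 0"
  defines "X \<equiv> l2norm M (\<lambda>x. dil \<epsilon> (snd (z x) - grad v x))"
  shows "lam * X\<^sup>2 \<le> l2inner M (S \<epsilon> z) (\<lambda>x. z x - jet v x)
      + l2norm M (\<lambda>x. \<beta> (fst (z x)) - \<beta> (u x)) * l2norm M (\<lambda>x. v x - u x)
      + (K * l2norm M (\<lambda>x. snd (grad v x) - Gu x) + \<epsilon> * (K * l2norm M (grad v) + C * R)) * X"
proof -
  have jv: "jet v \<in> H" using H_jet[OF v] by simp
  define w where "w x = z x - jet v x" for x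
  have w: "w \<in> H" unfolding w_def[abs_def] by (rule H_diff[OF z jv])
  define g where "g x = snd (w x)" for x
  define w0 where "w0 x = fst (w x)" for x
  note sz = H_sq[OF z] and sv = H_sq[OF jv] and sw = H_sq[OF w]
  have s0: "sq_integrable M w0" unfolding w0_def[abs_def] by (rule sq_integrable_fst[OF sw])
  have sg: "sq_integrable M g" unfolding g_def[abs_def] by (rule sq_integrable_snd[OF sw])
  have sz0: "sq_integrable M (\<lambda>x. fst (z x))" and sz1: "sq_integrable M (\<lambda>x. snd (z x))"
    by (rule sq_integrable_fst[OF sz], rule sq_integrable_snd[OF sz])
  have sv0: "sq_integrable M v" using sq_integrable_fst[OF sv] by (simp add: jet_def)
  have sv1: "sq_integrable M (grad v)" using sq_integrable_snd[OF sv] by (simp add: jet_def)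
  have g_eq: "g x = snd (z x) - grad v x" for x by (simp add: g_def w_def jet_def)
  have w0_eq: "w0 x = fst (z x) - v x" for x by (simp add: w0_def w_def jet_def)
  have X: "X = l2norm M (\<lambda>x. dil \<epsilon> (g x))" by (simp add: X_def g_eq)
  define v1 where "v1 x = (fst (grad v x), 0::'b)" for x
  define v2 where "v2 x = (0::'a, snd (grad v x))" for x
  have sv1': "sq_integrable M v1" "sq_integrable M v2" unfolding v1_def[abs_def] v2_def[abs_def]
    by (intro sq_emb1 sq_emb2 sq_integrable_fst sq_integrable_snd sv1)+
  define g1 where "g1 x = (fst (g x), 0::'b)" for x
  define g2 where "g2 x = (0::'a, snd (g x))" for x
  have sg': "sq_integrable M g1" "sq_integrable M g2" unfolding g1_def[abs_def] g2_def[abs_def]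
    by (intro sq_emb1 sq_emb2 sq_integrable_fst sq_integrable_snd sg)+
  note sq = sq_A sq_dil sg sz1 sv1 sv1' sg' sq_integrable_scaleR sq_integrable_add
  have Dv: "dil \<epsilon> (grad v x) = \<epsilon> *\<^sub>R v1 x + v2 x" for x by (simp add: dil_def v1_def v2_def)
  have Dg: "dil \<epsilon> (g x) = \<epsilon> *\<^sub>R g1 x + g2 x" for x by (simp add: dil_def g1_def g2_def)
  have Adv: "A x (dil \<epsilon> (grad v x)) = \<epsilon> *\<^sub>R A x (v1 x) + A x (v2 x)" for x
    unfolding Dv by (simp only: linear_add[OF A_lin] linear_scale[OF A_lin])
  have Ag: "A x (dil \<epsilon> (g x)) = A x (dil \<epsilon> (snd (z x))) - A x (dil \<epsilon> (grad v x))" for x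
    unfolding g_eq by (simp only: linear_diff[OF linear_dil] linear_diff[OF A_lin])
  have "lam * X\<^sup>2 \<le> l2inner M (\<lambda>x. A x (dil \<epsilon> (g x))) (\<lambda>x. dil \<epsilon> (g x))"
    unfolding X by (rule coercive[OF sg])
  also have "\<dots> = l2inner M (\<lambda>x. A x (dil \<epsilon> (snd (z x)))) (\<lambda>x. dil \<epsilon> (g x)) - l2inner M (\<lambda>x. A x (dil \<epsilon> (grad v x))) (\<lambda>x. dil \<epsilon> (g x))"
    unfolding Ag by (intro l2inner_diff_left sq)
  finally have 1: "lam * X\<^sup>2 \<le> l2inner M (\<lambda>x. A x (dil \<epsilon> (snd (z x)))) (\<lambda>x. dil \<epsilon> (g x)) - l2inner M (\<lambda>x. A x (dil \<epsilon> (grad v x))) (\<lambda>x. dil \<epsilon> (g x))" .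
  have 2: "l2inner M (S \<epsilon> z) w = l2inner M (\<lambda>x. \<beta> (fst (z x)) - f x) w0 + l2inner M (\<lambda>x. A x (dil \<epsilon> (snd (z x)))) (\<lambda>x. dil \<epsilon> (g x))"
    using S_inner[OF sz sw, of \<epsilon>] by (simp only: w0_def[abs_def] g_def[abs_def])
  have 3: "l2inner M (\<lambda>x. A x (dil \<epsilon> (grad v x))) (\<lambda>x. dil \<epsilon> (g x))
      = \<epsilon> * l2inner M (\<lambda>x. A x (v1 x)) (\<lambda>x. dil \<epsilon> (g x)) + l2inner M (\<lambda>x. A x (v2 x)) (\<lambda>x. dil \<epsilon> (g x))"
    unfolding Adv by (simp only: l2inner_add_left l2inner_scaleR_left sq)
  have 4: "l2inner M (\<lambda>x. A x (v2 x)) (\<lambda>x. dil \<epsilon> (g x)) = \<epsilon> * l2inner M (\<lambda>x. A x (v2 x)) g1 + l2inner M (\<lambda>x. A x (v2 x)) g2"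
    unfolding Dg by (simp only: l2inner_add_right l2inner_scaleR_right sq)
  have sgg: "sq_integrable M (\<lambda>x. snd (g x))" by (rule sq_integrable_snd[OF sg])
  have sd: "sq_integrable M (\<lambda>x. snd (grad v x) - Gu x)" by (intro sq_integrable_diff sq_integrable_snd sv1 Gu)
  \<comment> \<open>The X2-gradient of v is split at \<open>Gu\<close>: the first part is evaluated
    by the limit equation, the second is small when v is close to u.\<close>
  have 5: "l2inner M (\<lambda>x. A x (v2 x)) g2 = l2inner M (\<lambda>x. snd (A x (0, Gu x))) (\<lambda>x. snd (g x))
      + l2inner M (\<lambda>x. snd (A x (0, snd (grad v x) - Gu x))) (\<lambda>x. snd (g x))"
  proof -
    have "l2inner M (\<lambda>x. A x (v2 x)) g2 = l2inner M (\<lambda>x. snd (A x (v2 x))) (\<lambda>x. snd (g x))"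
      by (simp add: l2inner_def g2_def inner_prod_def)
    also have "(\<lambda>x. snd (A x (v2 x))) = (\<lambda>x. snd (A x (0, Gu x)) + snd (A x (0, snd (grad v x) - Gu x)))"
    proof
      fix x
      have "v2 x = (0, Gu x) + (0, snd (grad v x) - Gu x)" by (simp add: v2_def)
      then show "snd (A x (v2 x)) = snd (A x (0, Gu x)) + snd (A x (0, snd (grad v x) - Gu x))"
        by (simp only: linear_add[OF A_lin] snd_add)
    qed
    finally show ?thesis by (simp only: l2inner_add_left sq_A22[OF Gu(2)] sq_A22[OF sd] sgg)
  qed
  have 6: "l2inner M (\<lambda>x. \<beta> (u x) - f x) w0 + l2inner M (\<lambda>x. snd (A x (0, Gu x))) (\<lambda>x. snd (g x)) = 0"
    using limit_equation[OF H_part2[OF w]] by (simp add: part2_def w0_def[abs_def] g_def)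
  have b1: "\<bar>l2inner M (\<lambda>x. A x (v1 x)) (\<lambda>x. dil \<epsilon> (g x))\<bar> \<le> K * l2norm M (grad v) * X"
  proof -
    have "l2norm M v1 \<le> l2norm M (grad v)"
      using l2norm_mono[OF sv1 sq_integrable_measurable[OF sv1'(1)], of 1]
        norm_fst_le[of "fst (grad v x)" "snd (grad v x)" for x] by (simp add: v1_def norm_Pair)
    from mult_left_mono[OF this less_imp_le[OF K(1)]]
    have "l2norm M (\<lambda>x. A x (v1 x)) \<le> K * l2norm M (grad v)"
      using l2norm_A[OF sv1'(1)] by linarith
    then have "l2norm M (\<lambda>x. A x (v1 x)) * X \<le> K * l2norm M (grad v) * X" by (rule mult_right_mono) (simp add: X)
    moreover have "\<bar>l2inner M (\<lambda>x. A x (v1 x)) (\<lambda>x. dil \<epsilon> (g x))\<bar> \<le> l2norm M (\<lambda>x. A x (v1 x)) * X"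
      unfolding X by (intro l2_Cauchy_Schwarz sq)
    ultimately show ?thesis by linarith
  qed
  have w0X: "l2norm M w0 \<le> R * X" unfolding X using H_Poincare_dil[OF w, of \<epsilon>] by (simp add: w0_def[abs_def] g_def)
  \<comment> \<open>Cauchy-Schwarz would spend the factor \<open>\<epsilon>\<close> on the
    X1-gradient g1 and leave a term that is not small. The mixed-term constant C bounds the pairing
    by the value instead, so the factor \<open>\<epsilon>\<close> is kept.\<close>
  have b2: "\<bar>l2inner M (\<lambda>x. A x (v2 x)) g1\<bar> \<le> C * R * X"
  proof -
    have "\<bar>l2inner M (\<lambda>x. A x (v2 x)) g1\<bar> \<le> C * l2norm M w0"
      using C(1)[OF w] by (simp add: v2_def g1_def[abs_def] g_def w0_def[abs_def])
    also have "\<dots> \<le> C * (R * X)" by (rule mult_left_mono[OF w0X C(2)])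
    finally show ?thesis by (simp add: mult.assoc)
  qed
  have b3: "\<bar>l2inner M (\<lambda>x. snd (A x (0, snd (grad v x) - Gu x))) (\<lambda>x. snd (g x))\<bar> \<le> K * l2norm M (\<lambda>x. snd (grad v x) - Gu x) * X"
  proof -
    have "l2norm M (\<lambda>x. snd (A x (0, snd (grad v x) - Gu x))) \<le> l2norm M (\<lambda>x. A x (0, snd (grad v x) - Gu x))"
      by (intro l2norm_snd_le sq_A sq_emb2 sd)
    also have "\<dots> \<le> K * l2norm M (\<lambda>x. (0::'a, snd (grad v x) - Gu x))" by (intro l2norm_A sq_emb2 sd)
    also have "l2norm M (\<lambda>x. (0::'a, snd (grad v x) - Gu x)) = l2norm M (\<lambda>x. snd (grad v x) - Gu x)"
      by (simp add: l2norm_def norm_Pair)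
    finally have "l2norm M (\<lambda>x. snd (A x (0, snd (grad v x) - Gu x))) * l2norm M (\<lambda>x. snd (g x))
        \<le> K * l2norm M (\<lambda>x. snd (grad v x) - Gu x) * X"
      unfolding X using K(1) by (intro mult_mono l2norm_snd_le_dil sg) auto
    then show ?thesis using l2_Cauchy_Schwarz[OF sq_A22[OF sd] sgg] by linarith
  qed
  \<comment> \<open>Write z - v as (z - u) - (v - u): the first pairing is nonnegative by
    monotonicity of \<open>\<beta>\<close> and is dropped, the second is small because v is close to
    u.\<close>
  have b4: "l2inner M (\<lambda>x. \<beta> (u x) - f x) w0 - l2inner M (\<lambda>x. \<beta> (fst (z x)) - f x) w0
      \<le> l2norm M (\<lambda>x. \<beta> (fst (z x)) - \<beta> (u x)) * l2norm M (\<lambda>x. v x - u x)"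
  proof -
    have sb: "sq_integrable M (\<lambda>x. \<beta> (fst (z x)) - \<beta> (u x))" by (intro sq_integrable_diff sq_\<beta> sz0 sq_u)
    have "l2inner M (\<lambda>x. \<beta> (fst (z x)) - f x) w0 - l2inner M (\<lambda>x. \<beta> (u x) - f x) w0
        = l2inner M (\<lambda>x. (\<beta> (fst (z x)) - f x) - (\<beta> (u x) - f x)) w0"
      by (intro l2inner_diff_left[symmetric] sq_integrable_diff sq_\<beta> sz0 sq_u sq_f s0)
    also have "\<dots> = l2inner M (\<lambda>x. \<beta> (fst (z x)) - \<beta> (u x)) (\<lambda>x. (fst (z x) - u x) - (v x - u x))"
      by (simp add: w0_eq[abs_def])
    also have "\<dots> = l2inner M (\<lambda>x. \<beta> (fst (z x)) - \<beta> (u x)) (\<lambda>x. fst (z x) - u x)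
        - l2inner M (\<lambda>x. \<beta> (fst (z x)) - \<beta> (u x)) (\<lambda>x. v x - u x)"
      by (intro l2inner_diff_right sb sq_integrable_diff sz0 sq_u sv0)
    finally have eq: "l2inner M (\<lambda>x. \<beta> (u x) - f x) w0 - l2inner M (\<lambda>x. \<beta> (fst (z x)) - f x) w0
       = l2inner M (\<lambda>x. \<beta> (fst (z x)) - \<beta> (u x)) (\<lambda>x. v x - u x) - l2inner M (\<lambda>x. \<beta> (fst (z x)) - \<beta> (u x)) (\<lambda>x. fst (z x) - u x)"
      by linarith
    have "0 \<le> l2inner M (\<lambda>x. \<beta> (fst (z x)) - \<beta> (u x)) (\<lambda>x. fst (z x) - u x)"
      unfolding l2inner_def inner_real_def by (intro Bochner_Integration.integral_nonneg \<beta>_monotone)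
    then show ?thesis
      unfolding eq using l2_Cauchy_Schwarz[OF sb sq_integrable_diff[OF sv0 sq_u]] by linarith
  qed
  define t1 where "t1 = l2inner M (\<lambda>x. A x (v1 x)) (\<lambda>x. dil \<epsilon> (g x))"
  define t2 where "t2 = l2inner M (\<lambda>x. A x (v2 x)) g1"
  have b12: "- (\<epsilon> * t1) - \<epsilon> * t2 \<le> \<epsilon> * (K * l2norm M (grad v) * X + C * R * X)"
  proof -
    have "- t1 - t2 \<le> K * l2norm M (grad v) * X + C * R * X" using b1 b2 unfolding t1_def t2_def by linarith
    from mult_left_mono[OF this e(1)] show ?thesis by (simp add: right_diff_distrib)
  qed
  have "lam * X\<^sup>2 \<le> l2inner M (S \<epsilon> z) w + l2norm M (\<lambda>x. \<beta> (fst (z x)) - \<beta> (u x)) * l2norm M (\<lambda>x. v x - u x)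
      + K * l2norm M (\<lambda>x. snd (grad v x) - Gu x) * X + \<epsilon> * (K * l2norm M (grad v) * X + C * R * X)"
    using 1 2 3 4 5 6 b3 b4 b12 unfolding t1_def[symmetric] t2_def[symmetric] by linarith
  then show ?thesis by (simp add: w_def[abs_def] algebra_simps)
qed

definition "B0 = R * l2norm M f / lam"

lemma B0_nonneg: "B0 \<ge> 0"
  using R(1) lam by (simp add: B0_def)

text \<open>The order of choices matters: v depends only on the accuracy e, and the threshold
  \<open>\<eta>\<close> on e and v, because the constants C and the norm of grad v may blow up as v
  approaches u. The number \<open>\<eta>\<close> is at once the admissible size of
  \<open>\<epsilon>\<close> and the admissible residual, and z need not solve any equation
  exactly.\<close>

lemma key_convergence:
  assumes "e > 0"
  obtains v \<eta> where "test_fun \<Omega> v" "\<eta> > 0"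
    "\<And>\<epsilon> z. 0 \<le> \<epsilon> \<Longrightarrow> \<epsilon> \<le> 1 \<Longrightarrow> \<epsilon> \<le> \<eta> \<Longrightarrow> z \<in> H \<Longrightarrow> l2norm M (\<lambda>x. snd (snd (z x))) \<le> B0 \<Longrightarrow>
      l2inner M (S \<epsilon> z) (\<lambda>x. z x - jet v x) \<le> \<eta> \<Longrightarrow> l2norm M (\<lambda>x. snd (snd (z x)) - Gu x) < e"
proof -
  define s where "s = e / 4"
  have s: "s > 0" using assms by (simp add: s_def)
  \<comment> \<open>A bound for the L2 distance of \<open>\<beta>(z)\<close> and
    \<open>\<beta>(u)\<close> from the growth condition; \<open>R * B0\<close> bounds the value of z
    by Poincare.\<close>
  define B1 where "B1 = m * (l2norm M (\<lambda>x. 1::real) + R * B0) + m * (l2norm M (\<lambda>x. 1::real) + l2norm M u)"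
  have B1: "B1 \<ge> 0" using \<beta>_growth(1) R(1) B0_nonneg by (simp add: B1_def)
  \<comment> \<open>Half of each budget in \<open>quadratic_bound\<close>:
    \<open>B1 * \<delta>\<close> takes half of \<open>lam * s\<^sup>2\<close> and
    \<open>K * \<delta>\<close> half of \<open>lam * s\<close>. The cap s leaves a total error of at
    most 2s + s, below e = 4s.\<close>
  define \<delta> where "\<delta> = min s (min (lam * s / (2 * K)) (lam * s\<^sup>2 / (2 * (B1 + 1))))"
  have \<delta>: "\<delta> > 0" using s lam K(1) B1 by (simp add: \<delta>_def)
  have \<delta>1: "\<delta> \<le> s" by (simp add: \<delta>_def)
  have \<delta>2: "K * \<delta> \<le> lam * s / 2"
  proof -
    have "K * \<delta> \<le> K * (lam * s / (2 * K))" using K(1) by (intro mult_left_mono) (auto simp: \<delta>_def)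
    then show ?thesis using K(1) by simp
  qed
  have \<delta>3: "B1 * \<delta> \<le> lam * s\<^sup>2 / 2"
  proof -
    have "B1 * \<delta> \<le> (B1 + 1) * (lam * s\<^sup>2 / (2 * (B1 + 1)))" using B1 \<delta> by (intro mult_mono) (auto simp: \<delta>_def)
    then show ?thesis using mult_divide_cancel(1)[of "B1 + 1" "lam * s\<^sup>2"] B1 by linarith
  qed
  have "(\<lambda>x. (u x, Gu x)) \<in> jet_closure part2 \<Omega>" by (rule H01_2_dense[OF u Gu])
  then obtain v where v: "test_fun \<Omega> v" "l2norm M (\<lambda>x. part2 (jet v x) - (u x, Gu x)) < \<delta>"
    using \<delta> unfolding jet_closure_def by blast
  have sd: "sq_integrable M (\<lambda>x. part2 (jet v x) - (u x, Gu x))"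
    by (intro sq_integrable_diff sq_integrable_T_jet[OF bounded_linear_part2 sets_dom(3) v(1)] sq_integrable_Pair sq_u Gu)
  have vu: "l2norm M (\<lambda>x. v x - u x) \<le> \<delta>" "l2norm M (\<lambda>x. snd (grad v x) - Gu x) \<le> \<delta>"
    using l2norm_fst_le[OF sd] l2norm_snd_le[OF sd] v(2) by (simp_all add: part2_def jet_def)
  obtain C where C: "C \<ge> 0" "\<And>w. w \<in> H \<Longrightarrow> \<bar>l2inner M (\<lambda>x. A x (0, snd (grad v x))) (\<lambda>x. (fst (snd (w x)), 0))\<bar> \<le> C * l2norm M (\<lambda>x. fst (w x))"
    using mixed_term[OF v(1)] by blast
  define C' where "C' = K * l2norm M (grad v) + C * R"
  have C': "C' \<ge> 0" using K(1) C(1) R(1) by (simp add: C'_def)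
  \<comment> \<open>The other halves of the two budgets, for the residual and for the terms carrying
    the factor \<open>\<epsilon>\<close>.\<close>
  define \<eta> where "\<eta> = min (lam * s\<^sup>2 / 2) (lam * s / (2 * (C' + 1)))"
  have \<eta>: "\<eta> > 0" using s lam C' by (simp add: \<eta>_def)
  have \<eta>1: "\<eta> \<le> lam * s\<^sup>2 / 2" unfolding \<eta>_def by (rule min.cobounded1)
  have \<eta>2: "\<eta> * C' \<le> lam * s / 2"
  proof -
    have "\<eta> * C' \<le> lam * s / (2 * (C' + 1)) * (C' + 1)" using \<eta> C' s lam by (intro mult_mono) (auto simp: \<eta>_def)
    then show ?thesis using mult_divide_cancel(2)[of "C' + 1" "lam * s"] C' by linarith
  qed
  show ?thesis
  proof (rule that[OF v(1) \<eta>])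
    fix \<epsilon> z assume e: "0 \<le> \<epsilon>" "\<epsilon> \<le> 1" "\<epsilon> \<le> \<eta>" and z: "z \<in> H" and zB: "l2norm M (\<lambda>x. snd (snd (z x))) \<le> B0"
      and zi: "l2inner M (S \<epsilon> z) (\<lambda>x. z x - jet v x) \<le> \<eta>"
    note sz = H_sq[OF z]
    define X where "X = l2norm M (\<lambda>x. dil \<epsilon> (snd (z x) - grad v x))"
    have X0: "X \<ge> 0" by (simp add: X_def)
    have sg: "sq_integrable M (\<lambda>x. snd (z x) - grad v x)"
      using sq_integrable_diff[OF sq_integrable_snd[OF sz] sq_integrable_snd[OF sq_integrable_jet[OF v(1) sets_dom(3)]]] by (simp add: jet_def)
    have \<beta>B: "l2norm M (\<lambda>x. \<beta> (fst (z x)) - \<beta> (u x)) \<le> B1"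
    proof -
      have "l2norm M (\<lambda>x. fst (z x)) \<le> R * B0"
        using H_Poincare[OF z] mult_left_mono[OF zB less_imp_le[OF R(1)]] by linarith
      then have "m * (l2norm M (\<lambda>x. 1::real) + l2norm M (\<lambda>x. fst (z x))) \<le> m * (l2norm M (\<lambda>x. 1::real) + R * B0)"
        using \<beta>_growth(1) by (intro mult_left_mono add_left_mono)
      then show ?thesis
        using l2norm_triangle_diff[OF sq_\<beta>[OF sq_integrable_fst[OF sz]] sq_\<beta>[OF sq_u]]
          l2norm_\<beta>[OF sq_integrable_fst[OF sz]] l2norm_\<beta>[OF sq_u] unfolding B1_def by linarith
    qed
    have "X \<le> 2 * s"
    proof (rule quadratic_bound[OF lam _ _ _ s])
      have "lam * X\<^sup>2 \<le> l2inner M (S \<epsilon> z) (\<lambda>x. z x - jet v x)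
          + l2norm M (\<lambda>x. \<beta> (fst (z x)) - \<beta> (u x)) * l2norm M (\<lambda>x. v x - u x)
          + (K * l2norm M (\<lambda>x. snd (grad v x) - Gu x) + \<epsilon> * C') * X"
        unfolding X_def C'_def by (rule key_estimate[OF e(1,2) z v(1) C(2) C(1)])
      also have "\<dots> \<le> \<eta> + B1 * \<delta> + (K * \<delta> + \<eta> * C') * X"
        using e K(1) B1 C' X0
        by (intro add_mono zi mult_mono \<beta>B vu mult_right_mono) auto
      finally show "lam * X\<^sup>2 \<le> (\<eta> + B1 * \<delta>) + (K * \<delta> + \<eta> * C') * X" .
      show "\<eta> + B1 * \<delta> \<le> lam * s\<^sup>2" using \<eta>1 \<delta>3 by linarith
      show "K * \<delta> + \<eta> * C' \<le> lam * s" using \<delta>2 \<eta>2 by linarith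
    qed
    have "l2norm M (\<lambda>x. snd (snd (z x)) - Gu x)
        \<le> l2norm M (\<lambda>x. snd (snd (z x)) - snd (grad v x)) + l2norm M (\<lambda>x. snd (grad v x) - Gu x)"
      using sq_integrable_snd[OF sq_integrable_jet[OF v(1) sets_dom(3)]]
      by (intro l2norm_triangle3 sq_integrable_snd sz Gu) (simp add: jet_def)
    also have "l2norm M (\<lambda>x. snd (snd (z x)) - snd (grad v x)) \<le> X"
      unfolding X_def using l2norm_snd_le_dil[OF sg, of \<epsilon>] by simp
    finally show "l2norm M (\<lambda>x. snd (snd (z x)) - Gu x) < e"
      using vu(2) \<delta>1 \<open>X \<le> 2 * s\<close> s unfolding s_def by linarith
  qed
qed

theorem solutions_converge:
  assumes z: "\<And>\<epsilon>. 0 < \<epsilon> \<Longrightarrow> \<epsilon> \<le> 1 \<Longrightarrow> z \<epsilon> \<in> H"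
    and sol: "\<And>\<epsilon> \<phi>. 0 < \<epsilon> \<Longrightarrow> \<epsilon> \<le> 1 \<Longrightarrow> \<phi> \<in> H \<Longrightarrow> l2inner M (S \<epsilon> (z \<epsilon>)) \<phi> = 0"
  shows "((\<lambda>\<epsilon>. l2norm M (\<lambda>x. snd (snd (z \<epsilon> x)) - Gu x)) \<longlongrightarrow> 0) (at_right 0)"
proof (rule tendstoI)
  fix e :: real assume "e > 0"
  obtain v \<eta> where v: "test_fun \<Omega> v" "\<eta> > 0"
    "\<And>\<epsilon> z. 0 \<le> \<epsilon> \<Longrightarrow> \<epsilon> \<le> 1 \<Longrightarrow> \<epsilon> \<le> \<eta> \<Longrightarrow> z \<in> H \<Longrightarrow> l2norm M (\<lambda>x. snd (snd (z x))) \<le> B0 \<Longrightarrow>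
      l2inner M (S \<epsilon> z) (\<lambda>x. z x - jet v x) \<le> \<eta> \<Longrightarrow> l2norm M (\<lambda>x. snd (snd (z x)) - Gu x) < e"
    by (rule key_convergence[OF \<open>e > 0\<close>]) (rule that)
  have "l2norm M (\<lambda>x. snd (snd (z \<epsilon> x)) - Gu x) < e" if \<epsilon>: "0 < \<epsilon>" "\<epsilon> < min 1 \<eta>" for \<epsilon>
  proof (rule v(3)[of \<epsilon>])
    have \<epsilon>': "0 < \<epsilon>" "\<epsilon> \<le> 1" using \<epsilon> by auto
    show zH: "z \<epsilon> \<in> H" by (rule z[OF \<epsilon>'])
    show "l2norm M (\<lambda>x. snd (snd (z \<epsilon> x))) \<le> B0"
      using l2norm_snd_le_dil[OF sq_integrable_snd[OF H_sq[OF zH]], of \<epsilon>] energy_bound[OF zH sol[OF \<epsilon>' zH]]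
      unfolding B0_def by linarith
    have "(\<lambda>x. z \<epsilon> x - jet v x) \<in> H" using H_diff[OF zH H_jet[OF v(1)]] by simp
    then show "l2inner M (S \<epsilon> (z \<epsilon>)) (\<lambda>x. z \<epsilon> x - jet v x) \<le> \<eta>" using sol[OF \<epsilon>'] v(2) by simp
  qed (use \<epsilon> in auto)
  moreover have "\<forall>\<^sub>F \<epsilon> in at_right 0. \<epsilon> \<in> {0 <..< min 1 \<eta>}"
    using v(2) by (intro eventually_at_right_real) simp
  ultimately show "\<forall>\<^sub>F \<epsilon> in at_right 0. dist (l2norm M (\<lambda>x. snd (snd (z \<epsilon> x)) - Gu x)) 0 < e"
    by (auto elim!: eventually_mono)
qed

text \<open>Replacing \<open>A\<^sub>\<epsilon>\<close> by \<open>A\<^sub>0\<close> costs \<open>O(\<epsilon>)\<close> once full gradients are controlled.\<close>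
lemma S_perturbation:
  assumes e: "0 \<le> \<epsilon>" "\<epsilon> \<le> 1" and w: "sq_integrable M w" and v: "sq_integrable M v"
  shows "\<bar>l2inner M (S 0 w) v - l2inner M (S \<epsilon> w) v\<bar> \<le> 2 * K * \<epsilon> * l2norm M (\<lambda>x. snd (w x)) * l2norm M (\<lambda>x. snd (v x))"
proof -
  let ?g = "\<lambda>x. snd (w x)" and ?h = "\<lambda>x. snd (v x)"
  have s: "sq_integrable M ?g" "sq_integrable M ?h" by (rule sq_integrable_snd[OF w], rule sq_integrable_snd[OF v])
  have Dl: "l2norm M (\<lambda>x. dil \<epsilon> (G x) - dil 0 (G x)) \<le> \<epsilon> * l2norm M G" if "sq_integrable M G" for G
    using e by (intro l2norm_mono that sq_integrable_measurable[OF sq_integrable_diff[OF sq_dil[OF that] sq_dil[OF that]]] AE_I2 norm_dil_diff_0)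
  have sd: "sq_integrable M (\<lambda>x. dil \<epsilon> (G x) - dil 0 (G x))" if "sq_integrable M G" for G
    by (intro sq_integrable_diff sq_dil that)
  have "l2inner M (S \<epsilon> w) v - l2inner M (S 0 w) v
      = l2inner M (\<lambda>x. A x (dil \<epsilon> (?g x))) (\<lambda>x. dil \<epsilon> (?h x)) - l2inner M (\<lambda>x. A x (dil 0 (?g x))) (\<lambda>x. dil 0 (?h x))"
    by (simp add: S_inner[OF w v])
  \<comment> \<open>The two arguments are changed one at a time; the dilations for
    \<open>\<epsilon>\<close> and 0 differ by at most \<open>\<epsilon>\<close> in norm, and the two
    changes account for the factor 2.\<close>
  also have "\<dots> = l2inner M (\<lambda>x. A x (dil \<epsilon> (?g x))) (\<lambda>x. dil \<epsilon> (?h x) - dil 0 (?h x))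
      + l2inner M (\<lambda>x. A x (dil \<epsilon> (?g x)) - A x (dil 0 (?g x))) (\<lambda>x. dil 0 (?h x))"
    by (simp add: l2inner_diff_left l2inner_diff_right sq_A sq_dil s)
  also have "(\<lambda>x. A x (dil \<epsilon> (?g x)) - A x (dil 0 (?g x))) = (\<lambda>x. A x (dil \<epsilon> (?g x) - dil 0 (?g x)))"
    by (simp add: linear_diff[OF A_lin])
  finally have eq: "l2inner M (S \<epsilon> w) v - l2inner M (S 0 w) v
      = l2inner M (\<lambda>x. A x (dil \<epsilon> (?g x))) (\<lambda>x. dil \<epsilon> (?h x) - dil 0 (?h x))
      + l2inner M (\<lambda>x. A x (dil \<epsilon> (?g x) - dil 0 (?g x))) (\<lambda>x. dil 0 (?h x))" .
  have 1: "\<bar>l2inner M (\<lambda>x. A x (dil \<epsilon> (?g x))) (\<lambda>x. dil \<epsilon> (?h x) - dil 0 (?h x))\<bar> \<le> (K * l2norm M ?g) * (\<epsilon> * l2norm M ?h)"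
  proof -
    have "l2norm M (\<lambda>x. A x (dil \<epsilon> (?g x))) \<le> K * l2norm M ?g"
      using l2norm_A[OF sq_dil[OF s(1), of \<epsilon>]] mult_left_mono[OF l2norm_dil_le[OF e s(1)] less_imp_le[OF K(1)]] by linarith
    then have "l2norm M (\<lambda>x. A x (dil \<epsilon> (?g x))) * l2norm M (\<lambda>x. dil \<epsilon> (?h x) - dil 0 (?h x)) \<le> (K * l2norm M ?g) * (\<epsilon> * l2norm M ?h)"
      using K(1) by (intro mult_mono Dl s) auto
    then show ?thesis using l2_Cauchy_Schwarz[OF sq_A[OF sq_dil[OF s(1), of \<epsilon>]] sd[OF s(2)]] by linarith
  qed
  have 2: "\<bar>l2inner M (\<lambda>x. A x (dil \<epsilon> (?g x) - dil 0 (?g x))) (\<lambda>x. dil 0 (?h x))\<bar> \<le> (K * (\<epsilon> * l2norm M ?g)) * l2norm M ?h"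
  proof -
    have "l2norm M (\<lambda>x. A x (dil \<epsilon> (?g x) - dil 0 (?g x))) \<le> K * (\<epsilon> * l2norm M ?g)"
      using l2norm_A[OF sd[OF s(1)]] mult_left_mono[OF Dl[OF s(1)] less_imp_le[OF K(1)]] by linarith
    then have "l2norm M (\<lambda>x. A x (dil \<epsilon> (?g x) - dil 0 (?g x))) * l2norm M (\<lambda>x. dil 0 (?h x)) \<le> (K * (\<epsilon> * l2norm M ?g)) * l2norm M ?h"
      using K(1) e by (intro mult_mono l2norm_dil_le s) auto
    then show ?thesis using l2_Cauchy_Schwarz[OF sq_A[OF sd[OF s(1)]] sq_dil[OF s(2), of 0]] by linarith
  qed
  show ?thesis using eq 1 2 by (simp add: algebra_simps)
qed

end

subsection \<open>Galerkin approximations\<close>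

text \<open>\<open>VH n\<close> consists of the jets of the functions in \<open>V\<^sub>n\<close>, and \<open>W \<epsilon> n\<close> is the jet of \<open>u\<^sub>\<epsilon>\<^sub>,\<^sub>n\<close>.\<close>
locale galerkin = limit_problem \<omega>1 \<omega>2 A \<beta> f lam m u Gu
  for \<omega>1 :: "'a::euclidean_space set" and \<omega>2 :: "'b::euclidean_space set" and A \<beta> f lam m u Gu +
  fixes VH :: "nat \<Rightarrow> ('a \<times> 'b \<Rightarrow> real \<times> 'a \<times> 'b) set" and W :: "real \<Rightarrow> nat \<Rightarrow> 'a \<times> 'b \<Rightarrow> real \<times> 'a \<times> 'b"
  assumes VH_H: "VH n \<subseteq> H"
    and VH_diff: "v \<in> VH n \<Longrightarrow> w \<in> VH n \<Longrightarrow> (\<lambda>x. v x - w x) \<in> VH n"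
    and VH_dim: "\<exists>C\<ge>0. \<forall>w\<in>VH n. l2norm M (\<lambda>x. snd (w x)) \<le> C * l2norm M (\<lambda>x. snd (snd (w x)))"
    and VH_approx: "w \<in> H \<Longrightarrow> \<delta> > 0 \<Longrightarrow> \<forall>\<^sub>F n in sequentially. \<exists>v\<in>VH n. l2norm M (\<lambda>x. w x - v x) < \<delta>"
    and W: "0 < \<epsilon> \<Longrightarrow> \<epsilon> \<le> 1 \<Longrightarrow> W \<epsilon> n \<in> VH n"
    and W_sol: "0 < \<epsilon> \<Longrightarrow> \<epsilon> \<le> 1 \<Longrightarrow> \<phi> \<in> VH n \<Longrightarrow> l2inner M (S \<epsilon> (W \<epsilon> n)) \<phi> = 0"
begin

lemma WH: "0 < \<epsilon> \<Longrightarrow> \<epsilon> \<le> 1 \<Longrightarrow> W \<epsilon> n \<in> H"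
  using W VH_H by blast

lemma W_energy: "0 < \<epsilon> \<Longrightarrow> \<epsilon> \<le> 1 \<Longrightarrow> l2norm M (\<lambda>x. dil \<epsilon> (snd (W \<epsilon> n x))) \<le> B0"
  unfolding B0_def by (intro energy_bound WH W_sol W)

lemma W_bound2:
  assumes "0 < \<epsilon>" "\<epsilon> \<le> 1" shows "l2norm M (\<lambda>x. snd (snd (W \<epsilon> n x))) \<le> B0"
  using W_energy[OF assms, of n] l2norm_snd_le_dil[OF sq_integrable_snd[OF H_sq[OF WH[OF assms]]], of n \<epsilon>] by linarith

text \<open>The value of the bound in \<open>l2norm_S\<close> when the dilated gradient is at most
  \<open>B0\<close> and hence the value at most \<open>R * B0\<close>. It is independent of both
  \<open>\<epsilon>\<close> and n.\<close>

definition "B2 = m * (l2norm M (\<lambda>x. 1::real) + R * B0) + l2norm M f + K * B0"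

lemma S_bound:
  assumes e: "0 \<le> \<epsilon>" "\<epsilon> \<le> 1" and w: "w \<in> H" and b: "l2norm M (\<lambda>x. dil \<epsilon> (snd (w x))) \<le> B0"
  shows "l2norm M (S \<epsilon> w) \<le> B2"
proof -
  have "l2norm M (\<lambda>x. fst (w x)) \<le> R * B0"
    using H_Poincare_dil[OF w, of \<epsilon>] mult_left_mono[OF b less_imp_le[OF R(1)]] by linarith
  then have "m * (l2norm M (\<lambda>x. 1::real) + l2norm M (\<lambda>x. fst (w x))) \<le> m * (l2norm M (\<lambda>x. 1::real) + R * B0)"
    using \<beta>_growth(1) by (intro mult_left_mono add_left_mono)
  then show ?thesis
    using l2norm_S[OF e H_sq[OF w]] mult_left_mono[OF b less_imp_le[OF K(1)]] unfolding B2_def by linarith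
qed

lemma B2_nonneg: "B2 \<ge> 0"
  using \<beta>_growth(1) R(1) K(1) B0_nonneg by (simp add: B2_def)

text \<open>Galerkin orthogonality: the residual vanishes on the discrete space, so w may be
  replaced by its distance to that space, which tends to zero while \<open>B2\<close> bounds the
  other factor.\<close>

lemma W_residual:
  assumes e: "0 < \<epsilon>" "\<epsilon> \<le> 1" and w: "w \<in> H"
  shows "(\<lambda>n. l2inner M (S \<epsilon> (W \<epsilon> n)) w) \<longlonglongrightarrow> 0"
proof (rule tendstoI)
  fix d :: real assume d: "d > 0"
  then have "\<forall>\<^sub>F n in sequentially. \<exists>v\<in>VH n. l2norm M (\<lambda>x. w x - v x) < d / (B2 + 1)"
    using B2_nonneg by (intro VH_approx w) auto
  then show "\<forall>\<^sub>F n in sequentially. dist (l2inner M (S \<epsilon> (W \<epsilon> n)) w) 0 < d"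
  proof eventually_elim
    case (elim n)
    then obtain v where v: "v \<in> VH n" "l2norm M (\<lambda>x. w x - v x) < d / (B2 + 1)" by blast
    have sv: "sq_integrable M v" using v(1) VH_H H_sq by blast
    note sS = sq_S[OF H_sq[OF WH[OF e, of n]], of \<epsilon>]
    have "l2inner M (S \<epsilon> (W \<epsilon> n)) w = l2inner M (S \<epsilon> (W \<epsilon> n)) (\<lambda>x. w x - v x)"
      using W_sol[OF e v(1)] by (simp add: l2inner_diff_right sS sv H_sq[OF w])
    then have "\<bar>l2inner M (S \<epsilon> (W \<epsilon> n)) w\<bar> \<le> l2norm M (S \<epsilon> (W \<epsilon> n)) * l2norm M (\<lambda>x. w x - v x)"
      using l2_Cauchy_Schwarz[OF sS sq_integrable_diff[OF H_sq[OF w] sv]] by simp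
    also have "\<dots> \<le> B2 * l2norm M (\<lambda>x. w x - v x)"
      using e by (intro mult_right_mono S_bound WH W_energy) auto
    also have "\<dots> \<le> (B2 + 1) * l2norm M (\<lambda>x. w x - v x)" by (intro mult_right_mono) auto
    also have "\<dots> < (B2 + 1) * (d / (B2 + 1))" using v(2) B2_nonneg by (intro mult_strict_left_mono) auto
    also have "\<dots> = d" using B2_nonneg by simp
    finally show ?case by (simp add: dist_real_def)
  qed
qed

lemma limit_n:
  assumes e: "0 < \<epsilon>" "\<epsilon> \<le> 1"
  obtains z where "z \<in> H" "\<And>\<phi>. \<phi> \<in> H \<Longrightarrow> l2inner M (S \<epsilon> z) \<phi> = 0"
    "(\<lambda>n. l2norm M (\<lambda>x. snd (snd (W \<epsilon> n x)) - snd (snd (z x)))) \<longlonglongrightarrow> 0"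
proof -
  obtain z where z: "z \<in> H" "\<And>\<phi>. \<phi> \<in> H \<Longrightarrow> l2inner M (S \<epsilon> z) \<phi> = 0"
    "(\<lambda>n. l2norm M (\<lambda>x. snd (W \<epsilon> n x) - snd (z x))) \<longlonglongrightarrow> 0"
    by (rule approximate_solutions_converge[OF e WH[OF e] W_sol[OF e W[OF e]] W_residual[OF e]]) (assumption, rule that)
  have "l2norm M (\<lambda>x. snd (snd (W \<epsilon> n x)) - snd (snd (z x))) \<le> l2norm M (\<lambda>x. snd (W \<epsilon> n x) - snd (z x))" for n
    using l2norm_snd_le[OF sq_integrable_diff[OF sq_integrable_snd[OF H_sq[OF WH[OF e]]] sq_integrable_snd[OF H_sq[OF z(1)]]], of n] by simp
  then have "(\<lambda>n. l2norm M (\<lambda>x. snd (snd (W \<epsilon> n x)) - snd (snd (z x)))) \<longlonglongrightarrow> 0"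
    by (intro tendsto_sandwich[OF _ _ tendsto_const z(3)] always_eventually allI) auto
  then show ?thesis using that z(1,2) by blast
qed

text \<open>Both solutions are compared with the operator at \<open>\<epsilon>\<close> = 0, for
  which each has a residual on the discrete space of the order of its own parameter; hence the bound
  by a sum of parameters. Coercivity at 0 controls the X2-gradient of the difference, and finite
  dimension recovers the rest of the jet.\<close>

lemma W_Lipschitz:
  obtains D where "D \<ge> 0"
    "\<And>\<epsilon> \<epsilon>'. 0 < \<epsilon> \<Longrightarrow> \<epsilon> \<le> 1 \<Longrightarrow> 0 < \<epsilon>' \<Longrightarrow> \<epsilon>' \<le> 1 \<Longrightarrow> l2norm M (\<lambda>x. W \<epsilon> n x - W \<epsilon>' n x) \<le> D * (\<epsilon> + \<epsilon>')"
proof -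
  obtain C where C: "C \<ge> 0" "\<And>w. w \<in> VH n \<Longrightarrow> l2norm M (\<lambda>x. snd (w x)) \<le> C * l2norm M (\<lambda>x. snd (snd (w x)))"
    using VH_dim by blast
  have Wg: "l2norm M (\<lambda>x. snd (W \<epsilon> n x)) \<le> C * B0" if "0 < \<epsilon>" "\<epsilon> \<le> 1" for \<epsilon>
    using C(2)[OF W[OF that]] mult_left_mono[OF W_bound2[OF that, of n] C(1)] by linarith
  \<comment> \<open>The fraction bounds the X2-gradient of the difference per unit of parameter:
    \<open>2 * K\<close> comes from the perturbation, \<open>C * B0\<close> bounds the gradient of a
    solution, one C converts the gradient of the difference, and lam comes from coercivity. The
    outer C recovers the full gradient and R + 1 the jet.\<close>
  define D where "D = (R + 1) * C * (2 * K * (C * B0) * C / lam)"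
  have D: "D \<ge> 0" using R(1) C(1) K(1) B0_nonneg lam by (simp add: D_def)
  show ?thesis
  proof (rule that[OF D])
    fix \<epsilon> \<epsilon>' :: real assume e: "0 < \<epsilon>" "\<epsilon> \<le> 1" and e': "0 < \<epsilon>'" "\<epsilon>' \<le> 1"
    define w where "w x = W \<epsilon> n x - W \<epsilon>' n x" for x
    have wV: "w \<in> VH n" unfolding w_def[abs_def] by (intro VH_diff W e e')
    then have wH: "w \<in> H" using VH_H by blast
    note s = H_sq[OF WH[OF e, of n]] H_sq[OF WH[OF e', of n]] and sw = H_sq[OF wH]
    let ?Y = "l2norm M (\<lambda>x. snd (snd (w x)))"
    have pert: "\<bar>l2inner M (S 0 (W t n)) w\<bar> \<le> 2 * K * t * (C * B0) * (C * ?Y)" if t: "0 < t" "t \<le> 1" for t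
    proof -
      have "\<bar>l2inner M (S 0 (W t n)) w\<bar> \<le> 2 * K * t * l2norm M (\<lambda>x. snd (W t n x)) * l2norm M (\<lambda>x. snd (w x))"
        using S_perturbation[OF _ t(2) H_sq[OF WH[OF t, of n]] sw] W_sol[OF t wV] t by simp
      also have "\<dots> \<le> 2 * K * t * (C * B0) * (C * ?Y)"
        using K(1) t C B0_nonneg by (intro mult_mono Wg C(2)[OF wV] mult_nonneg_nonneg) auto
      finally show ?thesis .
    qed
    have "lam * ?Y\<^sup>2 \<le> lam * (l2norm M (\<lambda>x. dil 0 (snd (w x))))\<^sup>2"
      using lam by (intro mult_left_mono power_mono l2norm_snd_le_dil sq_integrable_snd sw) auto
    also have "\<dots> \<le> l2inner M (\<lambda>x. S 0 (W \<epsilon> n) x - S 0 (W \<epsilon>' n) x) w"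
      using S_monotone[OF s, of 0] by (simp add: w_def[abs_def])
    also have "\<dots> = l2inner M (S 0 (W \<epsilon> n)) w - l2inner M (S 0 (W \<epsilon>' n)) w"
      by (intro l2inner_diff_left sq_S s sw)
    also have "\<dots> \<le> 2 * K * \<epsilon> * (C * B0) * (C * ?Y) + 2 * K * \<epsilon>' * (C * B0) * (C * ?Y)"
      using pert[OF e] pert[OF e'] by linarith
    finally have star: "?Y * (lam * ?Y) \<le> ?Y * (2 * K * (C * B0) * C * (\<epsilon> + \<epsilon>'))"
      by (simp add: power2_eq_square algebra_simps)
    have Y: "?Y \<le> 2 * K * (C * B0) * C / lam * (\<epsilon> + \<epsilon>')"
    proof (cases "?Y = 0")
      case True
      have "0 \<le> 2 * K * (C * B0) * C / lam * (\<epsilon> + \<epsilon>')" using K(1) C(1) B0_nonneg lam e e' by simp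
      then show ?thesis unfolding True .
    next
      case False
      then have "?Y > 0" using l2norm_nonneg[of M "\<lambda>x. snd (snd (w x))"] by linarith
      then have "lam * ?Y \<le> 2 * K * (C * B0) * C * (\<epsilon> + \<epsilon>')" using star by (simp only: mult_le_cancel_left_pos)
      then have "?Y \<le> 2 * K * (C * B0) * C * (\<epsilon> + \<epsilon>') / lam"
        by (simp only: pos_le_divide_eq[OF lam] mult.commute[of lam])
      then show ?thesis by simp
    qed
    have "l2norm M w \<le> (R + 1) * l2norm M (\<lambda>x. snd (w x))" by (rule H_Poincare_snd[OF wH])
    also have "\<dots> \<le> (R + 1) * (C * ?Y)" using R(1) by (intro mult_left_mono C(2)[OF wV]) simp
    also have "\<dots> \<le> (R + 1) * (C * (2 * K * (C * B0) * C / lam * (\<epsilon> + \<epsilon>')))"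
      using R(1) by (intro mult_left_mono Y C(1)) simp
    also have "\<dots> = D * (\<epsilon> + \<epsilon>')" by (simp add: D_def)
    finally show "l2norm M (\<lambda>x. W \<epsilon> n x - W \<epsilon>' n x) \<le> D * (\<epsilon> + \<epsilon>')" by (simp add: w_def[abs_def])
  qed
qed

text \<open>Let the second parameter tend to 0 in \<open>W_Lipschitz\<close>. The linear rate is
  kept because \<open>limit_eps_converges\<close> has to pick a suitable \<open>\<epsilon>\<close>
  for each n.\<close>

lemma limit_eps:
  obtains z D where "z \<in> H" "D \<ge> 0" "\<And>\<epsilon>. 0 < \<epsilon> \<Longrightarrow> \<epsilon> \<le> 1 \<Longrightarrow> l2norm M (\<lambda>x. W \<epsilon> n x - z x) \<le> D * \<epsilon>"
proof -
  obtain D where D: "D \<ge> 0"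
    "\<And>\<epsilon> \<epsilon>'. 0 < \<epsilon> \<Longrightarrow> \<epsilon> \<le> 1 \<Longrightarrow> 0 < \<epsilon>' \<Longrightarrow> \<epsilon>' \<le> 1 \<Longrightarrow> l2norm M (\<lambda>x. W \<epsilon> n x - W \<epsilon>' n x) \<le> D * (\<epsilon> + \<epsilon>')"
    by (rule W_Lipschitz) (rule that)
  define t where "t k = inverse (real (Suc k))" for k
  have t: "0 < t k" "t k \<le> 1" for k by (auto simp: t_def inverse_le_1_iff)
  have t0: "t \<longlonglongrightarrow> 0" unfolding t_def by (rule LIMSEQ_inverse_real_of_nat)
  have tm: "t j \<le> t k" if "k \<le> j" for j k
    unfolding t_def using that by (intro le_imp_inverse_le) auto
  have Cauchy: "l2_Cauchy M (\<lambda>k. W (t k) n)"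
  proof (rule l2_Cauchy_if_bound)
    show "(l2norm M (\<lambda>x. W (t j) n x - W (t k) n x))\<^sup>2 \<le> (D * (t k + t k))\<^sup>2" if "k \<le> j" for j k
    proof (rule power_mono)
      have "D * (t j + t k) \<le> D * (t k + t k)" using tm[OF that] D(1) by (intro mult_left_mono) auto
      then show "l2norm M (\<lambda>x. W (t j) n x - W (t k) n x) \<le> D * (t k + t k)"
        using D(2)[OF t t, of j k] by linarith
    qed simp
    have "(\<lambda>k. (D * (t k + t k))\<^sup>2) \<longlonglongrightarrow> (D * (0 + 0))\<^sup>2" by (intro tendsto_power tendsto_mult tendsto_add tendsto_const t0)
    then show "(\<lambda>k. (D * (t k + t k))\<^sup>2) \<longlonglongrightarrow> 0" by simp
  qed
  obtain z where z: "z \<in> H" "(\<lambda>k. l2norm M (\<lambda>x. W (t k) n x - z x)) \<longlonglongrightarrow> 0"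
    by (rule jet_closure_complete[OF bounded_linear_ident sets_dom(3) WH[OF t] Cauchy]) (rule that)
  have "l2norm M (\<lambda>x. W \<epsilon> n x - z x) \<le> D * \<epsilon>" if e: "0 < \<epsilon>" "\<epsilon> \<le> 1" for \<epsilon>
  proof (rule LIMSEQ_le_const)
    have "(\<lambda>k. D * (\<epsilon> + t k) + l2norm M (\<lambda>x. W (t k) n x - z x)) \<longlonglongrightarrow> D * (\<epsilon> + 0) + 0"
      by (intro tendsto_add tendsto_mult tendsto_const t0 z(2))
    then show "(\<lambda>k. D * (\<epsilon> + t k) + l2norm M (\<lambda>x. W (t k) n x - z x)) \<longlonglongrightarrow> D * \<epsilon>" by simp
    have "l2norm M (\<lambda>x. W \<epsilon> n x - z x) \<le> D * (\<epsilon> + t k) + l2norm M (\<lambda>x. W (t k) n x - z x)" for k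
      using l2norm_triangle3[OF H_sq[OF WH[OF e]] H_sq[OF WH[OF t]] H_sq[OF z(1)], of n k n] D(2)[OF e t, of k] by linarith
    then show "\<exists>N. \<forall>k\<ge>N. l2norm M (\<lambda>x. W \<epsilon> n x - z x) \<le> D * (\<epsilon> + t k) + l2norm M (\<lambda>x. W (t k) n x - z x)" by blast
  qed
  then show ?thesis using that z(1) D(1) by blast
qed

text \<open>For fixed n, a sufficiently small \<open>\<epsilon>\<close> makes the Galerkin solution
  both close to its limit \<open>z n\<close> and nearly a solution of the problem at 0, so
  \<open>key_convergence\<close> applies with parameter 0. Since v is not in the discrete space, it
  is replaced there by an approximation w, which exists once n is large; no bound uniform in n on
  the norm comparison is used.\<close>

lemma limit_eps_converges:
  assumes z: "\<And>n. z n \<in> H" and D: "\<And>n \<epsilon>. 0 < \<epsilon> \<Longrightarrow> \<epsilon> \<le> 1 \<Longrightarrow> l2norm M (\<lambda>x. W \<epsilon> n x - z n x) \<le> D n * \<epsilon>"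
    and D0: "\<And>n. D n \<ge> 0"
  shows "(\<lambda>n. l2norm M (\<lambda>x. snd (snd (z n x)) - Gu x)) \<longlonglongrightarrow> 0"
proof (rule tendstoI)
  fix e :: real assume e: "e > 0"
  then have "e / 2 > 0" by simp
  obtain v \<eta> where v: "test_fun \<Omega> v" "\<eta> > 0"
    "\<And>\<epsilon> z. 0 \<le> \<epsilon> \<Longrightarrow> \<epsilon> \<le> 1 \<Longrightarrow> \<epsilon> \<le> \<eta> \<Longrightarrow> z \<in> H \<Longrightarrow> l2norm M (\<lambda>x. snd (snd (z x))) \<le> B0 \<Longrightarrow>
      l2inner M (S \<epsilon> z) (\<lambda>x. z x - jet v x) \<le> \<eta> \<Longrightarrow> l2norm M (\<lambda>x. snd (snd (z x)) - Gu x) < e / 2"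
    by (rule key_convergence[OF \<open>e / 2 > 0\<close>]) (rule that)
  have jv: "jet v \<in> H" using H_jet[OF v(1)] by simp
  have "\<forall>\<^sub>F n in sequentially. \<exists>w\<in>VH n. l2norm M (\<lambda>x. jet v x - w x) < \<eta> / (2 * (B2 + 1))"
    using v(2) B2_nonneg by (intro VH_approx jv) simp
  then show "\<forall>\<^sub>F n in sequentially. dist (l2norm M (\<lambda>x. snd (snd (z n x)) - Gu x)) 0 < e"
  proof eventually_elim
    case (elim n)
    then obtain w where w: "w \<in> VH n" "l2norm M (\<lambda>x. jet v x - w x) < \<eta> / (2 * (B2 + 1))" by blast
    have wH: "w \<in> H" using w(1) VH_H by blast
    obtain C where C: "C \<ge> 0" "\<And>w. w \<in> VH n \<Longrightarrow> l2norm M (\<lambda>x. snd (w x)) \<le> C * l2norm M (\<lambda>x. snd (snd (w x)))"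
      using VH_dim by blast
    \<comment> \<open>The factor of \<open>\<epsilon>\<close> in \<open>S_perturbation\<close> for
      the test jet \<open>?Z - w\<close>, using that the gradient of \<open>?Z\<close> is at most
      \<open>C * B0\<close>. It depends on n, through C and w.\<close>
    define Q where "Q = 2 * K * (C * B0) * (C * B0 + l2norm M (\<lambda>x. snd (w x)))"
    have Q: "Q \<ge> 0" using K(1) C(1) B0_nonneg by (simp add: Q_def)
    \<comment> \<open>The two nontrivial constraints limit the perturbation residual to
      \<open>\<eta>\<close>/2, leaving the other half for replacing v by w, and the distance to
      \<open>z n\<close> to e/4. The additions of 1 avoid division by zero.\<close>
    define \<epsilon> where "\<epsilon> = min 1 (min (\<eta> / (2 * (Q + 1))) (e / (4 * (D n + 1))))"
    have \<epsilon>: "0 < \<epsilon>" "\<epsilon> \<le> 1" using v(2) Q e D0[of n] by (auto simp: \<epsilon>_def)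
    have \<epsilon>Q: "\<epsilon> * Q \<le> \<eta> / 2"
    proof -
      have "\<epsilon> * Q \<le> \<eta> / (2 * (Q + 1)) * (Q + 1)" using Q v(2) by (intro mult_mono) (auto simp: \<epsilon>_def)
      then show ?thesis using mult_divide_cancel(2)[of "Q + 1" \<eta>] Q by linarith
    qed
    have \<epsilon>D: "D n * \<epsilon> \<le> e / 4"
    proof -
      have "D n * \<epsilon> \<le> (D n + 1) * (e / (4 * (D n + 1)))" using D0[of n] \<epsilon> by (intro mult_mono) (auto simp: \<epsilon>_def)
      then show ?thesis using mult_divide_cancel(3)[of "D n + 1" e] D0[of n] by linarith
    qed
    let ?Z = "W \<epsilon> n"
    have ZH: "?Z \<in> H" by (rule WH[OF \<epsilon>])
    note sZ = H_sq[OF ZH] and sw = H_sq[OF wH] and sv = H_sq[OF jv]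
    have dV: "(\<lambda>x. ?Z x - w x) \<in> VH n" by (intro VH_diff W \<epsilon> w(1))
    have Zg: "l2norm M (\<lambda>x. snd (?Z x)) \<le> C * B0"
      using C(2)[OF W[OF \<epsilon>]] mult_left_mono[OF W_bound2[OF \<epsilon>, of n] C(1)] by linarith
    have "l2norm M (\<lambda>x. snd (snd (?Z x)) - Gu x) < e / 2"
    \<comment> \<open>The estimate is used with the operator at 0, although \<open>?Z\<close> solves
      the discrete problem with the positive parameter chosen above.\<close>
    proof (rule v(3)[of 0])
      show "l2norm M (\<lambda>x. snd (snd (?Z x))) \<le> B0" by (rule W_bound2[OF \<epsilon>])
      have "l2inner M (S 0 ?Z) (\<lambda>x. ?Z x - w x) \<le> 2 * K * \<epsilon> * l2norm M (\<lambda>x. snd (?Z x)) * l2norm M (\<lambda>x. snd (?Z x - w x))"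
        using S_perturbation[OF less_imp_le[OF \<epsilon>(1)] \<epsilon>(2) sZ sq_integrable_diff[OF sZ sw]] W_sol[OF \<epsilon> dV] by simp
      also have "\<dots> \<le> 2 * K * \<epsilon> * (C * B0) * (C * B0 + l2norm M (\<lambda>x. snd (w x)))"
      proof (intro mult_mono Zg)
        have "l2norm M (\<lambda>x. snd (?Z x - w x)) \<le> l2norm M (\<lambda>x. snd (?Z x)) + l2norm M (\<lambda>x. snd (w x))"
          using l2norm_triangle_diff[OF sq_integrable_snd[OF sZ] sq_integrable_snd[OF sw]] by simp
        then show "l2norm M (\<lambda>x. snd (?Z x - w x)) \<le> C * B0 + l2norm M (\<lambda>x. snd (w x))" using Zg by linarith
      qed (use K(1) \<epsilon> C(1) B0_nonneg in auto)
      also have "\<dots> = \<epsilon> * Q" by (simp add: Q_def)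
      finally have 1: "l2inner M (S 0 ?Z) (\<lambda>x. ?Z x - w x) \<le> \<eta> / 2" using \<epsilon>Q by linarith
      have "\<bar>l2inner M (S 0 ?Z) (\<lambda>x. jet v x - w x)\<bar> \<le> l2norm M (S 0 ?Z) * l2norm M (\<lambda>x. jet v x - w x)"
        by (intro l2_Cauchy_Schwarz sq_S sZ sq_integrable_diff sv sw)
      also have "\<dots> \<le> B2 * l2norm M (\<lambda>x. jet v x - w x)"
      proof (intro mult_right_mono S_bound ZH)
        have "l2norm M (\<lambda>x. dil 0 (snd (?Z x))) = l2norm M (\<lambda>x. snd (snd (?Z x)))"
          by (simp add: l2norm_def dil_def norm_Pair)
        then show "l2norm M (\<lambda>x. dil 0 (snd (?Z x))) \<le> B0" using W_bound2[OF \<epsilon>] by simp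
      qed auto
      also have "\<dots> \<le> (B2 + 1) * (\<eta> / (2 * (B2 + 1)))" using w(2) B2_nonneg by (intro mult_mono) auto
      also have "\<dots> = \<eta> / 2" using B2_nonneg by (intro mult_divide_cancel(1)) linarith
      finally have 2: "\<bar>l2inner M (S 0 ?Z) (\<lambda>x. jet v x - w x)\<bar> \<le> \<eta> / 2" .
      have "l2inner M (S 0 ?Z) (\<lambda>x. ?Z x - jet v x) = l2inner M (S 0 ?Z) (\<lambda>x. ?Z x - w x) - l2inner M (S 0 ?Z) (\<lambda>x. jet v x - w x)"
        by (simp add: l2inner_diff_right sq_S sZ sv sw)
      then show "l2inner M (S 0 ?Z) (\<lambda>x. ?Z x - jet v x) \<le> \<eta>" using 1 2 by linarith
    qed (use v(2) ZH in auto)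
    moreover have "l2norm M (\<lambda>x. snd (snd (z n x)) - snd (snd (?Z x))) \<le> e / 4"
    proof -
      have sd: "sq_integrable M (\<lambda>x. ?Z x - z n x)" by (intro sq_integrable_diff sZ H_sq[OF z])
      have "l2norm M (\<lambda>x. snd (snd (z n x)) - snd (snd (?Z x))) = l2norm M (\<lambda>x. snd (snd (?Z x - z n x)))"
        by (subst l2norm_commute) simp
      also have "\<dots> \<le> l2norm M (\<lambda>x. ?Z x - z n x)"
        using l2norm_snd_le[OF sq_integrable_snd[OF sd]] l2norm_snd_le[OF sd] by linarith
      finally show ?thesis using D[OF \<epsilon>, of n] \<epsilon>D by linarith
    qed
    moreover have "l2norm M (\<lambda>x. snd (snd (z n x)) - Gu x)
        \<le> l2norm M (\<lambda>x. snd (snd (z n x)) - snd (snd (?Z x))) + l2norm M (\<lambda>x. snd (snd (?Z x)) - Gu x)"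
      by (intro l2norm_triangle3 sq_integrable_snd H_sq[OF z] sZ Gu)
    ultimately have "l2norm M (\<lambda>x. snd (snd (z n x)) - Gu x) < e" using e by linarith
    then show ?case by (simp add: dist_real_def)
  qed
qed

end

section \<open>From jets back to the spaces and convergence of the statement\<close>

context bounded_product
begin

lemma conv_H01_2_I:
  assumes "weak_grad2 \<Omega> v Gv" "\<forall>\<^sub>F k in F. weak_grad2 \<Omega> (w k) (Gw k)"
    "((\<lambda>k. l2norm M (\<lambda>x. Gw k x - Gv x)) \<longlongrightarrow> 0) F"
  shows "conv_H01_2 \<omega>1 \<omega>2 w F v"
proof -
  have "((\<lambda>k. (l2norm M (\<lambda>x. Gw k x - Gv x))\<^sup>2) \<longlongrightarrow> 0\<^sup>2) F" by (rule tendsto_power[OF assms(3)])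
  then show ?thesis
    unfolding conv_H01_2_def using assms(1,2)
    by (intro exI[of _ Gw] exI[of _ Gv]) (simp add: set_integral_lebesgue_on[OF sets_dom(3)] l2norm_sq)
qed

end

lemma eventually_at_right_0_1: "\<forall>\<^sub>F \<epsilon> in at_right (0::real). 0 < \<epsilon> \<and> \<epsilon> \<le> 1"
  using eventually_at_right_real[of 0 "1::real"] by (auto elim: eventually_mono)

context galerkin
begin

lemma limit_n_eps:
  assumes U: "\<And>\<epsilon> n. 0 < \<epsilon> \<Longrightarrow> \<epsilon> \<le> 1 \<Longrightarrow> U \<epsilon> n = (\<lambda>x. fst (W \<epsilon> n x))"
  shows "\<exists>Ulim. (\<forall>\<epsilon>\<in>{0<..1}. Ulim \<epsilon> \<in> H01_2 \<omega>1 \<omega>2 \<and> conv_H01_2 \<omega>1 \<omega>2 (\<lambda>n. U \<epsilon> n) sequentially (Ulim \<epsilon>)) \<and>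
      conv_H01_2 \<omega>1 \<omega>2 Ulim (at_right 0) u"
proof -
  define Pr where "Pr \<epsilon> z \<longleftrightarrow> z \<in> H \<and> (\<forall>\<phi>\<in>H. l2inner M (S \<epsilon> z) \<phi> = 0) \<and>
      (\<lambda>n. l2norm M (\<lambda>x. snd (snd (W \<epsilon> n x)) - snd (snd (z x)))) \<longlonglongrightarrow> 0" for \<epsilon> z
  \<comment> \<open>Outside (0, 1] the value is arbitrary; the filter \<open>at_right 0\<close> only
    sees small positive parameters.\<close>
  define z where "z \<epsilon> = (SOME z. Pr \<epsilon> z)" for \<epsilon>
  have Pr: "Pr \<epsilon> (z \<epsilon>)" if e: "0 < \<epsilon>" "\<epsilon> \<le> 1" for \<epsilon>
  proof -
    obtain y where "y \<in> H" "\<And>\<phi>. \<phi> \<in> H \<Longrightarrow> l2inner M (S \<epsilon> y) \<phi> = 0"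
      "(\<lambda>n. l2norm M (\<lambda>x. snd (snd (W \<epsilon> n x)) - snd (snd (y x)))) \<longlonglongrightarrow> 0"
      by (rule limit_n[OF e]) (rule that)
    then have "Pr \<epsilon> y" by (simp add: Pr_def)
    then show ?thesis unfolding z_def by (rule someI[of "Pr \<epsilon>"])
  qed
  have z: "0 < \<epsilon> \<Longrightarrow> \<epsilon> \<le> 1 \<Longrightarrow> z \<epsilon> \<in> H"
    "0 < \<epsilon> \<Longrightarrow> \<epsilon> \<le> 1 \<Longrightarrow> \<phi> \<in> H \<Longrightarrow> l2inner M (S \<epsilon> (z \<epsilon>)) \<phi> = 0"
    "0 < \<epsilon> \<Longrightarrow> \<epsilon> \<le> 1 \<Longrightarrow> (\<lambda>n. l2norm M (\<lambda>x. snd (snd (W \<epsilon> n x)) - snd (snd (z \<epsilon> x)))) \<longlonglongrightarrow> 0" for \<epsilon> \<phi>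
    using Pr[of \<epsilon>] unfolding Pr_def by blast+
  show ?thesis
  proof (intro exI[of _ "\<lambda>\<epsilon> x. fst (z \<epsilon> x)"] conjI ballI)
    fix \<epsilon> :: real assume "\<epsilon> \<in> {0<..1}"
    then have e: "0 < \<epsilon>" "\<epsilon> \<le> 1" by auto
    show "(\<lambda>x. fst (z \<epsilon> x)) \<in> H01_2 \<omega>1 \<omega>2" by (rule H_fst_H01_2[OF z(1)[OF e]])
    show "conv_H01_2 \<omega>1 \<omega>2 (\<lambda>n. U \<epsilon> n) sequentially (\<lambda>x. fst (z \<epsilon> x))"
      unfolding U[OF e]
      by (rule conv_H01_2_I[OF H_weak_grad2[OF z(1)[OF e]] _ z(3)[OF e]]) (intro always_eventually allI H_weak_grad2 WH e)
  next
    show "conv_H01_2 \<omega>1 \<omega>2 (\<lambda>\<epsilon> x. fst (z \<epsilon> x)) (at_right 0) u"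
    proof (rule conv_H01_2_I[OF Gu(1) _ solutions_converge[OF z(1,2)]])
      show "\<forall>\<^sub>F \<epsilon> in at_right 0. weak_grad2 \<Omega> (\<lambda>x. fst (z \<epsilon> x)) (\<lambda>x. snd (snd (z \<epsilon> x)))"
        using eventually_at_right_0_1 by (rule eventually_mono) (blast intro: H_weak_grad2 z(1))
    qed
  qed
qed

lemma limit_eps_n:
  assumes U: "\<And>\<epsilon> n. 0 < \<epsilon> \<Longrightarrow> \<epsilon> \<le> 1 \<Longrightarrow> U \<epsilon> n = (\<lambda>x. fst (W \<epsilon> n x))"
  shows "\<exists>Ulim. (\<forall>n. Ulim n \<in> H01_2 \<omega>1 \<omega>2 \<and> conv_H01_2 \<omega>1 \<omega>2 (\<lambda>\<epsilon>. U \<epsilon> n) (at_right 0) (Ulim n)) \<and>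
      conv_H01_2 \<omega>1 \<omega>2 Ulim sequentially u"
proof -
  \<comment> \<open>The limit jet and its rate constant are paired so that both can be chosen
    simultaneously for every n.\<close>
  define Pr where "Pr n p \<longleftrightarrow> fst p \<in> H \<and> snd p \<ge> (0::real) \<and>
      (\<forall>\<epsilon>. 0 < \<epsilon> \<longrightarrow> \<epsilon> \<le> 1 \<longrightarrow> l2norm M (\<lambda>x. W \<epsilon> n x - fst p x) \<le> snd p * \<epsilon>)" for n p
  have "\<exists>p. Pr n p" for n
  proof -
    obtain z D where "z \<in> H" "D \<ge> 0" "\<And>\<epsilon>. 0 < \<epsilon> \<Longrightarrow> \<epsilon> \<le> 1 \<Longrightarrow> l2norm M (\<lambda>x. W \<epsilon> n x - z x) \<le> D * \<epsilon>"
      by (rule limit_eps) (rule that)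
    then show ?thesis by (intro exI[of _ "(z, D)"]) (simp add: Pr_def)
  qed
  then obtain p where p: "\<And>n. Pr n (p n)" by metis
  define z where "z n = fst (p n)" for n
  define D where "D n = snd (p n)" for n
  have z: "z n \<in> H" and D0: "D n \<ge> 0"
    and D: "0 < \<epsilon> \<Longrightarrow> \<epsilon> \<le> 1 \<Longrightarrow> l2norm M (\<lambda>x. W \<epsilon> n x - z n x) \<le> D n * \<epsilon>" for n \<epsilon>
    using p[of n] by (auto simp: Pr_def z_def D_def)
  show ?thesis
  proof (intro exI[of _ "\<lambda>n x. fst (z n x)"] conjI allI)
    fix n
    show "(\<lambda>x. fst (z n x)) \<in> H01_2 \<omega>1 \<omega>2" by (rule H_fst_H01_2[OF z])
    show "conv_H01_2 \<omega>1 \<omega>2 (\<lambda>\<epsilon>. U \<epsilon> n) (at_right 0) (\<lambda>x. fst (z n x))"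
    proof (rule conv_H01_2_I[OF H_weak_grad2[OF z]])
      show "\<forall>\<^sub>F \<epsilon> in at_right 0. weak_grad2 \<Omega> (U \<epsilon> n) (\<lambda>x. snd (snd (W \<epsilon> n x)))"
        using eventually_at_right_0_1
      proof (rule eventually_mono)
        fix \<epsilon> :: real assume "0 < \<epsilon> \<and> \<epsilon> \<le> 1"
        then have e: "0 < \<epsilon>" "\<epsilon> \<le> 1" by auto
        show "weak_grad2 \<Omega> (U \<epsilon> n) (\<lambda>x. snd (snd (W \<epsilon> n x)))" unfolding U[OF e] by (rule H_weak_grad2[OF WH[OF e]])
      qed
      have le: "\<forall>\<^sub>F \<epsilon> in at_right 0. l2norm M (\<lambda>x. snd (snd (W \<epsilon> n x)) - snd (snd (z n x))) \<le> D n * \<epsilon>"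
        using eventually_at_right_0_1
      proof (rule eventually_mono)
        fix \<epsilon> :: real assume "0 < \<epsilon> \<and> \<epsilon> \<le> 1"
        then have e: "0 < \<epsilon>" "\<epsilon> \<le> 1" by auto
        have sd: "sq_integrable M (\<lambda>x. W \<epsilon> n x - z n x)" by (intro sq_integrable_diff H_sq WH e z)
        show "l2norm M (\<lambda>x. snd (snd (W \<epsilon> n x)) - snd (snd (z n x))) \<le> D n * \<epsilon>"
          using l2norm_snd_le[OF sq_integrable_snd[OF sd]] l2norm_snd_le[OF sd] D[OF e, of n] by simp
      qed
      have "((\<lambda>\<epsilon>. D n * \<epsilon>) \<longlongrightarrow> D n * 0) (at_right 0)" by (intro tendsto_mult tendsto_const tendsto_ident_at)
      then have lim: "((\<lambda>\<epsilon>. D n * \<epsilon>) \<longlongrightarrow> 0) (at_right 0)" by simp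
      show "((\<lambda>\<epsilon>. l2norm M (\<lambda>x. snd (snd (W \<epsilon> n x)) - snd (snd (z n x)))) \<longlongrightarrow> 0) (at_right 0)"
        by (rule tendsto_sandwich[OF _ le tendsto_const lim]) simp
    qed
  next
    show "conv_H01_2 \<omega>1 \<omega>2 (\<lambda>n x. fst (z n x)) sequentially u"
      by (rule conv_H01_2_I[OF Gu(1) _ limit_eps_converges[OF z D D0]]) (intro always_eventually allI H_weak_grad2 z)
  qed
qed

end

text \<open>Lifts the scalar Galerkin problem to jets. The hypotheses quantify over arbitrary weak
  gradients, so they may be instantiated with the gradients carried by the chosen jets, and
  uniqueness identifies the gradient in the approximation property.\<close>

theorem (in limit_problem) galerkin_limits:
  fixes V :: "nat \<Rightarrow> ('a \<times> 'b \<Rightarrow> real) set" and U :: "real \<Rightarrow> nat \<Rightarrow> 'a \<times> 'b \<Rightarrow> real"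
  assumes V_sub: "\<And>n. fin_dim_subspace (V n) \<and> V n \<subseteq> H01 \<Omega>"
    and V_approx: "\<And>w \<delta>. w \<in> H01 \<Omega> \<Longrightarrow> \<delta> > 0 \<Longrightarrow> \<forall>\<^sub>F n in sequentially.
        \<exists>v\<in>V n. \<exists>G. weak_grad \<Omega> (\<lambda>x. w x - v x) G \<and> (LINT x:\<Omega>|lebesgue. (norm (G x))\<^sup>2) < \<delta>"
    and U_V: "\<And>\<epsilon> n. 0 < \<epsilon> \<Longrightarrow> \<epsilon> \<le> 1 \<Longrightarrow> U \<epsilon> n \<in> V n"
    and U_sol: "\<And>\<epsilon> n \<phi> GU G\<phi>. 0 < \<epsilon> \<Longrightarrow> \<epsilon> \<le> 1 \<Longrightarrow> \<phi> \<in> V n \<Longrightarrow> weak_grad \<Omega> (U \<epsilon> n) GU \<Longrightarrow> weak_grad \<Omega> \<phi> G\<phi> \<Longrightarrow>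
        (LINT x:\<Omega>|lebesgue. \<beta> (U \<epsilon> n x) * \<phi> x) + (LINT x:\<Omega>|lebesgue. Aeps \<epsilon> A x (GU x) \<bullet> G\<phi> x)
        = (LINT x:\<Omega>|lebesgue. f x * \<phi> x)"
  obtains VH W where "galerkin \<omega>1 \<omega>2 A \<beta> f lam m u Gu VH W"
    "\<And>\<epsilon> n. 0 < \<epsilon> \<Longrightarrow> \<epsilon> \<le> 1 \<Longrightarrow> U \<epsilon> n = (\<lambda>x. fst (W \<epsilon> n x))"
proof -
  define J where "J v = (SOME w. w \<in> H \<and> (\<lambda>x. fst (w x)) = v)" for v
  have J: "J v \<in> H" "(\<lambda>x. fst (J v x)) = v" if "v \<in> H01 \<Omega>" for v
  proof -
    have "\<exists>w. w \<in> H \<and> (\<lambda>x. fst (w x)) = v" using H01_jet[OF that] by blast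
    from someI_ex[OF this] show "J v \<in> H" "(\<lambda>x. fst (J v x)) = v" unfolding J_def by blast+
  qed
  obtain B where B: "\<And>n. finite (B n)" "\<And>n. V n = fspan (B n)"
    using V_sub unfolding fin_dim_subspace_def by metis
  have BV: "b \<in> V n" if b: "b \<in> B n" for b n
  proof -
    have eq: "b x = (\<Sum>b'\<in>B n. (if b' = b then 1 else 0) * b' x)" for x
    proof -
      have "(\<Sum>b'\<in>B n. (if b' = b then 1 else 0) * b' x) = (\<Sum>b'\<in>B n. if b' = b then b' x else 0)"
        by (rule sum.cong) auto
      then show ?thesis using b B(1)[of n] by simp
    qed
    show ?thesis
      unfolding B(2) fspan_def by (rule CollectI, rule exI, rule conjI, rule ext, rule eq, rule TrueI)
  qed
  have JB: "J b \<in> H" "\<And>x. fst (J b x) = b x" if "b \<in> B n" for b n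
    using J[of b] BV[OF that] V_sub[of n] by (auto simp: fun_eq_iff)
  define cb where "cb n c x = (\<Sum>b\<in>B n. c b *\<^sub>R J b x)" for n c x
  \<comment> \<open>The span of one chosen jet per generator. Lifting every function of
    \<open>V n\<close> separately would not give a linear space, as gradients are only fixed almost
    everywhere; the span is closed under differences and finitely generated.\<close>
  define VH where "VH n = range (cb n)" for n
  have cbH: "cb n c \<in> H" for n c
    unfolding cb_def[abs_def] by (intro jet_closure_sum[OF bounded_linear_ident sets_dom(3)] H_scaleR JB)
  have cb_fst: "fst (cb n c x) = (\<Sum>b\<in>B n. c b * b x)" for n c x
    unfolding cb_def using JB(2) by (simp add: fst_sum)
  have VH_V: "(\<lambda>x. fst (w x)) \<in> V n" if "w \<in> VH n" for w n
    using that unfolding VH_def B(2) fspan_def by (auto simp: cb_fst)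
  have V_VH: "\<exists>w\<in>VH n. (\<lambda>x. fst (w x)) = v" if v: "v \<in> V n" for v n
  proof -
    obtain c where "v = (\<lambda>x. \<Sum>b\<in>B n. c b * b x)" using v unfolding B(2) fspan_def by blast
    then show ?thesis unfolding VH_def by (intro bexI[of _ "cb n c"]) (auto simp: cb_fst)
  qed
  define W where "W \<epsilon> n = (SOME w. w \<in> VH n \<and> (\<lambda>x. fst (w x)) = U \<epsilon> n)" for \<epsilon> n
  have W: "W \<epsilon> n \<in> VH n" "(\<lambda>x. fst (W \<epsilon> n x)) = U \<epsilon> n" if "0 < \<epsilon>" "\<epsilon> \<le> 1" for \<epsilon> n
  proof -
    have "\<exists>w. w \<in> VH n \<and> (\<lambda>x. fst (w x)) = U \<epsilon> n" using V_VH[OF U_V[OF that]] by blast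
    from someI_ex[OF this] show "W \<epsilon> n \<in> VH n" "(\<lambda>x. fst (W \<epsilon> n x)) = U \<epsilon> n" unfolding W_def by blast+
  qed
  have VHH: "VH n \<subseteq> H" for n using cbH by (auto simp: VH_def)
  have "galerkin \<omega>1 \<omega>2 A \<beta> f lam m u Gu VH W"
  proof unfold_locales
    fix n
    show "VH n \<subseteq> H" by (rule VHH)
    show "(\<lambda>x. v x - w x) \<in> VH n" if vw: "v \<in> VH n" "w \<in> VH n" for v w
    proof -
      obtain c d where "v = cb n c" "w = cb n d" using vw unfolding VH_def by (elim rangeE)
      then have "(\<lambda>x. v x - w x) = cb n (\<lambda>b. c b - d b)"
        by (simp add: cb_def[abs_def] sum_subtractf scaleR_diff_left)
      then show ?thesis by (simp add: VH_def)
    qed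
    have "\<exists>C\<ge>0. \<forall>c. l2norm M (\<lambda>x. snd (\<Sum>b\<in>B n. c b *\<^sub>R J b x)) \<le> C * l2norm M (\<lambda>x. snd (snd (\<Sum>b\<in>B n. c b *\<^sub>R J b x)))"
    proof (rule finite_span_seminorm_bound[OF bounded_linear_compose[OF bounded_linear_snd bounded_linear_snd] bounded_linear_snd B(1)])
      show "sq_integrable M (J b)" if "b \<in> B n" for b by (rule H_sq[OF JB(1)[OF that]])
      show "l2norm M (\<lambda>x. snd (\<Sum>b\<in>B n. c b *\<^sub>R J b x)) = 0"
        if "l2norm M (\<lambda>x. snd (snd (\<Sum>b\<in>B n. c b *\<^sub>R J b x))) = 0" for c
        using H_null[OF cbH[of n c]] that unfolding cb_def .
    qed
    then show "\<exists>C\<ge>0. \<forall>w\<in>VH n. l2norm M (\<lambda>x. snd (w x)) \<le> C * l2norm M (\<lambda>x. snd (snd (w x)))"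
      unfolding VH_def cb_def[abs_def] by blast
  next
    fix w and \<delta> :: real assume w: "w \<in> H" and \<delta>: "\<delta> > 0"
    have wH01: "(\<lambda>x. fst (w x)) \<in> H01 \<Omega>" unfolding H01_iff[OF sets_dom(3)]
      by (intro exI[of _ "\<lambda>x. snd (w x)"]) (simp add: w)
    \<comment> \<open>The approximation property controls the squared norm of the gradient only;
      Poincare bounds the whole jet by R + 1 times the gradient.\<close>
    define \<gamma> where "\<gamma> = \<delta> / (R + 1)"
    have \<gamma>: "\<gamma> > 0" using \<delta> R(1) by (simp add: \<gamma>_def)
    have "\<forall>\<^sub>F n in sequentially. \<exists>v\<in>V n. \<exists>G. weak_grad \<Omega> (\<lambda>x. fst (w x) - v x) G \<and> (LINT x:\<Omega>|lebesgue. (norm (G x))\<^sup>2) < \<gamma>\<^sup>2"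
      using \<gamma> by (intro V_approx[OF wH01]) simp
    then show "\<forall>\<^sub>F n in sequentially. \<exists>v\<in>VH n. l2norm M (\<lambda>x. w x - v x) < \<delta>"
    proof (rule eventually_mono)
      fix n assume "\<exists>v\<in>V n. \<exists>G. weak_grad \<Omega> (\<lambda>x. fst (w x) - v x) G \<and> (LINT x:\<Omega>|lebesgue. (norm (G x))\<^sup>2) < \<gamma>\<^sup>2"
      then obtain v G where v: "v \<in> V n" and G: "weak_grad \<Omega> (\<lambda>x. fst (w x) - v x) G"
        "(\<integral>x. (norm (G x))\<^sup>2 \<partial>M) < \<gamma>\<^sup>2"
        unfolding set_integral_lebesgue_on[OF sets_dom(3)] by blast
      obtain v' where v': "v' \<in> VH n" "(\<lambda>x. fst (v' x)) = v" using V_VH[OF v] by blast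
      have v'H: "v' \<in> H" using v'(1) VHH by blast
      have dH: "(\<lambda>x. w x - v' x) \<in> H" by (rule H_diff[OF w v'H])
      note sd = sq_integrable_snd[OF H_sq[OF dH]]
      have "weak_grad \<Omega> (\<lambda>x. fst (w x) - v x) (\<lambda>x. snd (w x - v' x))"
        using H_weak_grad[OF dH] by (simp add: v'(2)[symmetric])
      from weak_grad_unique[OF open_\<Omega> G(1) this]
      have ae: "AE x in M. G x = snd (w x - v' x)" by (simp add: AE_lebesgue_on_iff[OF sets_dom(3)])
      have "(l2norm M (\<lambda>x. snd (w x - v' x)))\<^sup>2 = (\<integral>x. (norm (snd (w x - v' x)))\<^sup>2 \<partial>M)" by (rule l2norm_sq)
      also have "\<dots> = (\<integral>x. (norm (G x))\<^sup>2 \<partial>M)"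
      proof (rule integral_cong_AE)
        \<comment> \<open>Measurability of G is inherited from the jet gradient with which it agrees
          almost everywhere.\<close>
        have "AE x in lebesgue. indicator \<Omega> x *\<^sub>R G x = indicator \<Omega> x *\<^sub>R snd (w x - v' x)"
          using ae[unfolded AE_lebesgue_on_iff[OF sets_dom(3)]] by eventually_elim (auto simp: indicator_def)
        moreover have "(\<lambda>x. indicator \<Omega> x *\<^sub>R snd (w x - v' x)) \<in> borel_measurable lebesgue"
          using sq_integrable_measurable[OF sd] sets_dom(3) by (subst (asm) borel_measurable_restrict_space_iff) auto
        ultimately have "(\<lambda>x. indicator \<Omega> x *\<^sub>R G x) \<in> borel_measurable lebesgue"
          by (rule borel_measurable_lebesgue_cong_AE[rotated])
        then have Gm: "G \<in> borel_measurable M"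
          using sets_dom(3) by (subst borel_measurable_restrict_space_iff) auto
        show "(\<lambda>x. (norm (G x))\<^sup>2) \<in> borel_measurable M"
          using Gm by measurable
        show "(\<lambda>x. (norm (snd (w x - v' x)))\<^sup>2) \<in> borel_measurable M"
          using sq_integrable_measurable[OF sd] by measurable
        show "AE x in M. (norm (snd (w x - v' x)))\<^sup>2 = (norm (G x))\<^sup>2" using ae by eventually_elim simp
      qed
      finally have "l2norm M (\<lambda>x. snd (w x - v' x)) < \<gamma>"
        using G(2) \<gamma> by (intro power2_less_imp_less[of _ \<gamma>]) auto
      then have "(R + 1) * l2norm M (\<lambda>x. snd (w x - v' x)) < (R + 1) * \<gamma>"
        using R(1) by (intro mult_strict_left_mono) auto
      also have "(R + 1) * \<gamma> = \<delta>" using R(1) by (simp add: \<gamma>_def)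
      finally show "\<exists>v\<in>VH n. l2norm M (\<lambda>x. w x - v x) < \<delta>"
        using H_Poincare_snd[OF dH] v'(1) by (intro bexI[of _ v']) auto
    qed
  next
    fix \<epsilon> :: real and n assume e: "0 < \<epsilon>" "\<epsilon> \<le> 1"
    show "W \<epsilon> n \<in> VH n" by (rule W[OF e])
  next
    fix \<epsilon> :: real and \<phi> n assume e: "0 < \<epsilon>" "\<epsilon> \<le> 1" and \<phi>: "\<phi> \<in> VH n"
    have WH': "W \<epsilon> n \<in> H" "\<phi> \<in> H" using W(1)[OF e] \<phi> VHH by auto
    note s = H_sq[OF WH'(1)] and s\<phi> = H_sq[OF WH'(2)]
    have wgU: "weak_grad \<Omega> (U \<epsilon> n) (\<lambda>x. snd (W \<epsilon> n x))" using H_weak_grad[OF WH'(1)] W(2)[OF e] by simp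
    have eq: "(\<integral>x. \<beta> (U \<epsilon> n x) * fst (\<phi> x) \<partial>M) + (\<integral>x. Aeps \<epsilon> A x (snd (W \<epsilon> n x)) \<bullet> snd (\<phi> x) \<partial>M) = (\<integral>x. f x * fst (\<phi> x) \<partial>M)"
      using U_sol[OF e VH_V[OF \<phi>] wgU H_weak_grad[OF WH'(2)]] unfolding set_integral_lebesgue_on[OF sets_dom(3)] .
    have Ux: "fst (W \<epsilon> n x) = U \<epsilon> n x" for x by (rule fun_cong[OF W(2)[OF e]])
    have sU: "sq_integrable M (U \<epsilon> n)" using sq_integrable_fst[OF s] by (simp add: Ux)
    have sA: "sq_integrable M (\<lambda>x. Aeps \<epsilon> A x (snd (W \<epsilon> n x)))"
      using sq_integrable_snd[OF sq_S[OF s, of \<epsilon>]] by (simp add: S_def)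
    have "S \<epsilon> (W \<epsilon> n) x \<bullet> \<phi> x = (\<beta> (U \<epsilon> n x) * fst (\<phi> x) - f x * fst (\<phi> x)) + Aeps \<epsilon> A x (snd (W \<epsilon> n x)) \<bullet> snd (\<phi> x)" for x
      by (cases "\<phi> x") (simp add: S_def Ux left_diff_distrib)
    then have "l2inner M (S \<epsilon> (W \<epsilon> n)) \<phi> = (\<integral>x. \<beta> (U \<epsilon> n x) * fst (\<phi> x) \<partial>M) - (\<integral>x. f x * fst (\<phi> x) \<partial>M)
        + (\<integral>x. Aeps \<epsilon> A x (snd (W \<epsilon> n x)) \<bullet> snd (\<phi> x) \<partial>M)"
      unfolding l2inner_def
      using sq_integrable_mult[OF sq_\<beta>[OF sU] sq_integrable_fst[OF s\<phi>]] sq_integrable_mult[OF sq_f sq_integrable_fst[OF s\<phi>]]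
        sq_integrable_inner[OF sA sq_integrable_snd[OF s\<phi>]] by simp
    then show "l2inner M (S \<epsilon> (W \<epsilon> n)) \<phi> = 0" using eq by simp
  qed
  then show ?thesis using that W(2)[symmetric] by blast
qed

theorem theorem2p2:
  fixes \<omega>1 :: "'a::euclidean_space set" and \<omega>2 :: "'b::euclidean_space set"
    and A :: "'a \<times> 'b \<Rightarrow> 'a \<times> 'b \<Rightarrow> 'a \<times> 'b"
    and \<beta> :: "real \<Rightarrow> real" and f :: "'a \<times> 'b \<Rightarrow> real"
    and lam M :: real
    and V :: "nat \<Rightarrow> ('a \<times> 'b \<Rightarrow> real) set"
    and U :: "real \<Rightarrow> nat \<Rightarrow> ('a \<times> 'b \<Rightarrow> real)"
    and u :: "'a \<times> 'b \<Rightarrow> real"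
  assumes dom: "bounded \<omega>1" "open \<omega>1" "bounded \<omega>2" "open \<omega>2"
    and f_L2: "L2 (\<omega>1 \<times> \<omega>2) f"
    and A_lin: "\<forall>x. linear (A x)"
    and A_ell: "lam > 0" "AE x in lebesgue. x \<in> \<omega>1 \<times> \<omega>2 \<longrightarrow>
                   (\<forall>\<xi>. A x \<xi> \<bullet> \<xi> \<ge> lam * (norm \<xi>)\<^sup>2)"
    and A_Linf: "\<forall>i\<in>Basis. \<forall>j\<in>Basis. Linf (\<omega>1 \<times> \<omega>2) (coef A i j)"
    and A_deriv: "\<forall>i\<in>Basis. \<forall>j\<in>Basis.
        (\<exists>g. weak_pderiv (\<omega>1 \<times> \<omega>2) (coef A (i, 0) (0, j)) (i, 0) g \<and> Linf (\<omega>1 \<times> \<omega>2) g) \<and>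
        (\<exists>g. weak_pderiv (\<omega>1 \<times> \<omega>2) (coef A (i, 0) (0, j)) (0, j) g \<and> Linf (\<omega>1 \<times> \<omega>2) g)"
    and \<beta>_cont: "continuous_on UNIV \<beta>" and \<beta>_mono: "mono \<beta>" and \<beta>0: "\<beta> 0 = 0"
    and \<beta>_growth: "M \<ge> 0" "\<forall>s. \<bar>\<beta> s\<bar> \<le> M * (1 + \<bar>s\<bar>)"
    and V_sub: "\<forall>n. fin_dim_subspace (V n) \<and> V n \<subseteq> H01 (\<omega>1 \<times> \<omega>2)"
    and V_approx: "\<forall>w\<in>H01 (\<omega>1 \<times> \<omega>2). \<forall>\<delta>>0. \<forall>\<^sub>F n in sequentially.
        \<exists>v\<in>V n. \<exists>G. weak_grad (\<omega>1 \<times> \<omega>2) (\<lambda>x. w x - v x) G \<and>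
            (LINT x:(\<omega>1 \<times> \<omega>2)|lebesgue. (norm (G x))\<^sup>2) < \<delta>"
    and U_sol: "\<forall>\<epsilon>\<in>{0<..1}. \<forall>n. U \<epsilon> n \<in> V n \<and>
        (\<forall>\<phi>\<in>V n. \<forall>GU G\<phi>. weak_grad (\<omega>1 \<times> \<omega>2) (U \<epsilon> n) GU \<longrightarrow> weak_grad (\<omega>1 \<times> \<omega>2) \<phi> G\<phi> \<longrightarrow>
           (LINT x:(\<omega>1 \<times> \<omega>2)|lebesgue. \<beta> (U \<epsilon> n x) * \<phi> x)
           + (LINT x:(\<omega>1 \<times> \<omega>2)|lebesgue. Aeps \<epsilon> A x (GU x) \<bullet> G\<phi> x)
           = (LINT x:(\<omega>1 \<times> \<omega>2)|lebesgue. f x * \<phi> x))"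
    and u_sol: "u \<in> H01_2 \<omega>1 \<omega>2"
      "AE X1 in lebesgue. X1 \<in> \<omega>1 \<longrightarrow>
         (\<forall>\<psi>\<in>H01 \<omega>2. \<forall>Gu G\<psi>. weak_grad \<omega>2 (\<lambda>X2. u (X1, X2)) Gu \<longrightarrow> weak_grad \<omega>2 \<psi> G\<psi> \<longrightarrow>
            (LINT X2:\<omega>2|lebesgue. \<beta> (u (X1, X2)) * \<psi> X2)
            + (LINT X2:\<omega>2|lebesgue. A22 A (X1, X2) (Gu X2) \<bullet> G\<psi> X2)
            = (LINT X2:\<omega>2|lebesgue. f (X1, X2) * \<psi> X2))"
  shows "(\<exists>Ulim. (\<forall>\<epsilon>\<in>{0<..1}. Ulim \<epsilon> \<in> H01_2 \<omega>1 \<omega>2 \<and>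
                   conv_H01_2 \<omega>1 \<omega>2 (\<lambda>n. U \<epsilon> n) sequentially (Ulim \<epsilon>)) \<and>
                conv_H01_2 \<omega>1 \<omega>2 Ulim (at_right 0) u)
       \<and> (\<exists>Ulim. (\<forall>n. Ulim n \<in> H01_2 \<omega>1 \<omega>2 \<and>
                   conv_H01_2 \<omega>1 \<omega>2 (\<lambda>\<epsilon>. U \<epsilon> n) (at_right 0) (Ulim n)) \<and>
                conv_H01_2 \<omega>1 \<omega>2 Ulim sequentially u)"
proof -
  have sets: "\<omega>1 \<times> \<omega>2 \<in> sets lebesgue" using open_Times[OF dom(2,4)] by auto
  \<comment> \<open>One X2-gradient of u is fixed for the whole development. The slice equation
    quantifies over all slice gradients and is later instantiated with the slices of this
    one.\<close>
  obtain Gu where Gu: "weak_grad2 (\<omega>1 \<times> \<omega>2) u Gu" "sq_integrable (lebesgue_on (\<omega>1 \<times> \<omega>2)) Gu"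
    using u_sol(1) unfolding H01_2_def L2_iff[OF sets] by blast
  have deriv: "\<exists>g. weak_pderiv (\<omega>1 \<times> \<omega>2) (coef A (i, 0) (0, j)) (i, 0) g \<and> Linf (\<omega>1 \<times> \<omega>2) g"
    if "i \<in> Basis" "j \<in> Basis" for i j using A_deriv that by blast
  interpret L: limit_problem \<omega>1 \<omega>2 A \<beta> f lam M u Gu
  proof (intro limit_problem.intro elliptic.intro)
    show "bounded_product \<omega>1 \<omega>2" using dom by (rule bounded_product.intro)
    show "elliptic_axioms \<omega>1 \<omega>2 A \<beta> f lam M"
      by (rule elliptic_axioms.intro) (use f_L2 A_lin A_ell A_Linf \<beta>_cont \<beta>_mono \<beta>0 \<beta>_growth in blast)+
    show "limit_problem_axioms \<omega>1 \<omega>2 A \<beta> f u Gu"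
      using deriv u_sol(1) Gu u_sol(2) by (rule limit_problem_axioms.intro)
  qed
  obtain VH W where "galerkin \<omega>1 \<omega>2 A \<beta> f lam M u Gu VH W"
    and U: "\<And>\<epsilon> n. 0 < \<epsilon> \<Longrightarrow> \<epsilon> \<le> 1 \<Longrightarrow> U \<epsilon> n = (\<lambda>x. fst (W \<epsilon> n x))"
  proof (rule L.galerkin_limits[of V U])
    show "fin_dim_subspace (V n) \<and> V n \<subseteq> H01 (\<omega>1 \<times> \<omega>2)" for n using V_sub by blast
    show "U \<epsilon> n \<in> V n" if "0 < \<epsilon>" "\<epsilon> \<le> 1" for \<epsilon> n using U_sol that by simp
  qed (use V_approx U_sol in auto)
  then interpret G: galerkin \<omega>1 \<omega>2 A \<beta> f lam M u Gu VH W by blast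
  show ?thesis using G.limit_n_eps[of U, OF U] G.limit_eps_n[of U, OF U] by blast
qed

end
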